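(* Let $X$ and $Y$ be anisotropic quasilinear $p$-hypersurfaces over $F$ with $\dim(Y) = p^n - 1 \leq \dim(X)$ for some integer $n \geq 0$. Suppose that there exists a rational morphism $X \dashrightarrow Y$. Then there exists a rational morphism $Y \dashrightarrow X$. If in addition $\dim(X) = p^n -1$, then $X$ and $Y$ are birational over $F$.
   Context: $p$ is a prime and $F$ is a non-perfect field of characteristic $p$. Rational morphisms are over the base field and need not be dominant. A quasilinear $p$-form over $F$ is a map $\varphi\colon V_\varphi \to F$ on a finite-dimensional $F$-vector space $V_\varphi$ with $\varphi(\lambda v)=\lambda^p\varphi(v)$ and $\varphi(v+w)=\varphi(v)+\varphi(w)$ for all $\lambda\in F$, $v,w\in V_\varphi$ (in coordinates, $a_1x_1^p+\dots+a_nx_n^p$). It is isotropic if $\varphi(v)=0$ for some $v\ne 0$, and anisotropic otherwise. For a quasilinear $p$-form $\varphi$ over $F$ with $\dim V_\varphi=d+2\ge 2$, $X_\varphi=\{\varphi=0\}\subset\mathbb{P}(V_\varphi)$ is the associated projective hypersurface, of dimension $d$; schemes of this type are called quasilinear $p$-hypersurfaces. $X_\varphi$ is called anisotropic if $\varphi$ is; in that case it is integral. *)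

theory Defs
  imports
    "HOL-Analysis.Function_Topology"
    "HOL-Algebra.QuotRing"
    "HOL-Library.Poly_Mapping"
    "HOL-Computational_Algebra.Primes"
begin

section \<open>Locally ringed spaces over a field\<close>

text \<open>
  Sections over an open set are functions on its points (with values in germs), so that
  restriction of sections is ordinary restriction of functions.  The field
  \<open>const\<close> is the structure morphism to the spectrum of the ground field, given as a map
  from the ground field to the sections over each open set.
\<close>

record ('p, 'g, 'k) lrspace =
  topo :: "'p topology"
  sections :: "'p set \<Rightarrow> ('p \<Rightarrow> 'g) ring"
  const :: "'p set \<Rightarrow> 'k \<Rightarrow> 'p \<Rightarrow> 'g"

definition open_sub :: "('p, 'g, 'k) lrspace \<Rightarrow> 'p set \<Rightarrow> ('p, 'g, 'k) lrspace" where
  "open_sub A U = A\<lparr>topo := subtopology (topo A) U\<rparr>"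

definition preim :: "('p, 'g, 'k) lrspace \<Rightarrow> ('p \<Rightarrow> 'q) \<Rightarrow> 'q set \<Rightarrow> 'p set" where
  "preim A f V = {x \<in> topspace (topo A). f x \<in> V}"

text \<open>
  The germ of a section \<open>s\<close> at \<open>x\<close> is a unit of the stalk.
\<close>

definition unit_at :: "('p, 'g, 'k) lrspace \<Rightarrow> ('p \<Rightarrow> 'g) \<Rightarrow> 'p set \<Rightarrow> 'p \<Rightarrow> bool" where
  "unit_at A s U x \<longleftrightarrow>
     (\<exists>W. openin (topo A) W \<and> x \<in> W \<and> W \<subseteq> U \<and> restrict s W \<in> Units (sections A W))"

text \<open>
  A morphism consists of a continuous map \<open>f\<close> and, for every open \<open>V\<close> of the target, a
  homomorphism \<open>pb V\<close> of algebras over the ground field from the sections over \<open>V\<close> to the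
  sections over the preimage of \<open>V\<close>, compatible with restriction.  The last condition says that
  the induced homomorphisms of stalks are local.
\<close>

definition morphism ::
  "('p, 'g, 'k) lrspace \<Rightarrow> ('q, 'h, 'k) lrspace \<Rightarrow>
   ('p \<Rightarrow> 'q) \<Rightarrow> ('q set \<Rightarrow> ('q \<Rightarrow> 'h) \<Rightarrow> ('p \<Rightarrow> 'g)) \<Rightarrow> bool" where
  "morphism A B f pb \<longleftrightarrow>
     continuous_map (topo A) (topo B) f \<and>
     (\<forall>V. openin (topo B) V \<longrightarrow>
        pb V \<in> ring_hom (sections B V) (sections A (preim A f V)) \<and>
        (\<forall>c. pb V (const B V c) = const A (preim A f V) c)) \<and>
     (\<forall>V W s. openin (topo B) V \<longrightarrow> openin (topo B) W \<longrightarrow> W \<subseteq> V \<longrightarrow>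
        s \<in> carrier (sections B V) \<longrightarrow>
        pb W (restrict s W) = restrict (pb V s) (preim A f W)) \<and>
     (\<forall>V s x. openin (topo B) V \<longrightarrow> s \<in> carrier (sections B V) \<longrightarrow> x \<in> preim A f V \<longrightarrow>
        unit_at A (pb V s) (preim A f V) x \<longrightarrow> unit_at B s V (f x))"

definition isomorphism ::
  "('p, 'g, 'k) lrspace \<Rightarrow> ('q, 'h, 'k) lrspace \<Rightarrow>
   ('p \<Rightarrow> 'q) \<Rightarrow> ('q set \<Rightarrow> ('q \<Rightarrow> 'h) \<Rightarrow> ('p \<Rightarrow> 'g)) \<Rightarrow> bool" where
  "isomorphism A B f pb \<longleftrightarrow>
     morphism A B f pb \<and> homeomorphic_map (topo A) (topo B) f \<and>
     (\<forall>V. openin (topo B) V \<longrightarrow>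
        pb V \<in> ring_iso (sections B V) (sections A (preim A f V)))"

text \<open>
  A rational morphism is represented by a morphism on a dense open subset.  For an integral
  scheme (hence irreducible), dense open means nonempty open.
\<close>

definition rational_morphism_exists ::
  "('p, 'g, 'k) lrspace \<Rightarrow> ('q, 'h, 'k) lrspace \<Rightarrow> bool" where
  "rational_morphism_exists A B \<longleftrightarrow>
     (\<exists>U f pb. openin (topo A) U \<and> U \<noteq> {} \<and> morphism (open_sub A U) B f pb)"

definition birational :: "('p, 'g, 'k) lrspace \<Rightarrow> ('q, 'h, 'k) lrspace \<Rightarrow> bool" where
  "birational A B \<longleftrightarrow>
     (\<exists>U V f pb. openin (topo A) U \<and> U \<noteq> {} \<and> openin (topo B) V \<and> V \<noteq> {} \<and>
        isomorphism (open_sub A U) (open_sub B V) f pb)"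


section \<open>Polynomials\<close>

text \<open>Monomials are exponent functions \<open>nat \<Rightarrow>\<^sub>0 nat\<close>; the variables are indexed by \<open>nat\<close>.\<close>

type_synonym 'a mpoly = "(nat \<Rightarrow>\<^sub>0 nat) \<Rightarrow>\<^sub>0 'a"

definition mono_deg :: "(nat \<Rightarrow>\<^sub>0 nat) \<Rightarrow> nat" where
  "mono_deg m = (\<Sum>i\<in>Poly_Mapping.keys m. Poly_Mapping.lookup m i)"

definition pconst :: "'a::field \<Rightarrow> 'a mpoly" where
  "pconst c = Poly_Mapping.single 0 c"

definition pvar :: "nat \<Rightarrow> 'a::field mpoly" where
  "pvar i = Poly_Mapping.single (Poly_Mapping.single i 1) 1"

definition homogeneous :: "nat \<Rightarrow> 'a::field mpoly \<Rightarrow> bool" where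
  "homogeneous d f \<longleftrightarrow> (\<forall>m\<in>Poly_Mapping.keys f. mono_deg m = d)"

definition hom_component :: "nat \<Rightarrow> 'a::field mpoly \<Rightarrow> 'a mpoly" where
  "hom_component d f =
     (\<Sum>m | m \<in> Poly_Mapping.keys f \<and> mono_deg m = d.
        Poly_Mapping.single m (Poly_Mapping.lookup f m))"

text \<open>The polynomial ring in the \<open>N\<close> variables with indices \<open>0, \<dots>, N - 1\<close>.\<close>

definition poly_ring :: "nat \<Rightarrow> 'a::field mpoly ring" where
  "poly_ring N =
     \<lparr>carrier = {f. \<forall>m\<in>Poly_Mapping.keys f. Poly_Mapping.keys m \<subseteq> {..<N}},
      monoid.mult = (*), one = 1, ring.zero = 0, add = (+)\<rparr>"


section \<open>Projective hypersurfaces\<close>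

text \<open>
  The scheme \<open>Proj (F[x\<^sub>0,\<dots>,x\<^bsub>N-1\<^esub>]/(F\<^sub>0))\<close> for a homogeneous polynomial \<open>F\<^sub>0\<close>.  Homogeneous
  primes of the quotient are represented by their preimages in the polynomial ring, i.e. by the
  homogeneous primes containing \<open>F\<^sub>0\<close>, and elements of the quotient by representatives.
\<close>

definition proj_points :: "nat \<Rightarrow> 'a::field mpoly \<Rightarrow> 'a mpoly set set" where
  "proj_points N F0 =
     {P. primeideal P (poly_ring N) \<and> (\<forall>f\<in>P. \<forall>d. hom_component d f \<in> P) \<and>
         F0 \<in> P \<and> (\<exists>i<N. pvar i \<notin> P)}"

definition proj_topo :: "nat \<Rightarrow> 'a::field mpoly \<Rightarrow> 'a mpoly set topology" where
  "proj_topo N F0 =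
     topology_generated_by
       {{P \<in> proj_points N F0. g \<notin> P} | g d. g \<in> carrier (poly_ring N) \<and> homogeneous d g}"

text \<open>
  The local ring at \<open>P\<close> is the degree zero part of the localisation of the homogeneous coordinate
  ring at the homogeneous elements outside \<open>P\<close>.  The pair \<open>(g, h)\<close> represents the fraction
  \<open>g / h\<close>, and \<open>germ N F0 P (g, h)\<close> is its equivalence class.
\<close>

definition proj_fracs :: "nat \<Rightarrow> 'a::field mpoly set \<Rightarrow> ('a mpoly \<times> 'a mpoly) set" where
  "proj_fracs N P =
     {(g, h). g \<in> carrier (poly_ring N) \<and> h \<in> carrier (poly_ring N) \<and> h \<notin> P \<and>
              (\<exists>d. homogeneous d g \<and> homogeneous d h)}"

type_synonym 'a germ = "('a mpoly \<times> 'a mpoly) set"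

definition germ ::
  "nat \<Rightarrow> 'a::field mpoly \<Rightarrow> 'a mpoly set \<Rightarrow> 'a mpoly \<times> 'a mpoly \<Rightarrow> 'a germ" where
  "germ N F0 P = (\<lambda>(g, h).
     {(g', h') \<in> proj_fracs N P.
        \<exists>t d. t \<in> carrier (poly_ring N) \<and> homogeneous d t \<and> t \<notin> P \<and>
              t * (g * h' - g' * h) \<in> PIdl\<^bsub>poly_ring N\<^esub> F0})"

definition germ_add ::
  "nat \<Rightarrow> 'a::field mpoly \<Rightarrow> 'a mpoly set \<Rightarrow> 'a germ \<Rightarrow> 'a germ \<Rightarrow> 'a germ" where
  "germ_add N F0 P A B =
     (\<Union>(g, h)\<in>A. \<Union>(g', h')\<in>B. germ N F0 P (g * h' + g' * h, h * h'))"

definition germ_mult ::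
  "nat \<Rightarrow> 'a::field mpoly \<Rightarrow> 'a mpoly set \<Rightarrow> 'a germ \<Rightarrow> 'a germ \<Rightarrow> 'a germ" where
  "germ_mult N F0 P A B =
     (\<Union>(g, h)\<in>A. \<Union>(g', h')\<in>B. germ N F0 P (g * g', h * h'))"

text \<open>Sections of the structure sheaf: functions that are locally given by a single fraction.\<close>

definition proj_sections ::
  "nat \<Rightarrow> 'a::field mpoly \<Rightarrow> 'a mpoly set set \<Rightarrow> ('a mpoly set \<Rightarrow> 'a germ) ring" where
  "proj_sections N F0 U =
     \<lparr>carrier = {s \<in> extensional U. \<forall>P\<in>U. \<exists>V g h. openin (proj_topo N F0) V \<and> P \<in> V \<and> V \<subseteq> U \<and>
                   (\<forall>Q\<in>V. (g, h) \<in> proj_fracs N Q \<and> s Q = germ N F0 Q (g, h))},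
      monoid.mult = (\<lambda>s t. \<lambda>P\<in>U. germ_mult N F0 P (s P) (t P)),
      one = (\<lambda>P\<in>U. germ N F0 P (1, 1)),
      ring.zero = (\<lambda>P\<in>U. germ N F0 P (0, 1)),
      add = (\<lambda>s t. \<lambda>P\<in>U. germ_add N F0 P (s P) (t P))\<rparr>"

definition proj_hypersurface ::
  "nat \<Rightarrow> 'a::field mpoly \<Rightarrow> ('a mpoly set, 'a germ, 'a) lrspace" where
  "proj_hypersurface N F0 =
     \<lparr>topo = proj_topo N F0,
      sections = proj_sections N F0,
      const = (\<lambda>U c. \<lambda>P\<in>U. germ N F0 P (pconst c, 1))\<rparr>"


section \<open>Quasilinear p-forms\<close>

text \<open>
  Below, \<open>smul\<close> is the scalar multiplication of a vector space with underlying type \<open>'v\<close>.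
\<close>

definition quasilinear_form ::
  "nat \<Rightarrow> ('a::field \<Rightarrow> 'v::ab_group_add \<Rightarrow> 'v) \<Rightarrow> ('v \<Rightarrow> 'a) \<Rightarrow> bool" where
  "quasilinear_form p smul \<phi> \<longleftrightarrow>
     (\<forall>c v. \<phi> (smul c v) = c ^ p * \<phi> v) \<and> (\<forall>v w. \<phi> (v + w) = \<phi> v + \<phi> w)"

definition isotropic :: "('v::ab_group_add \<Rightarrow> 'a::field) \<Rightarrow> bool" where
  "isotropic \<phi> \<longleftrightarrow> (\<exists>v. v \<noteq> 0 \<and> \<phi> v = 0)"

definition anisotropic :: "('v::ab_group_add \<Rightarrow> 'a::field) \<Rightarrow> bool" where
  "anisotropic \<phi> \<longleftrightarrow> \<not> isotropic \<phi>"

text \<open>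
  The list \<open>bs\<close> is an ordered basis of the vector space, used for homogeneous coordinates on its
  projective space; in these coordinates \<open>\<phi>\<close> is \<open>\<Sum>i. \<phi> (bs ! i) * x\<^sub>i ^ p\<close>.
\<close>

definition is_basis :: "('a::field \<Rightarrow> 'v::ab_group_add \<Rightarrow> 'v) \<Rightarrow> 'v list \<Rightarrow> bool" where
  "is_basis smul bs \<longleftrightarrow> finite_dimensional_vector_space smul (set bs) \<and> distinct bs"

definition form_poly :: "nat \<Rightarrow> ('v \<Rightarrow> 'a::field) \<Rightarrow> 'v list \<Rightarrow> 'a mpoly" where
  "form_poly p \<phi> bs = (\<Sum>i<length bs. pconst (\<phi> (bs ! i)) * pvar i ^ p)"

definition quasilinear_hypersurface ::
  "nat \<Rightarrow> ('v \<Rightarrow> 'a::field) \<Rightarrow> 'v list \<Rightarrow> ('a mpoly set, 'a germ, 'a) lrspace" where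
  "quasilinear_hypersurface p \<phi> bs = proj_hypersurface (length bs) (form_poly p \<phi> bs)"

text \<open>A form on a space of dimension \<open>d + 2\<close> defines a hypersurface of dimension \<open>d\<close>.\<close>

definition hypersurface_dim :: "('a::field \<Rightarrow> 'v::ab_group_add \<Rightarrow> 'v) \<Rightarrow> int" where
  "hypersurface_dim smul = int (vector_space.dim smul UNIV) - 2"

end

(* Identify the function field L of X with its image under Frobenius, so that p-th powers of
   functions become elements of a subfield of F(S_1, S_2, ...) and a rational map to Y becomes a
   nontrivial relation  sum_j b_j w_j = 0  with w_j in L.  All partial derivatives act on L since the
   equation of X is a form in x_i^p.  Differentiating relations yields Hoffmann's bound: a form of
   dimension p^n + 1 has over L at most one relation up to scaling, and that relation has no zero
   coordinate.  After specialising to linear sections one may assume that X has dimension p^n - 1.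
   The derivatives of the relation w satisfy  sum_j b_j D_i(w_j) = (a_i / a_0) c  with c nonzero, and
   together with the uniqueness of relations this makes the Jacobian matrix (D_i w_j) invertible.  So L has no
   derivations over the field generated by w, hence is generated over it by p-th powers, and the
   relation  sum_i a_i x_i = 0  descends to that field.  Uniqueness now identifies the descended
   relation with x up to scaling, which is the inverse map.  On the geometric side every section over
   a nonempty open set is determined by its value in L, the stalk at the generic point. *)

theory Submission
  imports
    Defs
    "HOL-Computational_Algebra.Polynomial"
    "HOL-Computational_Algebra.Fraction_Field"
begin

section \<open>Evaluation of polynomials\<close>

text \<open>What Frobenius gains is a second field of constants: \<open>L0\<close> has constants in
  F^p, but it lies in F(S), where all of F is available as p-th roots of those constants. The price
  is that the F-linear derivations of F(S) do not preserve \<open>L0\<close> in general; on it they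
  are \<open>D i - r i * D 0\<close>, and \<open>r i\<close> may lie outside \<open>L0\<close>.
  Differentiating a relation w between the b_j therefore need not give another relation. It gives
  the proportionality of the values \<open>mu (D i w)\<close> to the \<open>r i\<close>, and so
  every relation says something about the size of the \<open>L0\<close>-span of the
  \<open>r i\<close>, which is what Hoffmann's bound controls. The number p^n + 1 of coordinates of
  Y is the largest for which that bound forces every relation to have full support; hence the
  uniqueness of relations. The degree of the map is normalised to 1 modulo p, so that Euler's
  identity recovers w from its derivatives; otherwise the Jacobian matrix could not be shown to be
  invertible. Dominance of a map between hypersurfaces of this same dimension has to be proved: it
  is the algebraic independence of w_1, w_2, ... over F, obtained from the Jacobian matrix and the
  separability of F(S) over F.\<close>

definition rhom :: "('a::comm_ring_1 \<Rightarrow> 'b::comm_ring_1) \<Rightarrow> bool" where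
  "rhom c \<longleftrightarrow> c 1 = 1 \<and> (\<forall>x y. c (x + y) = c x + c y) \<and> (\<forall>x y. c (x * y) = c x * c y)"

context
  fixes c :: "'a::comm_ring_1 \<Rightarrow> 'b::comm_ring_1"
  assumes c: "rhom c"
begin

lemma rhom_1: "c 1 = 1"
  and rhom_add: "c (x + y) = c x + c y"
  and rhom_mult: "c (x * y) = c x * c y"
  using c by (auto simp: rhom_def)

lemma rhom_0: "c 0 = 0"
  using rhom_add[of 0 0] by simp

lemma rhom_minus: "c (- x) = - c x"
  using rhom_add[of x "- x"] by (simp add: rhom_0 eq_neg_iff_add_eq_0 add.commute)

lemma rhom_diff: "c (x - y) = c x - c y"
  using rhom_add[of x "- y"] by (simp add: rhom_minus)

lemma rhom_sum: "c (sum f A) = (\<Sum>x\<in>A. c (f x))"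
  by (induction A rule: infinite_finite_induct) (auto simp: rhom_0 rhom_add)

lemma rhom_prod: "c (prod f A) = (\<Prod>x\<in>A. c (f x))"
  by (induction A rule: infinite_finite_induct) (auto simp: rhom_1 rhom_mult)

lemma rhom_power: "c (x ^ n) = c x ^ n"
  by (induction n) (auto simp: rhom_1 rhom_mult)

lemmas rhom_simps = rhom_0 rhom_1 rhom_add rhom_mult rhom_minus rhom_diff rhom_sum rhom_prod rhom_power

end

lemma rhom_comp: "rhom f \<Longrightarrow> rhom g \<Longrightarrow> rhom (\<lambda>x. g (f x))"
  by (auto simp: rhom_def)

definition mon :: "(nat \<Rightarrow> 'b::comm_monoid_mult) \<Rightarrow> (nat \<Rightarrow>\<^sub>0 nat) \<Rightarrow> 'b" where
  "mon g m = (\<Prod>i\<in>Poly_Mapping.keys m. g i ^ Poly_Mapping.lookup m i)"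

lemma mon_superset:
  assumes "finite A" "Poly_Mapping.keys m \<subseteq> A"
  shows "mon g m = (\<Prod>i\<in>A. g i ^ Poly_Mapping.lookup m i)"
  unfolding mon_def
  by (rule prod.mono_neutral_left) (use assms in \<open>auto simp: in_keys_iff\<close>)

lemma mon_0 [simp]: "mon g 0 = 1"
  by (simp add: mon_def)

lemma mon_add: "mon g (m + m') = mon g m * mon g m'"
proof -
  let ?A = "Poly_Mapping.keys m \<union> Poly_Mapping.keys m'"
  have "Poly_Mapping.keys (m + m') \<subseteq> ?A" by (rule Poly_Mapping.keys_add)
  then show ?thesis
    by (simp add: mon_superset[of ?A] lookup_add power_add prod.distrib)
qed

lemma mon_single: "mon g (Poly_Mapping.single i n) = g i ^ n"
  by (simp add: mon_def)

text \<open>The coefficient map \<open>c\<close> is kept general because constants are also sent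
  through Frobenius, in \<open>tw\<close> and in \<open>qform.th\<close>.\<close>

definition ev :: "('a::field \<Rightarrow> 'b::comm_ring_1) \<Rightarrow> (nat \<Rightarrow> 'b) \<Rightarrow> 'a mpoly \<Rightarrow> 'b" where
  "ev c g f = (\<Sum>m\<in>Poly_Mapping.keys f. c (Poly_Mapping.lookup f m) * mon g m)"

lemma ev_superset:
  assumes "rhom c" "finite A" "Poly_Mapping.keys f \<subseteq> A"
  shows "ev c g f = (\<Sum>m\<in>A. c (Poly_Mapping.lookup f m) * mon g m)"
  unfolding ev_def
  by (rule sum.mono_neutral_left) (use assms in \<open>auto simp: in_keys_iff rhom_0[OF assms(1)]\<close>)

lemma ev_single: assumes "rhom c" shows "ev c g (Poly_Mapping.single m a) = c a * mon g m"
  by (simp add: ev_def rhom_0[OF assms])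

lemma ev_add: assumes "rhom c" shows "ev c g (f + f') = ev c g f + ev c g f'"
proof -
  let ?A = "Poly_Mapping.keys f \<union> Poly_Mapping.keys f'"
  have "Poly_Mapping.keys (f + f') \<subseteq> ?A" by (rule Poly_Mapping.keys_add)
  then show ?thesis
    by (simp add: ev_superset[OF assms, of ?A] lookup_add rhom_add[OF assms] distrib_right sum.distrib)
qed

lemma ev_zero: "ev c g 0 = 0"
  by (simp add: ev_def)

lemma ev_sum: "rhom c \<Longrightarrow> ev c g (sum f A) = (\<Sum>x\<in>A. ev c g (f x))"
  by (induction A rule: infinite_finite_induct) (auto simp: ev_zero ev_add)

lemma mpoly_sum_single:
  "(\<Sum>m\<in>Poly_Mapping.keys f. Poly_Mapping.single m (Poly_Mapping.lookup f m)) = f"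
  by (rule poly_mapping_eqI) (auto simp: lookup_sum lookup_single when_def in_keys_iff)

lemma ev_mult: assumes "rhom c" shows "ev c g (f * f') = ev c g f * ev c g f'"
proof -
  let ?s = "\<lambda>f m. Poly_Mapping.single m (Poly_Mapping.lookup f m)"
  have "f * f' = (\<Sum>m\<in>Poly_Mapping.keys f. ?s f m) * (\<Sum>m\<in>Poly_Mapping.keys f'. ?s f' m)"
    by (simp add: mpoly_sum_single)
  also have "\<dots> = (\<Sum>m\<in>Poly_Mapping.keys f. \<Sum>m'\<in>Poly_Mapping.keys f'.
      Poly_Mapping.single (m + m') (Poly_Mapping.lookup f m * Poly_Mapping.lookup f' m'))"
    by (simp add: sum_product mult_single)
  finally have "ev c g (f * f') = (\<Sum>m\<in>Poly_Mapping.keys f. \<Sum>m'\<in>Poly_Mapping.keys f'.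
      c (Poly_Mapping.lookup f m) * mon g m * (c (Poly_Mapping.lookup f' m') * mon g m'))"
    by (simp add: ev_sum[OF assms] ev_single[OF assms] rhom_mult[OF assms] mon_add mult.assoc mult.left_commute)
  then show ?thesis by (simp add: ev_def sum_product)
qed

lemma ev_pconst: "rhom c \<Longrightarrow> ev c g (pconst a) = c a"
  by (simp add: pconst_def ev_single)

lemma ev_pvar: assumes "rhom c" shows "ev c g (pvar i) = g i"
  by (simp add: pvar_def ev_single[OF assms] mon_single rhom_1[OF assms])

lemma rhom_ev: assumes "rhom c" shows "rhom (ev c g)"
  using ev_pconst[OF assms, of g 1]
  by (auto simp: rhom_def[of "ev c g"] ev_add[OF assms] ev_mult[OF assms] pconst_def rhom_1[OF assms])

lemma rhom_pconst: "rhom pconst"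
  by (auto simp: rhom_def pconst_def single_add mult_single)

lemma pconst_eq_0_iff [simp]: "pconst c = 0 \<longleftrightarrow> c = 0"
  unfolding pconst_def by (metis lookup_single_eq lookup_zero single_zero)

lemma mon_pvar: "mon pvar m = Poly_Mapping.single m 1"
proof -
  have "Poly_Mapping.single (\<Sum>i\<in>A. Poly_Mapping.single i (Poly_Mapping.lookup m i)) (1::'a) =
      (\<Prod>i\<in>A. pvar i ^ Poly_Mapping.lookup m i)" if "finite A" for A :: "nat set"
    using that
  proof (induction A)
    case (insert i A)
    have pw: "pvar i ^ n = Poly_Mapping.single (Poly_Mapping.single i n) (1::'a)" for n
      by (induction n) (auto simp: pvar_def mult_single single_add[symmetric])
    show ?case using insert by (simp add: pw insert.IH[symmetric] mult_single)
  qed simp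
  moreover have "(\<Sum>i\<in>Poly_Mapping.keys m. Poly_Mapping.single i (Poly_Mapping.lookup m i)) = m"
    by (rule poly_mapping_eqI) (auto simp: lookup_sum lookup_single when_def in_keys_iff)
  ultimately show ?thesis by (simp add: mon_def) (metis finite_keys)
qed

lemma single_eq_pconst_mon: "Poly_Mapping.single m c = pconst c * mon pvar m"
  by (simp add: mon_pvar pconst_def mult_single)

section \<open>Polynomials in finitely many variables, and induction over them\<close>

lemma PR_iff: "f \<in> carrier (poly_ring N) \<longleftrightarrow> (\<forall>m\<in>Poly_Mapping.keys f. Poly_Mapping.keys m \<subseteq> {..<N})"
  by (simp add: poly_ring_def)

lemma PR_0: "0 \<in> carrier (poly_ring N)"
  and PR_1: "1 \<in> carrier (poly_ring N)"
  and PR_pconst: "pconst c \<in> carrier (poly_ring N)"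
  and PR_pvar: "i < N \<Longrightarrow> pvar i \<in> carrier (poly_ring N)"
  by (auto simp: PR_iff pconst_def pvar_def)

lemma PR_add: "f \<in> carrier (poly_ring N) \<Longrightarrow> g \<in> carrier (poly_ring N) \<Longrightarrow> f + g \<in> carrier (poly_ring N)"
  unfolding PR_iff using Poly_Mapping.keys_add[of f g] by blast

lemma PR_mult:
  assumes "f \<in> carrier (poly_ring N)" "g \<in> carrier (poly_ring N)" shows "f * g \<in> carrier (poly_ring N)"
  unfolding PR_iff
proof
  fix m assume "m \<in> Poly_Mapping.keys (f * g)"
  then obtain a b where ab: "m = a + b" "a \<in> Poly_Mapping.keys f" "b \<in> Poly_Mapping.keys g"
    using Poly_Mapping.keys_mult[of f g] by blast
  then show "Poly_Mapping.keys m \<subseteq> {..<N}"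
    using assms Poly_Mapping.keys_add[of a b] unfolding PR_iff by blast
qed

lemma PR_uminus: "f \<in> carrier (poly_ring N) \<Longrightarrow> - f \<in> carrier (poly_ring N)"
  by (auto simp: PR_iff in_keys_iff)

lemma PR_diff: "f \<in> carrier (poly_ring N) \<Longrightarrow> g \<in> carrier (poly_ring N) \<Longrightarrow> f - g \<in> carrier (poly_ring N)"
  using PR_add[of f N "- g"] PR_uminus by auto

lemma PR_sum: "(\<And>x. x \<in> A \<Longrightarrow> f x \<in> carrier (poly_ring N)) \<Longrightarrow> sum f A \<in> carrier (poly_ring N)"
  by (induction A rule: infinite_finite_induct) (auto simp: PR_0 PR_add)

lemma PR_prod: "(\<And>x. x \<in> A \<Longrightarrow> f x \<in> carrier (poly_ring N)) \<Longrightarrow> prod f A \<in> carrier (poly_ring N)"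
  by (induction A rule: infinite_finite_induct) (auto simp: PR_1 PR_mult)

lemma PR_power: "f \<in> carrier (poly_ring N) \<Longrightarrow> f ^ n \<in> carrier (poly_ring N)"
  by (induction n) (auto simp: PR_1 PR_mult)

lemmas PR_intros = PR_0 PR_1 PR_pconst PR_pvar PR_add PR_mult PR_uminus PR_diff PR_sum PR_prod PR_power

lemma PR_mono: "N \<le> N' \<Longrightarrow> f \<in> carrier (poly_ring N) \<Longrightarrow> f \<in> carrier (poly_ring N')"
  by (fastforce simp: PR_iff)

lemma PR_exists: "\<exists>N. f \<in> carrier (poly_ring N)"
proof -
  have "finite (\<Union>m\<in>Poly_Mapping.keys f. Poly_Mapping.keys m)" by simp
  then obtain N where "(\<Union>m\<in>Poly_Mapping.keys f. Poly_Mapping.keys m) \<subseteq> {..<N}"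
    using finite_nat_iff_bounded by blast
  then show ?thesis unfolding PR_iff by blast
qed

lemma mpoly_induct [consumes 1, case_names const var add mult]:
  assumes f: "f \<in> carrier (poly_ring N)"
    and const: "\<And>c. P (pconst c)" and var: "\<And>i. i < N \<Longrightarrow> P (pvar i)"
    and add: "\<And>f g. f \<in> carrier (poly_ring N) \<Longrightarrow> g \<in> carrier (poly_ring N) \<Longrightarrow> P f \<Longrightarrow> P g \<Longrightarrow> P (f + g)"
    and mult: "\<And>f g. f \<in> carrier (poly_ring N) \<Longrightarrow> g \<in> carrier (poly_ring N) \<Longrightarrow> P f \<Longrightarrow> P g \<Longrightarrow> P (f * g)"
  shows "P f"
proof -
  have P0: "P 0" and P1: "P 1"
    using const[of 0] const[of 1] by (simp_all add: rhom_0[OF rhom_pconst] rhom_1[OF rhom_pconst])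
  have pw: "P (pvar i ^ n)" if "i < N" for i n
    using that by (induction n) (auto intro!: P1 mult var PR_intros)
  have mn: "P (\<Prod>i\<in>A. pvar i ^ Poly_Mapping.lookup m i)" if "finite A" "A \<subseteq> {..<N}" for A and m :: "nat \<Rightarrow>\<^sub>0 nat"
    using that by (induction A) (auto intro!: P1 mult pw PR_intros)
  have mnP: "mon pvar m \<in> carrier (poly_ring N)" if "Poly_Mapping.keys m \<subseteq> {..<N}" for m
    using that by (auto simp: mon_pvar PR_iff)
  have "P (\<Sum>m\<in>A. Poly_Mapping.single m (Poly_Mapping.lookup f m))" if "finite A" "A \<subseteq> Poly_Mapping.keys f" for A
    using that
  proof (induction A)
    case (insert m A)
    have k: "Poly_Mapping.keys m \<subseteq> {..<N}" using insert.prems f by (auto simp: PR_iff)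
    have s: "P (Poly_Mapping.single m (Poly_Mapping.lookup f m))"
      unfolding single_eq_pconst_mon
      by (intro mult const PR_pconst mnP k) (unfold mon_def, intro mn k finite_keys)
    have "(\<Sum>m\<in>A. Poly_Mapping.single m (Poly_Mapping.lookup f m)) \<in> carrier (poly_ring N)"
      using insert.prems f by (intro PR_sum) (auto simp: PR_iff in_keys_iff)
    moreover have "Poly_Mapping.single m (Poly_Mapping.lookup f m) \<in> carrier (poly_ring N)"
      using k by (auto simp: PR_iff)
    ultimately show ?case using insert s by (auto intro!: add)
  qed (simp add: P0)
  from this[of "Poly_Mapping.keys f"] show ?thesis by (simp add: mpoly_sum_single)
qed

lemma rhom_eq_on_PR:
  assumes "rhom F" "rhom G" "\<And>c. F (pconst c) = G (pconst c)" "\<And>i. i < N \<Longrightarrow> F (pvar i) = G (pvar i)"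
    and "f \<in> carrier (poly_ring N)"
  shows "F f = G f"
  using assms(5) by (induction f rule: mpoly_induct) (use assms in \<open>auto simp: rhom_simps[OF assms(1)] rhom_simps[OF assms(2)]\<close>)

lemma ev_pconst_PR:
  assumes "f \<in> carrier (poly_ring N)" "\<And>i. i < N \<Longrightarrow> g i \<in> carrier (poly_ring M)"
  shows "ev pconst g f \<in> carrier (poly_ring M)"
  using assms(1) by (induction f rule: mpoly_induct)
    (auto simp: ev_pconst ev_pvar ev_add ev_mult rhom_pconst assms(2) intro: PR_intros)

section \<open>Partial derivatives\<close>

text \<open>If the variable \<open>i\<close> is absent from \<open>m\<close>, the truncated
  difference leaves \<open>m\<close> unchanged, but the coefficient in front of it is then
  0.\<close>

definition pd :: "nat \<Rightarrow> 'a::field mpoly \<Rightarrow> 'a mpoly" where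
  "pd i f = (\<Sum>m\<in>Poly_Mapping.keys f.
     Poly_Mapping.single (m - Poly_Mapping.single i 1) (of_nat (Poly_Mapping.lookup m i) * Poly_Mapping.lookup f m))"

lemma pd_superset:
  assumes "finite A" "Poly_Mapping.keys f \<subseteq> A"
  shows "pd i f = (\<Sum>m\<in>A.
     Poly_Mapping.single (m - Poly_Mapping.single i 1) (of_nat (Poly_Mapping.lookup m i) * Poly_Mapping.lookup f m))"
  unfolding pd_def
  by (rule sum.mono_neutral_left) (use assms in \<open>auto simp: in_keys_iff\<close>)

lemma pd_single: "pd i (Poly_Mapping.single m c) =
    Poly_Mapping.single (m - Poly_Mapping.single i 1) (of_nat (Poly_Mapping.lookup m i) * c)"
  by (simp add: pd_def)

lemma pd_add: "pd i (f + g) = pd i f + pd i g"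
proof -
  let ?A = "Poly_Mapping.keys f \<union> Poly_Mapping.keys g"
  have "Poly_Mapping.keys (f + g) \<subseteq> ?A" by (rule Poly_Mapping.keys_add)
  then show ?thesis
    by (simp add: pd_superset[of ?A] lookup_add distrib_left sum.distrib single_add)
qed

lemma pd_zero [simp]: "pd i 0 = 0"
  by (simp add: pd_def)

lemma pd_sum: "pd i (sum f A) = (\<Sum>x\<in>A. pd i (f x))"
  by (induction A rule: infinite_finite_induct) (auto simp: pd_add)

lemma minus_single_add:
  "Poly_Mapping.lookup m i \<noteq> 0 \<Longrightarrow> m - Poly_Mapping.single i 1 + m' = m + m' - Poly_Mapping.single i (1::nat)"
  by (rule poly_mapping_eqI) (auto simp: lookup_add lookup_minus lookup_single when_def)

lemma pd_mult: "pd i (f * g) = pd i f * g + f * pd i g"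
proof -
  let ?s = "\<lambda>f m. Poly_Mapping.single m (Poly_Mapping.lookup f m)"
  have sg: "pd i (Poly_Mapping.single m c * Poly_Mapping.single m' c') =
      pd i (Poly_Mapping.single m c) * Poly_Mapping.single m' c' +
      Poly_Mapping.single m c * pd i (Poly_Mapping.single m' c')" for m m' and c c' :: 'a
  proof -
    have 1: "Poly_Mapping.single (m - Poly_Mapping.single i 1 + m') (of_nat (Poly_Mapping.lookup m i) * c * c') =
      Poly_Mapping.single (m + m' - Poly_Mapping.single i 1) (of_nat (Poly_Mapping.lookup m i) * c * c')"
      using minus_single_add[of m i m'] by (cases "Poly_Mapping.lookup m i = 0") simp_all
    have 2: "Poly_Mapping.single (m + (m' - Poly_Mapping.single i 1)) (c * (of_nat (Poly_Mapping.lookup m' i) * c')) =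
      Poly_Mapping.single (m + m' - Poly_Mapping.single i 1) (c * (of_nat (Poly_Mapping.lookup m' i) * c'))"
      using minus_single_add[of m' i m]
      by (cases "Poly_Mapping.lookup m' i = 0") (simp_all add: add.commute)
    show ?thesis
      unfolding pd_single mult_single 1 2 single_add[symmetric]
      by (simp add: lookup_add algebra_simps)
  qed
  have "f * g = (\<Sum>m\<in>Poly_Mapping.keys f. ?s f m) * (\<Sum>m\<in>Poly_Mapping.keys g. ?s g m)"
    by (simp add: mpoly_sum_single)
  then have "pd i (f * g) = (\<Sum>m\<in>Poly_Mapping.keys f. \<Sum>m'\<in>Poly_Mapping.keys g.
      pd i (?s f m) * ?s g m' + ?s f m * pd i (?s g m'))"
    by (simp add: sum_product pd_sum sg)
  also have "\<dots> = (\<Sum>m\<in>Poly_Mapping.keys f. pd i (?s f m)) * (\<Sum>m\<in>Poly_Mapping.keys g. ?s g m) +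
      (\<Sum>m\<in>Poly_Mapping.keys f. ?s f m) * (\<Sum>m\<in>Poly_Mapping.keys g. pd i (?s g m))"
    by (simp add: sum_product sum.distrib)
  also have "\<dots> = pd i f * g + f * pd i g"
    by (simp add: pd_sum[symmetric] mpoly_sum_single)
  finally show ?thesis .
qed

lemma pd_pconst [simp]: "pd i (pconst c) = 0"
  by (simp add: pconst_def pd_single)

lemma pd_pvar: "pd i (pvar j) = (if i = j then 1 else 0)"
  by (auto simp: pvar_def pd_single lookup_single when_def)

lemma pd_uminus: "pd i (- f) = - pd i f"
  using pd_add[of i f "- f"] by (simp add: eq_neg_iff_add_eq_0 add.commute)

lemma pd_power: "pd i (f ^ n) = of_nat n * f ^ (n - 1) * pd i f"
proof (induction n)
  case 0
  show ?case using pd_pconst[of i 1] by (simp add: pconst_def)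
next
  case (Suc n)
  then show ?case by (cases n) (auto simp: pd_mult algebra_simps)
qed

lemma when_eq_if:
  "(A \<and> l \<noteq> 0 \<longleftrightarrow> B) \<Longrightarrow> (B \<Longrightarrow> l = l') \<Longrightarrow>
    (of_nat l * x when A) = (if B then of_nat l' * x else (0::'a::semiring_1))"
  by (cases "l = 0") (auto simp: when_def)

text \<open>Only one monomial of \<open>f\<close> can contribute: any other \<open>n\<close> with
  the same truncated difference does not contain the variable \<open>i\<close> and carries the
  factor 0.\<close>

lemma lookup_pd: "Poly_Mapping.lookup (pd i f) m =
    of_nat (Suc (Poly_Mapping.lookup m i)) * Poly_Mapping.lookup f (m + Poly_Mapping.single i 1)"
proof -
  have "Poly_Mapping.lookup (pd i f) m = (\<Sum>n\<in>Poly_Mapping.keys f.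
      (of_nat (Poly_Mapping.lookup n i) * Poly_Mapping.lookup f n when n - Poly_Mapping.single i 1 = m))"
    by (simp add: pd_def lookup_sum lookup_single)
  also have "\<dots> = (\<Sum>n\<in>Poly_Mapping.keys f.
      (if n = m + Poly_Mapping.single i 1 then of_nat (Suc (Poly_Mapping.lookup m i)) * Poly_Mapping.lookup f n else 0))"
  proof (rule sum.cong[OF refl])
    fix n
    have "n = m + Poly_Mapping.single i 1" if "n - Poly_Mapping.single i 1 = m" "Poly_Mapping.lookup n i \<noteq> 0"
      using that minus_single_add[of n i "Poly_Mapping.single i 1"] by auto
    then have "n - Poly_Mapping.single i 1 = m \<and> Poly_Mapping.lookup n i \<noteq> 0 \<longleftrightarrow> n = m + Poly_Mapping.single i 1"
      by (metis add_diff_cancel_right' add_is_0 lookup_add lookup_single_eq one_neq_zero)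
    moreover have "Poly_Mapping.lookup n i = Suc (Poly_Mapping.lookup m i)" if "n = m + Poly_Mapping.single i 1"
      using that by (simp add: lookup_add)
    ultimately show "(of_nat (Poly_Mapping.lookup n i) * Poly_Mapping.lookup f n when n - Poly_Mapping.single i 1 = m) =
      (if n = m + Poly_Mapping.single i 1 then of_nat (Suc (Poly_Mapping.lookup m i)) * Poly_Mapping.lookup f n else 0)"
      by (intro when_eq_if)
  qed
  also have "\<dots> = of_nat (Suc (Poly_Mapping.lookup m i)) * Poly_Mapping.lookup f (m + Poly_Mapping.single i 1)"
    by (simp add: in_keys_iff)
  finally show ?thesis .
qed

lemma pd_PR: "f \<in> carrier (poly_ring N) \<Longrightarrow> pd i f \<in> carrier (poly_ring N)"
  by (induction f rule: mpoly_induct) (auto simp: pd_pvar pd_add pd_mult intro: PR_intros)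

lemma pd_commute: "pd i (pd j f) = pd j (pd i f)"
proof -
  obtain N where "f \<in> carrier (poly_ring N)" using PR_exists by blast
  then show ?thesis
  proof (induction f rule: mpoly_induct)
    case (var k)
    have "pd l (1 :: 'a mpoly) = 0" for l using pd_power[of l 1 0] by simp
    then show ?case by (auto simp: pd_pvar)
  qed (auto simp: pd_add pd_mult algebra_simps)
qed

section \<open>Homogeneous components\<close>

lemma lookup_hom_component:
  "Poly_Mapping.lookup (hom_component d f) m = (if mono_deg m = d then Poly_Mapping.lookup f m else 0)"
  by (auto simp: hom_component_def lookup_sum lookup_single when_def in_keys_iff sum.delta)

lemma mono_deg_superset:
  assumes "finite A" "Poly_Mapping.keys m \<subseteq> A"
  shows "mono_deg m = (\<Sum>i\<in>A. Poly_Mapping.lookup m i)"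
  unfolding mono_deg_def
  by (rule sum.mono_neutral_left) (use assms in \<open>auto simp: in_keys_iff\<close>)

lemma mono_deg_add: "mono_deg (m + m') = mono_deg m + mono_deg m'"
proof -
  let ?A = "Poly_Mapping.keys m \<union> Poly_Mapping.keys m'"
  have "Poly_Mapping.keys (m + m') \<subseteq> ?A" by (rule Poly_Mapping.keys_add)
  then show ?thesis
    by (simp add: mono_deg_superset[of ?A] lookup_add sum.distrib)
qed

lemma mono_deg_single [simp]: "mono_deg (Poly_Mapping.single i n) = n"
  by (simp add: mono_deg_def)

lemma mono_deg_0 [simp]: "mono_deg 0 = 0"
  by (simp add: mono_deg_def)

lemma homogeneous_0: "homogeneous d 0"
  and homogeneous_1: "homogeneous 0 1"
  and homogeneous_pconst: "homogeneous 0 (pconst c)"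
  and homogeneous_pvar: "homogeneous 1 (pvar i)"
  by (auto simp: homogeneous_def pconst_def pvar_def)

lemma homogeneous_add: "homogeneous d f \<Longrightarrow> homogeneous d g \<Longrightarrow> homogeneous d (f + g)"
  unfolding homogeneous_def using Poly_Mapping.keys_add[of f g] by blast

lemma homogeneous_uminus: "homogeneous d f \<Longrightarrow> homogeneous d (- f)"
  by (auto simp: homogeneous_def in_keys_iff)

lemma homogeneous_diff: "homogeneous d f \<Longrightarrow> homogeneous d g \<Longrightarrow> homogeneous d (f - g)"
  using homogeneous_add[of d f "- g"] by (simp add: homogeneous_uminus)

lemma homogeneous_mult:
  assumes "homogeneous d f" "homogeneous e g" shows "homogeneous (d + e) (f * g)"
  unfolding homogeneous_def
proof
  fix m assume "m \<in> Poly_Mapping.keys (f * g)"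
  then obtain a b where "m = a + b" "a \<in> Poly_Mapping.keys f" "b \<in> Poly_Mapping.keys g"
    using Poly_Mapping.keys_mult[of f g] by blast
  then show "mono_deg m = d + e"
    using assms by (simp add: homogeneous_def mono_deg_add)
qed

lemma homogeneous_sum: "(\<And>x. x \<in> A \<Longrightarrow> homogeneous d (f x)) \<Longrightarrow> homogeneous d (sum f A)"
  by (induction A rule: infinite_finite_induct) (auto simp: homogeneous_0 homogeneous_add)

lemma homogeneous_power: "homogeneous d f \<Longrightarrow> homogeneous (n * d) (f ^ n)"
  by (induction n) (auto simp: homogeneous_1 homogeneous_mult)

lemma homogeneous_prod:
  "(\<And>x. x \<in> A \<Longrightarrow> homogeneous (d x) (f x)) \<Longrightarrow> homogeneous (sum d A) (prod f A)"
  by (induction A rule: infinite_finite_induct) (auto simp: homogeneous_1 homogeneous_mult)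

lemma homogeneous_hom_component: "homogeneous d (hom_component d f)"
  by (auto simp: homogeneous_def in_keys_iff lookup_hom_component split: if_splits)

lemma hom_component_same: "homogeneous d f \<Longrightarrow> hom_component d f = f"
  by (rule poly_mapping_eqI) (auto simp: lookup_hom_component homogeneous_def in_keys_iff)

lemma hom_component_other: "homogeneous d f \<Longrightarrow> d \<noteq> e \<Longrightarrow> hom_component e f = 0"
  by (rule poly_mapping_eqI) (auto simp: lookup_hom_component homogeneous_def in_keys_iff)

lemma hom_component_add: "hom_component d (f + g) = hom_component d f + hom_component d g"
  by (rule poly_mapping_eqI) (auto simp: lookup_hom_component lookup_add)

lemma hom_component_diff: "hom_component d (f - g) = hom_component d f - hom_component d g"
  by (rule poly_mapping_eqI) (auto simp: lookup_hom_component lookup_minus)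

lemma hom_component_zero: "hom_component d 0 = 0"
  by (rule poly_mapping_eqI) (auto simp: lookup_hom_component)

lemma hom_component_sum: "hom_component d (sum f A) = (\<Sum>x\<in>A. hom_component d (f x))"
  by (induction A rule: infinite_finite_induct) (auto simp: hom_component_zero hom_component_add)

lemma hom_component_PR: "f \<in> carrier (poly_ring N) \<Longrightarrow> hom_component d f \<in> carrier (poly_ring N)"
  by (auto simp: PR_iff in_keys_iff lookup_hom_component split: if_splits)

lemma sum_hom_components:
  assumes "finite A" "mono_deg ` Poly_Mapping.keys f \<subseteq> A"
  shows "(\<Sum>d\<in>A. hom_component d f) = f"
  by (rule poly_mapping_eqI)
    (use assms in \<open>auto simp: lookup_sum lookup_hom_component sum.delta image_subset_iff simp flip: not_in_keys_iff_lookup_eq_zero\<close>)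

lemma hom_component_mult_homogeneous:
  assumes "homogeneous e g" shows "hom_component (d + e) (f * g) = hom_component d f * g"
proof -
  let ?A = "mono_deg ` Poly_Mapping.keys f \<union> {d}"
  have "f * g = (\<Sum>i\<in>?A. hom_component i f) * g" by (subst sum_hom_components) auto
  also have "hom_component (d + e) \<dots> = (\<Sum>i\<in>?A. hom_component (d + e) (hom_component i f * g))"
    by (simp only: sum_distrib_right hom_component_sum)
  also have "\<dots> = (\<Sum>i\<in>?A. if i = d then hom_component d f * g else 0)"
  proof (rule sum.cong[OF refl])
    fix i
    have "homogeneous (i + e) (hom_component i f * g)"
      by (intro homogeneous_mult homogeneous_hom_component assms)
    then show "hom_component (d + e) (hom_component i f * g) = (if i = d then hom_component d f * g else 0)"
      by (auto simp: hom_component_same hom_component_other)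
  qed
  also have "\<dots> = hom_component d f * g" by simp
  finally show ?thesis .
qed

lemma hom_component_mult_low:
  assumes "homogeneous e g" "d < e" shows "hom_component d (f * g) = 0"
proof -
  let ?A = "mono_deg ` Poly_Mapping.keys f"
  have "f * g = (\<Sum>i\<in>?A. hom_component i f) * g" by (subst sum_hom_components) auto
  also have "hom_component d \<dots> = (\<Sum>i\<in>?A. hom_component d (hom_component i f * g))"
    by (simp only: sum_distrib_right hom_component_sum)
  also have "\<dots> = 0"
  proof (rule sum.neutral, rule ballI)
    fix i
    have "homogeneous (i + e) (hom_component i f * g)"
      by (intro homogeneous_mult homogeneous_hom_component assms)
    then show "hom_component d (hom_component i f * g) = 0"
      using assms(2) by (auto intro: hom_component_other)
  qed
  finally show ?thesis .
qed

lemma homogeneous_ev: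
  assumes "homogeneous e f" "f \<in> carrier (poly_ring N)" "\<And>i. i < N \<Longrightarrow> homogeneous d (h i)"
  shows "homogeneous (e * d) (ev pconst h f)"
  unfolding ev_def
proof (rule homogeneous_sum)
  fix m assume m: "m \<in> Poly_Mapping.keys f"
  have "homogeneous (\<Sum>i\<in>Poly_Mapping.keys m. Poly_Mapping.lookup m i * d) (mon h m)"
    unfolding mon_def using m assms(2,3)
    by (intro homogeneous_prod homogeneous_power) (auto simp: PR_iff)
  moreover have "(\<Sum>i\<in>Poly_Mapping.keys m. Poly_Mapping.lookup m i * d) = e * d"
    using m assms(1) by (auto simp: homogeneous_def mono_deg_def simp flip: sum_distrib_right)
  ultimately show "homogeneous (e * d) (pconst (Poly_Mapping.lookup f m) * mon h m)"
    using homogeneous_mult[OF homogeneous_pconst] by fastforce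
qed

lemma hom_component_ev:
  assumes "f \<in> carrier (poly_ring N)" "\<And>i. i < N \<Longrightarrow> homogeneous d (h i)" "d > 0"
  shows "hom_component (e * d) (ev pconst h f) = ev pconst h (hom_component e f)"
proof -
  let ?A = "mono_deg ` Poly_Mapping.keys f \<union> {e}"
  have "ev pconst h f = ev pconst h (\<Sum>i\<in>?A. hom_component i f)" by (subst sum_hom_components) auto
  also have "hom_component (e * d) \<dots> = (\<Sum>i\<in>?A. hom_component (e * d) (ev pconst h (hom_component i f)))"
    by (simp only: ev_sum[OF rhom_pconst] hom_component_sum)
  also have "\<dots> = (\<Sum>i\<in>?A. if i = e then ev pconst h (hom_component e f) else 0)"
  proof (rule sum.cong[OF refl])
    fix i
    have "homogeneous (i * d) (ev pconst h (hom_component i f))"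
      by (intro homogeneous_ev[of _ _ N] homogeneous_hom_component hom_component_PR assms)
    then show "hom_component (e * d) (ev pconst h (hom_component i f)) = (if i = e then ev pconst h (hom_component e f) else 0)"
      using assms(3) by (auto simp: hom_component_same intro: hom_component_other)
  qed
  also have "\<dots> = ev pconst h (hom_component e f)" by simp
  finally show ?thesis .
qed

section \<open>Subfields and simple extensions\<close>

text \<open>The fields of the proof are all subsets of F(S), so that towers of fields can be built
  by recursion and compared by inclusion.\<close>

definition csub :: "'r::comm_ring_1 set \<Rightarrow> bool" where
  "csub C \<longleftrightarrow> 0 \<in> C \<and> 1 \<in> C \<and> (\<forall>x\<in>C. \<forall>y\<in>C. x + y \<in> C \<and> x - y \<in> C \<and> x * y \<in> C)"

lemma csubD:
  assumes "csub C"
  shows "0 \<in> C" "1 \<in> C" "x \<in> C \<Longrightarrow> y \<in> C \<Longrightarrow> x + y \<in> C" "x \<in> C \<Longrightarrow> y \<in> C \<Longrightarrow> x - y \<in> C"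
    "x \<in> C \<Longrightarrow> y \<in> C \<Longrightarrow> x * y \<in> C"
  using assms by (auto simp: csub_def)

lemma csub_uminus: "csub C \<Longrightarrow> x \<in> C \<Longrightarrow> - x \<in> C"
  using csubD(4)[of C 0 x] csubD(1) by auto

lemma csub_sum: "csub C \<Longrightarrow> (\<And>i. i \<in> A \<Longrightarrow> f i \<in> C) \<Longrightarrow> sum f A \<in> C"
  by (induction A rule: infinite_finite_induct) (auto simp: csubD)

lemma csub_prod: "csub C \<Longrightarrow> (\<And>i. i \<in> A \<Longrightarrow> f i \<in> C) \<Longrightarrow> prod f A \<in> C"
  by (induction A rule: infinite_finite_induct) (auto simp: csubD)

lemma csub_power: "csub C \<Longrightarrow> x \<in> C \<Longrightarrow> x ^ n \<in> C"
  by (induction n) (auto simp: csubD)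

lemma csub_of_nat: "csub C \<Longrightarrow> of_nat n \<in> C"
  by (induction n) (auto simp: csubD)

lemmas csub_intros = csubD csub_uminus csub_sum csub_prod csub_power csub_of_nat

lemma csub_PR: "csub (carrier (poly_ring N))"
  by (auto simp: csub_def intro: PR_intros)

definition sfld :: "'k::field set \<Rightarrow> bool" where
  "sfld K \<longleftrightarrow> csub K \<and> (\<forall>x\<in>K. inverse x \<in> K)"

lemma sfld_csub: "sfld K \<Longrightarrow> csub K"
  by (simp add: sfld_def)

lemma sfld_inverse: "sfld K \<Longrightarrow> x \<in> K \<Longrightarrow> inverse x \<in> K"
  by (simp add: sfld_def)

lemma sfld_divide: "sfld K \<Longrightarrow> x \<in> K \<Longrightarrow> y \<in> K \<Longrightarrow> x / y \<in> K"
  by (simp add: divide_inverse sfld_inverse sfld_csub csubD)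

text \<open>This is the fraction field of the image of \<open>C\<close>. Since
  \<open>\<theta>\<close> may have a kernel, it also covers the fraction fields of quotients such as
  F[x]/(Phi).\<close>

definition fracs :: "('r::comm_ring_1 \<Rightarrow> 'k::field) \<Rightarrow> 'r set \<Rightarrow> 'k set" where
  "fracs \<theta> C = {\<theta> f / \<theta> g | f g. f \<in> C \<and> g \<in> C \<and> \<theta> g \<noteq> 0}"

lemma fracsI: "f \<in> C \<Longrightarrow> g \<in> C \<Longrightarrow> \<theta> g \<noteq> 0 \<Longrightarrow> \<theta> f / \<theta> g \<in> fracs \<theta> C"
  by (auto simp: fracs_def)

lemma fracsE:
  assumes "x \<in> fracs \<theta> C" obtains f g where "f \<in> C" "g \<in> C" "\<theta> g \<noteq> 0" "x = \<theta> f / \<theta> g"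
  using assms by (auto simp: fracs_def)

lemma fracs_base: "rhom \<theta> \<Longrightarrow> csub C \<Longrightarrow> f \<in> C \<Longrightarrow> \<theta> f \<in> fracs \<theta> C"
  using fracsI[of f C 1 \<theta>] by (simp add: rhom_1 csubD)

lemma sfld_fracs:
  assumes th: "rhom \<theta>" and C: "csub C" shows "sfld (fracs \<theta> C)"
proof -
  note r = rhom_simps[OF th]
  have "x + y \<in> fracs \<theta> C \<and> x - y \<in> fracs \<theta> C \<and> x * y \<in> fracs \<theta> C"
    if x: "x \<in> fracs \<theta> C" and y: "y \<in> fracs \<theta> C" for x y
  proof -
    obtain f g where fg1: "f \<in> C" "g \<in> C" "\<theta> g \<noteq> 0" "x = \<theta> f / \<theta> g"
      by (rule fracsE[OF x])
    obtain f' g' where "f' \<in> C" "g' \<in> C" "\<theta> g' \<noteq> 0" "y = \<theta> f' / \<theta> g'"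
      by (rule fracsE[OF y])
    note fg = fg1 this
    have eq: "x + y = \<theta> (f * g' + f' * g) / \<theta> (g * g')" "x - y = \<theta> (f * g' - f' * g) / \<theta> (g * g')"
      "x * y = \<theta> (f * f') / \<theta> (g * g')"
      using fg(3,7) unfolding fg(4,8) by (simp_all add: r add_frac_eq diff_frac_eq)
    show ?thesis unfolding eq
      using fg by (intro conjI fracsI) (auto simp: r intro!: csub_intros C)
  qed
  moreover have "inverse x \<in> fracs \<theta> C" if x: "x \<in> fracs \<theta> C" for x
  proof -
    obtain f g where fg: "f \<in> C" "g \<in> C" "\<theta> g \<noteq> 0" "x = \<theta> f / \<theta> g"
      by (rule fracsE[OF x])
    show ?thesis
    proof (cases "\<theta> f = 0")
      case True
      then show ?thesis using fracs_base[OF th C csubD(1)[OF C]] fg by (simp add: r)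
    next
      case False
      then show ?thesis using fg fracsI[of g C f \<theta>] by simp
    qed
  qed
  moreover have "0 \<in> fracs \<theta> C" "1 \<in> fracs \<theta> C"
    using fracs_base[OF th C] csubD(1,2)[OF C] r(1,2) by metis+
  ultimately show ?thesis by (auto simp: sfld_def csub_def)
qed

lemma fracs_common_denom:
  assumes th: "rhom \<theta>" and C: "csub C" and "finite A" "\<And>j. j \<in> A \<Longrightarrow> v j \<in> fracs \<theta> C"
  shows "\<exists>f g. g \<in> C \<and> \<theta> g \<noteq> 0 \<and> (\<forall>j\<in>A. f j \<in> C \<and> v j = \<theta> (f j) / \<theta> g)"
  using assms(3,4)
proof (induction A)
  case empty
  then show ?case using csubD(2)[OF C] rhom_1[OF th] by (metis empty_iff zero_neq_one)
next
  case (insert i A)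
  then obtain f g where fg: "g \<in> C" "\<theta> g \<noteq> 0" "\<forall>j\<in>A. f j \<in> C \<and> v j = \<theta> (f j) / \<theta> g"
    by (metis insertCI)
  obtain f' g' where fg': "f' \<in> C" "g' \<in> C" "\<theta> g' \<noteq> 0" "v i = \<theta> f' / \<theta> g'"
    by (rule fracsE[OF insert.prems[of i]]) auto
  have "g * g' \<in> C" "\<theta> (g * g') \<noteq> 0" using fg fg' C by (auto simp: csubD rhom_mult[OF th])
  moreover have "\<forall>j\<in>insert i A. (if j = i then f' * g else f j * g') \<in> C \<and>
      v j = \<theta> (if j = i then f' * g else f j * g') / \<theta> (g * g')"
    using fg fg' C by (auto simp: csubD rhom_mult[OF th])
  ultimately show ?case by (intro exI[of _ "\<lambda>j. if j = i then f' * g else f j * g'"] exI[of _ "g * g'"]) blast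
qed

section \<open>Derivations of subfields\<close>

definition deriv_on :: "('k::field \<Rightarrow> 'k) \<Rightarrow> 'k set \<Rightarrow> bool" where
  "deriv_on D Q \<longleftrightarrow> (\<forall>x\<in>Q. D x \<in> Q) \<and>
     (\<forall>x\<in>Q. \<forall>y\<in>Q. D (x + y) = D x + D y \<and> D (x * y) = D x * y + x * D y)"

context
  fixes D :: "'k::field \<Rightarrow> 'k" and Q
  assumes D: "deriv_on D Q" and Q: "sfld Q"
begin

lemma deriv_closed: "x \<in> Q \<Longrightarrow> D x \<in> Q"
  and deriv_add: "x \<in> Q \<Longrightarrow> y \<in> Q \<Longrightarrow> D (x + y) = D x + D y"
  and deriv_mult: "x \<in> Q \<Longrightarrow> y \<in> Q \<Longrightarrow> D (x * y) = D x * y + x * D y"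
  using D by (auto simp: deriv_on_def)

lemma deriv_0: "D 0 = 0"
proof -
  have "D 0 + 0 = D 0 + D 0" using deriv_add[of 0 0] csubD(1)[OF sfld_csub[OF Q]] by simp
  then show ?thesis by (simp only: add_left_cancel)
qed

lemma deriv_1: "D 1 = 0"
proof -
  have "D 1 + 0 = D 1 + D 1" using deriv_mult[of 1 1] csubD(2)[OF sfld_csub[OF Q]] by simp
  then show ?thesis by (simp only: add_left_cancel)
qed

lemma deriv_uminus: "x \<in> Q \<Longrightarrow> D (- x) = - D x"
  using deriv_add[of x "- x"] csub_uminus[OF sfld_csub[OF Q]] deriv_0
  by (simp add: eq_neg_iff_add_eq_0 add.commute)

lemma deriv_sum: "(\<And>i. i \<in> A \<Longrightarrow> f i \<in> Q) \<Longrightarrow> D (sum f A) = (\<Sum>i\<in>A. D (f i))"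
  by (induction A rule: infinite_finite_induct)
    (auto simp: deriv_0 deriv_add csub_sum[OF sfld_csub[OF Q]])

lemma deriv_power: "x \<in> Q \<Longrightarrow> D (x ^ n) = of_nat n * x ^ (n - 1) * D x"
proof (induction n)
  case (Suc n)
  then show ?case
    by (cases n) (auto simp: deriv_1 deriv_mult csub_power[OF sfld_csub[OF Q]] csubD[OF sfld_csub[OF Q]] algebra_simps)
qed (simp add: deriv_1)

lemma deriv_divide:
  assumes "x \<in> Q" "y \<in> Q" "y \<noteq> 0" shows "D (x / y) = (D x - x / y * D y) / y"
proof -
  have "D x = D (x / y * y)" using assms by simp
  also have "\<dots> = D (x / y) * y + x / y * D y"
    using assms by (intro deriv_mult sfld_divide Q)
  finally show ?thesis using assms by (simp add: field_simps)
qed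

end

text \<open>The quotient rule dictates the value on a fraction. It depends on the fraction alone
  because, for two representations f/g and f'/g', the element \<open>f * g' - f' * g\<close> lies in
  the kernel of \<open>\<theta>\<close>, which \<open>d\<close> maps into itself.\<close>

lemma deriv_extend:
  assumes th: "rhom \<theta>" and C: "csub C" and dC: "\<And>f. f \<in> C \<Longrightarrow> d f \<in> C"
    and add: "\<And>f g. f \<in> C \<Longrightarrow> g \<in> C \<Longrightarrow> d (f + g) = d f + d g"
    and mult: "\<And>f g. f \<in> C \<Longrightarrow> g \<in> C \<Longrightarrow> d (f * g) = d f * g + f * d g"
    and ker: "\<And>f. f \<in> C \<Longrightarrow> \<theta> f = 0 \<Longrightarrow> \<theta> (d f) = 0"
  obtains D where "deriv_on D (fracs \<theta> C)" "\<And>f. f \<in> C \<Longrightarrow> D (\<theta> f) = \<theta> (d f)"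
proof -
  note r = rhom_simps[OF th]
  define rep where "rep z f g \<longleftrightarrow> f \<in> C \<and> g \<in> C \<and> \<theta> g \<noteq> 0 \<and> z = \<theta> f / \<theta> g" for z f g
  \<comment> \<open>The quotient rule, with \<open>z\<close> written for
    \<open>\<theta> f / \<theta> g\<close>.\<close>
  define D where "D z = (SOME v. \<exists>f g. rep z f g \<and> v = (\<theta> (d f) - z * \<theta> (d g)) / \<theta> g)" for z
  have d_diff: "d (f - g) = d f - d g" if "f \<in> C" "g \<in> C" for f g
    using add[of "f - g" g] that C by (simp add: csubD)
  have wd: "(\<theta> (d f) - z * \<theta> (d g)) / \<theta> g = (\<theta> (d f') - z * \<theta> (d g')) / \<theta> g'"
    if "rep z f g" "rep z f' g'" for z f g f' g'
  proof -
    have c: "f \<in> C" "g \<in> C" "f' \<in> C" "g' \<in> C" and nz: "\<theta> g \<noteq> 0" "\<theta> g' \<noteq> 0"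
      using that by (auto simp: rep_def)
    have z: "\<theta> f = z * \<theta> g" using that(1) by (simp add: rep_def)
    have z': "\<theta> f' = z * \<theta> g'" using that(2) by (simp add: rep_def)
    note z = z z'
    have "\<theta> (f * g' - f' * g) = 0" by (simp add: r z)
    then have "\<theta> (d (f * g' - f' * g)) = 0" using c C by (intro ker) (auto simp: csubD)
    then have "\<theta> (d f) * \<theta> g' + z * \<theta> g * \<theta> (d g') - (\<theta> (d f') * \<theta> g + z * \<theta> g' * \<theta> (d g)) = 0"
      using c C by (simp add: d_diff mult csubD r z)
    then show ?thesis using nz by (simp add: field_simps)
  qed
  have D: "D z = (\<theta> (d f) - z * \<theta> (d g)) / \<theta> g" if "rep z f g" for z f g
  proof -
    have "\<exists>v f g. rep z f g \<and> v = (\<theta> (d f) - z * \<theta> (d g)) / \<theta> g" using that by blast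
    from someI_ex[OF this] show ?thesis unfolding D_def[symmetric] using wd that by metis
  qed
  have ex: "\<exists>f g. rep z f g" if "z \<in> fracs \<theta> C" for z
    using that by (auto simp: fracs_def rep_def)
  have sf: "sfld (fracs \<theta> C)" by (rule sfld_fracs[OF th C])
  have "D x \<in> fracs \<theta> C" if x: "x \<in> fracs \<theta> C" for x
  proof -
    obtain f g where fg: "rep x f g" using ex[OF x] by blast
    show ?thesis unfolding D[OF fg]
      using fg x by (intro sfld_divide[OF sf] csub_intros(4,5)[OF sfld_csub[OF sf]] fracs_base[OF th C] dC)
        (auto simp: rep_def)
  qed
  moreover have "D (x + y) = D x + D y \<and> D (x * y) = D x * y + x * D y"
    if x: "x \<in> fracs \<theta> C" and y: "y \<in> fracs \<theta> C" for x y
  proof -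
    obtain f g where fg: "rep x f g" using ex[OF x] by blast
    obtain f' g' where fg': "rep y f' g'" using ex[OF y] by blast
    have c: "f \<in> C" "g \<in> C" "f' \<in> C" "g' \<in> C" and nz: "\<theta> g \<noteq> 0" "\<theta> g' \<noteq> 0"
      using fg fg' by (auto simp: rep_def)
    have z: "\<theta> f = x * \<theta> g" using fg by (simp add: rep_def)
    have z': "\<theta> f' = y * \<theta> g'" using fg' by (simp add: rep_def)
    note z = z z'
    have cc: "f * g' \<in> C" "f' * g \<in> C" "f * f' \<in> C" "g * g' \<in> C"
      using c C by (auto simp: csubD)
    have "rep (x + y) (f * g' + f' * g) (g * g')" "rep (x * y) (f * f') (g * g')"
      unfolding rep_def using cc nz z C by (auto simp: r csubD field_simps)
    note Ds = this[THEN D]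
    show ?thesis
      unfolding Ds D[OF fg] D[OF fg'] using c nz cc
      by (simp add: r add mult z divide_simps) (simp add: algebra_simps)
  qed
  moreover have "D (\<theta> f) = \<theta> (d f)" if "f \<in> C" for f
  proof -
    have "rep (\<theta> f) f 1" using that C by (simp add: rep_def r csubD)
    moreover have "d 1 = 0" using mult[of 1 1] C by (simp add: csubD)
    ultimately show ?thesis using D by (simp add: r)
  qed
  ultimately show ?thesis by (intro that[of D]) (auto simp: deriv_on_def)
qed

section \<open>Polynomials over a subfield, and minimal polynomials\<close>

definition KP :: "'k::field set \<Rightarrow> 'k poly set" where
  "KP K = {P. \<forall>i. poly.coeff P i \<in> K}"

lemma
  assumes K: "sfld K"
  shows KP_0: "0 \<in> KP K" and KP_const: "c \<in> K \<Longrightarrow> [:c:] \<in> KP K"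
    and KP_monom: "c \<in> K \<Longrightarrow> Polynomial.monom c n \<in> KP K"
    and KP_add: "P \<in> KP K \<Longrightarrow> R \<in> KP K \<Longrightarrow> P + R \<in> KP K"
    and KP_diff: "P \<in> KP K \<Longrightarrow> R \<in> KP K \<Longrightarrow> P - R \<in> KP K"
    and KP_mult: "P \<in> KP K \<Longrightarrow> R \<in> KP K \<Longrightarrow> P * R \<in> KP K"
    and KP_smult: "c \<in> K \<Longrightarrow> P \<in> KP K \<Longrightarrow> Polynomial.smult c P \<in> KP K"
    and KP_pderiv: "P \<in> KP K \<Longrightarrow> pderiv P \<in> KP K"
    and KP_pCons: "c \<in> K \<Longrightarrow> P \<in> KP K \<Longrightarrow> pCons c P \<in> KP K"
  using sfld_csub[OF K]
  by (auto simp: KP_def coeff_mult coeff_pderiv coeff_pCons coeff_monom simp del: of_nat_Suc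
      intro!: csub_intros split: nat.split)

lemma KP_sum: "sfld K \<Longrightarrow> (\<And>i. i \<in> A \<Longrightarrow> f i \<in> KP K) \<Longrightarrow> sum f A \<in> KP K"
  by (induction A rule: infinite_finite_induct) (auto simp: KP_0 KP_add)

lemma KP_1: "sfld K \<Longrightarrow> 1 \<in> KP K"
  unfolding one_pCons by (intro KP_const csubD sfld_csub)

lemma csub_KP: "sfld K \<Longrightarrow> csub (KP K)"
  unfolding csub_def by (intro conjI ballI KP_0 KP_1 KP_add KP_diff KP_mult)

lemma KP_pcompose_monom: "sfld K \<Longrightarrow> P \<in> KP K \<Longrightarrow> pcompose P (Polynomial.monom 1 n) \<in> KP K"
proof (induction P rule: pCons_induct)
  case (pCons a P)
  then have "a \<in> K" "P \<in> KP K" by (auto simp: KP_def coeff_pCons split: nat.splits dest: spec[of _ 0] spec[of _ "Suc _"])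
  then show ?case using pCons
    by (simp add: pcompose_pCons KP_add KP_const KP_mult KP_monom csubD sfld_csub)
qed (simp add: KP_0)

lemma rhom_poly: "rhom (\<lambda>P. poly P x)"
  by (simp add: rhom_def)

lemma KP_division:
  assumes K: "sfld K" and P: "P \<in> KP K" "P \<noteq> 0" and F: "F \<in> KP K"
  shows "\<exists>Q R. Q \<in> KP K \<and> R \<in> KP K \<and> F = P * Q + R \<and> (R = 0 \<or> degree R < degree P)"
  using F
proof (induction "degree F" arbitrary: F rule: less_induct)
  case less
  show ?case
  proof (cases "F = 0 \<or> degree F < degree P")
    case True
    then show ?thesis using less.prems by (intro exI[of _ 0] exI[of _ F]) (auto simp: KP_0[OF K])
  next
    case False
    define n where "n = degree F - degree P"
    define c where "c = lead_coeff F / lead_coeff P"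
    define M where "M = Polynomial.monom c n"
    have M: "M \<in> KP K" unfolding M_def c_def
      using P less.prems by (intro KP_monom[OF K] sfld_divide[OF K]) (auto simp: KP_def)
    have c0: "c \<noteq> 0" using False P by (simp add: c_def)
    have dM: "degree (P * M) = degree F"
      using False P c0 by (simp add: M_def n_def degree_mult_eq degree_monom_eq monom_eq_0_iff)
    have lM: "lead_coeff (P * M) = lead_coeff F"
      using False P by (simp add: lead_coeff_mult M_def c_def degree_monom_eq)
    have FM: "F - P * M \<in> KP K" using M P less.prems K by (intro KP_diff KP_mult)
    show ?thesis
    proof (cases "F - P * M = 0")
      case True
      then show ?thesis using M by (intro exI[of _ M] exI[of _ 0]) (auto simp: KP_0[OF K])
    next
      case nz: False
      have "degree (F - P * M) < degree F"
      proof -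
        have "degree (F - P * M) \<le> degree F" using dM by (metis degree_diff_le order_refl)
        moreover have "poly.coeff (F - P * M) (degree F) = 0" using lM dM by simp
        ultimately show ?thesis using nz by (metis leading_coeff_0_iff order_le_less)
      qed
      from less.hyps[OF this FM] obtain Q R where
        QR: "Q \<in> KP K" "R \<in> KP K" "F - P * M = P * Q + R" "R = 0 \<or> degree R < degree P" by blast
      then have "F = P * (Q + M) + R" by (simp add: algebra_simps)
      then show ?thesis using QR M KP_add[OF K] by blast
    qed
  qed
qed

text \<open>Unique factorisation for the single prime X - x: it is cancelled against whichever of
  the two factors vanishes at \<open>x\<close>.\<close>

lemma monic_factor_linear_power:
  fixes P :: "'k::field poly"
  assumes "[:- x, 1:] ^ n = P * R" "lead_coeff P = 1"
  shows "\<exists>e. P = [:- x, 1:] ^ e"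
  using assms
proof (induction n arbitrary: P R)
  case 0
  then have "degree P = 0" by (metis degree_1 degree_mult_eq mult_eq_0_iff power_0 zero_neq_one add_is_0)
  then have "P = 1" using 0(2) by (metis degree_eq_zeroE lead_coeff_pCons(2) one_pCons)
  then show ?case by (intro exI[of _ 0]) simp
next
  case (Suc n)
  have "poly (P * R) x = 0" by (simp flip: Suc.prems(1))
  then consider "poly P x = 0" | "poly R x = 0" by auto
  then show ?case
  proof cases
    case 1
    then obtain P' where P': "P = [:- x, 1:] * P'" using poly_eq_0_iff_dvd by blast
    have "lead_coeff P = lead_coeff P'" unfolding P' by (simp add: lead_coeff_mult del: mult_pCons_left)
    moreover have "[:- x, 1:] * [:- x, 1:] ^ n = [:- x, 1:] * (P' * R)"
      using Suc.prems(1) P' by (simp add: mult.assoc del: mult_pCons_left)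
    then have "[:- x, 1:] ^ n = P' * R" by (metis mult_left_cancel pCons_eq_0_iff zero_neq_one)
    ultimately obtain e where "P' = [:- x, 1:] ^ e" using Suc by metis
    then show ?thesis using P' by (intro exI[of _ "Suc e"]) simp
  next
    case 2
    then obtain R' where R': "R = [:- x, 1:] * R'" using poly_eq_0_iff_dvd by blast
    have "[:- x, 1:] * [:- x, 1:] ^ n = [:- x, 1:] * (P * R')"
      using Suc.prems(1) R' by (simp add: mult.left_commute del: mult_pCons_left)
    then have "[:- x, 1:] ^ n = P * R'" by (metis mult_left_cancel pCons_eq_0_iff zero_neq_one)
    then show ?thesis using Suc by metis
  qed
qed

lemma min_poly:
  assumes K: "sfld K" and F: "F \<in> KP K" "F \<noteq> 0" "poly F x = 0"
  obtains P where "P \<in> KP K" "lead_coeff P = 1" "poly P x = 0" "degree P > 0"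
    "\<And>G. G \<in> KP K \<Longrightarrow> poly G x = 0 \<Longrightarrow> degree G < degree P \<Longrightarrow> G = 0"
proof -
  let ?S = "\<lambda>G. G \<in> KP K \<and> G \<noteq> 0 \<and> poly G x = 0"
  define G where "G = arg_min degree ?S"
  have G: "?S G" and min: "\<And>H. ?S H \<Longrightarrow> degree G \<le> degree H"
    using arg_min_natI[of ?S F degree] arg_min_nat_le[of ?S _ degree] F unfolding G_def by auto
  define P where "P = Polynomial.smult (inverse (lead_coeff G)) G"
  have P: "P \<in> KP K" unfolding P_def using G by (intro KP_smult[OF K] sfld_inverse[OF K]) (auto simp: KP_def)
  have l: "lead_coeff P = 1" "degree P = degree G" using G by (auto simp: P_def)
  have r: "poly P x = 0" using G by (simp add: P_def)
  have "degree P > 0"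
  proof (rule ccontr)
    assume "\<not> degree P > 0"
    then obtain c where "P = [:c:]" by (metis degree_eq_zeroE gr0I)
    then show False using l(1) r by simp
  qed
  then show ?thesis using that[OF P l(1) r] min l(2) by (metis leD)
qed

text \<open>Otherwise the constant coefficient of the minimal polynomial of \<open>x\<close>, a factor of \<open>X\<^sup>p - x\<^sup>p\<close>,
  is \<open>\<plusminus> x ^ e\<close> with \<open>0 < e < p\<close>, and then \<open>x \<in> K\<close>.\<close>

lemma powers_independent:
  fixes x :: "'k::field"
  assumes p: "prime p" "CHAR('k) = p" and K: "sfld K" and x: "x ^ p \<in> K" "x \<notin> K"
    and F: "F \<in> KP K" "poly F x = 0" "degree F < p"
  shows "F = 0"
proof (rule ccontr)
  assume "F \<noteq> 0"
  then obtain P where P: "P \<in> KP K" "lead_coeff P = 1" "poly P x = 0" "degree P > 0"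
    and min: "\<And>G. G \<in> KP K \<Longrightarrow> poly G x = 0 \<Longrightarrow> degree G < degree P \<Longrightarrow> G = 0"
    using min_poly[OF K F(1) _ F(2)] by metis
  have deg: "degree P < p"
    using min[OF F(1,2)] F(3) \<open>F \<noteq> 0\<close> by fastforce
  have P0: "P \<noteq> 0" using P(2) by auto
  define X where "X = Polynomial.monom 1 p - [:x ^ p:]"
  have X: "X \<in> KP K" unfolding X_def using x K csubD(2)[OF sfld_csub[OF K]] by (intro KP_diff KP_monom KP_const) auto
  have cp: "CHAR('k poly) = p" using p by simp
  have pw: "[:- x, 1:] ^ p = X"
  proof -
    have "([:- x:] + Polynomial.monom 1 1) ^ p = [:- x:] ^ p + Polynomial.monom 1 1 ^ p"
      by (rule freshmans_dream) (simp_all add: p cp)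
    moreover have "[:- x:] + Polynomial.monom 1 1 = [:- x, 1:]" by (simp add: monom_Suc monom_0)
    moreover have "[:- x:] ^ p = [:(- x) ^ p:]" by (simp add: poly_const_pow)
    moreover have "(- x) ^ p = - (x ^ p)"
    proof -
      have "(x + (- x)) ^ p = x ^ p + (- x) ^ p" by (rule freshmans_dream) (simp_all add: p)
      then show ?thesis using p prime_gt_0_nat[of p] by (simp add: power_0_left eq_neg_iff_add_eq_0 add.commute)
    qed
    ultimately show ?thesis by (simp add: X_def monom_power)
  qed
  obtain Q R where QR: "Q \<in> KP K" "R \<in> KP K" "X = P * Q + R" "R = 0 \<or> degree R < degree P"
    using KP_division[OF K P(1) P0 X] by blast
  have "poly X x = 0" by (simp add: X_def poly_monom)
  then have "poly R x = 0" using QR(3) P(3) by simp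
  then have "R = 0" using min QR by blast
  then have "[:- x, 1:] ^ p = P * Q" using QR pw by simp
  then obtain e where e: "P = [:- x, 1:] ^ e" using monic_factor_linear_power P(2) by blast
  have de: "degree P = e" unfolding e by (simp add: degree_power_eq)
  have "poly P 0 = (- x) ^ e" by (simp add: e)
  then have "(- x) ^ e \<in> K" using P(1) by (metis (mono_tags) KP_def mem_Collect_eq poly_0_coeff_0)
  then have xe: "x ^ e \<in> K" using csub_uminus[OF sfld_csub[OF K]]
    by (metis add.inverse_inverse power_minus_even power_minus_odd)
  have "coprime e p" using deg P(4) de p(1)
    by (metis coprime_commute nat_dvd_not_less prime_imp_coprime)
  then obtain u v where uv: "e * u = p * v + 1"
    using bezout_nat[of e p] P(4) de by (auto simp: coprime_iff_gcd_eq_1)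
  have x0: "x \<noteq> 0" using x(2) csubD(1)[OF sfld_csub[OF K]] by auto
  have "(x ^ e) ^ u = (x ^ p) ^ v * x" by (simp add: uv flip: power_mult)
  then have "x = (x ^ e) ^ u / (x ^ p) ^ v" using x0 by simp
  also have "\<dots> \<in> K" by (intro sfld_divide[OF K] csub_power[OF sfld_csub[OF K]] xe x)
  finally show False using x by simp
qed

section \<open>Simple extensions and their derivations\<close>

definition adj :: "'k::field set \<Rightarrow> 'k \<Rightarrow> 'k set" where
  "adj K x = fracs (\<lambda>P. poly P x) (KP K)"

lemma sfld_adj: "sfld K \<Longrightarrow> sfld (adj K x)"
  unfolding adj_def by (intro sfld_fracs rhom_poly csub_KP)

lemma adj_base: "sfld K \<Longrightarrow> c \<in> K \<Longrightarrow> c \<in> adj K x"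
  unfolding adj_def using fracs_base[OF rhom_poly csub_KP KP_const, of K c x] by simp

lemma adj_gen: "sfld K \<Longrightarrow> x \<in> adj K x"
  unfolding adj_def
  using fracs_base[OF rhom_poly csub_KP KP_pCons[OF _ _ KP_const], of K 0 1 x]
  by (simp add: csubD sfld_csub)

lemma poly_in_sfld: "sfld L \<Longrightarrow> P \<in> KP L \<Longrightarrow> x \<in> L \<Longrightarrow> poly P x \<in> L"
  unfolding poly_altdef by (intro csub_intros sfld_csub) (auto simp: KP_def)

lemma adj_least: "sfld L \<Longrightarrow> K \<subseteq> L \<Longrightarrow> x \<in> L \<Longrightarrow> adj K x \<subseteq> L"
  unfolding adj_def fracs_def
  by (auto intro!: sfld_divide poly_in_sfld simp: KP_def subset_iff)

text \<open>The derivation is d/dx. It is well defined because a polynomial over \<open>K\<close>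
  that vanishes at \<open>x\<close> is a multiple of X^p - x^p, whose derivative is 0.\<close>

lemma adj_derivation:
  fixes x :: "'k::field"
  assumes p: "prime p" "CHAR('k) = p" and K: "sfld K" and x: "x ^ p \<in> K" "x \<notin> K"
  obtains D where "deriv_on D (adj K x)" "D x = 1" "\<And>c. c \<in> K \<Longrightarrow> D c = 0"
proof -
  have "poly (pderiv F) x = 0" if F: "F \<in> KP K" "poly F x = 0" for F
  proof -
    define X where "X = Polynomial.monom 1 p - [:x ^ p:]"
    have X: "X \<in> KP K" unfolding X_def using x K csubD(2)[OF sfld_csub[OF K]] by (intro KP_diff KP_monom KP_const) auto
    have p0: "p > 0" using p prime_gt_0_nat by blast
    have dX: "degree X = p"
      unfolding X_def diff_conv_add_uminus by (subst degree_add_eq_left) (auto simp: degree_monom_eq p0)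
    have X0: "X \<noteq> 0" "poly X x = 0" using dX p0 by (auto simp: X_def poly_monom)
    obtain Q R where QR: "Q \<in> KP K" "R \<in> KP K" "F = X * Q + R" "R = 0 \<or> degree R < degree X"
      using KP_division[OF K X X0(1) F(1)] by blast
    have "poly R x = 0" using QR(3) F X0 by simp
    then have "R = 0" using QR powers_independent[OF p K x, of R] dX by auto
    moreover have "of_nat p = (0::'k)" using p by (metis of_nat_CHAR)
    then have "pderiv X = 0" by (simp add: X_def pderiv_diff pderiv_monom pderiv_pCons)
    ultimately show ?thesis using QR X0 by (simp add: pderiv_mult)
  qed
  note ker = this
  have "\<exists>D. deriv_on D (adj K x) \<and> (\<forall>F\<in>KP K. D (poly F x) = poly (pderiv F) x)"
    unfolding adj_def
    by (rule deriv_extend[OF rhom_poly csub_KP[OF K], of pderiv x])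
      (simp_all add: KP_pderiv[OF K] pderiv_add pderiv_mult ker algebra_simps, blast)
  then obtain D where D: "deriv_on D (adj K x)" "\<And>F. F \<in> KP K \<Longrightarrow> D (poly F x) = poly (pderiv F) x"
    by blast
  have "D x = 1" using D(2)[of "[:0, 1:]"] K by (simp add: KP_pCons KP_const csubD sfld_csub KP_0 pderiv_pCons)
  moreover have "D c = 0" if "c \<in> K" for c using D(2)[of "[:c:]"] that K by (simp add: KP_const pderiv_pCons)
  ultimately show ?thesis using that D(1) by blast
qed

section \<open>Homogeneous linear systems over a subfield\<close>

lemma underdetermined:
  fixes n m :: nat
  assumes K: "sfld K" and "\<And>i j. i < n \<Longrightarrow> j < m \<Longrightarrow> A i j \<in> K" and "n < m"
  shows "\<exists>c. (\<forall>j<m. c j \<in> K) \<and> (\<exists>j<m. c j \<noteq> 0) \<and> (\<forall>i<n. (\<Sum>j<m. A i j * c j) = 0)"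
  using assms(2,3)
proof (induction n arbitrary: A m)
  case 0
  then show ?case using csubD(1,2)[OF sfld_csub[OF K]] by (intro exI[of _ "\<lambda>_. 1"]) auto
next
  case (Suc n)
  note Kc = csub_intros[OF sfld_csub[OF K]]
  show ?case
  proof (cases "\<exists>j<m. A n j \<noteq> 0")
    case False
    then obtain c where "(\<forall>j<m. c j \<in> K) \<and> (\<exists>j<m. c j \<noteq> 0) \<and> (\<forall>i<n. (\<Sum>j<m. A i j * c j) = 0)"
      using Suc.IH[of m A] Suc.prems by auto
    then show ?thesis using False by (intro exI[of _ c]) (auto simp: less_Suc_eq)
  next
    case True
    then obtain j0 where j0: "j0 < m" "A n j0 \<noteq> 0" by blast
    \<comment> \<open>An enumeration of the columns other than the pivot column
      \<open>j0\<close>.\<close>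
    define \<sigma> where "\<sigma> j = (if j < j0 then j else Suc j)" for j :: nat
    have \<sigma>: "\<sigma> j < m" "\<sigma> j \<noteq> j0" if "j < m - 1" for j using that j0 by (auto simp: \<sigma>_def)
    have bij: "bij_betw \<sigma> {..<m - 1} ({..<m} - {j0})"
      unfolding bij_betw_def
    proof (intro conjI equalityI subsetI)
      show "inj_on \<sigma> {..<m - 1}" by (auto simp: inj_on_def \<sigma>_def split: if_splits)
      show "k \<in> {..<m} - {j0}" if "k \<in> \<sigma> ` {..<m - 1}" for k using that \<sigma> by auto
      show "k \<in> \<sigma> ` {..<m - 1}" if "k \<in> {..<m} - {j0}" for k
        using that j0 by (intro image_eqI[of _ _ "if k < j0 then k else k - 1"]) (auto simp: \<sigma>_def)
    qed
    \<comment> \<open>Gaussian elimination: row \<open>n\<close> is used to clear column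
      \<open>j0\<close> from the other rows.\<close>
    define B where "B i j = A i (\<sigma> j) - A i j0 * A n (\<sigma> j) / A n j0" for i j
    have BK: "B i j \<in> K" if "i < n" "j < m - 1" for i j
      unfolding B_def using that \<sigma> Suc.prems j0 by (intro Kc sfld_divide[OF K]) auto
    have nm: "n < m - 1" using Suc.prems(2) by simp
    obtain c where c: "\<forall>j<m - 1. c j \<in> K" "\<exists>j<m - 1. c j \<noteq> 0" "\<forall>i<n. (\<Sum>j<m - 1. B i j * c j) = 0"
      using Suc.IH[of "m - 1" B] BK nm by blast
    define c0 where "c0 = - (\<Sum>j<m - 1. A n (\<sigma> j) * c j) / A n j0"
    define c' where "c' k = (if k = j0 then c0 else c (inv_into {..<m - 1} \<sigma> k))" for k
    have c'\<sigma>: "c' (\<sigma> j) = c j" if "j < m - 1" for j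
      using that \<sigma> bij by (auto simp: c'_def bij_betw_def inv_into_f_f)
    have im: "\<exists>j<m - 1. k = \<sigma> j" if "k < m" "k \<noteq> j0" for k
      using that bij unfolding bij_betw_def by (metis DiffI imageE lessThan_iff singletonD)
    have c0: "c0 \<in> K" unfolding c0_def using c j0 \<sigma> Suc.prems by (intro Kc sfld_divide[OF K]) auto
    have 1: "\<forall>j<m. c' j \<in> K"
      using c0 c c'\<sigma> im by (metis c'_def)
    have 2: "\<exists>j<m. c' j \<noteq> 0" using c(2) c'\<sigma> \<sigma> by metis
    have s: "(\<Sum>j<m. A i j * c' j) = A i j0 * c0 + (\<Sum>j<m - 1. A i (\<sigma> j) * c j)" for i
    proof -
      have "(\<Sum>j<m. A i j * c' j) = A i j0 * c' j0 + (\<Sum>j\<in>{..<m} - {j0}. A i j * c' j)"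
        using j0 by (simp add: sum.remove)
      also have "(\<Sum>j\<in>{..<m} - {j0}. A i j * c' j) = (\<Sum>j<m - 1. A i (\<sigma> j) * c' (\<sigma> j))"
        by (rule sum.reindex_bij_betw[OF bij, symmetric])
      finally show ?thesis using c'\<sigma> by (simp add: c'_def)
    qed
    have "(\<Sum>j<m. A i j * c' j) = 0" if "i < Suc n" for i
    proof (cases "i = n")
      case True
      then show ?thesis using j0 by (simp add: s c0_def)
    next
      case False
      then have "0 = (\<Sum>j<m - 1. B i j * c j)" using c(3) that by simp
      also have "\<dots> = (\<Sum>j<m - 1. A i (\<sigma> j) * c j) - A i j0 / A n j0 * (\<Sum>j<m - 1. A n (\<sigma> j) * c j)"
        by (simp add: B_def algebra_simps sum_subtractf sum_distrib_left)
      also have "\<dots> = (\<Sum>j<m. A i j * c' j)" by (simp add: s c0_def)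
      finally show ?thesis by simp
    qed
    then show ?thesis using 1 2 by blast
  qed
qed

lemma span_dependent:
  fixes n m :: nat
  assumes K: "sfld K" and "n < m"
    and v: "\<And>j. j < m \<Longrightarrow> \<exists>c. (\<forall>i<n. c i \<in> K) \<and> v j = (\<Sum>i<n. c i * u i)"
  shows "\<exists>c. (\<forall>j<m. c j \<in> K) \<and> (\<exists>j<m. c j \<noteq> 0) \<and> (\<Sum>j<m. c j * v j) = 0"
proof -
  obtain A where A: "\<And>j. j < m \<Longrightarrow> (\<forall>i<n. A j i \<in> K) \<and> v j = (\<Sum>i<n. A j i * u i)"
    using v by metis
  obtain c where c: "\<forall>j<m. c j \<in> K" "\<exists>j<m. c j \<noteq> 0" "\<forall>i<n. (\<Sum>j<m. A j i * c j) = 0"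
    using underdetermined[OF K, of n m "\<lambda>i j. A j i"] A assms(2) by blast
  have "(\<Sum>j<m. c j * v j) = (\<Sum>j<m. \<Sum>i<n. A j i * c j * u i)"
    using A by (intro sum.cong) (auto simp: sum_distrib_left algebra_simps)
  also have "\<dots> = (\<Sum>i<n. (\<Sum>j<m. A j i * c j) * u i)"
    by (subst sum.swap) (simp add: sum_distrib_right)
  also have "\<dots> = 0" using c(3) by simp
  finally show ?thesis using c by blast
qed

section \<open>Descent of linear relations along separable extensions\<close>

lemma poly_map_poly_frobenius:
  fixes P :: "'k::field poly"
  assumes p: "prime p" "CHAR('k) = p"
  shows "poly (map_poly (\<lambda>c. c ^ p) P) (x ^ p) = poly P x ^ p"
proof (induction P rule: pCons_induct)
  case (pCons a P)
  have "(a + x * poly P x) ^ p = a ^ p + (x * poly P x) ^ p"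
    by (rule freshmans_dream) (simp_all add: p)
  then show ?case using pCons prime_gt_0_nat[OF p(1)] by (simp add: map_poly_pCons power_0_left power_mult_distrib)
qed (use prime_gt_0_nat[OF p(1)] in \<open>simp add: power_0_left\<close>)

lemma poly_eq_sum_less:
  fixes P :: "'k::field poly"
  shows "degree P < n \<Longrightarrow> poly P x = (\<Sum>i<n. poly.coeff P i * x ^ i)"
  unfolding poly_altdef by (rule sum.mono_neutral_left) (auto simp: coeff_eq_0)

text \<open>If \<open>x\<close> lies in \<open>K(x\<^sup>p)\<close> then \<open>x\<close> is separable over \<open>K\<close>, so adjoining it creates no new
  linear relation between \<open>p\<close>-th roots of elements of \<open>K\<close>: with \<open>d\<close> the degree of \<open>x\<close>, the powers
  \<open>x ^ (p * j)\<close>, \<open>j < d\<close>, are still independent, and a relation can be compared after taking \<open>p\<close>-th powers.\<close>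

lemma separable_descent:
  fixes x :: "'k::field" and N :: nat
  assumes p: "prime p" "CHAR('k) = p" and K: "sfld K" and x: "x \<in> adj K (x ^ p)"
    and a: "\<And>i. i < N \<Longrightarrow> a i ^ p \<in> K" and z: "\<And>i. i < N \<Longrightarrow> z i \<in> adj K x"
    and rel: "(\<Sum>i<N. a i * z i) = 0" and nz: "\<exists>i<N. z i \<noteq> 0"
  shows "\<exists>c. (\<forall>i<N. c i \<in> K) \<and> (\<exists>i<N. c i \<noteq> 0) \<and> (\<Sum>i<N. a i * c i) = 0"
proof -
  have p0: "p > 0" using p prime_gt_0_nat by blast
  note Kc = csub_intros[OF sfld_csub[OF K]]
  obtain S Q where SQ: "S \<in> KP K" "Q \<in> KP K" "poly Q (x ^ p) \<noteq> 0" "x = poly S (x ^ p) / poly Q (x ^ p)"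
    using x unfolding adj_def by (rule fracsE)
  define X where "X = (Polynomial.monom 1 p :: 'k poly)"
  \<comment> \<open>Clearing denominators in x = S(x^p) / Q(x^p) gives a polynomial with the root x.
    Its derivative is Q(X^p), which does not vanish at x, so \<open>F\<close> is not zero.\<close>
  define F where "F = [:0, 1:] * pcompose Q X - pcompose S X"
  have F: "F \<in> KP K" unfolding F_def X_def using SQ K Kc
    by (intro KP_diff KP_mult KP_pcompose_monom KP_pCons KP_0) (auto simp: KP_0)
  have "of_nat p = (0::'k)" using p by (metis of_nat_CHAR)
  then have dX: "pderiv X = 0" by (simp add: X_def pderiv_monom)
  have Xx: "poly X x = x ^ p" by (simp add: X_def poly_monom)
  have xq: "x * poly Q (x ^ p) = poly S (x ^ p)"
    using nonzero_eq_divide_eq[OF SQ(3)] SQ(4) by blast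
  have Fx: "poly F x = 0" by (simp add: F_def poly_pcompose Xx xq)
  have "poly (pderiv F) x = poly Q (x ^ p)"
    by (simp add: F_def pderiv_diff pderiv_mult pderiv_pcompose dX pderiv_pCons poly_pcompose Xx del: mult_pCons_left)
  then have "F \<noteq> 0" using SQ(3) by auto
  then obtain P where P: "P \<in> KP K" "lead_coeff P = 1" "poly P x = 0" "degree P > 0"
    and min: "\<And>G. G \<in> KP K \<Longrightarrow> poly G x = 0 \<Longrightarrow> degree G < degree P \<Longrightarrow> G = 0"
    using min_poly[OF K F _ Fx] by metis
  define d where "d = degree P"
  have P0: "P \<noteq> 0" using P(2) by auto
  obtain f g where fg: "poly g x \<noteq> 0" "\<And>i. i < N \<Longrightarrow> f i \<in> KP K" "\<And>i. i < N \<Longrightarrow> z i = poly (f i) x / poly g x"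
    using fracs_common_denom[OF rhom_poly csub_KP[OF K] finite_lessThan, of N z x] z unfolding adj_def by auto
  have "\<exists>R. R \<in> KP K \<and> poly R x = poly (f i) x \<and> degree R < d" if "i < N" for i
    using KP_division[OF K P(1) P0 fg(2)[OF that]] P(3,4) by (auto simp: d_def)
  then obtain R where R: "\<And>i. i < N \<Longrightarrow> R i \<in> KP K \<and> poly (R i) x = poly (f i) x \<and> degree (R i) < d"
    by metis
  have relR: "(\<Sum>i<N. a i * poly (R i) x) = 0"
  proof -
    have "(\<Sum>i<N. a i * poly (R i) x) = (\<Sum>i<N. a i * z i) * poly g x"
      unfolding sum_distrib_right by (rule sum.cong) (use R fg in auto)
    then show ?thesis using rel by simp
  qed
  \<comment> \<open>The value of \<open>T\<close> at x^p is the p-th power of the relation reduced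
    to degree below d, so x^p is a root of \<open>T\<close>.\<close>
  define T where "T = (\<Sum>i<N. Polynomial.smult (a i ^ p) (map_poly (\<lambda>c. c ^ p) (R i)))"
  have cT: "poly.coeff T j = (\<Sum>i<N. a i * poly.coeff (R i) j) ^ p" for j
  proof -
    have "poly.coeff T j = (\<Sum>i<N. (a i * poly.coeff (R i) j) ^ p)"
      using p0 by (simp add: T_def coeff_sum coeff_map_poly power_0_left power_mult_distrib)
    also have "\<dots> = (\<Sum>i<N. a i * poly.coeff (R i) j) ^ p"
      by (rule freshmans_dream_sum[symmetric]) (simp_all add: p)
    finally show ?thesis .
  qed
  have T: "T \<in> KP K" unfolding T_def
    using R a p0 by (intro KP_sum[OF K] KP_smult[OF K]) (auto simp: KP_def coeff_map_poly power_0_left intro: Kc)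
  have "degree T \<le> d - 1"
  proof (intro degree_le allI impI)
    fix j assume "d - 1 < j"
    then have "poly.coeff (R i) j = 0" if "i < N" for i using R[OF that] by (intro coeff_eq_0) linarith
    then show "poly.coeff T j = 0" using p0 by (simp add: cT)
  qed
  then have dT: "degree T < d" using P(4) by (simp add: d_def)
  have "poly T (x ^ p) = (\<Sum>i<N. (a i * poly (R i) x) ^ p)"
    by (simp add: T_def poly_sum poly_map_poly_frobenius[OF p] power_mult_distrib)
  also have "\<dots> = (\<Sum>i<N. a i * poly (R i) x) ^ p"
    by (rule freshmans_dream_sum[symmetric]) (simp_all add: p)
  finally have Tx: "poly T (x ^ p) = 0" using relR p0 by (simp add: power_0_left)
  have "T = 0"
  proof (rule ccontr)
    assume T0: "T \<noteq> 0"
    let ?t = "degree T"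
    define s q where "s = poly S (x ^ p)" and "q = poly Q (x ^ p)"
    have span: "\<exists>c. (\<forall>j<?t. c j \<in> K) \<and> poly G (x ^ p) = (\<Sum>j<?t. c j * (x ^ p) ^ j)" if G: "G \<in> KP K" for G
    proof -
      obtain H where H: "H \<in> KP K" "poly G (x ^ p) = poly H (x ^ p)" "H = 0 \<or> degree H < ?t"
        using KP_division[OF K T T0 G] Tx by auto
      then show ?thesis using poly_eq_sum_less[of H ?t "x ^ p"]
        by (intro exI[of _ "poly.coeff H"]) (auto simp: KP_def)
    qed
    \<comment> \<open>With the common denominator \<open>q ^ (d - 1)\<close>, each power of
      \<open>x\<close> below the d-th becomes a polynomial in x^p. If \<open>T\<close> were not
      zero, these d elements would lie in the span of fewer than d powers of x^p, against the
      minimality of d.\<close>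
    have "\<exists>c. (\<forall>j<?t. c j \<in> K) \<and> q ^ (d - 1) * x ^ i = (\<Sum>j<?t. c j * (x ^ p) ^ j)" if "i < d" for i
    proof -
      have "q ^ (d - 1) = q ^ (d - 1 - i) * q ^ i" using that by (simp flip: power_add)
      moreover have "q * x = s" using xq by (simp add: s_def q_def mult.commute)
      ultimately have "q ^ (d - 1) * x ^ i = q ^ (d - 1 - i) * s ^ i"
        by (simp add: mult.assoc flip: power_mult_distrib)
      also have "\<dots> = poly (Q ^ (d - 1 - i) * S ^ i) (x ^ p)" by (simp add: s_def q_def)
      finally have eq: "q ^ (d - 1) * x ^ i = poly (Q ^ (d - 1 - i) * S ^ i) (x ^ p)" .
      have "Q ^ (d - 1 - i) * S ^ i \<in> KP K"
        by (intro csubD(5)[OF csub_KP[OF K]] csub_power[OF csub_KP[OF K]] SQ)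
      from span[OF this] show ?thesis unfolding eq .
    qed
    from span_dependent[OF K dT, of "\<lambda>i. q ^ (d - 1) * x ^ i" "\<lambda>j. (x ^ p) ^ j", OF this] obtain c where
      c: "\<forall>i<d. c i \<in> K" "\<exists>i<d. c i \<noteq> 0" "(\<Sum>i<d. c i * (q ^ (d - 1) * x ^ i)) = 0" by blast
    have "q ^ (d - 1) * (\<Sum>i<d. c i * x ^ i) = 0"
      using c(3) by (simp add: sum_distrib_left mult.left_commute)
    then have c0: "(\<Sum>i<d. c i * x ^ i) = 0" using SQ(3) by (simp add: q_def)
    define G where "G = (\<Sum>i<d. Polynomial.monom (c i) i)"
    have "G \<in> KP K" unfolding G_def using c(1) K by (intro KP_sum KP_monom) auto
    moreover have "poly G x = 0" using c0 by (simp add: G_def poly_sum poly_monom)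
    moreover have cG: "poly.coeff G j = (if j < d then c j else 0)" for j
      by (simp add: G_def coeff_sum coeff_monom)
    then have "degree G \<le> d - 1" by (intro degree_le) auto
    ultimately have "G = 0" using min[of G] P(4) by (simp add: d_def)
    then show False using c(2) cG by (metis coeff_0)
  qed
  \<comment> \<open>The coefficients of \<open>T = 0\<close> are p-th powers; taking roots gives one
    relation over \<open>K\<close> for each \<open>j\<close>.\<close>
  then have all: "(\<Sum>i<N. a i * poly.coeff (R i) j) = 0" for j using cT[of j] p0 by simp
  obtain i where i: "i < N" "z i \<noteq> 0" using nz by blast
  then have "R i \<noteq> 0" using R[of i] fg(3)[of i] by auto
  then obtain j where "poly.coeff (R i) j \<noteq> 0" by (metis leading_coeff_0_iff)
  then show ?thesis using all[of j] i R by (intro exI[of _ "\<lambda>i. poly.coeff (R i) j"]) (auto simp: KP_def)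
qed

section \<open>The generic point of a quasilinear hypersurface\<close>

lemma rhom_frob:
  assumes "prime p" "CHAR('b::comm_ring_1) = p" shows "rhom (\<lambda>x::'b. x ^ p)"
proof -
  have "(x + y) ^ p = x ^ p + y ^ p" for x y :: 'b
    by (rule freshmans_dream) (simp_all add: assms)
  then show ?thesis by (simp add: rhom_def power_mult_distrib)
qed

definition inc :: "'a::field mpoly \<Rightarrow> 'a mpoly fract" where
  "inc f = Fract f 1"

lemma rhom_inc: "rhom inc"
  by (simp add: rhom_def inc_def One_fract_def)

lemma inc_eq_0_iff [simp]: "inc f = 0 \<longleftrightarrow> f = 0"
  by (simp add: inc_def Zero_fract_def eq_fract)

lemma fracs_inc: "fracs inc UNIV = UNIV"
proof -
  have "z \<in> fracs inc UNIV" for z :: "'a::field mpoly fract"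
    by (cases z) (auto simp: fracs_def inc_def intro!: exI simp: Zero_fract_def eq_fract)
  then show ?thesis by blast
qed

definition emb :: "'a::field \<Rightarrow> 'a mpoly fract" where
  "emb c = inc (pconst c)"

lemma rhom_emb: "rhom emb"
  unfolding emb_def by (rule rhom_comp[OF rhom_pconst rhom_inc])

lemma emb_eq_0_iff [simp]: "emb c = 0 \<longleftrightarrow> c = 0"
  by (simp add: emb_def)

lemma CHAR_mpoly: "CHAR('a::field mpoly) = CHAR('a)"
proof (rule CHAR_eqI)
  have 1: "of_nat n = (pconst (of_nat n) :: 'a mpoly)" for n by (simp add: pconst_def)
  have *: "of_nat n = (0 :: 'a mpoly) \<longleftrightarrow> CHAR('a) dvd n" for n
    unfolding 1 pconst_eq_0_iff by (rule of_nat_eq_0_iff_char_dvd)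
  show "of_nat CHAR('a) = (0 :: 'a mpoly)" unfolding * by (rule dvd_refl)
  show "CHAR('a) dvd n" if "of_nat n = (0 :: 'a mpoly)" for n using that unfolding * .
qed

lemma CHAR_mpoly_fract: "CHAR('a::field mpoly fract) = CHAR('a)"
proof (rule CHAR_eqI)
  have 1: "of_nat n = (inc (of_nat n) :: 'a mpoly fract)" for n
    unfolding inc_def by (rule of_nat_fract)
  have *: "of_nat n = (0 :: 'a mpoly fract) \<longleftrightarrow> CHAR('a) dvd n" for n
    unfolding 1 inc_eq_0_iff of_nat_eq_0_iff_char_dvd CHAR_mpoly ..
  show "of_nat CHAR('a) = (0 :: 'a mpoly fract)" unfolding * by (rule dvd_refl)
  show "CHAR('a) dvd n" if "of_nat n = (0 :: 'a mpoly fract)" for n using that unfolding * .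
qed

lemma lookup_pconst_mult: "Poly_Mapping.lookup (pconst c * h) m = c * Poly_Mapping.lookup h m"
  unfolding pconst_def mult_map_scale_conv_mult[symmetric] by (simp add: map.rep_eq when_def)

section \<open>Linear independence over F^p and over F^p(S)\<close>

definition frob_indep :: "nat \<Rightarrow> nat \<Rightarrow> (nat \<Rightarrow> 'a::field) \<Rightarrow> bool" where
  "frob_indep p n e \<longleftrightarrow> (\<forall>c. (\<Sum>i<n. c i ^ p * e i) = 0 \<longrightarrow> (\<forall>i<n. c i = 0))"

lemma frob_indepD: "frob_indep p n e \<Longrightarrow> (\<Sum>i<n. c i ^ p * e i) = 0 \<Longrightarrow> i < n \<Longrightarrow> c i = 0"
  by (auto simp: frob_indep_def)

lemma frob_indep_nonzero:
  assumes "frob_indep p n e" "i < n" "p > 0" shows "e i \<noteq> 0"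
proof
  assume "e i = 0"
  then have "(\<Sum>j<n. (if j = i then 1 else 0) ^ p * e j) = 0"
    using assms(3) by (intro sum.neutral) auto
  from frob_indepD[OF assms(1) this assms(2)] show False by simp
qed

text \<open>The coefficients of \<open>tw p f\<close> are \<open>p\<close>-th powers; \<open>k0S p\<close> is the field \<open>F\<^sup>p(S\<^sub>0, S\<^sub>1, \<dots>)\<close>.\<close>

definition tw :: "nat \<Rightarrow> 'a::field mpoly \<Rightarrow> 'a mpoly fract" where
  "tw p = ev (\<lambda>c. emb (c ^ p)) (\<lambda>i. inc (pvar i))"

definition k0S :: "nat \<Rightarrow> 'a::field mpoly fract set" where
  "k0S p = fracs (tw p) UNIV"

definition twp :: "nat \<Rightarrow> 'a::field mpoly \<Rightarrow> 'a mpoly" where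
  "twp p f = (\<Sum>m\<in>Poly_Mapping.keys f. Poly_Mapping.single m (Poly_Mapping.lookup f m ^ p))"

lemma lookup_twp: "p > 0 \<Longrightarrow> Poly_Mapping.lookup (twp p f) m = Poly_Mapping.lookup f m ^ p"
  by (auto simp: twp_def lookup_sum lookup_single when_def in_keys_iff power_0_left)

lemma mon_inc: "mon (\<lambda>i. inc (g i)) m = inc (mon g m)"
  by (simp add: mon_def rhom_simps[OF rhom_inc])

lemma tw_eq_inc: "tw p f = inc (twp p f)"
  by (simp add: tw_def ev_def twp_def rhom_simps[OF rhom_inc] mon_inc emb_def single_eq_pconst_mon)

lemma tw_eq_0_iff: "p > 0 \<Longrightarrow> tw p f = 0 \<longleftrightarrow> f = 0"
  by (auto simp: tw_eq_inc poly_mapping_eq_iff fun_eq_iff lookup_twp)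

lemma csub_UNIV: "csub UNIV"
  by (simp add: csub_def)

locale char_p =
  fixes p :: nat and ty :: "'a::field itself"
  assumes prime_p: "prime p" and char_a: "CHAR('a) = p"
begin

lemma p_pos: "p > 0"
  using prime_p prime_gt_0_nat by blast

lemma char_K: "CHAR('a mpoly fract) = p" and char_mp: "CHAR('a mpoly) = p"
  by (simp_all add: CHAR_mpoly_fract CHAR_mpoly char_a)

lemma rhom_femb: "rhom (\<lambda>c::'a. emb (c ^ p))"
  by (rule rhom_comp[OF rhom_frob[OF prime_p char_a] rhom_emb])

lemma rhom_tw: "rhom (tw p :: 'a mpoly \<Rightarrow> _)"
  unfolding tw_def by (rule rhom_ev[OF rhom_femb])

lemma sfld_k0S: "sfld (k0S p :: 'a mpoly fract set)"
  unfolding k0S_def by (rule sfld_fracs[OF rhom_tw csub_UNIV])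

lemma tw_in_k0S: "tw p (f :: 'a mpoly) \<in> k0S p"
  unfolding k0S_def by (intro fracs_base rhom_tw csub_UNIV UNIV_I)

lemma tw_pvar: "tw p (pvar i :: 'a mpoly) = inc (pvar i)"
  unfolding tw_def by (rule ev_pvar[OF rhom_femb])

lemma tw_pconst: "tw p (pconst c :: 'a mpoly) = emb (c ^ p)"
  unfolding tw_def by (rule ev_pconst[OF rhom_femb])

text \<open>After clearing denominators, compare coefficients in F[S]: the polynomials
  \<open>twp p (f j)\<close> have p-th powers as coefficients, so each monomial yields a relation
  between the \<open>e j\<close> over F^p.\<close>

lemma k0S_indep:
  fixes e :: "nat \<Rightarrow> 'a"
  assumes e: "frob_indep p n e" and v: "\<And>j. j < n \<Longrightarrow> v j \<in> k0S p"
    and s: "(\<Sum>j<n. emb (e j) * v j) = 0" and j: "j < n"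
  shows "v j = 0"
proof -
  have v': "v j \<in> fracs (tw p) UNIV" if "j \<in> {..<n}" for j using v that by (simp add: k0S_def)
  obtain f g where fg: "tw p g \<noteq> 0" "\<forall>j\<in>{..<n}. f j \<in> UNIV \<and> v j = tw p (f j) / tw p g"
    using fracs_common_denom[where v = v and A = "{..<n}", OF rhom_tw csub_UNIV finite_lessThan v'] by blast
  have "inc (\<Sum>j<n. pconst (e j) * twp p (f j)) = (\<Sum>j<n. emb (e j) * v j) * tw p g"
    unfolding sum_distrib_right rhom_sum[OF rhom_inc]
    by (rule sum.cong) (use fg in \<open>auto simp: rhom_mult[OF rhom_inc] emb_def tw_eq_inc\<close>)
  then have z: "(\<Sum>j<n. pconst (e j) * twp p (f j)) = 0" by (simp add: s)
  have "Poly_Mapping.lookup (f j) m = 0" for m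
  proof -
    have "(\<Sum>j<n. Poly_Mapping.lookup (f j) m ^ p * e j) = Poly_Mapping.lookup (\<Sum>j<n. pconst (e j) * twp p (f j)) m"
      by (simp add: lookup_sum lookup_pconst_mult lookup_twp[OF p_pos] mult.commute)
    then show ?thesis using frob_indepD[OF e _ j, of "\<lambda>j. Poly_Mapping.lookup (f j) m"] z by simp
  qed
  then have "f j = 0" by (simp add: poly_mapping_eq_iff fun_eq_iff)
  then show ?thesis using fg(2) j by (simp add: rhom_0[OF rhom_tw])
qed

end

text \<open>The partial derivative by the variable with index \<open>i\<close> on F(S). It is linear
  over all of F, in particular over the coefficients of the relations to be differentiated.\<close>

definition dK :: "nat \<Rightarrow> 'a::field mpoly fract \<Rightarrow> 'a mpoly fract" where
  "dK i = (SOME D. deriv_on D UNIV \<and> (\<forall>f. D (inc f) = inc (pd i f)))"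

lemma dK: "deriv_on (dK i) UNIV" "dK i (inc f) = inc (pd i f)"
proof -
  have "\<exists>D. deriv_on D UNIV \<and> (\<forall>f. D (inc f) = inc (pd i f))"
    unfolding fracs_inc[symmetric]
    by (rule deriv_extend[OF rhom_inc csub_UNIV, of "pd i"])
      (auto simp: pd_add pd_mult)
  from someI_ex[OF this, folded dK_def] show "deriv_on (dK i) UNIV" "dK i (inc f) = inc (pd i f)"
    by auto
qed

lemma sfld_UNIV: "sfld UNIV"
  by (simp add: sfld_def csub_UNIV)

lemma dK_emb_mult: "dK i (emb c * z) = emb c * dK i z"
  using deriv_mult[OF dK(1) sfld_UNIV, of "emb c" z i] by (simp add: emb_def dK(2) rhom_0[OF rhom_inc])

definition pvset :: "nat set \<Rightarrow> 'a::field mpoly set" where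
  "pvset V = {f. \<forall>m\<in>Poly_Mapping.keys f. Poly_Mapping.keys m \<subseteq> V}"

lemma csub_pvset: "csub (pvset V)"
proof -
  have m: "f * g \<in> pvset V" if fg: "f \<in> pvset V" "g \<in> pvset V" for f g :: "'a mpoly"
    unfolding pvset_def
  proof (intro CollectI ballI)
    fix m assume "m \<in> Poly_Mapping.keys (f * g)"
    then obtain a b where "m = a + b" "a \<in> Poly_Mapping.keys f" "b \<in> Poly_Mapping.keys g"
      using Poly_Mapping.keys_mult[of f g] by blast
    then show "Poly_Mapping.keys m \<subseteq> V"
      using fg Poly_Mapping.keys_add[of a b] unfolding pvset_def by blast
  qed
  have a: "f + g \<in> pvset V" if "f \<in> pvset V" "g \<in> pvset V" for f g :: "'a mpoly"
    using that Poly_Mapping.keys_add[of f g] unfolding pvset_def by blast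
  have u: "- g \<in> pvset V" if "g \<in> pvset V" for g :: "'a mpoly"
    using that by (simp add: pvset_def in_keys_iff)
  have d: "f - g \<in> pvset V" if "f \<in> pvset V" "g \<in> pvset V" for f g :: "'a mpoly"
    unfolding diff_conv_add_uminus by (rule a[OF that(1) u[OF that(2)]])
  have "0 \<in> pvset V" "1 \<in> pvset V" by (simp_all add: pvset_def)
  then show ?thesis unfolding csub_def by (intro conjI ballI m a d)
qed

lemma pvset_pvar: "i \<in> V \<Longrightarrow> pvar i \<in> pvset V" and pvset_pconst: "pconst c \<in> pvset V"
  by (auto simp: pvset_def pvar_def pconst_def)

lemma pvset_subset_PR: "pvset {1..<N} \<subseteq> carrier (poly_ring N)"
  by (fastforce simp: pvset_def PR_iff)

definition diag_poly :: "nat \<Rightarrow> nat \<Rightarrow> (nat \<Rightarrow> 'a::field) \<Rightarrow> 'a mpoly" where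
  "diag_poly p N a = (\<Sum>i<N. pconst (a i) * pvar i ^ p)"

locale qform = char_p p ty for p and ty :: "'a::field itself" +
  fixes N :: nat and a :: "nat \<Rightarrow> 'a"
  assumes N2: "2 \<le> N" and indep: "frob_indep p N a"
begin

abbreviation "PN \<equiv> carrier (poly_ring N) :: 'a mpoly set"

definition r :: "nat \<Rightarrow> 'a" where "r i = a i / a 0"

text \<open>The value at 0 is solved from the linear equation that \<open>th Phi = 0\<close> becomes
  after taking the p-th root and dividing by \<open>a 0\<close>.\<close>

definition xi :: "nat \<Rightarrow> 'a mpoly fract" where
  "xi i = (if i = 0 then - (\<Sum>j=1..<N. emb (r j) * inc (pvar j)) else inc (pvar i))"

text \<open>\<open>th\<close> is the Frobenius map of the coordinate ring \<open>F[x]/(Phi)\<close>, with \<open>x\<^sub>i\<^sup>p\<close> for \<open>i \<noteq> 0\<close> renamed to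
  the variable \<open>S\<^sub>i\<close> of \<open>F(S)\<close>; so \<open>L0\<close> is a copy of the function field, over \<open>F\<^sup>p\<close>.\<close>

definition th :: "'a mpoly \<Rightarrow> 'a mpoly fract" where
  "th = ev (\<lambda>c. emb (c ^ p)) xi"

definition L0 :: "'a mpoly fract set" where
  "L0 = fracs th PN"

abbreviation "Phi \<equiv> diag_poly p N a"

lemma a0: "a 0 \<noteq> 0"
  using frob_indep_nonzero[OF indep _ p_pos, of 0] N2 by simp

lemma r0: "r 0 = 1" by (simp add: r_def a0)

lemma r_indep: "frob_indep p N r"
  unfolding frob_indep_def
proof (rule allI, rule impI)
  fix c assume "(\<Sum>i<N. c i ^ p * r i) = 0"
  moreover have "(\<Sum>i<N. c i ^ p * a i) = a 0 * (\<Sum>i<N. c i ^ p * r i)"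
    unfolding sum_distrib_left by (rule sum.cong) (auto simp: r_def a0)
  ultimately have "(\<Sum>i<N. c i ^ p * a i) = 0" by (simp only: mult_zero_right)
  then show "\<forall>i<N. c i = 0" using frob_indepD[OF indep] by blast
qed

lemma rhom_th: "rhom th"
  unfolding th_def by (rule rhom_ev[OF rhom_femb])

lemma th_pvar: "th (pvar i) = xi i"
  unfolding th_def by (rule ev_pvar[OF rhom_femb])

lemma th_pconst: "th (pconst c) = emb (c ^ p)"
  unfolding th_def by (rule ev_pconst[OF rhom_femb])

lemma sfld_L0: "sfld L0"
  unfolding L0_def by (rule sfld_fracs[OF rhom_th csub_PR])

lemma th_L0: "f \<in> PN \<Longrightarrow> th f \<in> L0"
  unfolding L0_def by (rule fracs_base[OF rhom_th csub_PR])

lemma xi_L0: "i < N \<Longrightarrow> xi i \<in> L0"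
  using th_L0[OF PR_pvar] by (simp add: th_pvar)

lemma emb_pow_L0: "emb (c ^ p) \<in> L0"
  using th_L0[OF PR_pconst] by (simp add: th_pconst)

lemma sum_split0: "(\<Sum>i<N. f i) = f 0 + (\<Sum>i=1..<N. f i)" for f :: "nat \<Rightarrow> 'b::comm_monoid_add"
proof -
  have "{..<N} = insert 0 {1..<N}" using N2 by auto
  then show ?thesis by simp
qed

lemma sum_xi: "(\<Sum>i<N. emb (r i) * xi i) = 0"
  unfolding sum_split0 by (simp add: xi_def r0 rhom_1[OF rhom_emb])

lemma xi_nonzero: "i \<noteq> 0 \<Longrightarrow> xi i \<noteq> 0"
  by (simp add: xi_def pvar_def) (metis lookup_single_eq lookup_zero one_neq_zero)

text \<open>Otherwise \<open>sum_xi\<close> would be a nontrivial relation between the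
  \<open>r i\<close> over F^p(S), against \<open>k0S_indep\<close>.\<close>

lemma xi0_notin: "xi 0 \<notin> k0S p"
proof
  assume *: "xi 0 \<in> k0S p"
  have "xi j \<in> k0S p" if "j < N" for j
    using * tw_in_k0S[of "pvar j"] by (cases "j = 0") (auto simp: xi_def tw_pvar)
  from k0S_indep[OF r_indep this sum_xi, of 1] show False using N2 xi_nonzero[of 1] by simp
qed

lemma xi0_pow: "xi 0 ^ p = tw p (- (\<Sum>j=1..<N. pconst (r j) * pvar j ^ p))"
proof -
  have "xi 0 ^ p = - (\<Sum>j=1..<N. (emb (r j) * inc (pvar j)) ^ p)"
    unfolding xi_def using rhom_frob[OF prime_p char_K, THEN rhom_minus] rhom_frob[OF prime_p char_K, THEN rhom_sum]
    by simp
  then show ?thesis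
    by (simp add: rhom_simps[OF rhom_tw] tw_pvar tw_pconst power_mult_distrib rhom_power[OF rhom_emb])
qed

lemma xi0_nonzero: "xi 0 \<noteq> 0"
  using xi0_notin csubD(1)[OF sfld_csub[OF sfld_k0S]] by metis

lemma Phi_PN: "Phi \<in> PN"
  unfolding diag_poly_def by (intro PR_intros) auto

text \<open>Frobenius is additive and the coefficients \<open>e i ^ p\<close> have p-th roots in
  F(S): a diagonal form becomes the p-th power of a linear form. This is where the equation of a
  hypersurface turns linear.\<close>

lemma th_diag: "th (\<Sum>i<n. pconst (e i) * h i ^ p) = (\<Sum>i<n. emb (e i) * th (h i)) ^ p"
proof -
  have "(\<Sum>i<n. emb (e i) * th (h i)) ^ p = (\<Sum>i<n. (emb (e i) * th (h i)) ^ p)"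
    using rhom_frob[OF prime_p char_K, THEN rhom_sum] by simp
  then show ?thesis
    by (simp add: rhom_simps[OF rhom_th] th_pconst power_mult_distrib rhom_power[OF rhom_emb])
qed

lemma th_Phi: "th Phi = 0"
proof -
  have "(\<Sum>i<N. emb (a i) * xi i) = emb (a 0) * (\<Sum>i<N. emb (r i) * xi i)"
    unfolding sum_distrib_left mult.assoc[symmetric] rhom_mult[OF rhom_emb, symmetric]
    by (simp add: r_def a0)
  then show ?thesis using p_pos by (simp add: diag_poly_def th_diag th_pvar sum_xi power_0_left)
qed

lemma th_pvset: "f \<in> pvset {1..<N} \<Longrightarrow> th f = tw p f"
proof -
  assume f: "f \<in> pvset {1..<N}"
  have "mon xi m = mon (\<lambda>i. inc (pvar i)) m" if "m \<in> Poly_Mapping.keys f" for m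
  proof -
    have "0 \<notin> Poly_Mapping.keys m" using that f unfolding pvset_def by fastforce
    then show ?thesis unfolding mon_def by (intro prod.cong) (auto simp: xi_def intro: gr0I)
  qed
  then show ?thesis by (simp add: th_def tw_def ev_def)
qed

lemma of_nat_p: "of_nat p = (0 :: 'a mpoly)"
  using char_mp by (metis of_nat_CHAR)

lemma pd_Phi: "pd i Phi = 0"
  by (simp add: diag_poly_def pd_sum pd_mult pd_power of_nat_p)

text \<open>Division with remainder by \<open>Phi\<close>, viewed as a polynomial of degree \<open>p\<close> in the variable \<open>0\<close>.\<close>

lemma normal_form:
  assumes "f \<in> PN"
  shows "\<exists>q c. q \<in> PN \<and> (\<forall>t<p. c t \<in> pvset {1..<N}) \<and> f = q * Phi + (\<Sum>t<p. c t * pvar 0 ^ t)"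
    (is "?NF f")
proof -
  note cp = csub_intros[OF csub_pvset]
  \<comment> \<open>What \<open>pvar 0 ^ p\<close> reduces to modulo \<open>Phi\<close>.\<close>
  define \<rho> where "\<rho> = - (\<Sum>j=1..<N. pconst (r j) * pvar j ^ p)"
  have \<rho>: "\<rho> \<in> pvset {1..<N}" unfolding \<rho>_def
    by (intro cp pvset_pconst pvset_pvar) auto
  have x0: "pvar 0 ^ p = pconst (1 / a 0) * Phi + \<rho>"
  proof -
    have "pconst (1 / a 0) * Phi = (\<Sum>i<N. pconst (r i) * pvar i ^ p)"
      by (simp add: diag_poly_def sum_distrib_left mult.assoc[symmetric] rhom_mult[OF rhom_pconst, symmetric] r_def)
    also have "\<dots> = pvar 0 ^ p - \<rho>"
      unfolding sum_split0 by (simp add: \<rho>_def r0 rhom_1[OF rhom_pconst])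
    finally show ?thesis by simp
  qed
  have pw: "\<exists>q\<in>PN. (pvar 0 ^ p) ^ u = q * Phi + \<rho> ^ u" for u
  proof (induction u)
    case 0
    show ?case by (rule bexI[of _ 0]) (auto intro: PR_intros)
  next
    case (Suc u)
    then obtain q where q: "q \<in> PN" "(pvar 0 ^ p) ^ u = q * Phi + \<rho> ^ u" by blast
    have "(pvar 0 ^ p) ^ Suc u = (q * (pconst (1 / a 0) * Phi + \<rho>) + pconst (1 / a 0) * \<rho> ^ u) * Phi + \<rho> ^ Suc u"
      using q(2) x0 by (simp add: algebra_simps)
    moreover have "q * (pconst (1 / a 0) * Phi + \<rho>) + pconst (1 / a 0) * \<rho> ^ u \<in> PN"
      using q(1) \<rho> pvset_subset_PR Phi_PN by (intro PR_intros) auto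
    ultimately show ?case by blast
  qed
  have single: "?NF (Poly_Mapping.single m c)" if m: "Poly_Mapping.keys m \<subseteq> {..<N}" for m c
  proof -
    define k where "k = Poly_Mapping.lookup m 0"
    define m' where "m' = m - Poly_Mapping.single 0 k"
    have mm: "m = Poly_Mapping.single 0 k + m'"
      by (rule poly_mapping_eqI) (auto simp: m'_def k_def lookup_add lookup_minus lookup_single when_def)
    have m': "Poly_Mapping.single m' c \<in> pvset {1..<N}"
      using m by (auto simp: pvset_def m'_def in_keys_iff lookup_minus lookup_single k_def when_def subset_iff
          split: if_splits)
    have "k = p * (k div p) + k mod p" by simp
    then have "pvar 0 ^ k = (pvar 0 ^ p) ^ (k div p) * (pvar 0 ^ (k mod p) :: 'a mpoly)"
      by (metis power_add power_mult)
    moreover have "Poly_Mapping.single m c = pvar 0 ^ k * Poly_Mapping.single m' c"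
      by (subst mm) (simp add: single_eq_pconst_mon[of _ c] mon_add mon_single mult.left_commute)
    ultimately have eq: "Poly_Mapping.single m c = (pvar 0 ^ p) ^ (k div p) * pvar 0 ^ (k mod p) * Poly_Mapping.single m' c"
      by (simp only:)
    obtain q where q: "q \<in> PN" "(pvar 0 ^ p) ^ (k div p) = q * Phi + \<rho> ^ (k div p)" using pw by blast
    let ?q = "q * pvar 0 ^ (k mod p) * Poly_Mapping.single m' c"
    let ?c = "\<lambda>t. if t = k mod p then \<rho> ^ (k div p) * Poly_Mapping.single m' c else 0"
    have "(\<Sum>t<p. ?c t * pvar 0 ^ t) = (\<Sum>t<p. if t = k mod p then \<rho> ^ (k div p) * Poly_Mapping.single m' c * pvar 0 ^ t else 0)"
      by (rule sum.cong) auto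
    also have "\<dots> = \<rho> ^ (k div p) * Poly_Mapping.single m' c * pvar 0 ^ (k mod p)"
      using p_pos by (simp add: sum.delta)
    finally have sc: "(\<Sum>t<p. ?c t * pvar 0 ^ t) = \<rho> ^ (k div p) * Poly_Mapping.single m' c * pvar 0 ^ (k mod p)" .
    have "Poly_Mapping.single m c = ?q * Phi + (\<Sum>t<p. ?c t * pvar 0 ^ t)"
      unfolding eq q(2) sc by (simp only: distrib_left distrib_right mult_ac)
    moreover have "?q \<in> PN" using N2
      by (intro PR_mult PR_power PR_pvar q(1) subsetD[OF pvset_subset_PR m']) simp
    moreover have "\<rho> ^ (k div p) * Poly_Mapping.single m' c \<in> pvset {1..<N}"
      by (intro csubD(5)[OF csub_pvset] csub_power[OF csub_pvset] \<rho> m')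
    then have "\<forall>t<p. ?c t \<in> pvset {1..<N}" by (simp add: csubD(1)[OF csub_pvset])
    ultimately show ?thesis by (intro exI[of _ ?q] exI[of _ ?c] conjI)
  qed
  have add: "?NF (f + g)" if f: "?NF f" and g: "?NF g" for f g
  proof -
    obtain q c where 1: "q \<in> PN" "\<forall>t<p. c t \<in> pvset {1..<N}" "f = q * Phi + (\<Sum>t<p. c t * pvar 0 ^ t)"
      using f by blast
    obtain q' c' where 2: "q' \<in> PN" "\<forall>t<p. c' t \<in> pvset {1..<N}" "g = q' * Phi + (\<Sum>t<p. c' t * pvar 0 ^ t)"
      using g by blast
    have "f + g = (q + q') * Phi + (\<Sum>t<p. (c t + c' t) * pvar 0 ^ t)"
      unfolding 1(3) 2(3) by (simp add: algebra_simps sum.distrib)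
    moreover have "q + q' \<in> PN" by (rule PR_add[OF 1(1) 2(1)])
    moreover have "\<forall>t<p. c t + c' t \<in> pvset {1..<N}"
      using 1(2) 2(2) by (simp add: csubD[OF csub_pvset])
    ultimately show ?thesis by (intro exI[of _ "q + q'"] exI[of _ "\<lambda>t. c t + c' t"] conjI)
  qed
  have zero: "?NF 0"
    by (rule exI[of _ 0], rule exI[of _ "\<lambda>_. 0"]) (auto intro: PR_intros cp)
  have "?NF (\<Sum>m\<in>A. Poly_Mapping.single m (Poly_Mapping.lookup f m))"
    if "finite A" "A \<subseteq> Poly_Mapping.keys f" for A
    using that
  proof (induction A)
    case empty
    show ?case using zero by simp
  next
    case (insert m A)
    have "Poly_Mapping.keys m \<subseteq> {..<N}" using insert.prems assms by (auto simp: PR_iff)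
    from add[OF single[OF this] insert.IH] show ?case using insert by simp
  qed
  from this[of "Poly_Mapping.keys f"] show ?thesis by (simp add: mpoly_sum_single)
qed

lemma k0S_powers_indep:
  assumes "\<And>t. t < p \<Longrightarrow> v t \<in> k0S p" "(\<Sum>t<p. v t * xi 0 ^ t) = 0" "t < p"
  shows "v t = 0"
proof -
  define F where "F = (\<Sum>t<p. Polynomial.monom (v t) t)"
  have cF: "poly.coeff F j = (if j < p then v j else 0)" for j
    by (simp add: F_def coeff_sum coeff_monom)
  have "F \<in> KP (k0S p)" unfolding F_def using assms(1) by (intro KP_sum KP_monom sfld_k0S) auto
  moreover have "poly F (xi 0) = 0" using assms(2) by (simp add: F_def poly_sum poly_monom)
  moreover have "degree F \<le> p - 1" by (intro degree_le) (auto simp: cF)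
  then have "degree F < p" using p_pos by linarith
  moreover have "xi 0 ^ p \<in> k0S p" by (simp only: xi0_pow tw_in_k0S)
  ultimately have "F = 0"
    using powers_independent[OF prime_p char_K sfld_k0S _ xi0_notin] by blast
  then show ?thesis using cF[of t] assms(3) by simp
qed

text \<open>The remainder of \<open>f\<close> modulo \<open>Phi\<close> has degree below p in the
  variable 0. Its image is a combination of powers of \<open>xi 0\<close> that are independent over
  F^p(S), so every coefficient vanishes.\<close>

lemma th_ker: assumes "f \<in> PN" "th f = 0" shows "\<exists>q\<in>PN. f = q * Phi"
proof -
  obtain q c where qc: "q \<in> PN" "\<And>t. t < p \<Longrightarrow> c t \<in> pvset {1..<N}" "f = q * Phi + (\<Sum>t<p. c t * pvar 0 ^ t)"
    using normal_form[OF assms(1)] by blast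
  have "th f = (\<Sum>t<p. th (c t) * xi 0 ^ t)"
    unfolding qc(3) by (simp add: rhom_simps[OF rhom_th] th_Phi th_pvar)
  also have "\<dots> = (\<Sum>t<p. tw p (c t) * xi 0 ^ t)"
    using qc(2) by (intro sum.cong) (auto simp: th_pvset)
  finally have "(\<Sum>t<p. tw p (c t) * xi 0 ^ t) = th f" ..
  then have S0: "(\<Sum>t<p. tw p (c t) * xi 0 ^ t) = 0" using assms(2) by (simp only:)
  have "tw p (c t) = 0" if "t < p" for t
    by (rule k0S_powers_indep[of "\<lambda>t. tw p (c t)", OF tw_in_k0S S0 that])
  then have "c t = 0" if "t < p" for t using that p_pos by (simp add: tw_eq_0_iff)
  then have "(\<Sum>t<p. c t * pvar 0 ^ t) = 0" by (intro sum.neutral) auto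
  then show ?thesis using qc by auto
qed

section \<open>Derivations of \<open>L0\<close> compared with those of F(S)\<close>

definition D :: "nat \<Rightarrow> 'a mpoly fract \<Rightarrow> 'a mpoly fract" where
  "D i = (SOME D. deriv_on D L0 \<and> (\<forall>f\<in>PN. D (th f) = th (pd i f)))"

lemma D: "deriv_on (D i) L0" and D_th: "f \<in> PN \<Longrightarrow> D i (th f) = th (pd i f)"
proof -
  have ker: "th (pd i f) = 0" if f: "f \<in> PN" "th f = 0" for f
  proof -
    obtain q where "f = q * Phi" using th_ker[OF f] by blast
    then show ?thesis by (simp add: pd_mult pd_Phi rhom_simps[OF rhom_th] th_Phi)
  qed
  have "\<exists>D. deriv_on D L0 \<and> (\<forall>f\<in>PN. D (th f) = th (pd i f))"
    unfolding L0_def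
    by (rule deriv_extend[OF rhom_th csub_PR, of N "pd i"])
      (simp_all add: pd_PR pd_add pd_mult ker, blast)
  from someI_ex[OF this, folded D_def] show "deriv_on (D i) L0" "f \<in> PN \<Longrightarrow> D i (th f) = th (pd i f)"
    by auto
qed

lemmas D_rules = deriv_closed[OF D sfld_L0] deriv_add[OF D sfld_L0] deriv_mult[OF D sfld_L0]
  deriv_0[OF D sfld_L0] deriv_1[OF D sfld_L0] deriv_sum[OF D sfld_L0]

lemma D_xi: "j < N \<Longrightarrow> D i (xi j) = (if i = j then 1 else 0)"
  using D_th[OF PR_pvar[of j N], of i] by (simp add: th_pvar pd_pvar rhom_simps[OF rhom_th])

lemma L0E:
  assumes "z \<in> L0"
  obtains f g where "f \<in> PN" "g \<in> PN" "th g \<noteq> 0" "z = th f / th g"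
  using assms unfolding L0_def by (rule fracsE)

text \<open>Both sides are derivations on \<open>L0\<close> that vanish on F^p, so it suffices to
  compare them at the \<open>xi j\<close>. The correction comes from \<open>xi 0\<close>, whose
  derivative in F(S) is \<open>- emb (r i)\<close>.\<close>

lemma dK_L0:
  assumes z: "z \<in> L0" and i: "1 \<le> i" "i < N"
  shows "dK i z = D i z - emb (r i) * D 0 z"
proof -
  note dKr = deriv_add[OF dK(1) sfld_UNIV] deriv_mult[OF dK(1) sfld_UNIV]
    deriv_sum[OF dK(1) sfld_UNIV] deriv_uminus[OF dK(1) sfld_UNIV]
  have th: "dK i (th f) = D i (th f) - emb (r i) * D 0 (th f)" if "f \<in> PN" for f
    using that
  proof (induction f rule: mpoly_induct)
    case (const c)
    show ?case
      by (simp add: D_th PR_pconst rhom_0[OF rhom_th]) (simp add: th_pconst emb_def dK(2) rhom_0[OF rhom_inc])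
  next
    case (var j)
    have "dK i (xi 0) = - (\<Sum>l=1..<N. emb (r l) * inc (if i = l then 1 else 0))"
      by (simp add: xi_def dKr dK_emb_mult dK(2) pd_pvar)
    also have "\<dots> = - (\<Sum>l=1..<N. if l = i then emb (r i) else 0)"
      by (rule arg_cong[where f = uminus], rule sum.cong) (auto simp: rhom_simps[OF rhom_inc])
    also have "\<dots> = - emb (r i)" using i by (simp add: sum.delta)
    finally have "dK i (xi 0) = - emb (r i)" .
    moreover have "dK i (xi j) = (if i = j then 1 else 0)" if "j \<noteq> 0"
      using that by (simp add: xi_def dK(2) pd_pvar rhom_simps[OF rhom_inc])
    ultimately show ?case using var i by (auto simp: th_pvar D_xi)
  next
    case (add f g)
    show ?case
      by (simp only: rhom_add[OF rhom_th] dKr(1)[OF UNIV_I UNIV_I] D_rules(2) th_L0 add) (simp add: algebra_simps)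
  next
    case (mult f g)
    show ?case
      by (simp only: rhom_mult[OF rhom_th] dKr(2)[OF UNIV_I UNIV_I] D_rules(3) th_L0 mult) (simp add: algebra_simps)
  qed
  obtain f g where fg: "f \<in> PN" "g \<in> PN" "th g \<noteq> 0" "z = th f / th g" using L0E[OF z] by blast
  note f1 = deriv_divide[OF dK(1) sfld_UNIV UNIV_I UNIV_I fg(3)]
  note f2 = deriv_divide[OF D sfld_L0 th_L0[OF fg(1)] th_L0[OF fg(2)] fg(3)]
  show ?thesis unfolding fg(4) f1 f2 th[OF fg(1)] th[OF fg(2)]
    using fg(3) by (simp add: divide_simps) (simp add: algebra_simps)
qed

definition mu :: "(nat \<Rightarrow> 'a) \<Rightarrow> nat \<Rightarrow> (nat \<Rightarrow> 'a mpoly fract) \<Rightarrow> 'a mpoly fract" where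
  "mu e n w = (\<Sum>j<n. emb (e j) * w j)"

text \<open>Apply \<open>dK i\<close> to the relation: it treats the coefficients \<open>e j\<close>
  as constants, and on the entries \<open>dK_L0\<close> applies.\<close>

lemma mu_D:
  assumes w: "\<And>j. j < n \<Longrightarrow> w j \<in> L0" and mu: "mu e n w = 0" and i: "i < N"
  shows "mu e n (\<lambda>j. D i (w j)) = emb (r i) * mu e n (\<lambda>j. D 0 (w j))"
proof (cases "i = 0")
  case True
  then show ?thesis by (simp add: r0 rhom_1[OF rhom_emb])
next
  case False
  have "0 = dK i (mu e n w)" by (simp add: mu deriv_0[OF dK(1) sfld_UNIV])
  also have "\<dots> = (\<Sum>j<n. emb (e j) * dK i (w j))"
    by (simp add: mu_def deriv_sum[OF dK(1) sfld_UNIV] dK_emb_mult)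
  also have "\<dots> = (\<Sum>j<n. emb (e j) * (D i (w j) - emb (r i) * D 0 (w j)))"
    using w False i by (intro sum.cong) (auto simp: dK_L0)
  also have "\<dots> = mu e n (\<lambda>j. D i (w j)) - emb (r i) * mu e n (\<lambda>j. D 0 (w j))"
    by (simp add: mu_def algebra_simps sum_subtractf sum_distrib_left)
  finally show ?thesis by simp
qed

text \<open>The commutator of two derivations is again a derivation. It vanishes on the image of
  \<open>th\<close>, where partial derivatives of polynomials commute, and therefore on
  fractions.\<close>

lemma D_commute:
  assumes z: "z \<in> L0" shows "D i (D j z) = D j (D i z)"
proof -
  obtain f g where fg: "f \<in> PN" "g \<in> PN" "th g \<noteq> 0" "z = th f / th g" using L0E[OF z] by blast
  have c: "D i (D j (th h)) = D j (D i (th h))" if "h \<in> PN" for h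
    using that by (simp add: D_th pd_PR pd_commute)
  have g: "th g \<in> L0" using th_L0 fg by blast
  have zg: "th f = z * th g" using fg by simp
  have "D i (D j (z * th g)) - D j (D i (z * th g)) = (D i (D j z) - D j (D i z)) * th g"
    using z g c[OF fg(2)] by (simp add: D_rules csubD[OF sfld_csub[OF sfld_L0]] algebra_simps)
  then show ?thesis using c[OF fg(1)] fg(3) unfolding zg by simp
qed

text \<open>\<open>D 0\<close>-constants are, up to \<open>p\<close>-th powers, in \<open>k0S p\<close>.\<close>

lemma constants_indep:
  assumes e: "frob_indep p n e" and w: "\<And>j. j < n \<Longrightarrow> w j \<in> L0" and D0: "\<And>j. j < n \<Longrightarrow> D 0 (w j) = 0"
    and mu: "mu e n w = 0" and j: "j < n"
  shows "w j = 0"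
proof -
  have w': "w j \<in> fracs th PN" if "j \<in> {..<n}" for j using w that by (simp add: L0_def)
  obtain f g where fg: "g \<in> PN" "th g \<noteq> 0" "\<forall>j\<in>{..<n}. f j \<in> PN \<and> w j = th (f j) / th g"
    using fracs_common_denom[where v = w and A = "{..<n}", OF rhom_th csub_PR finite_lessThan w'] by blast
  \<comment> \<open>The factor \<open>th g ^ p\<close> clears the denominators and is itself killed
    by \<open>D 0\<close>.\<close>
  define v where "v j = w j * th g ^ p" for j
  have gp: "D 0 (th g ^ p) = 0"
  proof -
    have "of_nat p = (0 :: 'a mpoly fract)" using char_K by (metis of_nat_CHAR)
    then show ?thesis unfolding deriv_power[OF D sfld_L0 th_L0[OF fg(1)]] by simp
  qed
  have gL: "th g ^ p \<in> L0" using csub_power[OF sfld_csub[OF sfld_L0]] th_L0[OF fg(1)] by blast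
  have v0: "v j \<in> k0S p" if j: "j < n" for j
  proof -
    have "v j = th (f j * g ^ (p - 1))"
    proof -
      have "w j = th (f j) / th g" using fg(3) j by blast
      moreover have "th g ^ p = th g * th g ^ (p - 1)" using p_pos by (simp flip: power_Suc)
      ultimately show ?thesis using fg(2) by (simp add: v_def rhom_mult[OF rhom_th] rhom_power[OF rhom_th])
    qed
    moreover have "f j * g ^ (p - 1) \<in> PN" using fg j by (intro PR_intros) auto
    ultimately obtain h where h: "h \<in> PN" "v j = th h" by blast
    obtain q c where qc: "q \<in> PN" "\<And>t. t < p \<Longrightarrow> c t \<in> pvset {1..<N}" "h = q * Phi + (\<Sum>t<p. c t * pvar 0 ^ t)"
      using normal_form[OF h(1)] by blast
    have cP: "c t \<in> PN" if "t < p" for t using qc(2)[OF that] pvset_subset_PR by blast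
    have "v j = (\<Sum>t<p. th (c t) * xi 0 ^ t)"
      unfolding h(2) qc(3) by (simp add: rhom_simps[OF rhom_th] th_Phi th_pvar)
    also have "\<dots> = (\<Sum>t<p. tw p (c t) * xi 0 ^ t)"
      using qc(2) by (intro sum.cong) (auto simp: th_pvset)
    finally have vs: "v j = (\<Sum>t<p. tw p (c t) * xi 0 ^ t)" .
    have tL: "tw p (c t) \<in> L0" if "t < p" for t using th_L0[OF cP[OF that]] th_pvset[OF qc(2)[OF that]] by simp
    have xL: "xi 0 ^ t \<in> L0" for t using csub_power[OF sfld_csub[OF sfld_L0] xi_L0] N2 by simp
    have pd0: "pd 0 f = 0" if "f \<in> pvset {1..<N}" for f :: "'a mpoly"
    proof (rule poly_mapping_eqI)
      fix m
      have "m + Poly_Mapping.single 0 1 \<notin> Poly_Mapping.keys f"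
        using that by (auto simp: pvset_def in_keys_iff lookup_add subset_iff dest!: bspec spec[of _ 0])
      then show "Poly_Mapping.lookup (pd 0 f) m = Poly_Mapping.lookup 0 m"
        by (simp add: lookup_pd in_keys_iff)
    qed
    have Dt: "D 0 (tw p (c t)) = 0" if "t < p" for t
      using D_th[OF cP[OF that], of 0] th_pvset[OF qc(2)[OF that]] pd0[OF qc(2)[OF that]]
      by (simp add: rhom_0[OF rhom_th])
    \<comment> \<open>On an expansion in powers of \<open>xi 0\<close> with coefficients free of the
      variable 0, \<open>D 0\<close> is d/d(xi 0). The exponents from 1 to p - 1 are invertible, so
      that only the constant term survives.\<close>
    have "0 = D 0 (v j)"
      using D_rules(3)[OF w[OF j] gL, of 0] D0[OF j] gp by (simp add: v_def)
    also have "\<dots> = (\<Sum>t<p. tw p (c t) * (of_nat t * xi 0 ^ (t - 1)))"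
      unfolding vs using tL xL Dt N2
      by (subst D_rules(6)) (auto simp: D_rules(3) deriv_power[OF D sfld_L0] xi_L0 D_xi
          intro!: sum.cong csubD(5)[OF sfld_csub[OF sfld_L0]])
    \<comment> \<open>Shifted so that it is again a combination of the first p powers; the top
      coefficient is filled up with 0.\<close>
    also have "\<dots> = (\<Sum>t<p. of_nat (Suc t) * (if Suc t < p then tw p (c (Suc t)) else 0) * xi 0 ^ t)"
    proof -
      obtain p' where p': "p = Suc p'" using p_pos gr0_implies_Suc by blast
      let ?F = "\<lambda>t. tw p (c t) * (of_nat t * xi 0 ^ (t - 1))"
      let ?G = "\<lambda>t. of_nat (Suc t) * (if Suc t < p then tw p (c (Suc t)) else 0) * xi 0 ^ t"
      have "(\<Sum>t<Suc p'. ?F t) = ?F 0 + (\<Sum>t<p'. ?F (Suc t))" by (rule sum.lessThan_Suc_shift)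
      also have "\<dots> = (\<Sum>t<p'. ?G t)"
        using p' by (simp add: mult_ac cong: sum.cong_simp)
      also have "\<dots> = (\<Sum>t<Suc p'. ?G t)" using p' by simp
      finally show ?thesis by (simp only: p'[symmetric])
    qed
    finally have S0: "0 = (\<Sum>t<p. of_nat (Suc t) * (if Suc t < p then tw p (c (Suc t)) else 0) * xi 0 ^ t)" .
    have "of_nat (Suc t) * (if Suc t < p then tw p (c (Suc t)) else 0) = 0" if "t < p" for t
    proof (rule k0S_powers_indep[of "\<lambda>t. of_nat (Suc t) * (if Suc t < p then tw p (c (Suc t)) else 0)", OF _ S0[symmetric] that])
      show "of_nat (Suc t) * (if Suc t < p then tw p (c (Suc t)) else 0) \<in> k0S p" for t
        using tw_in_k0S csubD(1)[OF sfld_csub[OF sfld_k0S]]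
        by (intro csubD(5)[OF sfld_csub[OF sfld_k0S]] csub_of_nat[OF sfld_csub[OF sfld_k0S]]) simp
    qed
    note z = this
    have "tw p (c (Suc t)) = 0" if t: "Suc t < p" for t
    proof -
      have "\<not> p dvd Suc t" using t by (simp add: nat_dvd_not_less)
      then have "of_nat (Suc t) \<noteq> (0 :: 'a mpoly fract)"
        unfolding of_nat_eq_0_iff_char_dvd char_K .
      then show ?thesis using z[of t] t by (simp del: of_nat_Suc)
    qed
    then have "v j = tw p (c 0)" unfolding vs
      using p_pos by (subst sum.remove[of _ 0]) (auto intro!: sum.neutral, metis not0_implies_Suc)
    then show ?thesis using tw_in_k0S by simp
  qed
  have "(\<Sum>j<n. emb (e j) * v j) = mu e n w * th g ^ p"
    by (simp add: v_def mu_def sum_distrib_right mult.assoc)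
  then have "v j = 0" using k0S_indep[OF e v0 _ j] mu by simp
  then show ?thesis using fg(2) by (simp add: v_def)
qed

end

section \<open>Linear algebra over a subfield\<close>

definition lspan :: "'k::field set \<Rightarrow> nat \<Rightarrow> (nat \<Rightarrow> 'k) \<Rightarrow> 'k set" where
  "lspan K n b = {(\<Sum>i<n. c i * b i) | c. \<forall>i<n. c i \<in> K}"

definition lindep :: "'k::field set \<Rightarrow> nat \<Rightarrow> (nat \<Rightarrow> 'k) \<Rightarrow> bool" where
  "lindep K n b \<longleftrightarrow> (\<forall>c. (\<forall>i<n. c i \<in> K) \<longrightarrow> (\<Sum>i<n. c i * b i) = 0 \<longrightarrow> (\<forall>i<n. c i = 0))"

lemma lindepD:
  "lindep K n b \<Longrightarrow> (\<And>i. i < n \<Longrightarrow> c i \<in> K) \<Longrightarrow> (\<Sum>i<n. c i * b i) = 0 \<Longrightarrow> i < n \<Longrightarrow> c i = 0"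
  unfolding lindep_def by blast

definition lbasis :: "'k::field set \<Rightarrow> nat \<Rightarrow> (nat \<Rightarrow> 'k) \<Rightarrow> 'k set \<Rightarrow> bool" where
  "lbasis K n b V \<longleftrightarrow> lspan K n b = V \<and> lindep K n b"

definition lsub :: "'k::field set \<Rightarrow> 'k set \<Rightarrow> bool" where
  "lsub K V \<longleftrightarrow> 0 \<in> V \<and> (\<forall>x\<in>V. \<forall>y\<in>V. x + y \<in> V) \<and> (\<forall>c\<in>K. \<forall>x\<in>V. c * x \<in> V)"

lemma lspanI: "(\<And>i. i < n \<Longrightarrow> c i \<in> K) \<Longrightarrow> (\<Sum>i<n. c i * b i) \<in> lspan K n b"
  by (auto simp: lspan_def)

lemma lspan_iff: "x \<in> lspan K n b \<longleftrightarrow> (\<exists>c. (\<forall>i<n. c i \<in> K) \<and> x = (\<Sum>i<n. c i * b i))"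
  by (auto simp: lspan_def)

lemma lspan_base:
  assumes "sfld K" "i < n" shows "b i \<in> lspan K n b"
proof -
  have "(\<Sum>j<n. (if j = i then 1 else 0) * b j) = (\<Sum>j<n. if j = i then b j else 0)"
    by (rule sum.cong) auto
  also have "\<dots> = b i" using assms(2) by simp
  finally show ?thesis
    using lspanI[of n "\<lambda>j. if j = i then 1 else 0" K b] csubD(1,2)[OF sfld_csub[OF assms(1)]] by simp
qed

lemma lsub_lspan: assumes K: "sfld K" shows "lsub K (lspan K n b)"
  unfolding lsub_def
proof (intro conjI ballI)
  note Kc = csub_intros[OF sfld_csub[OF K]]
  show "0 \<in> lspan K n b" using lspanI[of n "\<lambda>_. 0" K b] Kc(1) by simp
  fix x y assume xy: "x \<in> lspan K n b" "y \<in> lspan K n b"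
  obtain c where c: "\<forall>i<n. c i \<in> K" "x = (\<Sum>i<n. c i * b i)" using xy(1) unfolding lspan_iff by blast
  obtain d where d: "\<forall>i<n. d i \<in> K" "y = (\<Sum>i<n. d i * b i)" using xy(2) unfolding lspan_iff by blast
  show "x + y \<in> lspan K n b"
    using lspanI[of n "\<lambda>i. c i + d i" K b] Kc(3) c d by (simp add: distrib_right sum.distrib)
next
  note Kc = csub_intros[OF sfld_csub[OF K]]
  fix k x assume k: "k \<in> K" and "x \<in> lspan K n b"
  then obtain c where c: "\<forall>i<n. c i \<in> K" "x = (\<Sum>i<n. c i * b i)" unfolding lspan_iff by blast
  show "k * x \<in> lspan K n b"
    using lspanI[of n "\<lambda>i. k * c i" K b] Kc(5)[OF k] c by (simp add: sum_distrib_left mult.assoc)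
qed

lemma lsub_sum: "lsub K V \<Longrightarrow> (\<And>i. i \<in> A \<Longrightarrow> f i \<in> V) \<Longrightarrow> sum f A \<in> V"
  by (induction A rule: infinite_finite_induct) (auto simp: lsub_def)

lemma lspan_subset:
  "lsub K V \<Longrightarrow> (\<And>i. i < n \<Longrightarrow> b i \<in> V) \<Longrightarrow> lspan K n b \<subseteq> V"
  unfolding lspan_def by (auto intro!: lsub_sum[of K]) (auto simp: lsub_def)

lemma lindep_le:
  assumes K: "sfld K" and "lindep K m b" "\<And>i. i < m \<Longrightarrow> b i \<in> lspan K n u" shows "m \<le> n"
proof (rule ccontr)
  assume "\<not> m \<le> n"
  then have nm: "n < m" by simp
  have "\<exists>c. (\<forall>i<n. c i \<in> K) \<and> b j = (\<Sum>i<n. c i * u i)" if "j < m" for j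
    using assms(3)[OF that] by (auto simp: lspan_def)
  from span_dependent[OF K nm, of b u, OF this] show False using assms(2) unfolding lindep_def by blast
qed

text \<open>Take an independent family in \<open>V\<close> of greatest length; lengths are bounded
  by \<open>k\<close>, and a vector of \<open>V\<close> outside its span would prolong it.\<close>

lemma lbasis_exists:
  assumes K: "sfld K" and V: "lsub K V" and sub: "V \<subseteq> lspan K k u"
  shows "\<exists>n b. lbasis K n b V \<and> n \<le> k"
proof -
  let ?P = "\<lambda>n. \<exists>b. lindep K n b \<and> (\<forall>i<n. b i \<in> V)"
  have bd: "n \<le> k" if "?P n" for n using that lindep_le[OF K] sub by blast
  have "?P 0" by (simp add: lindep_def)
  then obtain n where n: "?P n" and max: "\<And>m. ?P m \<Longrightarrow> m \<le> n"
    using Nat.ex_has_greatest_nat[of ?P 0 k] bd by blast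
  obtain b where b: "lindep K n b" "\<forall>i<n. b i \<in> V" using n by blast
  have "lspan K n b \<subseteq> V" using lspan_subset[OF V] b(2) by blast
  moreover have "v \<in> lspan K n b" if v: "v \<in> V" for v
  proof -
    define b' where "b' i = (if i = n then v else b i)" for i
    have "\<not> ?P (Suc n)" using max by fastforce
    moreover have "\<forall>i<Suc n. b' i \<in> V" using b(2) v by (auto simp: b'_def less_Suc_eq)
    ultimately have "\<not> lindep K (Suc n) b'" by blast
    then obtain c where c: "\<forall>i<Suc n. c i \<in> K" "(\<Sum>i<Suc n. c i * b' i) = 0" "\<exists>i<Suc n. c i \<noteq> 0"
      unfolding lindep_def by blast
    have s: "(\<Sum>i<n. c i * b i) + c n * v = 0" using c(2) by (simp add: b'_def)
    have "c n \<noteq> 0"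
    proof
      assume "c n = 0"
      then have "\<forall>i<n. c i = 0" using s b(1) c(1) unfolding lindep_def by auto
      then show False using c(3) \<open>c n = 0\<close> by (auto simp: less_Suc_eq)
    qed
    then have "v = - (\<Sum>i<n. c i * b i) / c n" using s by (simp add: field_simps eq_neg_iff_add_eq_0)
    also have "\<dots> = (\<Sum>i<n. (- c i / c n) * b i)" by (simp add: sum_negf sum_divide_distrib)
    also have "\<dots> \<in> lspan K n b"
      using c(1) by (intro lspanI sfld_divide[OF K] csub_uminus[OF sfld_csub[OF K]]) auto
    finally show ?thesis .
  qed
  ultimately have "lbasis K n b V" using b(1) by (auto simp: lbasis_def)
  then show ?thesis using bd[OF n] by blast
qed

lemma lbasis_unique:
  assumes "sfld K" "lbasis K n b V" "lbasis K m c V" shows "n = m"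
proof (rule antisym)
  show "n \<le> m" "m \<le> n"
    using assms lindep_le[of K] lspan_base[of K] unfolding lbasis_def by metis+
qed

lemma sum_lessThan_mult:
  fixes f :: "nat \<Rightarrow> 'b::comm_monoid_add"
  shows "(\<Sum>k<m * q. f k) = (\<Sum>j<q. \<Sum>i<m. f (j * m + i))"
proof -
  have "(\<Sum>j<q. \<Sum>i<m. f (j * m + i)) = (\<Sum>j<q. sum f {j * m..<j * m + m})"
  proof (rule sum.cong[OF refl])
    show "(\<Sum>i<m. f (j * m + i)) = sum f {j * m..<j * m + m}" for j
      using sum.shift_bounds_nat_ivl[of f 0 "j * m" m] by (simp add: add.commute lessThan_atLeast0)
  qed
  also have "\<dots> = (\<Sum>k<q * m. f k)" by (rule sum.nat_group)
  finally show ?thesis by (simp add: mult.commute)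
qed

text \<open>The products of the members of the two bases, with the index \<open>k\<close> standing
  for the pair of \<open>k mod m\<close> and \<open>k div m\<close>.\<close>

lemma lbasis_tower:
  assumes K: "sfld K" and L: "sfld L" and l: "lbasis K m l L" and b: "lbasis L q b U"
  shows "lbasis K (m * q) (\<lambda>k. l (k mod m) * b (k div m)) U"
proof -
  let ?b = "\<lambda>k. l (k mod m) * b (k div m)"
  have s: "(\<Sum>k<m * q. c k * ?b k) = (\<Sum>j<q. (\<Sum>i<m. c (j * m + i) * l i) * b j)" for c
    unfolding sum_lessThan_mult sum_distrib_right by (intro sum.cong) (auto simp: mult.assoc)
  have lt: "j * m + i < m * q" if "i < m" "j < q" for i j
  proof -
    have "j * m + i < Suc j * m" using that by simp
    also have "\<dots> \<le> q * m" using that by (intro mult_le_mono) auto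
    finally show ?thesis by (simp add: mult.commute)
  qed
  have "lspan K (m * q) ?b \<subseteq> U"
  proof
    fix x assume "x \<in> lspan K (m * q) ?b"
    then obtain c where c: "\<forall>k<m * q. c k \<in> K" "x = (\<Sum>k<m * q. c k * ?b k)" unfolding lspan_iff by blast
    have "(\<Sum>i<m. c (j * m + i) * l i) \<in> L" if "j < q" for j
      using l c(1) lt[OF _ that] unfolding lbasis_def by (auto intro!: lspanI)
    then show "x \<in> U" using b unfolding c(2) s lbasis_def by (auto intro!: lspanI)
  qed
  moreover have "x \<in> lspan K (m * q) ?b" if x: "x \<in> U" for x
  proof -
    obtain d where d: "\<forall>j<q. d j \<in> L" "x = (\<Sum>j<q. d j * b j)"
      using x b unfolding lbasis_def lspan_def by blast
    have "\<exists>c. (\<forall>i<m. c i \<in> K) \<and> d j = (\<Sum>i<m. c i * l i)" if "j < q" for j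
      using d(1) that l unfolding lbasis_def lspan_def by blast
    then obtain c where c: "\<And>j. j < q \<Longrightarrow> (\<forall>i<m. c j i \<in> K) \<and> d j = (\<Sum>i<m. c j i * l i)" by metis
    have "x = (\<Sum>k<m * q. c (k div m) (k mod m) * ?b k)"
      unfolding s d(2) using c by (intro sum.cong) auto
    moreover have "c (k div m) (k mod m) \<in> K" if "k < m * q" for k
    proof -
      have "m > 0" using that by (cases m) auto
      then show ?thesis using c[of "k div m"] that by (simp add: less_mult_imp_div_less mult.commute)
    qed
    ultimately show ?thesis by (auto intro!: lspanI)
  qed
  moreover have "lindep K (m * q) ?b"
    unfolding lindep_def
  proof (intro allI impI)
    fix c k assume c: "\<forall>k<m * q. c k \<in> K" "(\<Sum>k<m * q. c k * ?b k) = 0" and k: "k < m * q"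
    have L1: "(\<Sum>i<m. c (j * m + i) * l i) \<in> L" if "j < q" for j
      using l c(1) lt[OF _ that] unfolding lbasis_def by (auto intro!: lspanI)
    have S1: "(\<Sum>j<q. (\<Sum>i<m. c (j * m + i) * l i) * b j) = 0" using c(2) unfolding s .
    have lb: "lindep L q b" using b by (simp add: lbasis_def)
    have z: "(\<Sum>i<m. c (j * m + i) * l i) = 0" if "j < q" for j
      by (rule lindepD[OF lb, where c = "\<lambda>j. \<Sum>i<m. c (j * m + i) * l i", OF L1 S1 that])
    have m: "m > 0" using k by (cases m) auto
    have j: "k div m < q" using k by (simp add: less_mult_imp_div_less mult.commute)
    have li: "lindep K m l" using l by (simp add: lbasis_def)
    have "c (k div m * m + k mod m) = 0"
    proof (rule lindepD[OF li, where c = "\<lambda>i. c (k div m * m + i)"])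
      show "c (k div m * m + i) \<in> K" if "i < m" for i using c(1) lt[OF that j] by blast
      show "(\<Sum>i<m. c (k div m * m + i) * l i) = 0" by (rule z[OF j])
      show "k mod m < m" using m by simp
    qed
    then show "c k = 0" by simp
  qed
  ultimately show ?thesis unfolding lbasis_def by blast
qed

lemma lsub_sfld: "sfld M \<Longrightarrow> L \<subseteq> M \<Longrightarrow> lsub L M"
  using csubD[OF sfld_csub, of M] by (auto simp: lsub_def)

text \<open>Polynomials in \<open>z\<close> are reduced modulo X^p - z^p. A fraction F(z) / G(z)
  equals F(z) G(z)^(p-1) divided by G(z)^p, and this denominator lies in \<open>L\<close>.\<close>

lemma adj_basis:
  fixes z :: "'k::field"
  assumes p: "prime p" "CHAR('k) = p" and L: "sfld L" and z: "z ^ p \<in> L" "z \<notin> L"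
  shows "lbasis L p (\<lambda>i. z ^ i) (adj L z)"
proof -
  note Lc = csub_intros[OF sfld_csub[OF L]]
  have p0: "p > 0" using prime_gt_0_nat[OF p(1)] .
  define X where "X = Polynomial.monom 1 p - [:z ^ p:]"
  have X: "X \<in> KP L" unfolding X_def using z Lc(2) by (intro KP_diff[OF L] KP_monom[OF L] KP_const[OF L]) auto
  have dX: "degree X = p"
    unfolding X_def diff_conv_add_uminus by (subst degree_add_eq_left) (auto simp: degree_monom_eq p0)
  have X0: "X \<noteq> 0" "poly X z = 0" using dX p0 by (auto simp: X_def poly_monom)
  have red: "poly F z \<in> lspan L p (\<lambda>i. z ^ i)" if F: "F \<in> KP L" for F
  proof -
    obtain Q R where QR: "Q \<in> KP L" "R \<in> KP L" "F = X * Q + R" "R = 0 \<or> degree R < degree X"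
      using KP_division[OF L X X0(1) F] by blast
    have "degree R < p" using QR(4) dX p0 by auto
    from poly_eq_sum_less[OF this, of z] have "poly F z = (\<Sum>i<p. poly.coeff R i * z ^ i)" using QR(3) X0 by simp
    then show ?thesis using QR(2) by (auto simp: KP_def intro: lspanI)
  qed
  have "adj L z \<subseteq> lspan L p (\<lambda>i. z ^ i)"
  proof
    fix y assume "y \<in> adj L z"
    then obtain F G where FG: "F \<in> KP L" "G \<in> KP L" "poly G z \<noteq> 0" "y = poly F z / poly G z"
      unfolding adj_def by (rule fracsE)
    have Gp: "poly G z ^ p \<in> L"
      unfolding poly_map_poly_frobenius[OF p, symmetric]
      using FG(2) p0 by (intro poly_in_sfld[OF L] z) (auto simp: KP_def coeff_map_poly power_0_left intro: Lc)
    have "poly G z ^ p = poly G z * poly G z ^ (p - 1)" using p0 by (simp flip: power_Suc)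
    then have "y = inverse (poly G z ^ p) * poly (F * G ^ (p - 1)) z" using FG(3,4) by (simp add: field_simps)
    moreover have "poly (F * G ^ (p - 1)) z \<in> lspan L p (\<lambda>i. z ^ i)"
      by (intro red csubD(5)[OF csub_KP[OF L]] csub_power[OF csub_KP[OF L]] FG)
    ultimately show "y \<in> lspan L p (\<lambda>i. z ^ i)"
      using lsub_lspan[OF L, of p "\<lambda>i. z ^ i"] sfld_inverse[OF L Gp] by (simp add: lsub_def)
  qed
  moreover have "lspan L p (\<lambda>i. z ^ i) \<subseteq> adj L z"
    using adj_base[OF L]
    by (intro lspan_subset[OF lsub_sfld[OF sfld_adj[OF L]]] csub_power[OF sfld_csub[OF sfld_adj[OF L]]] adj_gen[OF L]) blast
  moreover have "lindep L p (\<lambda>i. z ^ i)"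
    unfolding lindep_def
  proof (intro allI impI)
    fix c i assume c: "\<forall>i<p. c i \<in> L" "(\<Sum>i<p. c i * z ^ i) = 0" and i: "i < p"
    define F where "F = (\<Sum>t<p. Polynomial.monom (c t) t)"
    have cF: "poly.coeff F j = (if j < p then c j else 0)" for j
      by (simp add: F_def coeff_sum coeff_monom)
    have "F \<in> KP L" unfolding F_def using c(1) by (intro KP_sum[OF L] KP_monom[OF L]) auto
    moreover have "poly F z = 0" using c(2) by (simp add: F_def poly_sum poly_monom)
    moreover have "degree F \<le> p - 1" by (intro degree_le) (auto simp: cF)
    then have "degree F < p" using p0 by linarith
    ultimately have "F = 0" using powers_independent[OF p L z] by blast
    then show "c i = 0" using cF[of i] i by simp
  qed
  ultimately show ?thesis by (auto simp: lbasis_def)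
qed

text \<open>Adjoining to \<open>L\<close> one element of \<open>M\<close> outside it divides the
  degree by p, and the hypotheses persist for the larger field.\<close>

lemma purely_inseparable_degree:
  fixes M :: "'k::field set"
  assumes p: "prime p" "CHAR('k) = p" and M: "sfld M"
    and "sfld L" "L \<subseteq> M" "\<And>z. z \<in> M \<Longrightarrow> z ^ p \<in> L" "lbasis L n b M"
  shows "\<exists>e. n = p ^ e"
  using assms(4-)
proof (induction n arbitrary: L b rule: less_induct)
  case (less n)
  note L = less.prems(1)
  show ?case
  proof (cases "L = M")
    case True
    have "lbasis L 1 (\<lambda>_. 1) L"
      unfolding lbasis_def lspan_def lindep_def by (auto intro: exI[of _ "\<lambda>_. _"])
    then have "n = 1" using lbasis_unique[OF L] less.prems(4) True by metis
    then show ?thesis by (intro exI[of _ 0]) simp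
  next
    case False
    then obtain z where z: "z \<in> M" "z \<notin> L" using less.prems(2) by blast
    have zp: "z ^ p \<in> L" using less.prems(3) z by blast
    let ?L = "adj L z"
    have L': "sfld ?L" by (rule sfld_adj[OF L])
    have LL: "L \<subseteq> ?L" using adj_base[OF L] by blast
    have LM: "?L \<subseteq> M" by (rule adj_least[OF M less.prems(2) z(1)])
    have bM: "b i \<in> M" if "i < n" for i using less.prems(4) lspan_base[OF L that, of b] unfolding lbasis_def by blast
    have "M \<subseteq> lspan ?L n b"
    proof -
      have "lspan L n b \<subseteq> lspan ?L n b" using LL unfolding lspan_def by blast
      then show ?thesis using less.prems(4) unfolding lbasis_def by blast
    qed
    then obtain m c where mc: "lbasis ?L m c M"
      using lbasis_exists[OF L' lsub_sfld[OF M LM]] by blast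
    from lbasis_tower[OF L L' adj_basis[OF p L zp z(2)] mc]
    have n: "n = p * m" using lbasis_unique[OF L less.prems(4)] by blast
    have "m \<noteq> 0"
    proof
      assume "m = 0"
      then have "M = {0}" using mc by (auto simp: lbasis_def lspan_def)
      then show False using csubD(2)[OF sfld_csub[OF M]] by simp
    qed
    then have "m < n" using n prime_gt_1_nat[OF p(1)] by simp
    from less.IH[OF this L' LM _ mc] obtain e where "m = p ^ e" using less.prems(3) LL by blast
    then show ?thesis using n by (intro exI[of _ "Suc e"]) simp
  qed
qed

lemma lbasis_scaled_le:
  assumes K: "sfld K" and b: "lbasis K u b U" and M: "lbasis K m c M" and g: "g \<noteq> 0" "\<And>x. x \<in> U \<Longrightarrow> g * x \<in> M"
  shows "u \<le> m"
proof (rule lindep_le[OF K, of u "\<lambda>i. g * b i" m c])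
  show "lindep K u (\<lambda>i. g * b i)"
    unfolding lindep_def
  proof (intro allI impI)
    fix d i assume d: "\<forall>i<u. d i \<in> K" "(\<Sum>i<u. d i * (g * b i)) = 0" and i: "i < u"
    have "g * (\<Sum>i<u. d i * b i) = 0" using d(2) by (simp add: sum_distrib_left mult.left_commute)
    then have "(\<Sum>i<u. d i * b i) = 0" using g by simp
    then show "d i = 0" using b d(1) i unfolding lbasis_def lindep_def by blast
  qed
  show "g * b i \<in> lspan K m c" if "i < u" for i
    using M b lspan_base[OF K that, of b] g(2) unfolding lbasis_def by blast
qed

text \<open>Made for relations: after scaling one entry to 1, each derivative has strictly smaller
  support by \<open>support_D\<close>. If that derivative satisfies \<open>Q\<close> again, it must
  be zero.\<close>

lemma minimal_support:
  fixes w :: "nat \<Rightarrow> 'k::zero" and n :: nat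
  assumes "Q w" "\<exists>j<n. w j \<noteq> 0"
  obtains v where "Q v" "\<exists>j<n. v j \<noteq> 0" "card {j. j < n \<and> v j \<noteq> 0} \<le> card {j. j < n \<and> w j \<noteq> 0}"
    "\<And>v'. Q v' \<Longrightarrow> {j. j < n \<and> v' j \<noteq> 0} \<subset> {j. j < n \<and> v j \<noteq> 0} \<Longrightarrow> \<forall>j<n. v' j = 0"
proof -
  let ?R = "\<lambda>v. Q v \<and> (\<exists>j<n. v j \<noteq> 0)" and ?s = "\<lambda>v. card {j. j < n \<and> v j \<noteq> 0}"
  define v where "v = arg_min ?s ?R"
  have v: "?R v" "?s v \<le> ?s w" and min: "\<And>v'. ?R v' \<Longrightarrow> ?s v \<le> ?s v'"
    using arg_min_natI[of ?R w ?s] arg_min_nat_le[of ?R _ ?s] assms unfolding v_def by auto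
  have "\<forall>j<n. v' j = 0" if "Q v'" "{j. j < n \<and> v' j \<noteq> 0} \<subset> {j. j < n \<and> v j \<noteq> 0}" for v'
  proof (rule ccontr)
    assume "\<not> (\<forall>j<n. v' j = 0)"
    then have "?s v \<le> ?s v'" using min that(1) by blast
    moreover have "?s v' < ?s v" by (rule psubset_card_mono[OF _ that(2)]) simp
    ultimately show False by simp
  qed
  then show ?thesis using that v by blast
qed

section \<open>Isotropy over the function field\<close>

context qform
begin

lemmas L0c = csub_intros[OF sfld_csub[OF sfld_L0]]

lemma mu_add: "mu e n (\<lambda>j. v j + w j) = mu e n v + mu e n w"
  and mu_scale: "mu e n (\<lambda>j. c * w j) = c * mu e n w"
  by (simp_all add: mu_def distrib_left sum.distrib sum_distrib_left mult.left_commute)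

lemma mu_sum: "mu e n (\<lambda>j. \<Sum>l\<in>A. w l j) = (\<Sum>l\<in>A. mu e n (w l))"
  unfolding mu_def sum_distrib_left by (rule sum.swap)

text \<open>The product rule adds only a multiple of \<open>mu e n w = 0\<close>. On relations the
  map sending w to \<open>mu (D i w)\<close> is thus linear over \<open>L0\<close>, although
  \<open>D i\<close> is not.\<close>

lemma mu_D_scale:
  assumes "c \<in> L0" "\<And>j. j < n \<Longrightarrow> w j \<in> L0" "mu e n w = 0"
  shows "mu e n (\<lambda>j. D i (c * w j)) = c * mu e n (\<lambda>j. D i (w j))"
proof -
  have "mu e n (\<lambda>j. D i (c * w j)) = mu e n (\<lambda>j. D i c * w j + c * D i (w j))"
    unfolding mu_def by (rule sum.cong) (use assms in \<open>auto simp: D_rules(3)\<close>)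
  then show ?thesis using assms(3) by (simp add: mu_add mu_scale)
qed

lemma support_D:
  assumes "\<And>j. j < n \<Longrightarrow> w j \<in> L0" "j0 < n" "w j0 = 1"
  shows "{j. j < n \<and> D i (w j) \<noteq> 0} \<subset> {j. j < n \<and> w j \<noteq> 0}"
proof -
  have "D i (w j0) = 0" using assms(3) by (simp add: D_rules(5))
  moreover have "D i (w j) = 0" if "w j = 0" for j using that by (simp add: D_rules(4))
  ultimately have "{j. j < n \<and> D i (w j) \<noteq> 0} \<subseteq> {j. j < n \<and> w j \<noteq> 0}"
      "j0 \<in> {j. j < n \<and> w j \<noteq> 0}" "j0 \<notin> {j. j < n \<and> D i (w j) \<noteq> 0}"
    using assms(2,3) by auto
  then show ?thesis by blast
qed

lemma L0_span_k0S: "z \<in> L0 \<Longrightarrow> z \<in> lspan (k0S p) p (\<lambda>t. xi 0 ^ t)"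
proof -
  assume "z \<in> L0"
  then obtain f g where fg: "f \<in> PN" "g \<in> PN" "th g \<noteq> 0" "z = th f / th g" by (rule L0E)
  note kc = csub_intros[OF sfld_csub[OF sfld_k0S]]
  have sp: "\<exists>c. th h = (\<Sum>t<p. tw p (c t) * xi 0 ^ t)" if h: "h \<in> PN" for h
  proof -
    obtain q c where qc: "q \<in> PN" "\<And>t. t < p \<Longrightarrow> c t \<in> pvset {1..<N}" "h = q * Phi + (\<Sum>t<p. c t * pvar 0 ^ t)"
      using normal_form[OF h] by blast
    have "th h = (\<Sum>t<p. th (c t) * xi 0 ^ t)"
      unfolding qc(3) by (simp add: rhom_simps[OF rhom_th] th_Phi th_pvar)
    also have "\<dots> = (\<Sum>t<p. tw p (c t) * xi 0 ^ t)"
      using qc(2) by (intro sum.cong) (auto simp: th_pvset)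
    finally show ?thesis by blast
  qed
  obtain d where d: "th g = (\<Sum>t<p. tw p (d t) * xi 0 ^ t)" using sp[OF fg(2)] by blast
  have "th g ^ p = (\<Sum>t<p. (tw p (d t) * xi 0 ^ t) ^ p)"
    unfolding d by (rule rhom_sum[OF rhom_frob[OF prime_p char_K]])
  also have "\<dots> = (\<Sum>t<p. tw p (d t) ^ p * (xi 0 ^ p) ^ t)"
    by (simp add: power_mult_distrib mult.commute flip: power_mult)
  also have "\<dots> \<in> k0S p"
    unfolding xi0_pow by (intro kc(5,7,9) tw_in_k0S)
  finally have gp: "th g ^ p \<in> k0S p" .
  have "f * g ^ (p - 1) \<in> PN" using fg by (intro PR_intros)
  then obtain c where c: "th (f * g ^ (p - 1)) = (\<Sum>t<p. tw p (c t) * xi 0 ^ t)" using sp by blast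
  have "th g ^ p = th g * th g ^ (p - 1)" using p_pos by (simp flip: power_Suc)
  then have "z = inverse (th g ^ p) * th (f * g ^ (p - 1))"
    using fg(3) unfolding fg(4) by (simp add: rhom_mult[OF rhom_th] rhom_power[OF rhom_th] field_simps)
  moreover have "th (f * g ^ (p - 1)) \<in> lspan (k0S p) p (\<lambda>t. xi 0 ^ t)"
    unfolding c by (intro lspanI tw_in_k0S)
  ultimately show ?thesis
    using lsub_lspan[OF sfld_k0S, of p "\<lambda>t. xi 0 ^ t"] sfld_inverse[OF sfld_k0S gp] by (simp add: lsub_def)
qed

text \<open>Hoffmann's bound: the stabiliser \<open>\<Lambda>\<close> of the \<open>L0\<close>-span \<open>U\<close> of the coefficients is a field
  of degree \<open>p ^ e\<close> over \<open>L0\<close>, so \<open>p ^ e\<close> divides the dimension \<open>u\<close> of \<open>U\<close>.  By \<open>mu_D\<close>, it contains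
  \<open>mu (D w)\<close> for every relation \<open>w\<close> between the coefficients.  If this map is injective on
  relations then \<open>N \<le> u + p ^ e\<close>; otherwise a second derivative moves \<open>U\<close> into \<open>\<Lambda>\<close>, whence
  \<open>u = p ^ e\<close> and \<open>N \<le> p * u\<close>.\<close>

lemma hoffmann_bound:
  assumes N: "p ^ n < N" and k: "k < p ^ n"
  shows "\<not> (\<forall>i<N. emb (r i) \<in> lspan L0 k b)"
proof
  assume sp: "\<forall>i<N. emb (r i) \<in> lspan L0 k b"
  define \<rho> where "\<rho> i = emb (r i)" for i
  define U where "U = lspan L0 N \<rho>"
  have \<rho>U: "\<rho> i \<in> U" if "i < N" for i unfolding U_def by (rule lspan_base[OF sfld_L0 that])
  have lU: "lsub L0 U" unfolding U_def by (rule lsub_lspan[OF sfld_L0])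
  have oneU: "1 \<in> U" using \<rho>U[of 0] N2 by (simp add: \<rho>_def r0 rhom_1[OF rhom_emb])
  have "U \<subseteq> lspan L0 k b"
    unfolding U_def using sp by (intro lspan_subset[OF lsub_lspan[OF sfld_L0]]) (simp add: \<rho>_def)
  then obtain u bU where u: "lbasis L0 u bU U" "u \<le> k"
    using lbasis_exists[OF sfld_L0 lU] by blast
  have Up: "x ^ p \<in> L0" if x: "x \<in> U" for x
  proof -
    obtain c where c: "\<forall>i<N. c i \<in> L0" "x = (\<Sum>i<N. c i * \<rho> i)" using x unfolding U_def lspan_iff by blast
    have "x ^ p = (\<Sum>i<N. (c i * \<rho> i) ^ p)"
      unfolding c(2) by (rule rhom_sum[OF rhom_frob[OF prime_p char_K]])
    also have "\<dots> = (\<Sum>i<N. c i ^ p * emb (r i ^ p))" by (simp add: power_mult_distrib \<rho>_def rhom_power[OF rhom_emb])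
    also have "\<dots> \<in> L0" using c(1) by (intro L0c(5,7,9) emb_pow_L0) auto
    finally show ?thesis .
  qed
  define \<Lambda> where "\<Lambda> = {z. \<forall>x\<in>U. z * x \<in> U}"
  have \<Lambda>U: "\<Lambda> \<subseteq> U" using oneU unfolding \<Lambda>_def by force
  have L\<Lambda>: "L0 \<subseteq> \<Lambda>" using lU unfolding \<Lambda>_def lsub_def by blast
  have csub\<Lambda>: "csub \<Lambda>"
  proof -
    have neg: "- x \<in> U" if "x \<in> U" for x
      using lU that L0c(6)[OF L0c(2)] unfolding lsub_def by (metis mult_minus1)
    have a1: "z - y \<in> \<Lambda>" if "z \<in> \<Lambda>" "y \<in> \<Lambda>" for z y
      unfolding \<Lambda>_def
    proof (intro CollectI ballI)
      fix x assume "x \<in> U"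
      then have "z * x \<in> U" "- (y * x) \<in> U" using that neg unfolding \<Lambda>_def by auto
      then have "z * x + - (y * x) \<in> U" using lU unfolding lsub_def by blast
      then show "(z - y) * x \<in> U" by (simp add: algebra_simps)
    qed
    have a2: "z + y \<in> \<Lambda>" if "z \<in> \<Lambda>" "y \<in> \<Lambda>" for z y
      using that lU unfolding \<Lambda>_def lsub_def by (simp add: distrib_right)
    have a3: "z * y \<in> \<Lambda>" if "z \<in> \<Lambda>" "y \<in> \<Lambda>" for z y
      using that unfolding \<Lambda>_def by (simp add: mult.assoc)
    show ?thesis unfolding csub_def
      by (intro conjI ballI a1 a2 a3 subsetD[OF L\<Lambda> L0c(1)] subsetD[OF L\<Lambda> L0c(2)])
  qed
  have sfld\<Lambda>: "sfld \<Lambda>"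
    unfolding sfld_def
  proof (intro conjI ballI csub\<Lambda>)
    fix z assume z: "z \<in> \<Lambda>"
    \<comment> \<open>As z^p lies in \<open>L0\<close>, inverses in \<open>\<Lambda>\<close> are
      obtained from powers.\<close>
    have "inverse z = inverse (z ^ p) * z ^ (p - 1)"
    proof (cases "z = 0")
      case True
      then show ?thesis using p_pos by (simp add: power_0_left)
    next
      case False
      have "z ^ p = z * z ^ (p - 1)" using p_pos by (simp flip: power_Suc)
      then show ?thesis using False by simp
    qed
    moreover have "inverse (z ^ p) \<in> \<Lambda>" using Up z \<Lambda>U L\<Lambda> sfld_inverse[OF sfld_L0] by blast
    ultimately show "inverse z \<in> \<Lambda>" using csubD(5)[OF csub\<Lambda>] csub_power[OF csub\<Lambda> z] by simp
  qed
  obtain m b\<Lambda> where m: "lbasis L0 m b\<Lambda> \<Lambda>"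
    using lbasis_exists[OF sfld_L0 lsub_sfld[OF sfld\<Lambda> L\<Lambda>]] \<Lambda>U u(1) unfolding lbasis_def by blast
  obtain e where e: "m = p ^ e"
    using purely_inseparable_degree[OF prime_p char_K sfld\<Lambda> sfld_L0 L\<Lambda> _ m] Up \<Lambda>U by blast
  have lU\<Lambda>: "lsub \<Lambda> U" using lU unfolding lsub_def \<Lambda>_def by blast
  have "U \<subseteq> lspan \<Lambda> u bU"
    using u(1) L\<Lambda> unfolding lbasis_def lspan_def by blast
  then obtain q bq where q: "lbasis \<Lambda> q bq U" using lbasis_exists[OF sfld\<Lambda> lU\<Lambda>] by blast
  from lbasis_tower[OF sfld_L0 sfld\<Lambda> m q]
  have upq: "u = p ^ e * q" using lbasis_unique[OF sfld_L0 u(1)] e by blast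
  have "u \<noteq> 0"
  proof
    assume "u = 0"
    then have "U = {0}" using u(1) by (auto simp: lbasis_def lspan_def)
    then show False using oneU by simp
  qed
  then have q0: "q > 0" using upq by simp
  have "p ^ e \<le> u" using upq q0 by simp
  then have "p ^ e < p ^ n" using u(2) k by linarith
  then have en: "e < n" using power_less_imp_less_exp[OF prime_gt_1_nat[OF prime_p]] by blast
  have rel\<Lambda>: "mu r N (\<lambda>j. D 0 (w j)) \<in> \<Lambda>" if w: "\<And>j. j < N \<Longrightarrow> w j \<in> L0" "mu r N w = 0" for w
  proof -
    let ?c = "mu r N (\<lambda>j. D 0 (w j))"
    have "?c * \<rho> i \<in> U" if i: "i < N" for i
    proof -
      have "?c * \<rho> i = mu r N (\<lambda>j. D i (w j))" using mu_D[of N w r i, OF w i] by (simp add: \<rho>_def mult.commute)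
      also have "\<dots> = (\<Sum>j<N. D i (w j) * \<rho> j)" by (simp add: mu_def \<rho>_def mult.commute)
      also have "\<dots> \<in> U" unfolding U_def using w(1) by (intro lspanI D_rules(1)) auto
      finally show ?thesis .
    qed
    moreover have "lsub L0 {x. ?c * x \<in> U}"
      using lU unfolding lsub_def by (simp add: distrib_left mult.left_commute)
    ultimately have "U \<subseteq> {x. ?c * x \<in> U}" unfolding U_def by (intro lspan_subset) auto
    then show ?thesis unfolding \<Lambda>_def by blast
  qed
  \<comment> \<open>The kernel of the map sending a relation w to \<open>mu (D 0 w)\<close>.\<close>
  define J where "J w \<longleftrightarrow> (\<forall>j<N. w j \<in> L0) \<and> mu r N w = 0 \<and> mu r N (\<lambda>j. D 0 (w j)) = 0" for w
  show False
  proof (cases "\<exists>w. J w \<and> (\<exists>j<N. w j \<noteq> 0)")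
    case False
    \<comment> \<open>Each \<open>\<rho> l\<close> that depends on earlier ones gives a relation
      whose last nonzero entry is a 1 at \<open>l\<close>; the other \<open>\<rho> l\<close> are
      independent. If the map is injective there are at most m of the former, and at most u of the
      latter.\<close>
    define S where "S = {l. l < N \<and> \<rho> l \<in> lspan L0 l \<rho>}"
    have finS: "finite S" by (simp add: S_def)
    have "\<exists>w. (\<forall>j<N. w j \<in> L0) \<and> mu r N w = 0 \<and> w l = 1 \<and> (\<forall>j<N. l < j \<longrightarrow> w j = 0)" if l: "l \<in> S" for l
    proof -
      obtain c where c: "\<forall>i<l. c i \<in> L0" "\<rho> l = (\<Sum>i<l. c i * \<rho> i)" using l unfolding S_def lspan_iff by blast
      define w where "w j = (if j < l then - c j else if j = l then 1 else 0)" for j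
      have lN: "l < N" using l by (simp add: S_def)
      have "mu r N w = (\<Sum>j\<in>{..<Suc l}. \<rho> j * w j)"
        unfolding mu_def \<rho>_def by (rule sum.mono_neutral_right) (use lN in \<open>auto simp: w_def\<close>)
      also have "\<dots> = (\<Sum>j<l. \<rho> j * - c j) + \<rho> l" by (simp add: w_def)
      also have "\<dots> = 0" unfolding c(2) by (simp add: sum_negf mult.commute)
      finally have "mu r N w = 0" .
      moreover have "\<forall>j<N. w j \<in> L0" using c(1) L0c by (auto simp: w_def)
      ultimately show ?thesis by (intro exI[of _ w]) (simp add: w_def)
    qed
    then obtain W where W: "\<And>l. l \<in> S \<Longrightarrow> (\<forall>j<N. W l j \<in> L0) \<and> mu r N (W l) = 0 \<and> W l l = 1 \<and> (\<forall>j<N. l < j \<longrightarrow> W l j = 0)"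
      by metis
    obtain h where h: "bij_betw h {..<card S} S" using ex_bij_betw_nat_finite[OF finS] by (auto simp: lessThan_atLeast0)
    have hS: "h i \<in> S" if "i < card S" for i using h that by (auto simp: bij_betw_def)
    have "lindep L0 (card S) (\<lambda>i. mu r N (\<lambda>j. D 0 (W (h i) j)))"
      unfolding lindep_def
    proof (intro allI impI)
      fix c i assume c: "\<forall>i<card S. c i \<in> L0" "(\<Sum>i<card S. c i * mu r N (\<lambda>j. D 0 (W (h i) j))) = 0" and i: "i < card S"
      define w where "w j = (\<Sum>i<card S. c i * W (h i) j)" for j
      have wL: "w j \<in> L0" if "j < N" for j unfolding w_def using c(1) W hS that by (intro L0c(7,5)) auto
      have "mu r N w = (\<Sum>i<card S. c i * mu r N (W (h i)))" unfolding w_def mu_sum mu_scale ..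
      then have "mu r N w = 0" using W hS by simp
      moreover have "mu r N (\<lambda>j. D 0 (w j)) = (\<Sum>i<card S. mu r N (\<lambda>j. D 0 (c i * W (h i) j)))"
      proof -
        have "D 0 (w j) = (\<Sum>i<card S. D 0 (c i * W (h i) j))" if "j < N" for j
          unfolding w_def using c(1) W hS that by (intro D_rules(6) L0c(5)) auto
        then show ?thesis unfolding mu_sum[symmetric] by (auto simp: mu_def intro!: sum.cong)
      qed
      moreover have "\<dots> = (\<Sum>i<card S. c i * mu r N (\<lambda>j. D 0 (W (h i) j)))"
        using c(1) W hS by (intro sum.cong mu_D_scale) auto
      ultimately have "J w" using wL c(2) by (simp add: J_def)
      then have w0: "w j = 0" if "j < N" for j using False that by blast
      show "c i = 0"
      proof (rule ccontr)
        assume "c i \<noteq> 0"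
        \<comment> \<open>At the largest index with a nonzero coefficient only one of the relations
          contributes, so \<open>w\<close> cannot vanish there.\<close>
        define T where "T = {h i | i. i < card S \<and> c i \<noteq> 0}"
        have T: "finite T" "T \<noteq> {}" using i \<open>c i \<noteq> 0\<close> by (auto simp: T_def)
        then have "Max T \<in> T" by (rule Max_in)
        then obtain i0 where i0: "i0 < card S" "c i0 \<noteq> 0" "Max T = h i0" by (auto simp: T_def)
        have hN: "h i0 < N" using hS[OF i0(1)] by (simp add: S_def)
        have "w (h i0) = (\<Sum>i<card S. if i = i0 then c i0 else 0)"
          unfolding w_def
        proof (rule sum.cong[OF refl])
          fix i assume i: "i \<in> {..<card S}"
          show "c i * W (h i) (h i0) = (if i = i0 then c i0 else 0)"
          proof (cases "i = i0")
            case True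
            then show ?thesis using W[OF hS[OF i0(1)]] by simp
          next
            case ne: False
            show ?thesis
            proof (cases "c i = 0")
              case nz: False
              then have "h i \<in> T" using i by (auto simp: T_def)
              then have "h i \<le> h i0" using Max_ge[OF T(1)] i0(3) by metis
              moreover have "h i \<noteq> h i0" using ne i i0(1) h by (auto simp: bij_betw_def inj_on_def)
              ultimately have "W (h i) (h i0) = 0" using W[OF hS, of i] i hN by auto
              then show ?thesis using ne by simp
            qed (use ne in simp)
          qed
        qed
        then have "w (h i0) = c i0" using i0(1) by simp
        then show False using w0[OF hN] i0(2) by simp
      qed
    qed
    then have Sm: "card S \<le> m"
      by (rule lindep_le[OF sfld_L0, where u = b\<Lambda>]) (use m rel\<Lambda> W hS in \<open>auto simp: lbasis_def\<close>)
    define S' where "S' = {..<N} - S"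
    have finS': "finite S'" by (simp add: S'_def)
    obtain h' where h': "bij_betw h' {..<card S'} S'" using ex_bij_betw_nat_finite[OF finS'] by (auto simp: lessThan_atLeast0)
    have hS': "h' i \<in> S'" if "i < card S'" for i using h' that by (auto simp: bij_betw_def)
    have "lindep L0 (card S') (\<lambda>i. \<rho> (h' i))"
      unfolding lindep_def
    proof (intro allI impI)
      fix c i assume c: "\<forall>i<card S'. c i \<in> L0" "(\<Sum>i<card S'. c i * \<rho> (h' i)) = 0" and i: "i < card S'"
      show "c i = 0"
      proof (rule ccontr)
        assume "c i \<noteq> 0"
        define T where "T = {h' i | i. i < card S' \<and> c i \<noteq> 0}"
        have T: "finite T" "T \<noteq> {}" using i \<open>c i \<noteq> 0\<close> by (auto simp: T_def)
        then have "Max T \<in> T" by (rule Max_in)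
        then obtain i0 where i0: "i0 < card S'" "c i0 \<noteq> 0" "Max T = h' i0" by (auto simp: T_def)
        define V where "V = lspan L0 (h' i0) \<rho>"
        have lV: "lsub L0 V" unfolding V_def by (rule lsub_lspan[OF sfld_L0])
        have "c i * \<rho> (h' i) \<in> V" if i: "i \<in> {..<card S'} - {i0}" for i
        proof (cases "c i = 0")
          case True
          then show ?thesis using lV by (simp add: lsub_def)
        next
          case nz: False
          then have "h' i \<in> T" using i by (auto simp: T_def)
          then have "h' i \<le> h' i0" using Max_ge[OF T(1)] i0(3) by metis
          moreover have "h' i \<noteq> h' i0" using i i0(1) h' by (auto simp: bij_betw_def inj_on_def)
          ultimately have "\<rho> (h' i) \<in> V" unfolding V_def by (intro lspan_base[OF sfld_L0]) simp
          then show ?thesis using lV c(1) i unfolding lsub_def by auto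
        qed
        then have "(\<Sum>i\<in>{..<card S'} - {i0}. c i * \<rho> (h' i)) \<in> V" by (rule lsub_sum[OF lV])
        moreover have "c i0 * \<rho> (h' i0) + (\<Sum>i\<in>{..<card S'} - {i0}. c i * \<rho> (h' i)) = 0"
          using c(2) i0(1) by (simp add: sum.remove)
        then have "\<rho> (h' i0) = (- inverse (c i0)) * (\<Sum>i\<in>{..<card S'} - {i0}. c i * \<rho> (h' i))"
          using i0(2) by (simp add: field_simps eq_neg_iff_add_eq_0)
        moreover have "- inverse (c i0) \<in> L0" using c(1) i0(1) sfld_inverse[OF sfld_L0] L0c(6) by blast
        moreover have "c * x \<in> V" if "c \<in> L0" "x \<in> V" for c x using lV that by (simp add: lsub_def)
        ultimately have "\<rho> (h' i0) \<in> V" by (simp only:)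
        then show False using hS'[OF i0(1)] unfolding V_def S_def S'_def by blast
      qed
    qed
    then have "card S' \<le> u"
      by (rule lindep_le[OF sfld_L0, where u = bU]) (use u(1) \<rho>U hS' in \<open>auto simp: lbasis_def S'_def\<close>)
    moreover have "card S' = N - card S" unfolding S'_def by (subst card_Diff_subset) (auto simp: S_def)
    ultimately have "N \<le> p ^ e * (q + 1)" using Sm upq e by simp
    \<comment> \<open>The dimension u is a multiple of p^e below p^n, so that one further p^e does
      not exceed p^n.\<close>
    also have "\<dots> \<le> p ^ e * p ^ (n - e)"
    proof -
      have "p ^ e * q < p ^ e * p ^ (n - e)" using en upq u(2) k by (simp flip: power_add)
      then show ?thesis by (intro mult_le_mono2) simp
    qed
    also have "\<dots> = p ^ n" using en by (simp flip: power_add)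
    finally show False using N by simp
  next
    case True
    then obtain w' where w': "J w'" "\<exists>j<N. w' j \<noteq> 0" by blast
    obtain w where w: "J w" "\<exists>j<N. w j \<noteq> 0"
      "card {j. j < N \<and> w j \<noteq> 0} \<le> card {j. j < N \<and> w' j \<noteq> 0}"
      and min: "\<And>v'. J v' \<Longrightarrow> {j. j < N \<and> v' j \<noteq> 0} \<subset> {j. j < N \<and> w j \<noteq> 0} \<Longrightarrow> \<forall>j<N. v' j = 0"
      using minimal_support[of J w' N, OF w'] by blast
    obtain j0 where j0: "j0 < N" "w j0 \<noteq> 0" using w(2) by blast
    define v where "v j = inverse (w j0) * w j" for j
    have iL: "inverse (w j0) \<in> L0" using w(1) j0 sfld_inverse[OF sfld_L0] by (auto simp: J_def)
    have wL: "\<And>j. j < N \<Longrightarrow> w j \<in> L0" and muw: "mu r N w = 0" using w(1) by (auto simp: J_def)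
    have vL: "\<And>j. j < N \<Longrightarrow> v j \<in> L0" unfolding v_def using iL wL by (intro L0c(5))
    have muv: "mu r N v = 0" unfolding v_def mu_scale muw by simp
    have muDv: "mu r N (\<lambda>j. D 0 (v j)) = 0"
      unfolding v_def using mu_D_scale[of _ N w r 0, OF iL wL muw] w(1) by (simp add: J_def)
    have vj0: "v j0 = 1" using j0 by (simp add: v_def)
    have supp: "{j. j < N \<and> v j \<noteq> 0} = {j. j < N \<and> w j \<noteq> 0}" using j0 by (auto simp: v_def)
    have DvL: "\<And>j. j < N \<Longrightarrow> D i (v j) \<in> L0" for i using vL by (intro D_rules(1))
    \<comment> \<open>Since \<open>mu (D 0 v) = 0\<close>, the derivative \<open>D 0 v\<close> is
      again a relation, of smaller support. Were \<open>g\<close> zero, it would lie in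
      \<open>J\<close> and vanish by minimality, and then \<open>v = 0\<close> by
      \<open>constants_indep\<close>.\<close>
    define g where "g = mu r N (\<lambda>j. D 0 (D 0 (v j)))"
    have g0: "g \<noteq> 0"
    proof
      assume "g = 0"
      then have "J (\<lambda>j. D 0 (v j))" using DvL muDv by (simp add: J_def g_def)
      from min[OF this] have "\<forall>j<N. D 0 (v j) = 0" using support_D[of N v j0 0, OF vL j0(1) vj0] supp by simp
      then have "v j0 = 0" using constants_indep[of N r v j0, OF r_indep vL _ muv j0(1)] by blast
      then show False using vj0 by simp
    qed
    \<comment> \<open>All \<open>D i v\<close> are relations too. Derivations commute, so
      \<open>D 0\<close> of \<open>D i v\<close> is \<open>D i\<close> of \<open>D 0 v\<close>: the
      first reading puts the value of \<open>mu\<close> in \<open>\<Lambda>\<close>, the second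
      identifies it as \<open>r i * g\<close>.\<close>
    have gr: "g * \<rho> i \<in> \<Lambda>" if i: "i < N" for i
    proof -
      have "mu r N (\<lambda>j. D i (v j)) = 0" using mu_D[of N v r i, OF vL muv i] muDv by simp
      from rel\<Lambda>[of "\<lambda>j. D i (v j)", OF DvL this] have "mu r N (\<lambda>j. D 0 (D i (v j))) \<in> \<Lambda>" .
      moreover have "mu r N (\<lambda>j. D 0 (D i (v j))) = mu r N (\<lambda>j. D i (D 0 (v j)))"
        unfolding mu_def by (rule sum.cong) (use vL D_commute in auto)
      moreover have "\<dots> = emb (r i) * g" using mu_D[of N "\<lambda>j. D 0 (v j)" r i, OF DvL muDv i] by (simp add: g_def)
      ultimately show ?thesis by (simp add: \<rho>_def mult.commute)
    qed
    have "lsub L0 {x. g * x \<in> \<Lambda>}"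
      using lsub_sfld[OF sfld\<Lambda> L\<Lambda>] unfolding lsub_def by (simp add: distrib_left mult.left_commute)
    then have "U \<subseteq> {x. g * x \<in> \<Lambda>}" unfolding U_def using gr by (intro lspan_subset) auto
    then have "u \<le> m" using lbasis_scaled_le[OF sfld_L0 u(1) m g0] by blast
    then have up: "u = p ^ e" using upq q0 e p_pos by auto
    \<comment> \<open>Now count over F^p(S): there \<open>L0\<close> lies in the span of p elements
      and so \<open>U\<close> in that of p * u, whereas the N elements \<open>\<rho> i\<close> are
      independent.\<close>
    have "lindep (k0S p) N \<rho>"
      unfolding lindep_def \<rho>_def using k0S_indep[OF r_indep] by (simp add: mult.commute)
    moreover have "\<rho> i \<in> lspan (k0S p) (p * u) (\<lambda>k. xi 0 ^ (k mod p) * bU (k div p))" if i: "i < N" for i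
    proof -
      obtain c where c: "\<forall>j<u. c j \<in> L0" "\<rho> i = (\<Sum>j<u. c j * bU j)"
        using \<rho>U[OF i] u(1) unfolding lbasis_def lspan_def by blast
      have "\<exists>d. (\<forall>t<p. d t \<in> k0S p) \<and> c j = (\<Sum>t<p. d t * xi 0 ^ t)" if "j < u" for j
        using L0_span_k0S c(1) that unfolding lspan_iff by blast
      then obtain d where d: "\<And>j. j < u \<Longrightarrow> (\<forall>t<p. d j t \<in> k0S p) \<and> c j = (\<Sum>t<p. d j t * xi 0 ^ t)" by metis
      have "(\<Sum>k<p * u. d (k div p) (k mod p) * (xi 0 ^ (k mod p) * bU (k div p))) =
          (\<Sum>j<u. (\<Sum>t<p. d j t * xi 0 ^ t) * bU j)"
        unfolding sum_lessThan_mult sum_distrib_right by (intro sum.cong) (auto simp: mult.assoc)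
      also have "\<dots> = \<rho> i" unfolding c(2) using d by (intro sum.cong) auto
      finally have eq: "\<rho> i = (\<Sum>k<p * u. d (k div p) (k mod p) * (xi 0 ^ (k mod p) * bU (k div p)))" ..
      show ?thesis unfolding eq
        using d p_pos by (intro lspanI) (simp add: less_mult_imp_div_less mult.commute)
    qed
    ultimately have "N \<le> p * u" by (rule lindep_le[OF sfld_k0S])
    then have "p ^ n < p ^ Suc e" using N up by simp
    then have "n < Suc e" using power_less_imp_less_exp[OF prime_gt_1_nat[OF prime_p]] by blast
    then show False using en by simp
  qed
qed

text \<open>For a relation of minimal support with one entry scaled to 1, \<open>mu_D\<close> writes
  each \<open>r i\<close> as an \<open>L0\<close>-combination of the \<open>e j / c\<close> with j
  in the rest of the support, and by \<open>hoffmann_bound\<close> that rest has at least p^n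
  members. So the minimal supports are already everything, and hence every nonzero relation is
  minimal.\<close>

lemma relation_full_support:
  assumes N: "p ^ n < N" and M: "M \<le> p ^ n + 1" and e: "frob_indep p M e"
    and w: "\<And>j. j < M \<Longrightarrow> w j \<in> L0" "mu e M w = 0" "\<exists>j<M. w j \<noteq> 0"
  shows "\<forall>j<M. w j \<noteq> 0" and "mu e M (\<lambda>j. D 0 (w j)) \<noteq> 0"
proof -
  define Q where "Q w \<longleftrightarrow> (\<forall>j<M. w j \<in> L0) \<and> mu e M w = 0" for w
  have key: "mu e M (\<lambda>j. D 0 (v j)) \<noteq> 0 \<and> M \<le> card {j. j < M \<and> v j \<noteq> 0}"
    if v: "Q v" "j0 < M" "v j0 = 1"
      and min: "\<And>v'. Q v' \<Longrightarrow> {j. j < M \<and> v' j \<noteq> 0} \<subset> {j. j < M \<and> v j \<noteq> 0} \<Longrightarrow> \<forall>j<M. v' j = 0"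
    for v j0
  proof -
    define c where "c = mu e M (\<lambda>j. D 0 (v j))"
    have vL: "\<And>j. j < M \<Longrightarrow> v j \<in> L0" and muv: "mu e M v = 0" using v(1) by (auto simp: Q_def)
    have c0: "c \<noteq> 0"
    proof
      assume "c = 0"
      then have "Q (\<lambda>j. D 0 (v j))" using vL by (simp add: Q_def c_def D_rules(1))
      from min[OF this support_D[of M v j0 0, OF vL v(2,3)]] have "v j0 = 0"
        using constants_indep[of M e v j0, OF e vL _ muv v(2)] by blast
      then show False using v(3) by simp
    qed
    \<comment> \<open>The position \<open>j0\<close> drops out of all derivatives because
      \<open>v j0 = 1\<close>.\<close>
    define T where "T = {j. j < M \<and> v j \<noteq> 0} - {j0}"
    have finT: "finite T" by (simp add: T_def)
    have TM: "T \<subseteq> {..<M}" by (auto simp: T_def)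
    obtain h where h: "bij_betw h {..<card T} T" using ex_bij_betw_nat_finite[OF finT] by (auto simp: lessThan_atLeast0)
    have hT: "h i \<in> T" if "i < card T" for i using h that by (auto simp: bij_betw_def)
    have "emb (r i) \<in> lspan L0 (card T) (\<lambda>l. emb (e (h l)) / c)" if i: "i < N" for i
    proof -
      have "emb (r i) * c = mu e M (\<lambda>j. D i (v j))" using mu_D[of M v e i, OF vL muv i] by (simp add: c_def)
      also have "\<dots> = (\<Sum>j\<in>T. emb (e j) * D i (v j))"
        unfolding mu_def using support_D[of M v j0 i, OF vL v(2,3)] v(3)
        by (intro sum.mono_neutral_right) (auto simp: T_def D_rules(4,5))
      also have "\<dots> = (\<Sum>l<card T. emb (e (h l)) * D i (v (h l)))"
        by (rule sum.reindex_bij_betw[OF h, symmetric])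
      finally have "emb (r i) * c / c = (\<Sum>l<card T. D i (v (h l)) * (emb (e (h l)) / c))"
        by (simp add: sum_divide_distrib mult.commute)
      then have eq: "emb (r i) = (\<Sum>l<card T. D i (v (h l)) * (emb (e (h l)) / c))" using c0 by simp
      show ?thesis unfolding eq using hT TM vL by (intro lspanI D_rules(1)) auto
    qed
    then have "\<not> card T < p ^ n" using hoffmann_bound[OF N] by blast
    moreover have "card T = card {j. j < M \<and> v j \<noteq> 0} - 1" unfolding T_def using v(2,3) by simp
    moreover have "card {j. j < M \<and> v j \<noteq> 0} \<noteq> 0" using v(2,3) by (auto simp: card_eq_0_iff)
    ultimately have "M \<le> card {j. j < M \<and> v j \<noteq> 0}" using M by linarith
    then show ?thesis using c0 by (simp add: c_def)
  qed
  have scale: "Q (\<lambda>j. c * v j)" if "Q v" "c \<in> L0" for v c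
    using that by (auto simp: Q_def mu_scale intro: L0c)
  have Qw: "Q w" using w by (simp add: Q_def)
  obtain v where v: "Q v" "\<exists>j<M. v j \<noteq> 0" "card {j. j < M \<and> v j \<noteq> 0} \<le> card {j. j < M \<and> w j \<noteq> 0}"
    and min: "\<And>v'. Q v' \<Longrightarrow> {j. j < M \<and> v' j \<noteq> 0} \<subset> {j. j < M \<and> v j \<noteq> 0} \<Longrightarrow> \<forall>j<M. v' j = 0"
    using minimal_support[of Q w M, OF Qw w(3)] by blast
  have norm: "mu e M (\<lambda>j. D 0 (u j)) \<noteq> 0 \<and> M \<le> card {j. j < M \<and> u j \<noteq> 0}"
    if u: "Q u" "\<exists>j<M. u j \<noteq> 0"
      and min: "\<And>v'. Q v' \<Longrightarrow> {j. j < M \<and> v' j \<noteq> 0} \<subset> {j. j < M \<and> u j \<noteq> 0} \<Longrightarrow> \<forall>j<M. v' j = 0"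
    for u
  proof -
    obtain j0 where j0: "j0 < M" "u j0 \<noteq> 0" using u(2) by blast
    have iL: "inverse (u j0) \<in> L0" using u(1) j0 sfld_inverse[OF sfld_L0] by (auto simp: Q_def)
    let ?u = "\<lambda>j. inverse (u j0) * u j"
    have supp: "{j. j < M \<and> ?u j \<noteq> 0} = {j. j < M \<and> u j \<noteq> 0}" using j0 by auto
    have uL: "\<And>j. j < M \<Longrightarrow> u j \<in> L0" and muu: "mu e M u = 0" using u(1) by (auto simp: Q_def)
    have "mu e M (\<lambda>j. D 0 (?u j)) \<noteq> 0 \<and> M \<le> card {j. j < M \<and> ?u j \<noteq> 0}"
    proof (rule key[OF scale[OF u(1) iL] j0(1)])
      show "inverse (u j0) * u j0 = 1" using j0 by simp
      show "\<forall>j<M. v' j = 0" if "Q v'" "{j. j < M \<and> v' j \<noteq> 0} \<subset> {j. j < M \<and> ?u j \<noteq> 0}" for v'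
        using min[OF that(1)] that(2) unfolding supp by blast
    qed
    moreover have "mu e M (\<lambda>j. D 0 (?u j)) = inverse (u j0) * mu e M (\<lambda>j. D 0 (u j))"
      by (rule mu_D_scale[of _ M u e 0, OF iL uL muu])
    ultimately show ?thesis unfolding supp using j0 by simp
  qed
  have "M \<le> card {j. j < M \<and> w j \<noteq> 0}" using norm[OF v(1,2) min] v(3) by linarith
  moreover have full: "{j. j < M \<and> u j \<noteq> 0} = {..<M}" if "M \<le> card {j. j < M \<and> u j \<noteq> 0}" for u :: "nat \<Rightarrow> 'a mpoly fract"
    by (rule card_seteq) (use that in auto)
  ultimately have sw: "{j. j < M \<and> w j \<noteq> 0} = {..<M}" by blast
  then show "\<forall>j<M. w j \<noteq> 0" by blast
  have "M \<le> card {j. j < M \<and> u j \<noteq> 0}" if u: "Q u" "\<exists>j<M. u j \<noteq> 0" for u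
  proof -
    obtain u' where u': "Q u'" "\<exists>j<M. u' j \<noteq> 0" "card {j. j < M \<and> u' j \<noteq> 0} \<le> card {j. j < M \<and> u j \<noteq> 0}"
      and min': "\<And>v'. Q v' \<Longrightarrow> {j. j < M \<and> v' j \<noteq> 0} \<subset> {j. j < M \<and> u' j \<noteq> 0} \<Longrightarrow> \<forall>j<M. v' j = 0"
      using minimal_support[of Q u M, OF u] by blast
    show ?thesis using norm[OF u'(1,2) min'] u'(3) by linarith
  qed
  note big = this
  have "\<forall>j<M. v' j = 0" if v': "Q v'" "{j. j < M \<and> v' j \<noteq> 0} \<subset> {j. j < M \<and> w j \<noteq> 0}" for v'
  proof (rule ccontr)
    assume "\<not> (\<forall>j<M. v' j = 0)"
    then have "\<exists>j<M. v' j \<noteq> 0" by blast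
    from full[OF big[OF v'(1) this]] show False using v'(2) unfolding sw by blast
  qed
  from norm[OF Qw w(3) this] show "mu e M (\<lambda>j. D 0 (w j)) \<noteq> 0" by blast
qed

text \<open>Subtract the multiple that cancels one entry; the difference lacks full support and is
  therefore zero.\<close>

lemma relation_unique:
  assumes N: "p ^ n < N" and M: "M \<le> p ^ n + 1" and e: "frob_indep p M e"
    and w: "\<And>j. j < M \<Longrightarrow> w j \<in> L0" "mu e M w = 0"
    and v: "\<And>j. j < M \<Longrightarrow> v j \<in> L0" "mu e M v = 0" "\<exists>j<M. v j \<noteq> 0"
  shows "\<exists>c\<in>L0. \<forall>j<M. w j = c * v j"
proof -
  obtain j0 where j0: "j0 < M" "v j0 \<noteq> 0" using v(3) by blast
  define c where "c = w j0 / v j0"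
  have c: "c \<in> L0" unfolding c_def using w v j0 by (intro sfld_divide[OF sfld_L0]) auto
  define u where "u j = w j - c * v j" for j
  have uL: "u j \<in> L0" if "j < M" for j unfolding u_def using w v c that by (intro L0c(4,5)) auto
  have "u = (\<lambda>j. w j + (- c) * v j)" by (rule ext) (simp add: u_def)
  then have "mu e M u = mu e M (\<lambda>j. w j + (- c) * v j)" by simp
  also have "\<dots> = 0" unfolding mu_add mu_scale using w v by simp
  finally have "mu e M u = 0" .
  moreover have "u j0 = 0" using j0 by (simp add: u_def c_def)
  ultimately have "\<forall>j<M. u j = 0" using relation_full_support(1)[of n M e u, OF N M e uL] j0(1) by blast
  then show ?thesis using c by (intro bexI[of _ c]) (auto simp: u_def)
qed

end

section \<open>Inverting rational maps\<close>

lemma rhom_inverse_emb: "emb (inverse x) = inverse (emb x)"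
proof (cases "x = 0")
  case False
  then have "emb x * emb (inverse x) = 1" using rhom_mult[OF rhom_emb, of x "inverse x"] by (simp add: rhom_1[OF rhom_emb])
  then show ?thesis by (metis inverse_unique)
qed (simp add: rhom_0[OF rhom_emb])

text \<open>Counting unknowns, the unit vector at \<open>j0\<close> is a combination of the rows;
  pair it with \<open>f\<close>. The elimination takes place over \<open>L\<close>, while the
  entries of \<open>f\<close> may be anywhere in the big field, as happens in
  \<open>jacobian\<close>.\<close>

lemma full_row_rank:
  assumes L: "sfld L" and u: "\<And>i j. i < n \<Longrightarrow> j < n \<Longrightarrow> u i j \<in> L"
    and rows: "\<And>c. (\<And>i. i < n \<Longrightarrow> c i \<in> L) \<Longrightarrow> (\<And>j. j < n \<Longrightarrow> (\<Sum>i<n. c i * u i j) = 0) \<Longrightarrow> \<forall>i<n. c i = 0"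
    and f: "\<And>i. i < n \<Longrightarrow> (\<Sum>j<n. u i j * f j) = 0" and j0: "j0 < (n::nat)"
  shows "f j0 = 0"
proof -
  \<comment> \<open>The transposed matrix with the unit vector at \<open>j0\<close> as an additional
    column: n equations in n + 1 unknowns.\<close>
  define A where "A j i = (if i = n then (if j = j0 then 1 else 0) else u i j)" for j i
  have "A j i \<in> L" if "j < n" "i < Suc n" for j i
    using that u csubD(1,2)[OF sfld_csub[OF L]] by (auto simp: A_def)
  then obtain c where c: "\<forall>i<Suc n. c i \<in> L" "\<exists>i<Suc n. c i \<noteq> 0" "\<forall>j<n. (\<Sum>i<Suc n. A j i * c i) = 0"
    using underdetermined[OF L, of n "Suc n" A] by blast
  have s: "(\<Sum>i<n. c i * u i j) + (if j = j0 then c n else 0) = 0" if "j < n" for j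
  proof -
    have "(\<Sum>i<Suc n. A j i * c i) = 0" using c(3) that by blast
    then show ?thesis by (auto simp: A_def mult.commute split: if_splits)
  qed
  have cn: "c n \<noteq> 0"
  proof
    assume cn: "c n = 0"
    have "(\<Sum>i<n. c i * u i j) = 0" if "j < n" for j using s[OF that] cn by (auto split: if_splits)
    then have "\<forall>i<n. c i = 0" using rows c(1) by simp
    then show False using c(2) cn by (auto simp: less_Suc_eq)
  qed
  have "0 = (\<Sum>i<n. c i * (\<Sum>j<n. u i j * f j))" using f by simp
  also have "\<dots> = (\<Sum>j<n. (\<Sum>i<n. c i * u i j) * f j)"
    unfolding sum_distrib_left sum_distrib_right by (subst sum.swap) (simp add: mult.assoc)
  also have "\<dots> = (\<Sum>j<n. if j = j0 then - c n * f j0 else 0)"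
  proof (rule sum.cong[OF refl])
    fix j assume "j \<in> {..<n}"
    then have "(\<Sum>i<n. c i * u i j) = - (if j = j0 then c n else 0)"
      using s[of j] by (simp add: eq_neg_iff_add_eq_0)
    then show "(\<Sum>i<n. c i * u i j) * f j = (if j = j0 then - c n * f j0 else 0)" by simp
  qed
  also have "\<dots> = - c n * f j0" using j0 by simp
  finally show ?thesis using cn by simp
qed

lemma euler_identity:
  assumes f: "homogeneous d f" "f \<in> carrier (poly_ring N)"
  shows "(\<Sum>i<N. pvar i * pd i f) = of_nat d * f"
proof -
  have sg: "(\<Sum>i<N. pvar i * pd i (Poly_Mapping.single m c)) = of_nat d * Poly_Mapping.single m c"
    if m: "mono_deg m = d" "Poly_Mapping.keys m \<subseteq> {..<N}" for m and c :: 'a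
  proof -
    have "pvar i * pd i (Poly_Mapping.single m c) = Poly_Mapping.single m (of_nat (Poly_Mapping.lookup m i) * c)" for i
    proof (cases "Poly_Mapping.lookup m i = 0")
      case False
      have "Poly_Mapping.single i 1 + (m - Poly_Mapping.single i 1) = m"
        using False by (intro poly_mapping_eqI) (auto simp: lookup_add lookup_minus lookup_single when_def)
      then show ?thesis by (simp add: pd_single pvar_def mult_single)
    qed (simp add: pd_single)
    then have "(\<Sum>i<N. pvar i * pd i (Poly_Mapping.single m c)) =
        Poly_Mapping.single m (\<Sum>i<N. of_nat (Poly_Mapping.lookup m i) * c)"
      by (induction N) (auto simp: single_add)
    also have "(\<Sum>i<N. of_nat (Poly_Mapping.lookup m i) * c) = of_nat d * c"
      using m mono_deg_superset[of "{..<N}" m] by (simp flip: sum_distrib_right of_nat_sum)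
    also have "Poly_Mapping.single m (of_nat d * c) = of_nat d * Poly_Mapping.single m c"
      using mult_single[of 0 "of_nat d" m c] by simp
    finally show ?thesis .
  qed
  let ?s = "\<lambda>m. Poly_Mapping.single m (Poly_Mapping.lookup f m)"
  have "(\<Sum>i<N. pvar i * pd i (\<Sum>m\<in>Poly_Mapping.keys f. ?s m)) = (\<Sum>m\<in>Poly_Mapping.keys f. \<Sum>i<N. pvar i * pd i (?s m))"
    unfolding pd_sum sum_distrib_left by (rule sum.swap)
  also have "\<dots> = (\<Sum>m\<in>Poly_Mapping.keys f. of_nat d * ?s m)"
    using f by (intro sum.cong[OF refl] sg) (auto simp: homogeneous_def PR_iff)
  finally show ?thesis by (simp add: mpoly_sum_single flip: sum_distrib_left)
qed

section \<open>Polynomials in p-th powers, and p-th roots of relations\<close>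

lemma lookup_map_mono: "Poly_Mapping.lookup (Poly_Mapping.map ((*) k) m) i = k * Poly_Mapping.lookup m (i :: nat)"
  for k :: nat
  by (simp add: map.rep_eq when_def)

lemma single_power: "Poly_Mapping.single m c ^ k = Poly_Mapping.single (Poly_Mapping.map ((*) k) m) (c ^ k)"
  for m :: "nat \<Rightarrow>\<^sub>0 nat" and c :: "'a::comm_semiring_1"
proof (induction k)
  case 0
  have "Poly_Mapping.map ((*) 0) m = 0" by (rule poly_mapping_eqI) (simp add: lookup_map_mono)
  then show ?case by (simp only: power_0 single_one)
next
  case (Suc k)
  have "m + Poly_Mapping.map ((*) k) m = Poly_Mapping.map ((*) (Suc k)) m"
    by (rule poly_mapping_eqI) (simp add: lookup_map_mono lookup_add)
  then show ?case by (simp only: power_Suc Suc mult_single)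
qed

lemma mon_power: "mon g (Poly_Mapping.map ((*) k) m) = mon g m ^ k"
  for g :: "nat \<Rightarrow> 'b::comm_monoid_mult" and k :: nat
proof (induction k)
  case 0
  have "Poly_Mapping.map ((*) 0) m = 0" by (rule poly_mapping_eqI) (simp add: lookup_map_mono)
  then show ?case by (simp only: power_0 mon_0)
next
  case (Suc k)
  have "Poly_Mapping.map ((*) (Suc k)) m = m + Poly_Mapping.map ((*) k) m"
    by (rule poly_mapping_eqI) (simp add: lookup_map_mono lookup_add)
  then show ?case by (simp only: power_Suc Suc mon_add)
qed

context char_p
begin

lemma lookup_power_p:
  "Poly_Mapping.lookup (f ^ p) (Poly_Mapping.map ((*) p) m) = Poly_Mapping.lookup (f :: 'a mpoly) m ^ p"
proof -
  have inj: "Poly_Mapping.map ((*) p) n = Poly_Mapping.map ((*) p) m \<longleftrightarrow> n = m" for n m :: "nat \<Rightarrow>\<^sub>0 nat"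
    using p_pos by (auto simp: poly_mapping_eq_iff fun_eq_iff lookup_map_mono)
  let ?s = "\<lambda>m. Poly_Mapping.single m (Poly_Mapping.lookup f m)"
  have "f ^ p = (\<Sum>m\<in>Poly_Mapping.keys f. ?s m) ^ p" by (simp add: mpoly_sum_single)
  also have "\<dots> = (\<Sum>m\<in>Poly_Mapping.keys f. ?s m ^ p)"
    by (rule rhom_sum[OF rhom_frob[OF prime_p char_mp]])
  also have "\<dots> = (\<Sum>n\<in>Poly_Mapping.keys f. Poly_Mapping.single (Poly_Mapping.map ((*) p) n) (Poly_Mapping.lookup f n ^ p))"
    by (simp only: single_power)
  finally show ?thesis
    using p_pos by (auto simp: lookup_sum lookup_single when_def inj in_keys_iff power_0_left)
qed

text \<open>Let F act on itself by \<open>c ^ p * x\<close>. A linear functional from this vector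
  space to F with value 1 at \<open>c0\<close> exists by extending \<open>c0\<close> to a basis; it
  is an F^p-linear functional followed by a p-th root.\<close>

lemma frobenius_functional:
  assumes "c0 \<noteq> (0::'a)"
  obtains l :: "'a \<Rightarrow> 'a" where "\<And>x y. l (x + y) = l x + l y" "\<And>c x. l (c ^ p * x) = c * l x" "l c0 = 1"
proof -
  have f: "(x + y) ^ p = x ^ p + y ^ p" for x y :: 'a
    by (rule rhom_add[OF rhom_frob[OF prime_p char_a]])
  interpret vs1: vector_space "\<lambda>(c::'a) x. c ^ p * x"
    by standard (simp_all add: algebra_simps power_mult_distrib f)
  interpret vs2: vector_space "(*) :: 'a \<Rightarrow> 'a \<Rightarrow> 'a"
    by standard (simp_all add: algebra_simps)
  interpret vp: vector_space_pair "\<lambda>(c::'a) x. c ^ p * x" "(*) :: 'a \<Rightarrow> 'a \<Rightarrow> 'a" ..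
  have "vs1.independent {c0}" using assms vs1.dependent_single by blast
  then obtain l where l: "Vector_Spaces.linear (\<lambda>(c::'a) x. c ^ p * x) (*) l" "\<forall>x\<in>{c0}. l x = 1"
    using vp.linear_independent_extend[of "{c0}" "\<lambda>_. 1"] by blast
  interpret l: Vector_Spaces.linear "\<lambda>(c::'a) x. c ^ p * x" "(*)" l by (rule l(1))
  show ?thesis using that[of l] l.add l.scale l(2) by blast
qed

text \<open>This is Mac Lane's criterion: \<open>F(S)\<close> is separable over \<open>F\<close>.\<close>

lemma frobenius_descent:
  fixes c :: "'i \<Rightarrow> 'a" and u :: "'i \<Rightarrow> 'a mpoly fract"
  assumes l: "\<And>x y. l (x + y) = l x + l y" "\<And>c x. l (c ^ p * x) = c * l x"
    and fin: "finite A" and s: "(\<Sum>m\<in>A. emb (c m) * u m ^ p) = 0"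
  shows "(\<Sum>m\<in>A. emb (l (c m)) * u m) = 0"
proof -
  have "u m \<in> fracs inc UNIV" for m by (simp add: fracs_inc)
  then obtain f g where fg: "inc g \<noteq> 0" "\<forall>m\<in>A. f m \<in> UNIV \<and> u m = inc (f m) / inc g"
    using fracs_common_denom[OF rhom_inc csub_UNIV fin, of u] by blast
  have "l 0 + 0 = l 0 + l 0" using l(1)[of 0 0] by simp
  then have l0: "l 0 = 0" by (simp only: add_left_cancel)
  have lsum: "l (sum h B) = (\<Sum>x\<in>B. l (h x))" for h :: "'i \<Rightarrow> 'a" and B
    by (induction B rule: infinite_finite_induct) (auto simp: l l0)
  have "inc (\<Sum>m\<in>A. pconst (c m) * f m ^ p) = (\<Sum>m\<in>A. emb (c m) * u m ^ p) * inc g ^ p"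
    unfolding sum_distrib_right rhom_sum[OF rhom_inc]
    by (rule sum.cong) (use fg in \<open>auto simp: rhom_mult[OF rhom_inc] rhom_power[OF rhom_inc] emb_def power_divide\<close>)
  then have z: "(\<Sum>m\<in>A. pconst (c m) * f m ^ p) = 0" by (simp add: s)
  have "(\<Sum>m\<in>A. pconst (l (c m)) * f m) = 0"
  proof (rule poly_mapping_eqI)
    fix k
    \<comment> \<open>The coefficient of \<open>f m ^ p\<close> at p times an exponent is the p-th
      power of the coefficient of \<open>f m\<close> at that exponent; \<open>l\<close> removes this
      power.\<close>
    have "0 = Poly_Mapping.lookup (\<Sum>m\<in>A. pconst (c m) * f m ^ p) (Poly_Mapping.map ((*) p) k)" using z by simp
    also have "\<dots> = (\<Sum>m\<in>A. Poly_Mapping.lookup (f m) k ^ p * c m)"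
      by (simp add: lookup_sum lookup_pconst_mult lookup_power_p mult.commute)
    finally have "l (\<Sum>m\<in>A. Poly_Mapping.lookup (f m) k ^ p * c m) = 0" using l0 by simp
    then show "Poly_Mapping.lookup (\<Sum>m\<in>A. pconst (l (c m)) * f m) k = Poly_Mapping.lookup 0 k"
      by (simp only: lsum l lookup_sum lookup_pconst_mult lookup_zero mult.commute[of "l _"])
  qed
  then have "inc (\<Sum>m\<in>A. pconst (l (c m)) * f m) = 0" by simp
  moreover have "(\<Sum>m\<in>A. emb (l (c m)) * u m) = inc (\<Sum>m\<in>A. pconst (l (c m)) * f m) / inc g"
    unfolding sum_divide_distrib rhom_sum[OF rhom_inc]
    by (rule sum.cong) (use fg in \<open>auto simp: rhom_mult[OF rhom_inc] emb_def\<close>)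
  ultimately show ?thesis by simp
qed

end

text \<open>The polynomials \<open>h\<close> describe a rational map from the hypersurface of \<open>\<Sum>i. a i * x\<^sub>i\<^sup>p\<close> to that of
  \<open>\<Sum>j. b j * y\<^sub>j\<^sup>p\<close>; after \<open>qform.th\<close> the equation of the target becomes linear.\<close>

definition rmap :: "nat \<Rightarrow> nat \<Rightarrow> (nat \<Rightarrow> 'a::field) \<Rightarrow> nat \<Rightarrow> (nat \<Rightarrow> 'a) \<Rightarrow> nat \<Rightarrow> (nat \<Rightarrow> 'a mpoly) \<Rightarrow> bool" where
  "rmap p N a M b d h \<longleftrightarrow> (\<forall>j<M. h j \<in> carrier (poly_ring N) \<and> homogeneous d (h j)) \<and>
    (\<Sum>j<M. emb (b j) * qform.th p N a (h j)) = 0 \<and> (\<exists>j<M. qform.th p N a (h j) \<noteq> 0)"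

text \<open>The degree is positive so that substitution multiplies degrees injectively and carries
  homogeneous components to homogeneous components (\<open>H_hom_component\<close>).\<close>

locale pmap = qform p ty N a + B: qform p ty M b
  for p and ty :: "'a::field itself" and N a M b +
  fixes d :: nat and h :: "nat \<Rightarrow> 'a mpoly"
  assumes d0: "d > 0" and h_rmap: "rmap p N a M b d h"
begin

definition H :: "'a mpoly \<Rightarrow> 'a mpoly" where "H = ev pconst h"

lemma h_PN: "j < M \<Longrightarrow> h j \<in> PN" and h_hom: "j < M \<Longrightarrow> homogeneous d (h j)"
  and h_rel: "(\<Sum>j<M. emb (b j) * th (h j)) = 0" and h_nz: "\<exists>j<M. th (h j) \<noteq> 0"
  using h_rmap by (auto simp: rmap_def)

lemma rhom_H: "rhom H"
  unfolding H_def by (rule rhom_ev[OF rhom_pconst])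

lemma H_pvar: "H (pvar j) = h j" and H_pconst: "H (pconst k) = pconst k"
  unfolding H_def by (rule ev_pvar[OF rhom_pconst], rule ev_pconst[OF rhom_pconst])

lemma H_PN: "G \<in> B.PN \<Longrightarrow> H G \<in> PN"
  unfolding H_def by (rule ev_pconst_PR[of G M h, OF _ h_PN])

lemma H_homogeneous: "G \<in> B.PN \<Longrightarrow> homogeneous t G \<Longrightarrow> homogeneous (t * d) (H G)"
  unfolding H_def using h_hom by (intro homogeneous_ev[of _ _ M]) auto

lemma H_hom_component: "G \<in> B.PN \<Longrightarrow> hom_component (t * d) (H G) = H (hom_component t G)"
  unfolding H_def by (rule hom_component_ev[of G M d h t, OF _ h_hom d0])

lemma th_H_Phi: "th (H B.Phi) = 0"
proof -
  have "H B.Phi = (\<Sum>j<M. pconst (b j) * h j ^ p)"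
    by (simp add: diag_poly_def rhom_simps[OF rhom_H] H_pvar H_pconst)
  then show ?thesis using h_rel th_diag[of b h M] p_pos by (simp add: power_0_left)
qed

lemma th_H_zero: "G \<in> B.PN \<Longrightarrow> B.th G = 0 \<Longrightarrow> th (H G) = 0"
  using B.th_ker[of G] th_H_Phi by (auto simp: rhom_mult[OF rhom_H] rhom_mult[OF rhom_th])

end

text \<open>Both hypersurfaces have p^n + 1 coordinates, the case of unique relations. With a degree
  that is 1 modulo p, Euler's identity has the coefficient 1; \<open>rmap_multiple\<close> supplies
  such a degree.\<close>

locale qmap = pmap p ty N a N b d h
  for p and ty :: "'a::field itself" and N a b d h +
  fixes n :: nat
  assumes Np: "N = p ^ n + 1" and d1: "of_nat d = (1::'a)"
begin

definition w :: "nat \<Rightarrow> 'a mpoly fract" where "w j = th (h j)"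

definition psi :: "'a mpoly \<Rightarrow> 'a mpoly fract" where "psi G = th (H G)"

definition c :: "'a mpoly fract" where "c = mu b N (\<lambda>j. D 0 (w j))"

lemma rhom_psi: "rhom psi"
  unfolding psi_def by (rule rhom_comp[OF rhom_H rhom_th])

lemma wL: "j < N \<Longrightarrow> w j \<in> L0"
  unfolding w_def by (intro th_L0 h_PN)

lemma mu_w: "mu b N w = 0"
  using h_rel by (simp add: mu_def w_def)

lemma c_nz: "c \<noteq> 0"
proof -
  have nz: "\<exists>j<N. w j \<noteq> 0" using h_nz unfolding w_def .
  show ?thesis unfolding c_def
    by (rule relation_full_support(2)[of n N b w, OF _ _ B.indep wL mu_w nz]) (simp_all add: Np)
qed

lemma mu_Dw: "i < N \<Longrightarrow> mu b N (\<lambda>j. D i (w j)) = emb (r i) * c"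
  unfolding c_def by (rule mu_D[of N w b i, OF wL mu_w])

lemma N0: "0 < N" using N2 by simp

lemma euler: "j < N \<Longrightarrow> (\<Sum>i<N. xi i * D i (w j)) = w j"
proof -
  assume j: "j < N"
  have "(\<Sum>i<N. xi i * D i (w j)) = th (\<Sum>i<N. pvar i * pd i (h j))"
    by (simp add: rhom_simps[OF rhom_th] th_pvar w_def D_th[OF h_PN[OF j]])
  also have "\<dots> = th (of_nat d * h j)" using euler_identity[OF h_hom[OF j] h_PN[OF j]] by simp
  also have "of_nat d * h j = h j"
  proof -
    have "(of_nat d :: 'a mpoly) = pconst (of_nat d)" by (simp add: pconst_def)
    then show ?thesis by (simp add: d1 rhom_1[OF rhom_pconst])
  qed
  finally show ?thesis by (simp add: w_def)
qed

lemma relation_xi: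
  assumes "\<And>i. i < N \<Longrightarrow> z i \<in> L0" "mu r N z = 0"
  shows "\<exists>k\<in>L0. \<forall>i<N. z i = k * xi i"
  by (rule relation_unique[of n N r z xi])
    (use Np r_indep assms xi_L0 sum_xi N0 xi0_nonzero in \<open>auto simp: mu_def\<close>)

text \<open>Applying \<open>mu b\<close> to a relation between the rows shows, by
  \<open>mu_Dw\<close>, that \<open>lam\<close> is a relation between the \<open>r i\<close>, hence
  a multiple of \<open>xi\<close>. But with the coefficients \<open>xi\<close> the rows combine to
  \<open>w\<close>, by \<open>euler\<close>, and \<open>w\<close> is not zero.\<close>

lemma rows_indep:
  assumes lam: "\<And>i. i < N \<Longrightarrow> lam i \<in> L0" and z: "\<And>j. j < N \<Longrightarrow> (\<Sum>i<N. lam i * D i (w j)) = 0"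
  shows "\<forall>i<N. lam i = 0"
proof -
  have "0 = mu b N (\<lambda>j. \<Sum>i<N. lam i * D i (w j))" using z by (simp add: mu_def)
  also have "\<dots> = (\<Sum>i<N. lam i * (emb (r i) * c))" unfolding mu_sum mu_scale by (simp add: mu_Dw)
  also have "\<dots> = c * mu r N lam" by (simp add: mu_def sum_distrib_left mult_ac)
  finally have "mu r N lam = 0" using c_nz by simp
  then obtain k where k: "\<forall>i<N. lam i = k * xi i" using relation_xi lam by blast
  obtain j where j: "j < N" "w j \<noteq> 0" using h_nz by (auto simp: w_def)
  have "k * w j = (\<Sum>i<N. lam i * D i (w j))"
  proof -
    have "k * w j = k * (\<Sum>i<N. xi i * D i (w j))" using euler[OF j(1)] by simp
    also have "\<dots> = (\<Sum>i<N. lam i * D i (w j))"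
      unfolding sum_distrib_left using k by (intro sum.cong) (auto simp: mult.assoc)
    finally show ?thesis .
  qed
  then have "k = 0" using z[OF j(1)] j(2) by simp
  then show ?thesis using k by simp
qed

section \<open>Descent of the relation to the field generated by the coordinates of the map\<close>

definition K0 :: "'a mpoly fract set" where "K0 = fracs psi PN"

lemma sfld_K0: "sfld K0"
  unfolding K0_def by (rule sfld_fracs[OF rhom_psi csub_PR])

lemma psi_K0: "G \<in> PN \<Longrightarrow> psi G \<in> K0"
  unfolding K0_def by (rule fracs_base[OF rhom_psi csub_PR])

lemma psi_pconst: "psi (pconst k) = emb (k ^ p)"
  by (simp add: psi_def H_pconst th_pconst)

lemma K0_L0: "K0 \<subseteq> L0"
proof
  fix z assume "z \<in> K0"
  then obtain f g where "f \<in> PN" "g \<in> PN" "psi g \<noteq> 0" "z = psi f / psi g"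
    unfolding K0_def by (rule fracsE)
  then show "z \<in> L0" unfolding psi_def by (auto intro!: sfld_divide[OF sfld_L0] th_L0 H_PN)
qed

lemma L0_generated:
  assumes K: "sfld K" and k: "\<And>k. emb (k ^ p) \<in> K" and xi: "\<And>i. i < N \<Longrightarrow> xi i \<in> K"
  shows "L0 \<subseteq> K"
proof
  have t: "th f \<in> K" if "f \<in> PN" for f
    using that
    by (induction f rule: mpoly_induct)
      (auto simp: th_pconst th_pvar k xi rhom_add[OF rhom_th] rhom_mult[OF rhom_th] csubD[OF sfld_csub[OF K]])
  fix z assume "z \<in> L0"
  then obtain f g where "f \<in> PN" "g \<in> PN" "th g \<noteq> 0" "z = th f / th g" by (rule L0E)
  then show "z \<in> K" using t sfld_divide[OF K] by simp
qed

text \<open>A derivation that kills the constants F^p is the combination of the \<open>D i\<close>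
  with coefficients \<open>D' (xi i)\<close>. That it kills each \<open>w j\<close> is then a
  relation between the rows of the Jacobian matrix.\<close>

lemma no_derivation:
  assumes D': "deriv_on D' L0" and k: "\<And>z. z \<in> K0 \<Longrightarrow> D' z = 0" and z: "z \<in> L0"
  shows "D' z = 0"
proof -
  note d' = deriv_add[OF D' sfld_L0] deriv_mult[OF D' sfld_L0] deriv_closed[OF D' sfld_L0]
  have th: "D' (th f) = (\<Sum>i<N. D' (xi i) * D i (th f))" if "f \<in> PN" for f
    using that
  proof (induction f rule: mpoly_induct)
    case (const k)
    have "D' (th (pconst k)) = 0" using assms(2)[OF psi_K0[OF PR_pconst]] by (simp add: psi_pconst th_pconst)
    moreover have "D i (th (pconst k)) = 0" for i by (simp add: D_th PR_pconst rhom_0[OF rhom_th])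
    ultimately show ?case by simp
  next
    case (var j)
    have "(\<Sum>i<N. D' (xi i) * D i (xi j)) = (\<Sum>i<N. if i = j then D' (xi j) else 0)"
      using var by (intro sum.cong) (auto simp: D_xi)
    then show ?case using var by (simp add: th_pvar)
  next
    case (add f g)
    show ?case
      by (simp only: rhom_add[OF rhom_th] d'(1) D_rules(2) th_L0 add distrib_left sum.distrib)
  next
    case (mult f g)
    have "(\<Sum>i<N. D' (xi i) * D i (th f * th g)) = (\<Sum>i<N. D' (xi i) * D i (th f)) * th g + th f * (\<Sum>i<N. D' (xi i) * D i (th g))"
      by (simp add: D_rules(3) th_L0 mult sum_distrib_left sum_distrib_right sum.distrib algebra_simps)
    then show ?case by (simp only: rhom_mult[OF rhom_th] d'(2) th_L0 mult)
  qed
  have Dw: "(\<Sum>i<N. D' (xi i) * D i (w j)) = 0" if j: "j < N" for j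
  proof -
    have "w j = psi (pvar j)" by (simp add: psi_def H_pvar w_def)
    then have "D' (w j) = 0" using assms(2)[OF psi_K0[OF PR_pvar[OF j]]] by (simp only:)
    then show ?thesis using th[OF h_PN[OF j]] by (simp add: w_def)
  qed
  have x: "\<forall>i<N. D' (xi i) = 0"
    by (rule rows_indep) (use Dw d'(3) xi_L0 in auto)
  obtain f g where fg: "f \<in> PN" "g \<in> PN" "th g \<noteq> 0" "z = th f / th g" using L0E[OF z] by blast
  have "D' (th f) = 0" "D' (th g) = 0" using th fg x by simp_all
  then show ?thesis unfolding fg(4) deriv_divide[OF D' sfld_L0 th_L0[OF fg(1)] th_L0[OF fg(2)] fg(3)] by simp
qed

definition dep :: "'a mpoly fract set \<Rightarrow> bool" where
  "dep K \<longleftrightarrow> (\<exists>z. (\<forall>i<N. z i \<in> K) \<and> (\<exists>i<N. z i \<noteq> 0) \<and> (\<Sum>i<N. emb (r i) * z i) = 0)"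

text \<open>A relation over K(x) is a multiple of \<open>xi\<close>; as it also contains
  \<open>xi 0\<close>, the field K(x) is all of \<open>L0\<close>. If x were outside K(x^p), then
  d/dx would be a derivation of \<open>L0\<close> over \<open>K\<close>, against
  \<open>no_derivation\<close>. So x is in K(x^p), and \<open>separable_descent\<close>
  applies.\<close>

lemma dep_step:
  assumes K: "sfld K" "K0 \<subseteq> K" "K \<subseteq> L0" and x: "x \<in> L0" and x0: "xi 0 \<in> adj K x" and dep: "dep (adj K x)"
  shows "dep K"
proof -
  obtain z where z: "\<forall>i<N. z i \<in> adj K x" "\<exists>i<N. z i \<noteq> 0" "(\<Sum>i<N. emb (r i) * z i) = 0"
    using dep unfolding dep_def by blast
  have sA: "sfld (adj K x)" by (rule sfld_adj[OF K(1)])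
  have AL: "adj K x \<subseteq> L0" by (rule adj_least[OF sfld_L0 K(3) x])
  have kK: "emb (k ^ p) \<in> K" for k using psi_K0[OF PR_pconst, of k] K(2) by (auto simp: psi_pconst)
  obtain \<kappa> where k: "\<forall>i<N. z i = \<kappa> * xi i" using relation_xi[of z] z AL by (auto simp: mu_def)
  have k0: "\<kappa> \<noteq> 0" using z(2) k by auto
  have z0: "z 0 \<noteq> 0" using k k0 xi0_nonzero N0 by simp
  have "xi i \<in> adj K x" if i: "i < N" for i
  proof -
    have "xi i = z i / z 0 * xi 0" using k k0 i N0 xi0_nonzero by simp
    then show ?thesis using z(1) i N0 x0 by (metis csubD(5) sA sfld_csub sfld_divide)
  qed
  then have AL': "adj K x = L0" using L0_generated[OF sA] AL adj_base[OF K(1) kK] by blast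
  show ?thesis
  proof (cases "x \<in> adj K (x ^ p)")
    case True
    have ap: "emb (r i) ^ p \<in> K" for i using kK[of "r i"] by (simp add: rhom_power[OF rhom_emb])
    show ?thesis
      using separable_descent[OF prime_p char_K K(1) True, of N "\<lambda>i. emb (r i)" z] ap z unfolding dep_def by blast
  next
    case False
    let ?K = "adj K (x ^ p)"
    have sK: "sfld ?K" by (rule sfld_adj[OF K(1)])
    have xp: "x ^ p \<in> ?K" by (rule adj_gen[OF K(1)])
    obtain D' where D': "deriv_on D' (adj ?K x)" "D' x = 1" "\<And>y. y \<in> ?K \<Longrightarrow> D' y = 0"
      using adj_derivation[OF prime_p char_K sK xp False] by blast
    have KK: "K \<subseteq> ?K" using adj_base[OF K(1)] by blast
    have KL: "?K \<subseteq> L0" by (intro adj_least[OF sfld_L0 K(3)] csub_power[OF sfld_csub[OF sfld_L0]] x)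
    have "adj K x \<subseteq> adj ?K x"
      by (rule adj_least[OF sfld_adj[OF sK] _ adj_gen[OF sK]]) (use KK adj_base[OF sK] in blast)
    moreover have "adj ?K x \<subseteq> L0" by (rule adj_least[OF sfld_L0 KL x])
    ultimately have "adj ?K x = L0" using AL' by blast
    then have "deriv_on D' L0" using D'(1) by simp
    from no_derivation[OF this _ x] have "D' x = 0" using D'(3) K(2) KK by blast
    then show ?thesis using D'(2) by simp
  qed
qed

lemma dep_K0: "dep K0"
proof -
  \<comment> \<open>The \<open>xi i\<close> are adjoined one at a time, with \<open>xi 0\<close>
    first since every step downwards needs it in the upper field.\<close>
  define E where "E = rec_nat K0 (\<lambda>i K. adj K (xi i))"
  have E0: "E 0 = K0" and ES: "E (Suc i) = adj (E i) (xi i)" for i by (simp_all add: E_def)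
  have E: "sfld (E i) \<and> K0 \<subseteq> E i \<and> (i \<le> N \<longrightarrow> E i \<subseteq> L0) \<and> (\<forall>l<i. xi l \<in> E i)" for i
  proof (induction i)
    case 0
    show ?case using sfld_K0 K0_L0 by (simp add: E0)
  next
    case (Suc i)
    have sub: "E i \<subseteq> adj (E i) (xi i)" using adj_base Suc by blast
    have "xi l \<in> adj (E i) (xi i)" if "l < Suc i" for l
      using that sub Suc adj_gen[of "E i" "xi i"] by (cases "l = i") auto
    moreover have "adj (E i) (xi i) \<subseteq> L0" if "Suc i \<le> N"
      using Suc that xi_L0[of i] by (intro adj_least[OF sfld_L0]) auto
    ultimately show ?case unfolding ES using Suc sub sfld_adj by blast
  qed
  have "dep (E N)"
    unfolding dep_def using E[of N] sum_xi N0 xi0_nonzero by (intro exI[of _ xi]) auto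
  moreover have "dep (E i)" if "dep (E (Suc i))" "i < N" for i
    using dep_step[of "E i" "xi i"] E[of i] E[of "Suc i"] that xi_L0[of i] unfolding ES by auto
  ultimately have "dep (E (N - k))" if "k \<le> N" for k
    using that
  proof (induction k)
    case (Suc k)
    then have "dep (E (Suc (N - Suc k)))" by (simp add: Suc_diff_Suc)
    then show ?case using Suc.prems \<open>\<And>i. dep (E (Suc i)) \<Longrightarrow> i < N \<Longrightarrow> dep (E i)\<close>[of "N - Suc k"] by simp
  qed simp
  from this[of N] show ?thesis by (simp add: E0)
qed

text \<open>The entries of a relation over \<open>K0\<close> are pulled back from the target. Being
  proportional to the coordinates \<open>xi i\<close> of the source, they describe the inverse
  map.\<close>

lemma inverse_exists:
  "\<exists>P k. (\<forall>i<N. P i \<in> PN \<and> psi (P i) = k * xi i) \<and> k \<noteq> 0"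
proof -
  obtain z where z: "\<forall>i<N. z i \<in> K0" "\<exists>i<N. z i \<noteq> 0" "(\<Sum>i<N. emb (r i) * z i) = 0"
    using dep_K0 unfolding dep_def by blast
  have "z i \<in> fracs psi PN" if "i \<in> {..<N}" for i using z(1) that by (simp add: K0_def)
  then obtain P g where Pg: "g \<in> PN" "psi g \<noteq> 0" "\<forall>i\<in>{..<N}. P i \<in> PN \<and> z i = psi (P i) / psi g"
    using fracs_common_denom[OF rhom_psi csub_PR finite_lessThan, of N z N] by blast
  have "\<And>i. i < N \<Longrightarrow> z i \<in> L0" using z(1) K0_L0 by blast
  then obtain k where k: "\<forall>i<N. z i = k * xi i" using relation_xi[of z] z(3) by (auto simp: mu_def)
  have "k \<noteq> 0" using z(2) k by auto
  moreover have "\<forall>i<N. P i \<in> PN \<and> psi (P i) = psi g * k * xi i"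
  proof (intro allI impI)
    fix i assume i: "i < N"
    have "psi (P i) = z i * psi g" using Pg i by simp
    moreover have "z i = k * xi i" using k i by blast
    ultimately have "psi (P i) = psi g * k * xi i" by (simp only: mult_ac)
    then show "P i \<in> PN \<and> psi (P i) = psi g * k * xi i" using Pg(3) i by blast
  qed
  ultimately show ?thesis using Pg(2) by (intro exI[of _ P] exI[of _ "psi g * k"]) auto
qed

text \<open>The numbers \<open>G i\<close> are proportional to the \<open>r i\<close>, and so are
  the \<open>mu b N (D i w)\<close>. Hence \<open>g\<close> minus a suitable multiple of
  \<open>b\<close> is orthogonal to all rows and vanishes by \<open>full_row_rank\<close>. The
  multiple is 0 because \<open>g 0 = 0\<close> while \<open>b 0\<close> is not 0.\<close>

lemma jacobian:
  assumes g0: "g 0 = 0" and g: "\<And>i. 1 \<le> i \<Longrightarrow> i < N \<Longrightarrow> (\<Sum>j<N. g j * dK i (w j)) = 0" and j: "j < N"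
  shows "g j = 0"
proof -
  define G where "G i = (\<Sum>j<N. g j * D i (w j))" for i
  have Gi: "G i = emb (r i) * G 0" if "i < N" for i
  proof (cases "i = 0")
    case True
    then show ?thesis by (simp add: r0 rhom_1[OF rhom_emb])
  next
    case False
    have "0 = (\<Sum>j<N. g j * dK i (w j))" using g that False by simp
    also have "\<dots> = (\<Sum>j<N. g j * (D i (w j) - emb (r i) * D 0 (w j)))"
      using that False wL by (intro sum.cong) (auto simp: dK_L0)
    also have "\<dots> = G i - emb (r i) * G 0"
      by (simp add: G_def algebra_simps sum_subtractf sum_distrib_left)
    finally show ?thesis by simp
  qed
  define \<beta> where "\<beta> = G 0 / c"
  have f: "(\<Sum>j<N. D i (w j) * (g j - \<beta> * emb (b j))) = 0" if "i < N" for i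
  proof -
    have "(\<Sum>j<N. D i (w j) * (g j - \<beta> * emb (b j))) = G i - \<beta> * mu b N (\<lambda>j. D i (w j))"
      by (simp add: G_def mu_def algebra_simps sum_subtractf sum_distrib_left)
    also have "\<dots> = 0" using Gi[OF that] mu_Dw[OF that] c_nz by (simp add: \<beta>_def)
    finally show ?thesis .
  qed
  have all: "g j - \<beta> * emb (b j) = 0" if "j < N" for j
    by (rule full_row_rank[OF sfld_L0, of N "\<lambda>i j. D i (w j)" "\<lambda>j. g j - \<beta> * emb (b j)" j])
      (use that f rows_indep wL D_rules(1) in auto)
  from all[OF N0] have "\<beta> = 0" using g0 B.a0 by simp
  then show ?thesis using all[OF j] by simp
qed

lemma dK_ev:
  assumes "G \<in> PN"
  shows "dK i (ev emb w G) = (\<Sum>j<N. ev emb w (pd j G) * dK i (w j))"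
  using assms
proof (induction G rule: mpoly_induct)
  case (const k)
  have "dK i (emb k) = 0" by (simp add: emb_def dK(2) rhom_0[OF rhom_inc])
  then show ?case by (simp add: ev_pconst[OF rhom_emb] ev_zero)
next
  case (var l)
  have "(\<Sum>j<N. ev emb w (pd j (pvar l)) * dK i (w j)) = (\<Sum>j<N. if j = l then dK i (w l) else 0)"
    by (intro sum.cong) (auto simp: pd_pvar ev_zero rhom_1[OF rhom_ev[OF rhom_emb]])
  then show ?case using var by (simp add: ev_pvar[OF rhom_emb])
next
  case (add f g)
  show ?case
    by (simp only: ev_add[OF rhom_emb] deriv_add[OF dK(1) sfld_UNIV UNIV_I UNIV_I] pd_add add distrib_right sum.distrib)
next
  case (mult f g)
  show ?case
    by (simp only: ev_mult[OF rhom_emb] ev_add[OF rhom_emb] deriv_mult[OF dK(1) sfld_UNIV UNIV_I UNIV_I] pd_mult mult)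
      (simp add: sum_distrib_left sum_distrib_right sum.distrib algebra_simps)
qed

text \<open>Given a relation \<open>G\<close>, its partial derivatives are, by the chain rule and
  \<open>jacobian\<close>, relations of smaller degree, hence zero. So \<open>G\<close> is a
  polynomial in p-th powers of the variables, and \<open>frobenius_descent\<close> produces from it
  a relation with all exponents divided by p, again of smaller degree.\<close>

lemma alg_indep:
  assumes "G \<in> pvset {1..<N}" "\<forall>m\<in>Poly_Mapping.keys G. mono_deg m \<le> k" "ev emb w G = 0"
  shows "G = 0"
  using assms
proof (induction k arbitrary: G rule: less_induct)
  case (less k)
  have GP: "G \<in> PN" using less.prems(1) pvset_subset_PR by blast
  show ?case
  proof (rule ccontr)
    assume "G \<noteq> 0"
    have kpos: "k > 0"
    proof (rule ccontr)
      assume "\<not> k > 0"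
      have "m = 0" if "m \<in> Poly_Mapping.keys G" for m
      proof (rule poly_mapping_eqI)
        fix i
        have "mono_deg m = 0" using less.prems(2) that \<open>\<not> k > 0\<close> by auto
        then show "Poly_Mapping.lookup m i = Poly_Mapping.lookup 0 i"
          by (cases "i \<in> Poly_Mapping.keys m") (auto simp: mono_deg_def in_keys_iff)
      qed
      then have G: "G = pconst (Poly_Mapping.lookup G 0)"
        unfolding pconst_def by (intro poly_mapping_eqI) (auto simp: lookup_single when_def simp flip: not_in_keys_iff_lookup_eq_zero)
      have "emb (Poly_Mapping.lookup G 0) = 0" using less.prems(3) by (subst (asm) G) (simp add: ev_pconst[OF rhom_emb])
      then show False using G \<open>G \<noteq> 0\<close> by (metis emb_eq_0_iff pconst_eq_0_iff)
    qed
    have pdG: "pd j G = 0" if j: "j < N" for j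
    proof -
      have keys: "m + Poly_Mapping.single j 1 \<in> Poly_Mapping.keys G" if "m \<in> Poly_Mapping.keys (pd j G)" for m j
        using that unfolding in_keys_iff lookup_pd by auto
      have pv: "pd j G \<in> pvset {1..<N}" for j
        unfolding pvset_def
      proof (intro CollectI ballI)
        fix m assume "m \<in> Poly_Mapping.keys (pd j G)"
        from keys[OF this] have "Poly_Mapping.keys (m + Poly_Mapping.single j 1) \<subseteq> {1..<N}"
          using less.prems(1) by (auto simp: pvset_def)
        moreover have "Poly_Mapping.keys m \<subseteq> Poly_Mapping.keys (m + Poly_Mapping.single j 1)"
          by (auto simp: in_keys_iff lookup_add)
        ultimately show "Poly_Mapping.keys m \<subseteq> {1..<N}" by blast
      qed
      have dg: "\<forall>m\<in>Poly_Mapping.keys (pd j G). mono_deg m \<le> k - 1" for j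
      proof
        fix m assume "m \<in> Poly_Mapping.keys (pd j G)"
        from less.prems(2)[rule_format, OF keys[OF this]] show "mono_deg m \<le> k - 1"
          by (simp add: mono_deg_add)
      qed
      have p0: "pd 0 G = 0"
      proof -
        have "m + Poly_Mapping.single 0 1 \<notin> Poly_Mapping.keys G" for m
        proof
          assume "m + Poly_Mapping.single 0 1 \<in> Poly_Mapping.keys G"
          then have "Poly_Mapping.keys (m + Poly_Mapping.single 0 1) \<subseteq> {1..<N}"
            using less.prems(1) by (auto simp: pvset_def)
          moreover have "0 \<in> Poly_Mapping.keys (m + Poly_Mapping.single 0 1)" by (simp add: in_keys_iff lookup_add)
          ultimately show False by auto
        qed
        then show ?thesis by (intro poly_mapping_eqI) (simp add: lookup_pd in_keys_iff)
      qed
      have "ev emb w (pd j G) = 0"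
      proof (rule jacobian[of "\<lambda>j. ev emb w (pd j G)" j, OF _ _ j])
        show "ev emb w (pd 0 G) = 0" by (simp add: p0 ev_zero)
        fix i
        show "(\<Sum>j<N. ev emb w (pd j G) * dK i (w j)) = 0"
          unfolding dK_ev[OF GP, of i, symmetric] less.prems(3) by (rule deriv_0[OF dK(1) sfld_UNIV])
      qed
      then show ?thesis using less.IH[of "k - 1" "pd j G"] kpos pv dg by simp
    qed
    define half where "half m = Poly_Mapping.map (\<lambda>x. x div p) m" for m :: "nat \<Rightarrow>\<^sub>0 nat"
    have lh: "Poly_Mapping.lookup (half m) i = Poly_Mapping.lookup m i div p" for m i
      by (simp add: half_def map.rep_eq when_def)
    have kh: "Poly_Mapping.keys (half m) \<subseteq> Poly_Mapping.keys m" for m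
      unfolding subset_iff in_keys_iff lh by (metis div_0)
    have half: "Poly_Mapping.map ((*) p) (half m) = m" if m: "m \<in> Poly_Mapping.keys G" for m
    proof (rule poly_mapping_eqI)
      fix i
      have "p dvd Poly_Mapping.lookup m i"
      proof (cases "Poly_Mapping.lookup m i = 0")
        case False
        then have i: "i \<in> Poly_Mapping.keys m" by (simp add: in_keys_iff)
        then have iN: "i < N" using m less.prems(1) by (fastforce simp: pvset_def)
        have e: "m - Poly_Mapping.single i 1 + Poly_Mapping.single i 1 = m"
          using False by (intro poly_mapping_eqI) (auto simp: lookup_add lookup_minus lookup_single when_def)
        have "0 = Poly_Mapping.lookup (pd i G) (m - Poly_Mapping.single i 1)" using pdG[OF iN] by simp
        also have "\<dots> = of_nat (Poly_Mapping.lookup m i) * Poly_Mapping.lookup G m"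
          unfolding lookup_pd e using False by (simp add: lookup_minus del: of_nat_Suc)
        finally have "of_nat (Poly_Mapping.lookup m i) = (0::'a)" using m by (simp add: in_keys_iff)
        then show ?thesis unfolding of_nat_eq_0_iff_char_dvd char_a .
      qed simp
      then show "Poly_Mapping.lookup (Poly_Mapping.map ((*) p) (half m)) i = Poly_Mapping.lookup m i"
        by (simp add: lookup_map_mono lh)
    qed
    obtain m0 where m0: "m0 \<in> Poly_Mapping.keys G" using \<open>G \<noteq> 0\<close> by (metis keys_eq_empty ex_in_conv)
    then have "Poly_Mapping.lookup G m0 \<noteq> 0" by (simp add: in_keys_iff)
    \<comment> \<open>The value 1 at one coefficient of \<open>G\<close> keeps the new relation from
      being zero.\<close>
    then obtain l where l: "\<And>x y. l (x + y) = l x + l y" "\<And>c x. l (c ^ p * x) = c * l x" "l (Poly_Mapping.lookup G m0) = 1"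
      using frobenius_functional by blast
    have "(\<Sum>m\<in>Poly_Mapping.keys G. emb (Poly_Mapping.lookup G m) * mon w (half m) ^ p) = ev emb w G"
      unfolding ev_def by (intro sum.cong[OF refl]) (simp add: half flip: mon_power)
    from frobenius_descent[OF l(1,2) finite_keys this[unfolded less.prems(3)]]
    have z: "(\<Sum>m\<in>Poly_Mapping.keys G. emb (l (Poly_Mapping.lookup G m)) * mon w (half m)) = 0" .
    define G' where "G' = (\<Sum>m\<in>Poly_Mapping.keys G. Poly_Mapping.single (half m) (l (Poly_Mapping.lookup G m)))"
    have ev': "ev emb w G' = 0" unfolding G'_def ev_sum[OF rhom_emb] ev_single[OF rhom_emb] by (rule z)
    have lG': "Poly_Mapping.lookup G' (half m0) = 1"
    proof -
      have "Poly_Mapping.lookup G' (half m0) = (\<Sum>m\<in>Poly_Mapping.keys G. if m = m0 then l (Poly_Mapping.lookup G m) else 0)"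
        unfolding G'_def lookup_sum lookup_single
        using half m0 by (intro sum.cong[OF refl]) (metis (full_types) when_simps)
      then show ?thesis using m0 l(3) by simp
    qed
    have keysG': "\<exists>m\<in>Poly_Mapping.keys G. m' = half m" if "m' \<in> Poly_Mapping.keys G'" for m'
    proof -
      have "Poly_Mapping.keys G' \<subseteq> (\<Union>m\<in>Poly_Mapping.keys G. Poly_Mapping.keys (Poly_Mapping.single (half m) (l (Poly_Mapping.lookup G m))))"
        unfolding G'_def by (rule Poly_Mapping.keys_sum)
      then show ?thesis using that by (auto split: if_splits)
    qed
    have "G' \<in> pvset {1..<N}"
      unfolding pvset_def
    proof (intro CollectI ballI)
      fix m' assume "m' \<in> Poly_Mapping.keys G'"
      then obtain m where m: "m \<in> Poly_Mapping.keys G" "m' = half m" using keysG' by blast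
      have "Poly_Mapping.keys m' \<subseteq> Poly_Mapping.keys m" unfolding m(2) by (rule kh)
      then show "Poly_Mapping.keys m' \<subseteq> {1..<N}" using m less.prems(1) unfolding pvset_def by blast
    qed
    moreover have "\<forall>m'\<in>Poly_Mapping.keys G'. mono_deg m' \<le> k div 2"
    proof
      fix m' assume "m' \<in> Poly_Mapping.keys G'"
      then obtain m where m: "m \<in> Poly_Mapping.keys G" "m' = half m" using keysG' by blast
      have "p * mono_deg m' = mono_deg m"
      proof -
        have "Poly_Mapping.keys m' \<subseteq> Poly_Mapping.keys m" unfolding m(2) by (rule kh)
        then have "p * mono_deg m' = (\<Sum>i\<in>Poly_Mapping.keys m. p * Poly_Mapping.lookup m' i)"
          by (simp add: mono_deg_superset[OF finite_keys] sum_distrib_left)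
        also have "\<dots> = mono_deg m"
          unfolding mono_deg_def using half[OF m(1)] m(2) by (intro sum.cong[OF refl]) (metis lookup_map_mono)
        finally show ?thesis .
      qed
      moreover have "2 * mono_deg m' \<le> p * mono_deg m'" using prime_ge_2_nat[OF prime_p] by (intro mult_le_mono1)
      moreover have "mono_deg m \<le> k" using less.prems(2) m(1) by blast
      ultimately show "mono_deg m' \<le> k div 2" by linarith
    qed
    ultimately have "G' = 0" using less.IH[of "k div 2" G'] kpos ev' by simp
    then show False using lG' by simp
  qed
qed

text \<open>This is dominance of the map. Both \<open>psi\<close> and \<open>B.th\<close> factor
  through \<open>E\<close>, which applies Frobenius to the coefficients and eliminates the variable
  0 by the linear equation of the target; on the image of \<open>E\<close>, evaluation at
  \<open>w\<close> is injective by \<open>alg_indep\<close>.\<close>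

lemma psi_ker:
  assumes G: "G \<in> PN" "psi G = 0" shows "B.th G = 0"
proof -
  define y where "y j = (if j = 0 then - (\<Sum>i=1..<N. pconst (B.r i) * pvar i) else pvar j :: 'a mpoly)" for j
  define E where "E = ev (\<lambda>k. pconst (k ^ p)) y"
  have rp: "rhom (\<lambda>k::'a. pconst (k ^ p))" by (rule rhom_comp[OF rhom_frob[OF prime_p char_a] rhom_pconst])
  have rE: "rhom E" unfolding E_def by (rule rhom_ev[OF rp])
  have Ec: "E (pconst k) = pconst (k ^ p)" and Ev: "E (pvar j) = y j" for k j
    unfolding E_def by (rule ev_pconst[OF rp], rule ev_pvar[OF rp])
  note cp = csub_intros[OF csub_pvset]
  have yp: "y j \<in> pvset {1..<N}" if "j < N" for j
    unfolding y_def using that by (auto intro!: cp pvset_pconst pvset_pvar)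
  note yp' = yp[unfolded One_nat_def]
  have EG: "E G \<in> pvset {1..<N}"
    using G(1) by (induction G rule: mpoly_induct)
      (auto simp: Ec Ev rhom_add[OF rE] rhom_mult[OF rE] yp' pvset_pconst csubD[OF csub_pvset])
  have w0: "w 0 = - (\<Sum>i=1..<N. emb (B.r i) * w i)"
  proof -
    have "0 = mu b N w / emb (b 0)" by (simp add: mu_w)
    also have "\<dots> = (\<Sum>j<N. emb (B.r j) * w j)"
      by (simp add: mu_def sum_divide_distrib B.r_def divide_inverse rhom_mult[OF rhom_emb] rhom_inverse_emb sum_distrib_left mult_ac)
    also have "\<dots> = w 0 + (\<Sum>i=1..<N. emb (B.r i) * w i)"
      unfolding sum_split0 by (simp add: B.r0 rhom_1[OF rhom_emb])
    finally show ?thesis by (simp add: eq_neg_iff_add_eq_0)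
  qed
  have "ev emb w (E G) = psi G"
    using rhom_comp[OF rE rhom_ev[OF rhom_emb]] rhom_psi _ _ G(1)
  proof (rule rhom_eq_on_PR)
    show "ev emb w (E (pconst k)) = psi (pconst k)" for k by (simp add: Ec ev_pconst[OF rhom_emb] psi_pconst)
    show "ev emb w (E (pvar j)) = psi (pvar j)" if "j < N" for j
      using w0 by (simp add: Ev y_def psi_def H_pvar rhom_simps[OF rhom_ev[OF rhom_emb]] ev_pconst[OF rhom_emb]
          ev_pvar[OF rhom_emb] flip: w_def)
  qed
  then have "E G = 0" using alg_indep[OF EG, of "Max (mono_deg ` Poly_Mapping.keys (E G))"] G(2) by simp
  moreover have "inc (E G) = B.th G"
    using rhom_comp[OF rE rhom_inc] B.rhom_th _ _ G(1)
  proof (rule rhom_eq_on_PR)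
    show "inc (E (pconst k)) = B.th (pconst k)" for k by (simp add: Ec B.th_pconst emb_def)
    show "inc (E (pvar j)) = B.th (pvar j)" if "j < N" for j
      by (simp add: Ev y_def B.th_pvar B.xi_def rhom_simps[OF rhom_inc] emb_def)
  qed
  ultimately show ?thesis by (simp add: rhom_0[OF rhom_inc])
qed

end

definition idl :: "nat \<Rightarrow> 'a::field mpoly \<Rightarrow> 'a mpoly set" where
  "idl N F = {q * F | q. q \<in> carrier (poly_ring N)}"

lemma homogeneous_diag: "homogeneous p (diag_poly p N a)"
proof -
  have "homogeneous (0 + p * 1) (pconst (a i) * pvar i ^ p)" for i
    by (intro homogeneous_mult homogeneous_pconst homogeneous_power homogeneous_pvar)
  then show ?thesis unfolding diag_poly_def by (intro homogeneous_sum) simp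
qed

lemma mon_scale: "mon (\<lambda>i. z * g i) m = z ^ mono_deg m * mon g m"
  for z :: "'b::comm_monoid_mult"
  by (simp add: mon_def mono_deg_def power_mult_distrib prod.distrib power_sum)

lemma ev_scale: "homogeneous d f \<Longrightarrow> ev c (\<lambda>i. z * g i) f = z ^ d * ev c g f"
  unfolding ev_def sum_distrib_left
  by (rule sum.cong) (auto simp: homogeneous_def mon_scale mult.left_commute)

lemma ev_cong:
  assumes "f \<in> carrier (poly_ring N)" "\<And>i. i < N \<Longrightarrow> g i = g' i" shows "ev c g f = ev c g' f"
  unfolding ev_def mon_def
proof (rule sum.cong[OF refl])
  fix m assume "m \<in> Poly_Mapping.keys f"
  then have "Poly_Mapping.keys m \<subseteq> {..<N}" using assms(1) by (simp add: PR_iff)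
  then have "(\<Prod>i\<in>Poly_Mapping.keys m. g i ^ Poly_Mapping.lookup m i) = (\<Prod>i\<in>Poly_Mapping.keys m. g' i ^ Poly_Mapping.lookup m i)"
    using assms(2) by (intro prod.cong) auto
  then show "c (Poly_Mapping.lookup f m) * (\<Prod>i\<in>Poly_Mapping.keys m. g i ^ Poly_Mapping.lookup m i) =
    c (Poly_Mapping.lookup f m) * (\<Prod>i\<in>Poly_Mapping.keys m. g' i ^ Poly_Mapping.lookup m i)" by simp
qed

context qform
begin

lemma idl_iff: "f \<in> PN \<Longrightarrow> f \<in> idl N Phi \<longleftrightarrow> th f = 0"
  using th_ker[of f] by (auto simp: idl_def rhom_mult[OF rhom_th] th_Phi)

lemma idl_PN: "f \<in> idl N Phi \<Longrightarrow> f \<in> PN"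
  using Phi_PN by (auto simp: idl_def intro: PR_mult)

lemma th_hom_component:
  assumes "f \<in> PN" "th f = 0" shows "th (hom_component e f) = 0"
proof -
  obtain q where q: "f = q * Phi" using th_ker[OF assms] by blast
  show ?thesis
  proof (cases "e < p")
    case True
    then show ?thesis unfolding q by (simp add: hom_component_mult_low[OF homogeneous_diag] rhom_0[OF rhom_th])
  next
    case False
    then have "hom_component e f = hom_component (e - p) q * Phi"
      using hom_component_mult_homogeneous[OF homogeneous_diag[of p N a], of "e - p" q] unfolding q by simp
    then show ?thesis by (simp add: rhom_mult[OF rhom_th] th_Phi)
  qed
qed

lemma xi_nz: "xi i \<noteq> 0"
  using xi_nonzero xi0_nonzero by (cases "i = 0") auto

lemma th_scale:
  assumes "f \<in> PN" "homogeneous d f" "\<And>i. i < N \<Longrightarrow> th (g i) = z * xi i"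
  shows "th (ev pconst g f) = z ^ d * th f"
proof -
  have "th (ev pconst g f) = ev (\<lambda>c. emb (c ^ p)) (\<lambda>i. th (g i)) f"
    using rhom_comp[OF rhom_ev[OF rhom_pconst] rhom_th] rhom_ev[OF rhom_femb] _ _ assms(1)
    by (rule rhom_eq_on_PR) (simp_all add: ev_pconst[OF rhom_pconst] ev_pconst[OF rhom_femb] ev_pvar[OF rhom_pconst] ev_pvar[OF rhom_femb] th_pconst)
  also have "\<dots> = ev (\<lambda>c. emb (c ^ p)) (\<lambda>i. z * xi i) f"
    by (rule ev_cong[OF assms(1) assms(3)])
  also have "\<dots> = z ^ d * th f" unfolding th_def by (rule ev_scale[OF assms(2)])
  finally show ?thesis .
qed

end

context qmap
begin

lemma w_nz: "j < N \<Longrightarrow> w j \<noteq> 0"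
proof -
  have nz: "\<exists>j<N. w j \<noteq> 0" using h_nz unfolding w_def .
  have "\<forall>j<N. w j \<noteq> 0"
    by (rule relation_full_support(1)[of n N b w, OF _ _ B.indep wL mu_w nz]) (simp_all add: Np)
  then show "j < N \<Longrightarrow> w j \<noteq> 0" by blast
qed

lemma psi_B_Phi: "psi B.Phi = 0"
  unfolding psi_def by (rule th_H_Phi)

lemma psi_iff: "G \<in> PN \<Longrightarrow> psi G = 0 \<longleftrightarrow> B.th G = 0"
  using psi_ker B.th_ker psi_B_Phi by (metis mult_zero_right rhom_mult[OF rhom_psi])

text \<open>Modulo \<open>Phi\<close>, \<open>H (P i) * pvar 0\<close> equals
  \<open>H (P 0) * pvar i\<close>. Comparing the components of degree e * d + 1 shows that the
  degree e parts of the \<open>P i\<close> are also proportional to \<open>xi\<close>; e is chosen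
  such that the part of \<open>P 0\<close> survives. The extra factor \<open>pvar 0\<close> makes
  the degree positive.\<close>

lemma homogeneous_inverse:
  "\<exists>k e z. e > 0 \<and> z \<noteq> 0 \<and> (\<forall>i<N. k i \<in> PN \<and> homogeneous e (k i) \<and> psi (k i) = z * xi i)"
proof -
  obtain P \<kappa> where P: "\<forall>i<N. P i \<in> PN \<and> psi (P i) = \<kappa> * xi i" and k0: "\<kappa> \<noteq> 0"
    using inverse_exists by blast
  have P0: "P 0 \<in> PN" "psi (P 0) \<noteq> 0" using P N0 k0 xi_nz by auto
  have ex: "\<exists>e. psi (hom_component e (P 0)) \<noteq> 0"
  proof (rule ccontr)
    assume "\<not> ?thesis"
    then have "psi (\<Sum>e\<in>mono_deg ` Poly_Mapping.keys (P 0). hom_component e (P 0)) = 0"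
      by (simp add: rhom_sum[OF rhom_psi])
    then show False using P0 by (subst (asm) sum_hom_components) auto
  qed
  then obtain e where e: "psi (hom_component e (P 0)) \<noteq> 0" by blast
  define k where "k i = hom_component e (P i) * pvar 0" for i
  define z where "z = psi (hom_component e (P 0)) / xi 0 * w 0"
  have "psi (hom_component e (P i)) = psi (hom_component e (P 0)) / xi 0 * xi i" if i: "i < N" for i
  proof -
    define f where "f = H (P i) * pvar 0 - H (P 0) * pvar i"
    have f: "f \<in> PN" unfolding f_def using P i N0 by (intro PR_intros H_PN) auto
    have "th f = 0" using P i N0 by (simp add: f_def rhom_simps[OF rhom_th] th_pvar flip: psi_def)
    from th_hom_component[OF f this, of "e * d + 1"]
    have "th (hom_component (e * d) (H (P i)) * pvar 0 - hom_component (e * d) (H (P 0)) * pvar i) = 0"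
      unfolding f_def hom_component_diff hom_component_mult_homogeneous[OF homogeneous_pvar] .
    then have "th (H (hom_component e (P i)) * pvar 0 - H (hom_component e (P 0)) * pvar i) = 0"
      unfolding H_def using hom_component_ev[where f = "P _" and N = N and h = h and d = d and e = e] P i N0 h_hom d0 by simp
    then have "psi (hom_component e (P i)) * xi 0 = psi (hom_component e (P 0)) * xi i"
      by (simp add: rhom_simps[OF rhom_th] th_pvar psi_def)
    then show ?thesis using xi_nz by (simp add: field_simps)
  qed
  note ps = this
  have "psi (pvar 0) = w 0" by (simp add: psi_def H_pvar w_def)
  then have "psi (k i) = psi (hom_component e (P i)) * w 0" for i by (simp only: k_def rhom_mult[OF rhom_psi])
  then have "psi (k i) = z * xi i" if "i < N" for i
    by (simp only: ps[OF that] z_def ac_simps)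
  moreover have "k i \<in> PN \<and> homogeneous (e + 1) (k i)" if "i < N" for i
    unfolding k_def using P that N0
    by (intro conjI PR_mult hom_component_PR PR_pvar homogeneous_mult homogeneous_hom_component homogeneous_pvar) auto
  moreover have "z \<noteq> 0" using e xi_nz w_nz N0 by (simp add: z_def)
  ultimately show ?thesis by (intro exI[of _ k] exI[of _ "e + 1"] exI[of _ z]) simp
qed

end

section \<open>Restriction to a hyperplane\<close>

context char_p
begin

lemma specialise_last:
  fixes f :: "'a mpoly"
  assumes "f \<in> carrier (poly_ring (Suc N))"
  defines "\<rho> \<equiv> ev pconst (\<lambda>i. if i = N then 0 else pvar i)"
  shows "\<rho> f \<in> carrier (poly_ring N) \<and> (\<exists>g\<in>carrier (poly_ring (Suc N)). f = \<rho> f + g * pvar N)"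
  using assms(1)
proof (induction f rule: mpoly_induct)
  case (const k)
  show ?case by (auto simp: \<rho>_def ev_pconst[OF rhom_pconst] intro: PR_intros bexI[of _ 0])
next
  case (var i)
  have "\<rho> (pvar i) = (if i = N then 0 else pvar i)" by (simp add: \<rho>_def ev_pvar[OF rhom_pconst])
  then show ?case using var by (auto intro: PR_intros bexI[of _ 0] bexI[of _ 1])
next
  case (add f g)
  obtain f' g' where fg: "f' \<in> carrier (poly_ring (Suc N))" "f = \<rho> f + f' * pvar N"
    "g' \<in> carrier (poly_ring (Suc N))" "g = \<rho> g + g' * pvar N" using add.IH by blast
  have "\<rho> (f + g) = \<rho> f + \<rho> g" unfolding \<rho>_def by (rule ev_add[OF rhom_pconst])
  moreover have "f + g = \<rho> f + \<rho> g + (f' + g') * pvar N"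
    by (subst fg(2), subst fg(4)) (simp add: algebra_simps)
  moreover have "\<rho> f + \<rho> g \<in> carrier (poly_ring N)" using add.IH by (intro PR_add) auto
  ultimately show ?case using PR_add[OF fg(1,3)] by metis
next
  case (mult f g)
  obtain f' g' where fg: "f' \<in> carrier (poly_ring (Suc N))" "f = \<rho> f + f' * pvar N"
    "g' \<in> carrier (poly_ring (Suc N))" "g = \<rho> g + g' * pvar N" using mult.IH by blast
  have "\<rho> (f * g) = \<rho> f * \<rho> g" unfolding \<rho>_def by (rule ev_mult[OF rhom_pconst])
  moreover have "f * g = \<rho> f * \<rho> g + (f' * g + \<rho> f * g') * pvar N"
  proof -
    have "f * g = (\<rho> f + f' * pvar N) * g" using fg(2) by simp
    also have "\<dots> = \<rho> f * (\<rho> g + g' * pvar N) + f' * pvar N * g" using fg(4) by (simp add: distrib_right)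
    finally show ?thesis by (simp add: algebra_simps)
  qed
  moreover have "\<rho> f * \<rho> g \<in> carrier (poly_ring N)" using mult.IH by (intro PR_mult) auto
  moreover have "f' * g + \<rho> f * g' \<in> carrier (poly_ring (Suc N))"
    using mult fg PR_mono[of N "Suc N"] by (intro PR_add PR_mult) auto
  ultimately show ?case by metis
qed

text \<open>Set the last variable to 0. If this makes every \<open>h j\<close> zero on the smaller
  hypersurface, then modulo the equation all \<open>h j\<close> are divisible by that variable, and
  the quotients describe the same map in one degree less.\<close>

lemma restrict_step:
  fixes a :: "nat \<Rightarrow> 'a"
  assumes N2: "2 \<le> N" and a: "frob_indep p (Suc N) a"
    and "\<And>j. j < M \<Longrightarrow> h j \<in> carrier (poly_ring (Suc N)) \<and> homogeneous d (h j)"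
    and "(\<Sum>j<M. emb (b j) * qform.th p (Suc N) a (h j)) = 0" and "\<exists>j<M. qform.th p (Suc N) a (h j) \<noteq> 0"
  shows "\<exists>d h. (\<forall>j<M. h j \<in> carrier (poly_ring N) \<and> homogeneous d (h j)) \<and>
    (\<Sum>j<M. emb (b j) * qform.th p N a (h j)) = 0 \<and> (\<exists>j<M. qform.th p N a (h j) \<noteq> 0)"
proof -
  have a': "frob_indep p N a"
    unfolding frob_indep_def
  proof (intro allI impI)
    fix c i assume c: "(\<Sum>i<N. c i ^ p * a i) = 0" and i: "i < N"
    have "(\<Sum>i<Suc N. (if i < N then c i else 0) ^ p * a i) = 0"
      using c p_pos by (simp add: power_0_left)
    from frob_indepD[OF a this, of i] show "c i = 0" using i by simp
  qed
  interpret A': qform p ty "Suc N" a by standard (use N2 a in auto)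
  interpret A: qform p ty N a by standard (use N2 a' in auto)
  define \<rho> where "\<rho> = ev pconst (\<lambda>i. if i = N then 0 else pvar i :: 'a mpoly)"
  have r\<rho>: "rhom \<rho>" unfolding \<rho>_def by (rule rhom_ev[OF rhom_pconst])
  have \<rho>c: "\<rho> (pconst k) = pconst k" for k unfolding \<rho>_def by (rule ev_pconst[OF rhom_pconst])
  have \<rho>v: "\<rho> (pvar i) = (if i = N then 0 else pvar i)" for i unfolding \<rho>_def by (rule ev_pvar[OF rhom_pconst])
  have \<rho>Phi: "\<rho> A'.Phi = A.Phi"
    using p_pos by (simp add: diag_poly_def rhom_simps[OF r\<rho>] \<rho>c \<rho>v power_0_left)
  have hom1: "homogeneous 1 (if i = N then 0 else pvar i :: 'a mpoly)" for i
    using homogeneous_0[of 1] homogeneous_pvar[of i] by auto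
  show ?thesis
    using assms(3-)
  proof (induction d arbitrary: h)
    \<comment> \<open>Forms of degree 0 are constants, and both versions of \<open>th\<close> agree
      on them.\<close>
    case 0
    have "\<rho> f = f" if f: "f \<in> carrier (poly_ring (Suc N))" "homogeneous 0 f" for f :: "'a mpoly"
    proof -
      obtain g where g: "g \<in> carrier (poly_ring (Suc N))" "f = \<rho> f + g * pvar N"
        using specialise_last[OF f(1)] unfolding \<rho>_def by blast
      have "homogeneous (0 * 1) (\<rho> f)" unfolding \<rho>_def using f hom1 by (intro homogeneous_ev[of _ _ "Suc N"]) auto
      then have "homogeneous 0 (f - \<rho> f)" using homogeneous_diff[OF f(2), of "\<rho> f"] by simp
      moreover have fg: "f - \<rho> f = g * pvar N" using g(2) by (simp add: diff_eq_eq add.commute)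
      ultimately have "homogeneous 0 (g * pvar N)" by simp
      then have "g * pvar N = 0" using hom_component_same hom_component_mult_low[OF homogeneous_pvar, of 0 g N] by fastforce
      then show ?thesis using fg by (metis eq_iff_diff_eq_0)
    qed
    note \<rho>id = this
    have hr: "\<rho> (h j) = h j" "h j \<in> carrier (poly_ring N)" if "j < M" for j
      using \<rho>id[of "h j"] specialise_last[of "h j" N] 0(1)[OF that] unfolding \<rho>_def by auto
    have const: "\<exists>k. h j = pconst k" if j: "j < M" for j
    proof -
      have "m = 0" if m: "m \<in> Poly_Mapping.keys (h j)" for m
      proof (rule poly_mapping_eqI)
        fix i
        have "mono_deg m = 0" using 0(1)[OF j] m by (simp add: homogeneous_def)
        then show "Poly_Mapping.lookup m i = Poly_Mapping.lookup 0 i"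
          by (cases "i \<in> Poly_Mapping.keys m") (auto simp: mono_deg_def in_keys_iff)
      qed
      then have "h j = pconst (Poly_Mapping.lookup (h j) 0)"
        unfolding pconst_def by (intro poly_mapping_eqI) (auto simp: lookup_single when_def simp flip: not_in_keys_iff_lookup_eq_zero)
      then show ?thesis by blast
    qed
    have eq: "A'.th (h j) = A.th (h j)" if "j < M" for j
      using const[OF that] by (auto simp: A.th_pconst A'.th_pconst)
    show ?case
      using 0(2,3) 0(1) hr(2) eq by (intro exI[of _ 0] exI[of _ h]) auto
  next
    case (Suc d)
    have rel: "(\<Sum>j<M. pconst (b j) * h j ^ p) \<in> idl (Suc N) A'.Phi"
    proof -
      have "(\<Sum>j<M. pconst (b j) * h j ^ p) \<in> carrier (poly_ring (Suc N))"
        using Suc.prems(1) by (intro PR_intros) auto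
      then show ?thesis using A'.th_diag[of b h M] Suc.prems(2) p_pos by (simp add: A'.idl_iff power_0_left)
    qed
    then obtain q where q: "q \<in> carrier (poly_ring (Suc N))" "(\<Sum>j<M. pconst (b j) * h j ^ p) = q * A'.Phi"
      by (auto simp: idl_def)
    have \<rho>P: "\<rho> f \<in> carrier (poly_ring N)" if "f \<in> carrier (poly_ring (Suc N))" for f
      using specialise_last[OF that] unfolding \<rho>_def by blast
    have "(\<Sum>j<M. pconst (b j) * \<rho> (h j) ^ p) = \<rho> (\<Sum>j<M. pconst (b j) * h j ^ p)"
      by (simp add: rhom_simps[OF r\<rho>] \<rho>c)
    also have "\<dots> = \<rho> q * A.Phi" unfolding q(2) by (simp add: rhom_mult[OF r\<rho>] \<rho>Phi)
    finally have "A.th (\<Sum>j<M. pconst (b j) * \<rho> (h j) ^ p) = 0" by (simp add: rhom_mult[OF A.rhom_th] A.th_Phi)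
    then have rel': "(\<Sum>j<M. emb (b j) * A.th (\<rho> (h j))) = 0" using p_pos by (simp add: A.th_diag)
    have h\<rho>: "homogeneous (Suc d) (\<rho> (h j))" if "j < M" for j
      using homogeneous_ev[of "Suc d" "h j" "Suc N" 1] Suc.prems(1)[OF that] hom1 unfolding \<rho>_def by simp
    show ?case
    proof (cases "\<exists>j<M. A.th (\<rho> (h j)) \<noteq> 0")
      case True
      then show ?thesis using rel' h\<rho> \<rho>P Suc.prems(1) by (intro exI[of _ "Suc d"] exI[of _ "\<lambda>j. \<rho> (h j)"]) auto
    next
      case False
      have "\<exists>h'. h' \<in> carrier (poly_ring (Suc N)) \<and> homogeneous d h' \<and> A'.th (h j) = A'.xi N * A'.th h'" if j: "j < M" for j
      proof -
        obtain g where g: "g \<in> carrier (poly_ring (Suc N))" "h j = \<rho> (h j) + g * pvar N"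
          using specialise_last[of "h j" N] Suc.prems(1)[OF j] unfolding \<rho>_def by blast
        obtain t where t: "t \<in> carrier (poly_ring N)" "\<rho> (h j) = t * A.Phi"
          using A.th_ker[of "\<rho> (h j)"] \<rho>P Suc.prems(1)[OF j] False j by blast
        define t' where "t' = (if Suc d < p then 0 else hom_component (Suc d - p) t)"
        have tt: "\<rho> (h j) = t' * A.Phi"
        proof -
          have "\<rho> (h j) = hom_component (Suc d) (t * A.Phi)"
            using hom_component_same[OF h\<rho>[OF j]] t(2) by simp
          also have "\<dots> = t' * A.Phi"
            using hom_component_mult_low[OF homogeneous_diag[of p N a], of "Suc d" t]
              hom_component_mult_homogeneous[OF homogeneous_diag[of p N a], of "Suc d - p" t]
            by (auto simp: t'_def)
          finally show ?thesis .
        qed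
        have t'P: "t' \<in> carrier (poly_ring (Suc N))"
          unfolding t'_def using hom_component_PR[OF t(1)] PR_mono[of N "Suc N"] by (auto intro: PR_0)
        define g' where "g' = hom_component d g"
        have gg: "h j = \<rho> (h j) + g' * pvar N"
        proof -
          have "h j = hom_component (Suc d) (\<rho> (h j) + g * pvar N)"
            using hom_component_same[of "Suc d" "h j"] Suc.prems(1)[OF j] g(2) by simp
          also have "\<dots> = \<rho> (h j) + g' * pvar N"
            using hom_component_mult_homogeneous[OF homogeneous_pvar, of d g N]
            by (simp add: hom_component_add hom_component_same[OF h\<rho>[OF j]] g'_def)
          finally show ?thesis .
        qed
        \<comment> \<open>The smaller form is the larger one minus \<open>a N\<close> times the p-th
          power of the last variable. So the multiple \<open>t' * A.Phi\<close>, too, is divisible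
          by that variable modulo \<open>A'.Phi\<close>.\<close>
        define h' where "h' = g' - pconst (a N) * t' * pvar N ^ (p - 1)"
        have "h' \<in> carrier (poly_ring (Suc N))"
          unfolding h'_def g'_def using g t'P by (intro PR_intros hom_component_PR) auto
        moreover have "homogeneous d h'"
        proof -
          have "homogeneous d (pconst (a N) * t' * pvar N ^ (p - 1))"
          proof (cases "Suc d < p")
            case True
            then show ?thesis by (simp add: t'_def homogeneous_0)
          next
            case nl: False
            have "homogeneous (0 + (Suc d - p) + (p - 1) * 1) (pconst (a N) * t' * pvar N ^ (p - 1))"
              using nl by (intro homogeneous_mult homogeneous_power homogeneous_pvar homogeneous_pconst)
                (simp add: t'_def homogeneous_hom_component)
            moreover have "0 + (Suc d - p) + (p - 1) * 1 = d" using nl p_pos by linarith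
            ultimately show ?thesis by simp
          qed
          then show ?thesis unfolding h'_def g'_def by (intro homogeneous_diff homogeneous_hom_component)
        qed
        moreover have "A'.th (h j) = A'.xi N * A'.th h'"
        proof -
          have "A.Phi = A'.Phi - pconst (a N) * (pvar N ^ (p - 1) * pvar N)"
            unfolding power_minus_mult[OF p_pos] by (simp add: diag_poly_def)
          then have "t' * A.Phi = t' * (A'.Phi - pconst (a N) * (pvar N ^ (p - 1) * pvar N))" by (simp only:)
          then have "t' * A.Phi + g' * pvar N = t' * A'.Phi + pvar N * h'"
            unfolding h'_def by (simp only: ring_distribs right_diff_distrib left_diff_distrib ac_simps) simp
          then have "h j = t' * A'.Phi + pvar N * h'" using gg tt by simp
          then show ?thesis by (simp add: rhom_simps[OF A'.rhom_th] A'.th_Phi A'.th_pvar)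
        qed
        ultimately show ?thesis by blast
      qed
      then obtain h' where h': "\<And>j. j < M \<Longrightarrow> h' j \<in> carrier (poly_ring (Suc N)) \<and> homogeneous d (h' j) \<and> A'.th (h j) = A'.xi N * A'.th (h' j)"
        by metis
      have "A'.xi N * (\<Sum>j<M. emb (b j) * A'.th (h' j)) = (\<Sum>j<M. emb (b j) * A'.th (h j))"
        unfolding sum_distrib_left using h' by (intro sum.cong) auto
      then have "(\<Sum>j<M. emb (b j) * A'.th (h' j)) = 0" using Suc.prems(2) A'.xi_nz by simp
      moreover have "\<exists>j<M. A'.th (h' j) \<noteq> 0" using Suc.prems(3) h' by force
      ultimately show ?thesis using Suc.IH[of h'] h' by blast
    qed
  qed
qed

lemma restrict_to:
  fixes a :: "nat \<Rightarrow> 'a"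
  assumes "2 \<le> N'" "N' \<le> N" and "frob_indep p N a"
    and "\<And>j. j < M \<Longrightarrow> h j \<in> carrier (poly_ring N) \<and> homogeneous d (h j)"
    and "(\<Sum>j<M. emb (b j) * qform.th p N a (h j)) = 0" and "\<exists>j<M. qform.th p N a (h j) \<noteq> 0"
  shows "frob_indep p N' a \<and> (\<exists>d h. (\<forall>j<M. h j \<in> carrier (poly_ring N') \<and> homogeneous d (h j)) \<and>
    (\<Sum>j<M. emb (b j) * qform.th p N' a (h j)) = 0 \<and> (\<exists>j<M. qform.th p N' a (h j) \<noteq> 0))"
  using assms(2-)
proof (induction N arbitrary: h d rule: dec_induct)
  case base
  then show ?case by blast
next
  case (step N)
  have a': "frob_indep p N a"
    unfolding frob_indep_def
  proof (intro allI impI)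
    fix c i assume c: "(\<Sum>i<N. c i ^ p * a i) = 0" and i: "i < N"
    have "(\<Sum>i<Suc N. (if i < N then c i else 0) ^ p * a i) = 0"
      using c p_pos by (simp add: power_0_left)
    from frob_indepD[OF step.prems(1) this, of i] show "c i = 0" using i by simp
  qed
  have "2 \<le> N" using assms(1) step.hyps by simp
  from restrict_step[OF this step.prems] obtain d' h' where
    "\<forall>j<M. h' j \<in> carrier (poly_ring N) \<and> homogeneous d' (h' j)"
    "(\<Sum>j<M. emb (b j) * qform.th p N a (h' j)) = 0" "\<exists>j<M. qform.th p N a (h' j) \<noteq> 0" by blast
  then show ?case using step.IH[OF a', of h' d'] by blast
qed

end

section \<open>The inverse rational map\<close>

context qmap
begin

text \<open>Identities on the target are tested after \<open>psi\<close>, which is injective modulo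
  \<open>B.Phi\<close> by \<open>psi_iff\<close>. There \<open>k i\<close> becomes a multiple of
  \<open>xi i\<close> by construction, and the composite \<open>K (h j)\<close> a multiple of
  \<open>w j\<close>.\<close>

lemma rmap_inverse:
  "\<exists>k e. e > 0 \<and> rmap p N b N a e k \<and> (\<exists>z. z \<noteq> 0 \<and> (\<forall>i<N. th (ev pconst h (k i)) = z * xi i)) \<and>
    (\<exists>z. z \<noteq> 0 \<and> (\<forall>j<N. B.th (ev pconst k (h j)) = z * B.xi j))"
proof -
  obtain k e z where e: "e > 0" and z: "z \<noteq> 0"
    and k: "\<And>i. i < N \<Longrightarrow> k i \<in> PN" "\<And>i. i < N \<Longrightarrow> homogeneous e (k i)" "\<And>i. i < N \<Longrightarrow> psi (k i) = z * xi i"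
    using homogeneous_inverse by blast
  have k_nz: "B.th (k 0) \<noteq> 0"
    using psi_iff[OF k(1)[OF N0]] k(3)[OF N0] z xi_nz by simp
  have rel: "(\<Sum>i<N. emb (a i) * B.th (k i)) = 0"
  proof -
    have S: "(\<Sum>i<N. pconst (a i) * k i ^ p) \<in> PN" using k(1) by (intro PR_intros) auto
    have "H (\<Sum>i<N. pconst (a i) * k i ^ p) = (\<Sum>i<N. pconst (a i) * H (k i) ^ p)"
      by (simp add: rhom_simps[OF rhom_H] H_pconst)
    then have "psi (\<Sum>i<N. pconst (a i) * k i ^ p) = (\<Sum>i<N. emb (a i) * psi (k i)) ^ p"
      unfolding psi_def using th_diag by simp
    also have "(\<Sum>i<N. emb (a i) * psi (k i)) = z * emb (a 0) * (\<Sum>i<N. emb (r i) * xi i)"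
      unfolding sum_distrib_left
    proof (rule sum.cong[OF refl])
      fix i assume "i \<in> {..<N}"
      moreover have "emb (a i) = emb (a 0) * emb (r i)"
        using a0 by (simp add: r_def flip: rhom_mult[OF rhom_emb])
      ultimately show "emb (a i) * psi (k i) = z * emb (a 0) * (emb (r i) * xi i)"
        using k(3) by (simp add: ac_simps)
    qed
    finally have "psi (\<Sum>i<N. pconst (a i) * k i ^ p) = 0" using sum_xi p_pos by (simp add: power_0_left)
    then have "B.th (\<Sum>i<N. pconst (a i) * k i ^ p) = 0" using psi_iff[OF S] by simp
    then show ?thesis using B.th_diag[of a k N] by simp
  qed
  define K where "K = ev pconst k"
  have rK: "rhom K" unfolding K_def by (rule rhom_ev[OF rhom_pconst])
  have K_PN: "f \<in> PN \<Longrightarrow> K f \<in> PN" for f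
    unfolding K_def by (rule ev_pconst_PR[of f N k, OF _ k(1)])
  have HK: "H (K f) = ev pconst (\<lambda>i. H (k i)) f" if "f \<in> PN" for f
    using rhom_comp[OF rK rhom_H] rhom_ev[OF rhom_pconst] _ _ that
    by (rule rhom_eq_on_PR) (simp_all add: K_def ev_pconst[OF rhom_pconst] ev_pvar[OF rhom_pconst] H_pconst)
  have psiK: "psi (K (h j)) = z ^ d * w j" if "j < N" for j
    unfolding psi_def HK[OF h_PN[OF that]] w_def
    by (rule th_scale[OF h_PN[OF that] h_hom[OF that]]) (simp add: k(3) flip: psi_def)
  have "B.th (K (h j)) * B.xi 0 = B.th (K (h 0)) * B.xi j" if j: "j < N" for j
  proof -
    define f where "f = K (h j) * pvar 0 - K (h 0) * pvar j"
    have f: "f \<in> PN" unfolding f_def using j N0 h_PN by (intro PR_intros K_PN) auto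
    have pv: "psi (pvar i) = w i" for i by (simp add: psi_def H_pvar w_def)
    have "psi f = 0" unfolding f_def using psiK[OF j] psiK[OF N0] by (simp add: rhom_simps[OF rhom_psi] pv)
    then have "B.th f = 0" using psi_iff[OF f] by simp
    then show ?thesis unfolding f_def by (simp add: rhom_simps[OF B.rhom_th] B.th_pvar)
  qed
  then have "B.th (K (h j)) = B.th (K (h 0)) / B.xi 0 * B.xi j" if "j < N" for j
    using that B.xi_nz by (simp add: field_simps)
  moreover have "B.th (K (h 0)) / B.xi 0 \<noteq> 0"
    using psi_iff[OF K_PN[OF h_PN[OF N0]]] psiK[OF N0] z w_nz[OF N0] B.xi_nz by simp
  ultimately have "\<exists>z. z \<noteq> 0 \<and> (\<forall>j<N. B.th (K (h j)) = z * B.xi j)" by blast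
  moreover have "rmap p N b N a e k"
    unfolding rmap_def using k rel k_nz N0 by blast
  moreover have "\<forall>i<N. th (ev pconst h (k i)) = z * xi i"
    using k(3) unfolding psi_def H_def by simp
  ultimately show ?thesis using e z unfolding K_def by blast
qed

end

context char_p
begin

text \<open>Multiplying all coordinates by a power of \<open>pvar 0\<close> leaves the map
  unchanged; the exponent (p - 1) * d + 1 makes the degree p * d + 1.\<close>

lemma rmap_multiple:
  fixes a b :: "nat \<Rightarrow> 'a"
  assumes "2 \<le> N" "frob_indep p N a" "rmap p N a M b d h"
  shows "\<exists>d h. rmap p N a M b d h \<and> d > 0 \<and> of_nat d = (1::'a)"
proof -
  interpret A: qform p ty N a by standard (use assms in auto)
  define h' where "h' j = pvar 0 ^ ((p - 1) * d + 1) * h j" for j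
  have th: "A.th (h' j) = A.xi 0 ^ ((p - 1) * d + 1) * A.th (h j)" for j
    by (simp only: h'_def rhom_mult[OF A.rhom_th] rhom_power[OF A.rhom_th] A.th_pvar)
  have deg: "((p - 1) * d + 1) * 1 + d = p * d + 1"
    using p_pos by (cases p) auto
  have "(\<Sum>j<M. emb (b j) * A.th (h' j)) = A.xi 0 ^ ((p - 1) * d + 1) * (\<Sum>j<M. emb (b j) * A.th (h j))"
    unfolding sum_distrib_left th by (simp only: ac_simps)
  then have "(\<Sum>j<M. emb (b j) * A.th (h' j)) = 0" using assms(3) by (simp add: rmap_def)
  moreover have "h' j \<in> carrier (poly_ring N) \<and> homogeneous (p * d + 1) (h' j)" if "j < M" for j
  proof -
    have "h j \<in> carrier (poly_ring N)" "homogeneous d (h j)" using assms(3) that by (auto simp: rmap_def)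
    then have "homogeneous (((p - 1) * d + 1) * 1 + d) (h' j)" unfolding h'_def
      by (intro homogeneous_mult homogeneous_power homogeneous_pvar)
    moreover have "h' j \<in> carrier (poly_ring N)" unfolding h'_def using assms(1) \<open>h j \<in> _\<close>
      by (intro PR_mult PR_power PR_pvar) auto
    ultimately show ?thesis unfolding deg by blast
  qed
  moreover have "\<exists>j<M. A.th (h' j) \<noteq> 0" using assms(3) A.xi_nz unfolding th by (auto simp: rmap_def)
  ultimately have "rmap p N a M b (p * d + 1) h'" unfolding rmap_def by blast
  moreover have "of_nat (p * d + 1) = (1::'a)" using char_a of_nat_CHAR[where 'a = 'a] by simp
  ultimately show ?thesis by (intro exI[of _ "p * d + 1"] exI[of _ h']) simp
qed

theorem rmap_birational:
  fixes a b :: "nat \<Rightarrow> 'a"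
  assumes "2 \<le> N" "N = p ^ n + 1" "frob_indep p N a" "frob_indep p N b" "rmap p N a N b d h"
  shows "\<exists>d h e k. d > 0 \<and> e > 0 \<and> rmap p N a N b d h \<and> rmap p N b N a e k \<and>
    (\<exists>z. z \<noteq> 0 \<and> (\<forall>i<N. qform.th p N a (ev pconst h (k i)) = z * qform.xi N a i)) \<and>
    (\<exists>z. z \<noteq> 0 \<and> (\<forall>j<N. qform.th p N b (ev pconst k (h j)) = z * qform.xi N b j))"
proof -
  obtain d h where dh: "rmap p N a N b d h" "d > 0" "of_nat d = (1::'a)"
    using rmap_multiple[OF assms(1,3,5)] by blast
  interpret qmap p ty N a b d h n
    by unfold_locales (use assms(1-4) dh in auto)
  show ?thesis using rmap_inverse dh(1,2) by blast
qed

text \<open>The linear section of the source by its first M coordinates has the dimension of the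
  target. The map is restricted to it and inverted there, and the inverse is padded with zeros,
  since the section lies in the source.\<close>

theorem rmap_reverse:
  fixes a b :: "nat \<Rightarrow> 'a"
  assumes "2 \<le> M" "M = p ^ n + 1" "M \<le> N" "frob_indep p N a" "frob_indep p M b" "rmap p N a M b d h"
  shows "\<exists>e k. e > 0 \<and> rmap p M b N a e k"
proof -
  have a: "frob_indep p M a" and "\<exists>d h. rmap p M a M b d h"
    using restrict_to[OF assms(1,3,4), of M h d b] assms(6) unfolding rmap_def by blast+
  then obtain e k where k: "e > 0" "rmap p M b M a e k"
    using rmap_birational[OF assms(1,2) a assms(5)] by blast
  interpret B: qform p ty M b by standard (use assms in auto)
  define k' where "k' i = (if i < M then k i else 0)" for i
  have "(\<Sum>i<N. emb (a i) * B.th (k' i)) = (\<Sum>i<M. emb (a i) * B.th (k' i))"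
    using assms(3) by (intro sum.mono_neutral_right) (auto simp: k'_def rhom_0[OF B.rhom_th])
  also have "\<dots> = (\<Sum>i<M. emb (a i) * B.th (k i))" by (intro sum.cong) (auto simp: k'_def)
  finally have "(\<Sum>i<N. emb (a i) * B.th (k' i)) = 0" using k(2) by (simp add: rmap_def)
  moreover have "\<exists>i<N. B.th (k' i) \<noteq> 0" using k(2) assms(3) by (force simp: rmap_def k'_def)
  moreover have "k' i \<in> carrier (poly_ring M) \<and> homogeneous e (k' i)" for i
    using k(2) by (auto simp: rmap_def k'_def PR_0 homogeneous_0)
  ultimately have "rmap p M b N a e k'" unfolding rmap_def by blast
  then show ?thesis using k(1) by blast
qed

end

section \<open>Points, germs and sections\<close>

lemma PR_simps:
  "x \<otimes>\<^bsub>poly_ring N\<^esub> y = x * y" "x \<oplus>\<^bsub>poly_ring N\<^esub> y = x + y"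
  "\<one>\<^bsub>poly_ring N\<^esub> = 1" "\<zero>\<^bsub>poly_ring N\<^esub> = 0"
  by (simp_all add: poly_ring_def)

lemma cring_PR: "cring (poly_ring N :: 'a::field mpoly ring)"
proof (rule cringI)
  show "abelian_group (poly_ring N :: 'a mpoly ring)"
  proof (rule abelian_groupI)
    fix x :: "'a mpoly" assume "x \<in> carrier (poly_ring N)"
    then show "\<exists>y\<in>carrier (poly_ring N). y \<oplus>\<^bsub>poly_ring N\<^esub> x = \<zero>\<^bsub>poly_ring N\<^esub>"
      by (intro bexI[of _ "- x"] PR_uminus) (auto simp: PR_simps)
  qed (auto simp: PR_simps PR_0 PR_add ac_simps)
  show "comm_monoid (poly_ring N :: 'a mpoly ring)"
    by (rule comm_monoidI) (auto simp: PR_simps PR_1 PR_mult ac_simps)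
qed (auto simp: PR_simps distrib_right)

lemma primeideal_iff:
  fixes P :: "'a::field mpoly set"
  shows "primeideal P (poly_ring N) \<longleftrightarrow> P \<subseteq> carrier (poly_ring N) \<and> 0 \<in> P \<and> (\<forall>f\<in>P. \<forall>g\<in>P. f + g \<in> P) \<and>
    (\<forall>f\<in>carrier (poly_ring N). \<forall>g\<in>P. f * g \<in> P) \<and> 1 \<notin> P \<and>
    (\<forall>f\<in>carrier (poly_ring N). \<forall>g\<in>carrier (poly_ring N). f * g \<in> P \<longrightarrow> f \<in> P \<or> g \<in> P)"
  (is "?L \<longleftrightarrow> ?R")
proof
  assume ?L
  then interpret primeideal P "poly_ring N" .
  have "1 \<notin> P"
  proof
    assume "1 \<in> P"
    then have "P = carrier (poly_ring N)" using one_imp_carrier by (simp add: PR_simps)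
    then show False using I_notcarr by simp
  qed
  moreover have "P \<subseteq> carrier (poly_ring N)" using a_subset .
  moreover have "0 \<in> P" using additive_subgroup.zero_closed[OF additive_subgroup_axioms] by (simp add: PR_simps)
  moreover have "f + g \<in> P" if "f \<in> P" "g \<in> P" for f g using additive_subgroup.a_closed[OF additive_subgroup_axioms that] by (simp add: PR_simps)
  moreover have "f * g \<in> P" if "f \<in> carrier (poly_ring N)" "g \<in> P" for f g
    using I_l_closed[OF that(2,1)] by (simp add: PR_simps)
  moreover have "f \<in> P \<or> g \<in> P" if "f \<in> carrier (poly_ring N)" "g \<in> carrier (poly_ring N)" "f * g \<in> P" for f g
    using I_prime[OF that(1,2)] that(3) by (simp add: PR_simps)
  ultimately show ?R by (intro conjI ballI impI) auto
next
  assume R: ?R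
  interpret R: cring "poly_ring N :: 'a mpoly ring" by (rule cring_PR)
  have neg: "\<ominus>\<^bsub>poly_ring N\<^esub> x = - x" if "x \<in> carrier (poly_ring N)" for x :: "'a mpoly"
    by (rule R.minus_equality) (use that PR_uminus in \<open>auto simp: PR_simps\<close>)
  have ml: "x * a \<in> P" and mr: "a * x \<in> P" if "a \<in> P" "x \<in> carrier (poly_ring N)" for a x
    using R that by (auto simp: mult.commute[of a x])
  have um: "- x \<in> P" if "x \<in> P" for x
  proof -
    have "(- 1) * x \<in> P" using R that PR_uminus[OF PR_1, of N] by blast
    then show ?thesis by simp
  qed
  have "subgroup P (add_monoid (poly_ring N))"
  proof (rule subgroup.intro)
    fix x assume x: "x \<in> P"
    then have "x \<in> carrier (poly_ring N)" using R by blast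
    then have "inv\<^bsub>add_monoid (poly_ring N)\<^esub> x = - x" using neg[of x] by (simp add: a_inv_def)
    then show "inv\<^bsub>add_monoid (poly_ring N)\<^esub> x \<in> P" using um[OF x] by simp
  qed (use R in \<open>auto simp: PR_simps\<close>)
  then have "ideal P (poly_ring N)"
    by (rule idealI[OF R.ring_axioms]) (use ml mr in \<open>auto simp: PR_simps\<close>)
  moreover have "carrier (poly_ring N) \<noteq> P" using R PR_1[of N] by blast
  ultimately show ?L
    by (rule primeidealI[OF _ cring_PR]) (use R in \<open>auto simp: PR_simps\<close>)
qed

lemma PIdl_eq: "PIdl\<^bsub>poly_ring N\<^esub> F = idl N F"
  by (auto simp: cgenideal_def idl_def PR_simps)

lemma topspace_proj_topo: "topspace (proj_topo N F0) = proj_points N F0"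
proof -
  have "1 \<notin> P" if "P \<in> proj_points N F0" for P using that by (simp add: proj_points_def primeideal_iff)
  then have "{P \<in> proj_points N F0. 1 \<notin> P} = proj_points N F0" by blast
  moreover have "{P \<in> proj_points N F0. 1 \<notin> P} \<in> {{P \<in> proj_points N F0. g \<notin> P} | g d. g \<in> carrier (poly_ring N) \<and> homogeneous d g}"
    using PR_1[of N] homogeneous_1 by blast
  ultimately show ?thesis unfolding proj_topo_def topology_generated_by_topspace by auto
qed

lemma openin_proj_basic:
  "g \<in> carrier (poly_ring N) \<Longrightarrow> homogeneous d g \<Longrightarrow> openin (proj_topo N F0) {P \<in> proj_points N F0. g \<notin> P}"
  unfolding proj_topo_def by (rule topology_generated_by_Basis) blast

text \<open>A prime contained in \<open>P\<close> avoids every polynomial that \<open>P\<close>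
  avoids, and this passes from basic open sets to all open sets.\<close>

lemma open_generalization:
  assumes "openin (proj_topo N F0) U" "P \<in> U" "Q \<in> proj_points N F0" "Q \<subseteq> P" shows "Q \<in> U"
proof -
  have "generate_topology_on {{P \<in> proj_points N F0. g \<notin> P} | g d. g \<in> carrier (poly_ring N) \<and> homogeneous d g} U"
    using assms(1) unfolding proj_topo_def by (rule openin_topology_generated_by)
  then show ?thesis using assms(2-) by (induction U) blast+
qed

lemma open_sub_topspace: "open_sub A (topspace (topo A)) = A"
  by (simp add: open_sub_def)

lemma open_sub_simps [simp]: "topo (open_sub A U) = subtopology (topo A) U"
  "sections (open_sub A U) = sections A" "const (open_sub A U) = const A"
  by (simp_all add: open_sub_def)

lemma proj_hypersurface_simps [simp]: "topo (proj_hypersurface N F0) = proj_topo N F0"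
  "sections (proj_hypersurface N F0) = proj_sections N F0"
  "const (proj_hypersurface N F0) U c = (\<lambda>P\<in>U. germ N F0 P (pconst c, 1))"
  by (simp_all add: proj_hypersurface_def)

lemma one_frac: "P \<in> proj_points N F0 \<Longrightarrow> g \<in> carrier (poly_ring N) \<Longrightarrow> homogeneous 0 g \<Longrightarrow> (g, 1) \<in> proj_fracs N P"
  using PR_1[of N] homogeneous_1 by (auto simp: proj_fracs_def proj_points_def primeideal_iff)

context qform
begin

section \<open>Points of the hypersurface, with the generic point \<open>eta\<close>\<close>

abbreviation "X \<equiv> proj_points N Phi"
abbreviation "TX \<equiv> proj_topo N Phi"
abbreviation "HX \<equiv> proj_hypersurface N Phi"
abbreviation "eta \<equiv> idl N Phi"

lemma pt:
  assumes "P \<in> X"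
  shows pt_PN: "f \<in> P \<Longrightarrow> f \<in> PN" and pt_0: "0 \<in> P" and pt_add: "f \<in> P \<Longrightarrow> g \<in> P \<Longrightarrow> f + g \<in> P"
    and pt_mult: "f \<in> PN \<Longrightarrow> g \<in> P \<Longrightarrow> f * g \<in> P" and pt_1: "1 \<notin> P"
    and pt_prime: "f \<in> PN \<Longrightarrow> g \<in> PN \<Longrightarrow> f * g \<in> P \<longleftrightarrow> f \<in> P \<or> g \<in> P"
    and pt_hom: "f \<in> P \<Longrightarrow> hom_component e f \<in> P" and pt_Phi: "Phi \<in> P"
proof -
  have P: "P \<subseteq> PN \<and> 0 \<in> P \<and> (\<forall>f\<in>P. \<forall>g\<in>P. f + g \<in> P) \<and> (\<forall>f\<in>PN. \<forall>g\<in>P. f * g \<in> P) \<and> 1 \<notin> P \<and>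
    (\<forall>f\<in>PN. \<forall>g\<in>PN. f * g \<in> P \<longrightarrow> f \<in> P \<or> g \<in> P)" "\<forall>f\<in>P. \<forall>e. hom_component e f \<in> P" "Phi \<in> P"
    using assms unfolding proj_points_def primeideal_iff by blast+
  show "f \<in> P \<Longrightarrow> f \<in> PN" "0 \<in> P" "f \<in> P \<Longrightarrow> g \<in> P \<Longrightarrow> f + g \<in> P" "f \<in> PN \<Longrightarrow> g \<in> P \<Longrightarrow> f * g \<in> P"
    "1 \<notin> P" "f \<in> P \<Longrightarrow> hom_component e f \<in> P" "Phi \<in> P" using P by blast+
  have "f * g \<in> P" if "f \<in> P" "g \<in> PN" using P that mult.commute[of f g] by metis
  then show "f \<in> PN \<Longrightarrow> g \<in> PN \<Longrightarrow> f * g \<in> P \<longleftrightarrow> f \<in> P \<or> g \<in> P" using P by blast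
qed

lemma pt_th: "P \<in> X \<Longrightarrow> f \<in> PN \<Longrightarrow> th f = 0 \<Longrightarrow> f \<in> P"
  using th_ker[of f] pt_mult[OF _ _ pt_Phi] by blast

lemma pt_th_nz: "P \<in> X \<Longrightarrow> f \<in> PN \<Longrightarrow> f \<notin> P \<Longrightarrow> th f \<noteq> 0"
  using pt_th by blast

lemma eta_subset: "P \<in> X \<Longrightarrow> eta \<subseteq> P"
  using pt_mult[OF _ _ pt_Phi] by (auto simp: idl_def)

lemma eta_iff: "f \<in> eta \<longleftrightarrow> f \<in> PN \<and> th f = 0"
  using idl_iff[of f] idl_PN[of f] by blast

lemma eta_X: "eta \<in> X"
proof -
  have "primeideal eta (poly_ring N)"
    unfolding primeideal_iff eta_iff
    by (auto simp: eta_iff rhom_simps[OF rhom_th] intro: PR_intros)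
  moreover have "\<forall>f\<in>eta. \<forall>e. hom_component e f \<in> eta"
    using th_hom_component hom_component_PR by (auto simp: eta_iff)
  moreover have "Phi \<in> eta" using Phi_PN th_Phi by (simp add: eta_iff)
  moreover have "pvar 0 \<notin> eta" using xi_nz by (simp add: eta_iff th_pvar)
  ultimately show ?thesis using N2 unfolding proj_points_def by (auto intro!: exI[of _ 0])
qed

lemma open_X: "openin TX U \<Longrightarrow> U \<subseteq> X"
  using openin_subset[of TX U] by (simp add: topspace_proj_topo)

lemma eta_open: "openin TX U \<Longrightarrow> U \<noteq> {} \<Longrightarrow> eta \<in> U"
  using open_generalization[OF _ _ eta_X] eta_subset open_X by blast

text \<open>The germ at \<open>P\<close> with value \<open>v\<close> in the function field.\<close>

definition gm :: "'a mpoly set \<Rightarrow> 'a mpoly fract \<Rightarrow> 'a germ" where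
  "gm P v = {(g, h) \<in> proj_fracs N P. th g = v * th h}"

text \<open>An empty set of fractions at \<open>P\<close> means that \<open>v\<close> does not come
  from the local ring at \<open>P\<close>.\<close>

definition reg :: "'a mpoly set set \<Rightarrow> 'a mpoly fract set" where
  "reg U = {v. \<forall>P\<in>U. gm P v \<noteq> {}}"

definition sec :: "'a mpoly set set \<Rightarrow> 'a mpoly fract \<Rightarrow> 'a mpoly set \<Rightarrow> 'a germ" where
  "sec U v = (\<lambda>P\<in>U. gm P v)"

lemma frac_nz: "P \<in> X \<Longrightarrow> (g, h) \<in> proj_fracs N P \<Longrightarrow> th h \<noteq> 0"
  using pt_th_nz by (auto simp: proj_fracs_def)

text \<open>The map \<open>th\<close> embeds F[x]/(Phi) into a field, so that the auxiliary factor
  \<open>t\<close> cancels and two fractions have the same germ exactly if they have the same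
  value.\<close>

lemma germ_gm:
  assumes P: "P \<in> X" and f: "(g, h) \<in> proj_fracs N P" shows "germ N Phi P (g, h) = gm P (th g / th h)"
proof -
  have "(\<exists>t d. t \<in> PN \<and> homogeneous d t \<and> t \<notin> P \<and> t * (g * h' - g' * h) \<in> eta) \<longleftrightarrow> th g' = th g / th h * th h'"
    if f': "(g', h') \<in> proj_fracs N P" for g' h'
  proof -
    have F: "g * h' - g' * h \<in> PN" using f f' by (auto simp: proj_fracs_def intro!: PR_intros)
    have th0: "th (g * h' - g' * h) = 0 \<longleftrightarrow> th g' = th g / th h * th h'"
      using frac_nz[OF P f] by (auto simp: rhom_simps[OF rhom_th] field_simps)
    show ?thesis
    proof
      assume "\<exists>t d. t \<in> PN \<and> homogeneous d t \<and> t \<notin> P \<and> t * (g * h' - g' * h) \<in> eta"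
      then obtain t where t: "t \<in> PN" "t \<notin> P" "th (t * (g * h' - g' * h)) = 0" by (auto simp: eta_iff)
      then have "th (g * h' - g' * h) = 0" using pt_th_nz[OF P] by (simp add: rhom_mult[OF rhom_th])
      then show "th g' = th g / th h * th h'" using th0 by blast
    next
      assume "th g' = th g / th h * th h'"
      then have "1 * (g * h' - g' * h) \<in> eta" using th0 F by (simp add: eta_iff)
      then show "\<exists>t d. t \<in> PN \<and> homogeneous d t \<and> t \<notin> P \<and> t * (g * h' - g' * h) \<in> eta"
        using PR_1 homogeneous_1 pt_1[OF P] by blast
    qed
  qed
  then show ?thesis unfolding germ_def gm_def PIdl_eq by auto
qed

lemma gmD: "P \<in> X \<Longrightarrow> (g, h) \<in> gm P v \<Longrightarrow> (g, h) \<in> proj_fracs N P \<and> th h \<noteq> 0 \<and> v = th g / th h"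
  using frac_nz[of P g h] by (auto simp: gm_def)

lemma gm_frac: "P \<in> X \<Longrightarrow> (g, h) \<in> proj_fracs N P \<Longrightarrow> (g, h) \<in> gm P (th g / th h)"
  using frac_nz[of P g h] by (auto simp: gm_def)

lemma gm_inj: "P \<in> X \<Longrightarrow> gm P u = gm P v \<Longrightarrow> gm P u \<noteq> {} \<Longrightarrow> u = v"
proof -
  assume P: "P \<in> X" and eq: "gm P u = gm P v" "gm P u \<noteq> {}"
  then obtain g h where "(g, h) \<in> gm P u" "(g, h) \<in> gm P v" by fast
  then show "u = v" using gmD[OF P] by metis
qed

lemma frac_add: "(g, h) \<in> proj_fracs N P \<Longrightarrow> (g', h') \<in> proj_fracs N P \<Longrightarrow> P \<in> X \<Longrightarrow> (g * h' + g' * h, h * h') \<in> proj_fracs N P"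
  and frac_mult: "(g, h) \<in> proj_fracs N P \<Longrightarrow> (g', h') \<in> proj_fracs N P \<Longrightarrow> P \<in> X \<Longrightarrow> (g * g', h * h') \<in> proj_fracs N P"
proof -
  assume f: "(g, h) \<in> proj_fracs N P" and f': "(g', h') \<in> proj_fracs N P" and P: "P \<in> X"
  obtain d e where d: "homogeneous d g" "homogeneous d h" "homogeneous e g'" "homogeneous e h'"
    using f f' unfolding proj_fracs_def by blast
  have c: "g \<in> PN" "h \<in> PN" "g' \<in> PN" "h' \<in> PN" "h \<notin> P" "h' \<notin> P" using f f' by (auto simp: proj_fracs_def)
  have "h * h' \<notin> P" "h * h' \<in> PN" using c pt_prime[OF P] PR_mult by auto
  moreover have "homogeneous (d + e) (h * h')" "homogeneous (d + e) (g * g')" "homogeneous (d + e) (g * h' + g' * h)"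
    using homogeneous_mult[OF d(2,4)] homogeneous_mult[OF d(1,3)] homogeneous_add[OF homogeneous_mult[OF d(1,4)], of "g' * h"]
      homogeneous_mult[OF d(3,2)] by (auto simp: add.commute)
  moreover have "g * g' \<in> PN" "g * h' + g' * h \<in> PN" using c by (auto intro: PR_intros)
  ultimately show "(g * h' + g' * h, h * h') \<in> proj_fracs N P" "(g * g', h * h') \<in> proj_fracs N P"
    unfolding proj_fracs_def by blast+
qed

lemma gm_add_rep: "P \<in> X \<Longrightarrow> (g, h) \<in> gm P u \<Longrightarrow> (g', h') \<in> gm P v \<Longrightarrow> (g * h' + g' * h, h * h') \<in> gm P (u + v)"
  and gm_mult_rep: "P \<in> X \<Longrightarrow> (g, h) \<in> gm P u \<Longrightarrow> (g', h') \<in> gm P v \<Longrightarrow> (g * g', h * h') \<in> gm P (u * v)"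
  using frac_add[of g h P g' h'] frac_mult[of g h P g' h']
  by (auto simp: gm_def rhom_simps[OF rhom_th] algebra_simps)

lemma gm_const: "P \<in> X \<Longrightarrow> (pconst c, 1) \<in> gm P (emb (c ^ p))"
  using one_frac[OF _ PR_pconst homogeneous_pconst]
  by (simp add: gm_def th_pconst rhom_1[OF rhom_th])

lemma gm_1: "P \<in> X \<Longrightarrow> (1, 1) \<in> gm P 1" and gm_0: "P \<in> X \<Longrightarrow> (0, 1) \<in> gm P 0"
  using one_frac[OF _ PR_1 homogeneous_1] one_frac[OF _ PR_0 homogeneous_0]
  by (auto simp: gm_def rhom_0[OF rhom_th])

lemma germ_const: "P \<in> X \<Longrightarrow> germ N Phi P (pconst c, 1) = gm P (emb (c ^ p))"
  and germ_1: "P \<in> X \<Longrightarrow> germ N Phi P (1, 1) = gm P 1"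
  using germ_gm[of P "pconst c" 1] germ_gm[of P 1 1] gm_const[of P c] gm_1[of P] gmD[of P]
  by metis+

lemma germ_add_gm:
  assumes P: "P \<in> X" and u: "gm P u \<noteq> {}" and v: "gm P v \<noteq> {}"
  shows "germ_add N Phi P (gm P u) (gm P v) = gm P (u + v)"
proof -
  have "germ N Phi P (g * h' + g' * h, h * h') = gm P (u + v)"
    if "(g, h) \<in> gm P u" "(g', h') \<in> gm P v" for g h g' h'
    using gmD[OF P gm_add_rep[OF P that]] germ_gm[OF P] by metis
  then have "germ_add N Phi P (gm P u) (gm P v) = (\<Union>x\<in>gm P u. \<Union>y\<in>gm P v. gm P (u + v))"
    unfolding germ_add_def by (intro SUP_cong refl) (auto split: prod.split)
  then show ?thesis using u v by simp
qed

lemma germ_mult_gm: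
  assumes P: "P \<in> X" and u: "gm P u \<noteq> {}" and v: "gm P v \<noteq> {}"
  shows "germ_mult N Phi P (gm P u) (gm P v) = gm P (u * v)"
proof -
  have "germ N Phi P (g * g', h * h') = gm P (u * v)"
    if "(g, h) \<in> gm P u" "(g', h') \<in> gm P v" for g h g' h'
    using gmD[OF P gm_mult_rep[OF P that]] germ_gm[OF P] by metis
  then have "germ_mult N Phi P (gm P u) (gm P v) = (\<Union>x\<in>gm P u. \<Union>y\<in>gm P v. gm P (u * v))"
    unfolding germ_mult_def by (intro SUP_cong refl) (auto split: prod.split)
  then show ?thesis using u v by simp
qed

lemma reg_add: "U \<subseteq> X \<Longrightarrow> u \<in> reg U \<Longrightarrow> v \<in> reg U \<Longrightarrow> u + v \<in> reg U"
  and reg_mult: "U \<subseteq> X \<Longrightarrow> u \<in> reg U \<Longrightarrow> v \<in> reg U \<Longrightarrow> u * v \<in> reg U"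
proof -
  assume U: "U \<subseteq> X" and uv: "u \<in> reg U" "v \<in> reg U"
  have "gm P (u + v) \<noteq> {} \<and> gm P (u * v) \<noteq> {}" if P: "P \<in> U" for P
  proof -
    obtain g h g' h' where "(g, h) \<in> gm P u" "(g', h') \<in> gm P v" using uv P unfolding reg_def by fast
    then show ?thesis using gm_add_rep[of P] gm_mult_rep[of P] U P by blast
  qed
  then show "u + v \<in> reg U" "u * v \<in> reg U" by (auto simp: reg_def)
qed

lemma reg_const: "U \<subseteq> X \<Longrightarrow> emb (c ^ p) \<in> reg U" and reg_1: "U \<subseteq> X \<Longrightarrow> 1 \<in> reg U" and reg_0: "U \<subseteq> X \<Longrightarrow> 0 \<in> reg U"
  using gm_const gm_1 gm_0 by (fastforce simp: reg_def)+

lemma reg_mono: "W \<subseteq> U \<Longrightarrow> v \<in> reg U \<Longrightarrow> v \<in> reg W"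
  by (auto simp: reg_def)

lemma sec_restrict: "W \<subseteq> U \<Longrightarrow> restrict (sec U v) W = sec W v"
  by (auto simp: sec_def fun_eq_iff)

lemma sec_empty: "sec {} u = sec {} v"
  by (simp add: sec_def restrict_def)

lemma sec_add: "U \<subseteq> X \<Longrightarrow> u \<in> reg U \<Longrightarrow> v \<in> reg U \<Longrightarrow> sec U u \<oplus>\<^bsub>proj_sections N Phi U\<^esub> sec U v = sec U (u + v)"
  and sec_mult: "U \<subseteq> X \<Longrightarrow> u \<in> reg U \<Longrightarrow> v \<in> reg U \<Longrightarrow> sec U u \<otimes>\<^bsub>proj_sections N Phi U\<^esub> sec U v = sec U (u * v)"
  and sec_1: "U \<subseteq> X \<Longrightarrow> \<one>\<^bsub>proj_sections N Phi U\<^esub> = sec U 1"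
  and sec_const: "U \<subseteq> X \<Longrightarrow> const HX U c = sec U (emb (c ^ p))"
  unfolding sec_def proj_sections_def
  by (auto simp: fun_eq_iff reg_def restrict_def germ_1 germ_const subset_iff germ_add_gm germ_mult_gm)

lemma sec_inj: "openin TX U \<Longrightarrow> U \<noteq> {} \<Longrightarrow> u \<in> reg U \<Longrightarrow> sec U u = sec U v \<Longrightarrow> u = v"
proof -
  assume U: "openin TX U" "U \<noteq> {}" and u: "u \<in> reg U" and eq: "sec U u = sec U v"
  have e: "eta \<in> U" using eta_open U by blast
  then have "gm eta u \<noteq> {}" using u by (simp add: reg_def)
  moreover have "gm eta u = gm eta v" using e fun_cong[OF eq, of eta] by (simp add: sec_def)
  ultimately show "u = v" using gm_inj[OF eta_X] by blast
qed

text \<open>All open sets on which a section is a single fraction contain \<open>eta\<close>, and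
  the values of these fractions must agree there. Conversely, a fraction for \<open>v\<close> at
  \<open>P\<close> remains one wherever its denominator does not vanish.\<close>

lemma carrier_sections: assumes U: "openin TX U" shows "carrier (proj_sections N Phi U) = sec U ` reg U"
proof (rule equalityI; rule subsetI)
  fix s assume s: "s \<in> carrier (proj_sections N Phi U)"
  have ext: "s \<in> extensional U" using s by (simp add: proj_sections_def)
  have loc: "\<exists>V g h. openin TX V \<and> P \<in> V \<and> (\<forall>Q\<in>V. (g, h) \<in> proj_fracs N Q \<and> s Q = gm Q (th g / th h))" if P: "P \<in> U" for P
  proof -
    obtain V g h where V: "openin TX V" "P \<in> V" "\<forall>Q\<in>V. (g, h) \<in> proj_fracs N Q \<and> s Q = germ N Phi Q (g, h)"
    proof -
      have "\<forall>P\<in>U. \<exists>V g h. openin TX V \<and> P \<in> V \<and> V \<subseteq> U \<and> (\<forall>Q\<in>V. (g, h) \<in> proj_fracs N Q \<and> s Q = germ N Phi Q (g, h))"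
        using s by (simp add: proj_sections_def)
      with P show thesis using that by blast
    qed
    then show ?thesis using germ_gm open_X[OF V(1)] by (intro exI[of _ V] exI[of _ g] exI[of _ h]) auto
  qed
  show "s \<in> sec U ` reg U"
  proof (cases "U = {}")
    \<comment> \<open>Over the empty set every value counts as regular and all of them give the same
      section, so 0 serves as the witness.\<close>
    case True
    then show ?thesis using ext by (auto simp: reg_def sec_def intro!: image_eqI[of _ _ 0])
  next
    case False
    then have "eta \<in> U" using eta_open U by blast
    from loc[OF this] obtain g0 h0 where g0: "(g0, h0) \<in> proj_fracs N eta" "s eta = gm eta (th g0 / th h0)" by blast
    define v where "v = th g0 / th h0"
    have v: "s P = gm P v \<and> gm P v \<noteq> {}" if P: "P \<in> U" for P
    proof -
      obtain V g h where V: "openin TX V" "P \<in> V" "\<forall>Q\<in>V. (g, h) \<in> proj_fracs N Q \<and> s Q = gm Q (th g / th h)"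
        using loc[OF P] by blast
      have "eta \<in> V" using eta_open[OF V(1)] V(2) by blast
      then have "gm eta (th g / th h) = gm eta v" "gm eta v \<noteq> {}"
        using V(3) g0 gm_frac[OF eta_X g0(1)] by (auto simp: v_def)
      then have "v = th g / th h" using gm_inj[OF eta_X, of v "th g / th h"] by metis
      moreover have "P \<in> X" using open_X[OF U] P by blast
      ultimately show ?thesis using V gm_frac by blast
    qed
    then have "s = sec U v" using ext by (auto simp: sec_def fun_eq_iff extensional_def)
    moreover have "v \<in> reg U" using v by (simp add: reg_def)
    ultimately show ?thesis by blast
  qed
next
  fix s assume "s \<in> sec U ` reg U"
  then obtain v where v: "v \<in> reg U" "s = sec U v" by blast
  have "\<exists>V g h. openin TX V \<and> P \<in> V \<and> V \<subseteq> U \<and> (\<forall>Q\<in>V. (g, h) \<in> proj_fracs N Q \<and> s Q = germ N Phi Q (g, h))"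
    if P: "P \<in> U" for P
  proof -
    obtain g h where gh: "(g, h) \<in> gm P v" using v(1) P unfolding reg_def by fast
    have PX: "P \<in> X" using open_X[OF U] P by blast
    note f = gmD[OF PX gh]
    obtain d where d: "g \<in> PN" "h \<in> PN" "h \<notin> P" "homogeneous d g" "homogeneous d h"
      using f unfolding proj_fracs_def by blast
    define V where "V = U \<inter> {Q \<in> X. h \<notin> Q}"
    have "openin TX V" unfolding V_def using U openin_proj_basic[OF d(2,5)] by (rule openin_Int)
    moreover have "(g, h) \<in> proj_fracs N Q \<and> s Q = germ N Phi Q (g, h)" if Q: "Q \<in> V" for Q
    proof -
      have q: "(g, h) \<in> proj_fracs N Q" using Q d by (auto simp: V_def proj_fracs_def)
      moreover have "germ N Phi Q (g, h) = gm Q v" using germ_gm[OF _ q] Q f by (simp add: V_def)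
      ultimately show ?thesis using Q by (simp add: v(2) sec_def V_def)
    qed
    ultimately show ?thesis using P PX d(3) by (intro exI[of _ V] exI[of _ g] exI[of _ h]) (auto simp: V_def)
  qed
  then show "s \<in> carrier (proj_sections N Phi U)"
    by (simp add: proj_sections_def v(2) sec_def)
qed

lemma Units_sec:
  assumes U: "openin TX U" "U \<noteq> {}" and v: "v \<in> reg U"
  shows "sec U v \<in> Units (proj_sections N Phi U) \<longleftrightarrow> v \<noteq> 0 \<and> inverse v \<in> reg U"
proof
  note UX = open_X[OF U(1)]
  assume "sec U v \<in> Units (proj_sections N Phi U)"
  then obtain u where u: "u \<in> reg U" "sec U u \<otimes>\<^bsub>proj_sections N Phi U\<^esub> sec U v = \<one>\<^bsub>proj_sections N Phi U\<^esub>"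
    unfolding Units_def carrier_sections[OF U(1)] by blast
  then have "sec U (u * v) = sec U 1" using sec_mult[OF UX u(1) v] sec_1[OF UX] by simp
  then have "u * v = 1" using sec_inj[OF U reg_mult[OF UX u(1) v]] by blast
  then show "v \<noteq> 0 \<and> inverse v \<in> reg U" using u(1) inverse_unique[of v u] by (auto simp: mult.commute)
next
  note UX = open_X[OF U(1)]
  assume "v \<noteq> 0 \<and> inverse v \<in> reg U"
  then have "sec U (inverse v) \<in> sec U ` reg U"
    "sec U (inverse v) \<otimes>\<^bsub>proj_sections N Phi U\<^esub> sec U v = \<one>\<^bsub>proj_sections N Phi U\<^esub>"
    "sec U v \<otimes>\<^bsub>proj_sections N Phi U\<^esub> sec U (inverse v) = \<one>\<^bsub>proj_sections N Phi U\<^esub>"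
    using v by (simp_all add: sec_mult[OF UX] sec_1[OF UX])
  then show "sec U v \<in> Units (proj_sections N Phi U)"
    unfolding Units_def carrier_sections[OF U(1)] using v by blast
qed

end

section \<open>Morphisms given by polynomials\<close>

context pmap
begin

definition fp :: "'a mpoly set \<Rightarrow> 'a mpoly set" where "fp P = {g \<in> B.PN. H g \<in> P}"

text \<open>The pullback of a function, computed from any fraction; \<open>sg_eq\<close> shows
  independence of the choice. The map may fail to be dominant, and so only functions with a germ at
  \<open>fp eta\<close> can be pulled back.\<close>

definition sg :: "'a germ \<Rightarrow> 'a mpoly fract" where
  "sg A = (case SOME x. x \<in> A of (g, h) \<Rightarrow> th (H g) / th (H h))"

lemma fp_point:
  assumes P: "P \<in> X" and j: "j < M" "h j \<notin> P" shows "fp P \<in> B.X"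
proof -
  note H = rhom_simps[OF rhom_H]
  have "primeideal (fp P) (poly_ring M)"
    unfolding primeideal_iff
  proof (intro conjI ballI impI)
    fix f g assume "f \<in> B.PN" "g \<in> B.PN" "f * g \<in> fp P"
    then show "f \<in> fp P \<or> g \<in> fp P"
      using pt_prime[OF P H_PN[of f] H_PN[of g]] by (simp add: fp_def H)
  next
    fix f g assume "f \<in> fp P" "g \<in> fp P"
    then show "f + g \<in> fp P" using pt_add[OF P] by (simp add: fp_def H PR_add)
  next
    fix f g assume "f \<in> B.PN" "g \<in> fp P"
    then show "f * g \<in> fp P" using pt_mult[OF P H_PN[of f]] by (simp add: fp_def H PR_mult)
  qed (use pt_0[OF P] pt_1[OF P] in \<open>auto simp: fp_def H PR_0\<close>)
  moreover have "hom_component t f \<in> fp P" if "f \<in> fp P" for f t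
    using that pt_hom[OF P, of "H f" "t * d"] by (simp add: fp_def H_hom_component hom_component_PR)
  moreover have "B.Phi \<in> fp P"
    using pt_th[OF P H_PN[OF B.Phi_PN] th_H_Phi] B.Phi_PN by (simp add: fp_def)
  moreover have "pvar j \<notin> fp P" using j(2) by (simp add: fp_def H_pvar)
  ultimately show ?thesis unfolding proj_points_def using j(1) by blast
qed

lemma fp_frac: assumes "(g, k) \<in> proj_fracs M (fp P)" shows "(H g, H k) \<in> proj_fracs N P"
proof -
  obtain t where "g \<in> B.PN" "k \<in> B.PN" "k \<notin> fp P" "homogeneous t g" "homogeneous t k"
    using assms unfolding proj_fracs_def by blast
  moreover from this have "H k \<notin> P" by (simp add: fp_def)
  ultimately show ?thesis unfolding proj_fracs_def using H_PN H_homogeneous by blast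
qed

lemma fp_mono: "P \<subseteq> Q \<Longrightarrow> fp P \<subseteq> fp Q"
  by (auto simp: fp_def)

lemma gm_fp_eta: "P \<in> X \<Longrightarrow> x \<in> B.gm (fp P) v \<Longrightarrow> x \<in> B.gm (fp eta) v"
  using fp_mono[OF eta_subset, of P] by (auto simp: B.gm_def proj_fracs_def)

lemma sg_eq:
  assumes P: "P \<in> X" and x: "(g, k) \<in> B.gm (fp P) v"
  shows "sg (B.gm (fp eta) v) = th (H g) / th (H k)" and "(H g, H k) \<in> gm P (sg (B.gm (fp eta) v))"
proof -
  have x': "(g, k) \<in> B.gm (fp eta) v" using gm_fp_eta[OF P x] .
  obtain g1 k1 where s: "(SOME x. x \<in> B.gm (fp eta) v) = (g1, k1)" by fastforce
  have x1: "(g1, k1) \<in> B.gm (fp eta) v" unfolding s[symmetric] using x' by (rule someI)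
  have nz: "th (H k) \<noteq> 0" "th (H k1) \<noteq> 0"
    using x' x1 fp_frac[of _ _ eta] frac_nz[OF eta_X] unfolding B.gm_def by blast+
  have c: "g \<in> B.PN" "k \<in> B.PN" "g1 \<in> B.PN" "k1 \<in> B.PN" "B.th g = v * B.th k" "B.th g1 = v * B.th k1"
    using x' x1 by (auto simp: B.gm_def proj_fracs_def)
  have "th (H (g1 * k - g * k1)) = 0"
    by (rule th_H_zero) (use c in \<open>auto simp: rhom_simps[OF B.rhom_th] intro!: PR_diff PR_mult\<close>)
  then have "th (H g1) / th (H k1) = th (H g) / th (H k)"
    using nz by (simp add: rhom_simps[OF rhom_H] rhom_simps[OF rhom_th] field_simps)
  then show 1: "sg (B.gm (fp eta) v) = th (H g) / th (H k)" by (simp add: sg_def s)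
  show "(H g, H k) \<in> gm P (sg (B.gm (fp eta) v))"
    unfolding 1 using x by (intro gm_frac[OF P] fp_frac) (simp add: B.gm_def)
qed

end

locale pmap_on = pmap +
  fixes U V
  assumes U: "openin TX U" and V: "openin B.TX V" and fpU: "P \<in> U \<Longrightarrow> fp P \<in> V"
begin

definition pre :: "'a mpoly set set \<Rightarrow> 'a mpoly set set" where "pre W = {P \<in> U. fp P \<in> W}"

text \<open>A section of the source is known from its value at \<open>eta\<close>, so the pullback
  reads only the germ of \<open>s\<close> at the image of \<open>eta\<close>.\<close>

definition pb :: "'a mpoly set set \<Rightarrow> ('a mpoly set \<Rightarrow> 'a germ) \<Rightarrow> 'a mpoly set \<Rightarrow> 'a germ" where
  "pb W s = sec (pre W) (sg (s (fp eta)))"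

abbreviation "chi v \<equiv> sg (B.gm (fp eta) v)"

lemma U_X: "P \<in> U \<Longrightarrow> P \<in> X"
  using open_X[OF U] by blast

lemma preim_eq: "preim (open_sub HX U) fp W = pre W"
  using open_X[OF U] by (auto simp: preim_def pre_def topspace_proj_topo)

lemma pre_X: "pre W \<subseteq> X"
  using U_X by (auto simp: pre_def)

lemma open_pre_basic: "g \<in> B.PN \<Longrightarrow> homogeneous t g \<Longrightarrow> openin TX (pre {Q \<in> B.X. g \<notin> Q})"
proof -
  assume g: "g \<in> B.PN" "homogeneous t g"
  have "pre {Q \<in> B.X. g \<notin> Q} = U \<inter> {P \<in> X. H g \<notin> P}"
    using B.open_X[OF V] fpU U_X g(1) by (auto simp: pre_def fp_def)
  then show ?thesis
    using openin_Int[OF U openin_proj_basic[OF H_PN[OF g(1)] H_homogeneous[OF g]]] by simp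
qed

lemma continuous_fp: "continuous_map (subtopology TX U) (subtopology B.TX V) fp"
proof -
  have ts: "topspace (subtopology TX U) = U" using open_X[OF U] by (auto simp: topspace_proj_topo)
  have "continuous_map (subtopology TX U) B.TX fp"
    unfolding proj_topo_def[of M]
  proof (rule continuous_on_generated_topo)
    fix W assume "W \<in> {{P \<in> B.X. g \<notin> P} | g d. g \<in> B.PN \<and> homogeneous d g}"
    then obtain g t where g: "g \<in> B.PN" "homogeneous t g" "W = {P \<in> B.X. g \<notin> P}" by blast
    have "fp -` W \<inter> topspace (subtopology TX U) = pre W" unfolding ts by (auto simp: pre_def)
    moreover have "openin (subtopology TX U) (pre W)"
      using open_pre_basic[OF g(1,2)] g(3) U by (auto simp: openin_open_subtopology pre_def)
    ultimately show "openin (subtopology TX U) (fp -` W \<inter> topspace (subtopology TX U))" by simp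
  next
    have "fp ` U \<subseteq> B.X" using fpU B.open_X[OF V] by blast
    moreover have "B.X = \<Union>{{P \<in> B.X. g \<notin> P} | g d. g \<in> B.PN \<and> homogeneous d g}"
      using topspace_proj_topo[of M B.Phi] unfolding proj_topo_def topology_generated_by_topspace by simp
    ultimately show "fp ` topspace (subtopology TX U) \<subseteq> \<Union>{{P \<in> B.X. g \<notin> P} | g d. g \<in> B.PN \<and> homogeneous d g}"
      unfolding ts by simp
  qed
  then show ?thesis unfolding continuous_map_in_subtopology ts using fpU by blast
qed

lemma open_pre: assumes "openin B.TX W" shows "openin TX (pre W)"
proof -
  have "continuous_map (subtopology TX U) B.TX fp"
    using continuous_fp by (simp add: continuous_map_in_subtopology)
  moreover have ts: "topspace (subtopology TX U) = U" using open_X[OF U] by (auto simp: topspace_proj_topo)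
  ultimately have "openin (subtopology TX U) (pre W)"
    using assms unfolding continuous_map_def pre_def ts by blast
  then show ?thesis using U by (simp add: openin_open_subtopology)
qed

lemma eta_pre: "openin B.TX W \<Longrightarrow> pre W \<noteq> {} \<Longrightarrow> eta \<in> pre W"
  by (rule eta_open[OF open_pre])

lemma pb_sec: "eta \<in> pre W \<Longrightarrow> pb W (B.sec W v) = sec (pre W) (chi v)"
  by (simp add: pb_def B.sec_def pre_def)

lemma chi_reg: assumes v: "v \<in> B.reg W" shows "chi v \<in> reg (pre W)"
proof -
  have "gm P (chi v) \<noteq> {}" if P: "P \<in> pre W" for P
  proof -
    obtain g k where "(g, k) \<in> B.gm (fp P) v" using v P unfolding B.reg_def pre_def by fast
    then show ?thesis using sg_eq(2)[of P g k v] P pre_X by blast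
  qed
  then show ?thesis by (simp add: reg_def)
qed

lemma
  assumes e: "eta \<in> pre W" and W: "openin B.TX W"
  shows chi_add: "u \<in> B.reg W \<Longrightarrow> v \<in> B.reg W \<Longrightarrow> chi (u + v) = chi u + chi v"
    and chi_mult: "u \<in> B.reg W \<Longrightarrow> v \<in> B.reg W \<Longrightarrow> chi (u * v) = chi u * chi v"
    and chi_const: "chi (emb (c ^ p)) = emb (c ^ p)" and chi_1: "chi 1 = 1"
proof -
  have fe: "fp eta \<in> W" "fp eta \<in> B.X" using e B.open_X[OF W] by (auto simp: pre_def)
  note simps = rhom_simps[OF rhom_H] rhom_simps[OF rhom_th] H_pconst th_pconst
  show "chi (emb (c ^ p)) = emb (c ^ p)" "chi 1 = 1"
    using sg_eq(1)[OF eta_X B.gm_const[OF fe(2), of c]] sg_eq(1)[OF eta_X B.gm_1[OF fe(2)]] by (simp_all add: simps)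
  assume uv: "u \<in> B.reg W" "v \<in> B.reg W"
  obtain g k g' k' where r: "(g, k) \<in> B.gm (fp eta) u" "(g', k') \<in> B.gm (fp eta) v"
    using uv fe(1) unfolding B.reg_def by fast
  have nz: "th (H k) \<noteq> 0" "th (H k') \<noteq> 0"
    using r fp_frac[of _ _ eta] frac_nz[OF eta_X] unfolding B.gm_def by blast+
  show "chi (u + v) = chi u + chi v" "chi (u * v) = chi u * chi v"
    using nz sg_eq(1)[OF eta_X B.gm_add_rep[OF fe(2) r]] sg_eq(1)[OF eta_X B.gm_mult_rep[OF fe(2) r]]
    unfolding sg_eq(1)[OF eta_X r(1)] sg_eq(1)[OF eta_X r(2)]
    by (simp_all add: simps add_frac_eq)
qed

lemma pb_ring_hom:
  assumes W: "openin B.TX W"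
  shows "pb W \<in> ring_hom (proj_sections M B.Phi W) (proj_sections N Phi (pre W))"
    and "pb W (const B.HX W c) = const HX (pre W) c"
proof -
  note WX = B.open_X[OF W]
  have "pb W \<in> ring_hom (proj_sections M B.Phi W) (proj_sections N Phi (pre W)) \<and> pb W (const B.HX W c) = const HX (pre W) c"
  proof (cases "pre W = {}")
    \<comment> \<open>Here \<open>fp eta\<close> may lie outside \<open>W\<close>, so that nothing
      is known about \<open>s (fp eta)\<close>; but the ring of sections over the empty set is
      trivial.\<close>
    case True
    have s0: "s = sec {} 0" if "s \<in> extensional {}" for s
      using that by (auto simp: sec_def extensional_def fun_eq_iff)
    have car: "carrier (proj_sections N Phi {}) = {sec {} 0}"
      unfolding carrier_sections[OF openin_empty] using sec_empty[of _ 0] by (auto simp: reg_def)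
    have pb: "pb W s = sec {} 0" for s unfolding pb_def True by (rule sec_empty)
    have ops: "s \<otimes>\<^bsub>proj_sections N Phi {}\<^esub> t = sec {} 0" "s \<oplus>\<^bsub>proj_sections N Phi {}\<^esub> t = sec {} 0"
      "\<one>\<^bsub>proj_sections N Phi {}\<^esub> = sec {} 0" "const HX {} c = sec {} 0" for s t
      by (rule s0, simp add: proj_sections_def restrict_def)+
    show ?thesis unfolding True by (auto intro!: ring_hom_memI simp: pb car ops simp del: proj_hypersurface_simps(3))
  next
    case False
    note e = eta_pre[OF W False]
    have "pb W \<in> ring_hom (proj_sections M B.Phi W) (proj_sections N Phi (pre W))"
    proof (rule ring_hom_memI)
      fix s assume "s \<in> carrier (proj_sections M B.Phi W)"
      then obtain v where "s = B.sec W v" "v \<in> B.reg W" unfolding B.carrier_sections[OF W] by blast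
      then show "pb W s \<in> carrier (proj_sections N Phi (pre W))"
        unfolding carrier_sections[OF open_pre[OF W]] by (simp add: pb_sec[OF e] chi_reg)
    next
      fix s t assume "s \<in> carrier (proj_sections M B.Phi W)" "t \<in> carrier (proj_sections M B.Phi W)"
      then obtain u v where uv: "s = B.sec W u" "u \<in> B.reg W" "t = B.sec W v" "v \<in> B.reg W"
        unfolding B.carrier_sections[OF W] by blast
      show "pb W (s \<otimes>\<^bsub>proj_sections M B.Phi W\<^esub> t) = pb W s \<otimes>\<^bsub>proj_sections N Phi (pre W)\<^esub> pb W t"
        unfolding uv(1,3) B.sec_mult[OF WX uv(2,4)] pb_sec[OF e] sec_mult[OF pre_X chi_reg[OF uv(2)] chi_reg[OF uv(4)]]
        by (simp add: chi_mult[OF e W uv(2,4)])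
      show "pb W (s \<oplus>\<^bsub>proj_sections M B.Phi W\<^esub> t) = pb W s \<oplus>\<^bsub>proj_sections N Phi (pre W)\<^esub> pb W t"
        unfolding uv(1,3) B.sec_add[OF WX uv(2,4)] pb_sec[OF e] sec_add[OF pre_X chi_reg[OF uv(2)] chi_reg[OF uv(4)]]
        by (simp add: chi_add[OF e W uv(2,4)])
    qed (simp add: B.sec_1[OF WX] sec_1[OF pre_X] pb_sec[OF e] chi_1[OF e W])
    moreover have "pb W (const B.HX W c) = const HX (pre W) c"
      unfolding B.sec_const[OF WX] sec_const[OF pre_X] by (simp only: pb_sec[OF e] chi_const[OF e W])
    ultimately show ?thesis by blast
  qed
  then show "pb W \<in> ring_hom (proj_sections M B.Phi W) (proj_sections N Phi (pre W))"
    "pb W (const B.HX W c) = const HX (pre W) c" by blast+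
qed

lemma pb_restrict:
  assumes "openin B.TX W" "W \<subseteq> W'" shows "pb W (restrict s W) = restrict (pb W' s) (pre W)"
proof -
  have sub: "pre W \<subseteq> pre W'" using assms(2) by (auto simp: pre_def)
  show ?thesis
  proof (cases "pre W = {}")
    case True
    then show ?thesis by (auto simp: pb_def sec_def fun_eq_iff)
  next
    case False
    then have "fp eta \<in> W" using eta_pre[OF assms(1)] by (auto simp: pre_def)
    then show ?thesis unfolding pb_def sec_restrict[OF sub] by simp
  qed
qed

text \<open>Write v = g/k at the image of \<open>x\<close>. If the pullback of \<open>v\<close> is
  invertible at \<open>x\<close>, then \<open>H g\<close> is not in \<open>x\<close>, that is,
  \<open>g\<close> is not in \<open>fp x\<close>; so k/g inverts \<open>v\<close> where neither
  \<open>g\<close> nor \<open>k\<close> vanishes.\<close>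

lemma pb_local:
  assumes W: "openin B.TX W" and s: "s \<in> carrier (proj_sections M B.Phi W)" and x: "x \<in> pre W"
    and Z: "openin TX Z" "x \<in> Z" "Z \<subseteq> pre W" "restrict (pb W s) Z \<in> Units (proj_sections N Phi Z)"
  shows "\<exists>Z. openin B.TX Z \<and> fp x \<in> Z \<and> Z \<subseteq> W \<and> restrict s Z \<in> Units (proj_sections M B.Phi Z)"
proof -
  have e: "eta \<in> pre W" using eta_pre[OF W] x by blast
  obtain v where v: "s = B.sec W v" "v \<in> B.reg W" using s unfolding B.carrier_sections[OF W] by blast
  have xX: "x \<in> X" and fx: "fp x \<in> W" "fp x \<in> B.X" using x pre_X B.open_X[OF W] by (auto simp: pre_def)
  have "restrict (pb W s) Z = sec Z (chi v)" unfolding v(1) pb_sec[OF e] by (rule sec_restrict[OF Z(3)])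
  then have inv: "chi v \<noteq> 0" "inverse (chi v) \<in> reg Z"
    using Units_sec[OF Z(1) _ reg_mono[OF Z(3) chi_reg[OF v(2)]]] Z(2,4) by auto
  obtain g k where gk: "(g, k) \<in> B.gm (fp x) v" using v(2) fx(1) unfolding B.reg_def by fast
  have c: "(g, k) \<in> proj_fracs M (fp x)" "B.th k \<noteq> 0" "v = B.th g / B.th k" using B.gmD[OF fx(2) gk] by auto
  obtain t where t: "g \<in> B.PN" "k \<in> B.PN" "k \<notin> fp x" "homogeneous t g" "homogeneous t k"
    using c(1) unfolding proj_fracs_def by blast
  obtain g' k' where gk': "(g', k') \<in> gm x (inverse (chi v))" using inv(2) Z(2) unfolding reg_def by fast
  have chi: "chi v = th (H g) / th (H k)" by (rule sg_eq(1)[OF xX gk])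
  have c': "g' \<in> PN" "k' \<in> PN" "k' \<notin> x" "th g' = inverse (chi v) * th k'"
    using gk' by (auto simp: gm_def proj_fracs_def)
  have "H g \<notin> x"
  proof
    assume Hg: "H g \<in> x"
    have "th (H g) \<noteq> 0" "th (H k) \<noteq> 0" using inv(1) unfolding chi by auto
    then have "th g' * th (H g) = th k' * th (H k)" using c'(4) unfolding chi by simp
    then have "th (k' * H k - g' * H g) = 0" by (simp add: rhom_simps[OF rhom_th])
    moreover have "k' * H k - g' * H g \<in> PN" by (intro PR_diff PR_mult c'(1,2) H_PN t(1,2))
    ultimately have "k' * H k - g' * H g \<in> x" by (rule pt_th[OF xX, rotated])
    from pt_add[OF xX this pt_mult[OF xX c'(1) Hg]] have "k' * H k \<in> x" by simp
    then show False using pt_prime[OF xX c'(2) H_PN[OF t(2)]] c'(3) t(2,3) by (simp add: fp_def)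
  qed
  then have gx: "g \<notin> fp x" by (simp add: fp_def)
  define Y where "Y = W \<inter> {Q \<in> B.X. g \<notin> Q} \<inter> {Q \<in> B.X. k \<notin> Q}"
  have oY: "openin B.TX Y" unfolding Y_def
    using openin_proj_basic[OF t(1,4)] openin_proj_basic[OF t(2,5)] W by blast
  have fY: "fp x \<in> Y" using fx gx t(3) by (simp add: Y_def)
  have "(k, g) \<in> B.gm Q (inverse v)" if "Q \<in> Y" for Q
    using that t c B.pt_th_nz[of Q g] by (auto simp: Y_def B.gm_def proj_fracs_def)
  then have "inverse v \<in> B.reg Y" by (auto simp: B.reg_def)
  moreover have "v \<noteq> 0" using c(2,3) B.pt_th_nz[OF fx(2) t(1) gx] by simp
  moreover have "v \<in> B.reg Y" using B.reg_mono[OF _ v(2), of Y] by (auto simp: Y_def)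
  ultimately have "B.sec Y v \<in> Units (proj_sections M B.Phi Y)"
    using B.Units_sec[OF oY] fY by blast
  moreover have "restrict s Y = B.sec Y v" unfolding v(1) by (rule B.sec_restrict) (auto simp: Y_def)
  ultimately show ?thesis using oY fY by (intro exI[of _ Y]) (auto simp: Y_def)
qed

theorem morphism_fp: "morphism (open_sub HX U) (open_sub B.HX V) fp pb"
proof -
  have op: "openin (subtopology B.TX V) W \<longleftrightarrow> openin B.TX W \<and> W \<subseteq> V" for W
    by (rule openin_open_subtopology[OF V])
  have op': "openin (subtopology TX U) W \<longleftrightarrow> openin TX W \<and> W \<subseteq> U" for W
    by (rule openin_open_subtopology[OF U])
  have pU: "pre W \<subseteq> U" for W by (auto simp: pre_def)
  show ?thesis
    unfolding morphism_def preim_eq unit_at_def open_sub_simps proj_hypersurface_simps(1,2) op op'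
  proof (intro conjI allI impI)
    fix W s x assume W: "openin B.TX W \<and> W \<subseteq> V" "s \<in> carrier (proj_sections M B.Phi W)" "x \<in> pre W"
      and "\<exists>Z. (openin TX Z \<and> Z \<subseteq> U) \<and> x \<in> Z \<and> Z \<subseteq> pre W \<and> restrict (pb W s) Z \<in> Units (proj_sections N Phi Z)"
    then obtain Z where Z: "openin TX Z" "x \<in> Z" "Z \<subseteq> pre W" "restrict (pb W s) Z \<in> Units (proj_sections N Phi Z)"
      by blast
    show "\<exists>Z. (openin B.TX Z \<and> Z \<subseteq> V) \<and> fp x \<in> Z \<and> Z \<subseteq> W \<and> restrict s Z \<in> Units (proj_sections M B.Phi Z)"
      using pb_local[OF conjunct1[OF W(1)] W(2,3) Z] W(1) by blast
  next
    show "continuous_map (subtopology TX U) (subtopology B.TX V) fp" by (rule continuous_fp)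
  next
    fix W c assume "openin B.TX W \<and> W \<subseteq> V"
    then have W: "openin B.TX W" ..
    show "pb W \<in> ring_hom (proj_sections M B.Phi W) (proj_sections N Phi (pre W))"
      by (rule pb_ring_hom[OF W])
    show "pb W (const B.HX W c) = const HX (pre W) c" by (rule pb_ring_hom[OF W])
  next
    fix W W' s assume "openin B.TX W' \<and> W' \<subseteq> V" "W' \<subseteq> W"
    then show "pb W' (restrict s W') = restrict (pb W s) (pre W')" by (intro pb_restrict) auto
  qed
qed

end

section \<open>Rational morphisms\<close>

context pmap
begin

theorem rational_morphism_fp: "rational_morphism_exists HX B.HX"
proof -
  obtain j where j: "j < M" "th (h j) \<noteq> 0" using h_nz by blast
  define U where "U = {P \<in> X. h j \<notin> P}"
  have U: "openin TX U" unfolding U_def by (rule openin_proj_basic[OF h_PN[OF j(1)] h_hom[OF j(1)]])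
  have V: "openin B.TX B.X" using openin_topspace[of B.TX] by (simp add: topspace_proj_topo)
  interpret pmap_on p ty N a M b d h U B.X
    by unfold_locales (use U V fp_point[OF _ j(1)] in \<open>auto simp: U_def\<close>)
  have "eta \<in> U" using eta_X j(2) by (simp add: U_def eta_iff)
  moreover have "open_sub B.HX B.X = B.HX"
    using open_sub_topspace[of B.HX] by (simp add: topspace_proj_topo)
  ultimately show ?thesis
    unfolding rational_morphism_exists_def using morphism_fp U by (metis emptyE proj_hypersurface_simps(1))
qed

end

locale qpair = qform p ty N a + B: qform p ty M b
  for p and ty :: "'a::field itself" and N a M b
begin

text \<open>Each numerator is multiplied by all the other denominators, which makes the degrees
  equal as well. The relation is a p-th power in F(S), and its root is the linear relation required
  by \<open>rmap\<close>.\<close>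

lemma rmap_of_fractions:
  assumes rel: "(\<Sum>i<M. emb (b i ^ p) * z i ^ p) = 0" and nz: "\<exists>j<M. z j \<noteq> 0"
    and z: "\<And>i. i < M \<Longrightarrow> gm eta (z i) \<noteq> {}"
  shows "\<exists>d h. rmap p N a M b d h"
proof -
  have "\<exists>g k e. g \<in> PN \<and> k \<in> PN \<and> homogeneous e g \<and> homogeneous e k \<and> th k \<noteq> 0 \<and> z i = th g / th k" if i: "i < M" for i
  proof -
    obtain g k where gk: "(g, k) \<in> gm eta (z i)" using z[OF i] by fast
    from gmD[OF eta_X this] have "(g, k) \<in> proj_fracs N eta" "th k \<noteq> 0" "z i = th g / th k" by auto
    then show ?thesis unfolding proj_fracs_def by blast
  qed
  then obtain g k e where gk: "\<And>i. i < M \<Longrightarrow> g i \<in> PN \<and> k i \<in> PN \<and> homogeneous (e i) (g i) \<and> homogeneous (e i) (k i) \<and> th (k i) \<noteq> 0 \<and> z i = th (g i) / th (k i)"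
    by metis
  define h where "h i = g i * (\<Prod>l\<in>{..<M} - {i}. k l)" for i
  define \<kappa> where "\<kappa> = (\<Prod>l<M. th (k l))"
  have \<kappa>: "\<kappa> \<noteq> 0" using gk by (simp add: \<kappa>_def)
  have th_h: "th (h i) = z i * \<kappa>" if i: "i < M" for i
  proof -
    have "\<kappa> = th (k i) * (\<Prod>l\<in>{..<M} - {i}. th (k l))" unfolding \<kappa>_def using i by (intro prod.remove) auto
    then show ?thesis using gk[OF i] by (simp add: h_def rhom_simps[OF rhom_th])
  qed
  have "homogeneous (sum e {..<M}) (h i)" if i: "i < M" for i
  proof -
    have "homogeneous (e i + sum e ({..<M} - {i})) (h i)"
      unfolding h_def using gk i by (intro homogeneous_mult homogeneous_prod) auto
    moreover have "e i + sum e ({..<M} - {i}) = sum e {..<M}" using i by (intro sum.remove[symmetric]) auto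
    ultimately show ?thesis by simp
  qed
  moreover have "h i \<in> PN" if "i < M" for i
    unfolding h_def using gk that by (intro PR_mult PR_prod) auto
  moreover have "(\<Sum>i<M. emb (b i) * th (h i)) = 0"
  proof -
    have "(\<Sum>i<M. emb (b i) * th (h i)) ^ p = th (\<Sum>i<M. pconst (b i) * h i ^ p)" by (rule th_diag[symmetric])
    also have "\<dots> = (\<Sum>i<M. emb (b i ^ p) * th (h i) ^ p)"
      by (simp add: rhom_simps[OF rhom_th] th_pconst)
    also have "\<dots> = (\<Sum>i<M. \<kappa> ^ p * (emb (b i ^ p) * z i ^ p))"
      by (rule sum.cong) (simp_all add: th_h power_mult_distrib)
    also have "\<dots> = 0" using rel by (simp flip: sum_distrib_left)
    finally show ?thesis by simp
  qed
  moreover have "\<exists>j<M. th (h j) \<noteq> 0" using nz th_h \<kappa> by auto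
  ultimately show ?thesis unfolding rmap_def by blast
qed

text \<open>Pull back the affine coordinates y_i / y_j of a chart that contains the image of
  \<open>eta\<close>. The pullback is a ring homomorphism over the ground field, so the values still
  satisfy the equation of the target; on values, the constant c acts as
  \<open>emb (c ^ p)\<close>.\<close>

theorem rmap_of_rational_morphism:
  assumes "rational_morphism_exists HX B.HX" shows "\<exists>d h. rmap p N a M b d h"
proof -
  obtain U f pb where U: "openin TX U" "U \<noteq> {}" and mor: "morphism (open_sub HX U) B.HX f pb"
    using assms unfolding rational_morphism_exists_def by auto
  have ts: "topspace (subtopology TX U) = U" using open_X[OF U(1)] by (auto simp: topspace_proj_topo)
  define pr where "pr W = {x \<in> U. f x \<in> W}" for W
  have pr: "preim (open_sub HX U) f W = pr W" for W using ts by (simp add: preim_def pr_def)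
  have cont: "continuous_map (subtopology TX U) B.TX f"
    using mor by (simp add: morphism_def)
  have all: "\<forall>W. openin B.TX W \<longrightarrow> pb W \<in> ring_hom (proj_sections M B.Phi W) (proj_sections N Phi (pr W)) \<and>
      (\<forall>c. pb W (const B.HX W c) = const HX (pr W) c)"
    using mor unfolding morphism_def pr open_sub_simps proj_hypersurface_simps(1,2) by (elim conjE)
  have hom: "pb W \<in> ring_hom (proj_sections M B.Phi W) (proj_sections N Phi (pr W))"
    and con: "pb W (const B.HX W c) = const HX (pr W) c" if "openin B.TX W" for W c
    using all that by blast+
  have e: "eta \<in> U" using eta_open[OF U] .
  then have "f eta \<in> B.X" using cont ts by (auto simp: continuous_map_def topspace_proj_topo)
  then obtain j where j: "j < M" "pvar j \<notin> f eta" unfolding proj_points_def by blast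
  define V where "V = {Q \<in> B.X. pvar j \<notin> Q}"
  have V: "openin B.TX V" unfolding V_def by (rule openin_proj_basic[OF PR_pvar[OF j(1)] homogeneous_pvar])
  note VX = B.open_X[OF V]
  define W where "W = pr V"
  have "openin (subtopology TX U) W" using cont V unfolding continuous_map_def W_def pr_def ts by blast
  then have W: "openin TX W" using openin_open_subtopology[OF U(1)] by blast
  have "eta \<in> W" using e j(2) \<open>f eta \<in> B.X\<close> by (simp add: W_def pr_def V_def)
  then have W0: "W \<noteq> {}" by blast
  note WX = open_X[OF W]
  \<comment> \<open>The value of the pulled back section. It is unique because the preimage
    \<open>W\<close> of the chart is nonempty.\<close>
  define \<chi> where "\<chi> v = (SOME u. u \<in> reg W \<and> pb V (B.sec V v) = sec W u)" for v
  have chi: "\<chi> v \<in> reg W" "pb V (B.sec V v) = sec W (\<chi> v)" if "v \<in> B.reg V" for v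
  proof -
    have "B.sec V v \<in> carrier (proj_sections M B.Phi V)" using that unfolding B.carrier_sections[OF V] by blast
    then have "pb V (B.sec V v) \<in> sec W ` reg W"
      using ring_hom_closed[OF hom[OF V]] carrier_sections[OF W] by (simp add: W_def)
    then have "\<exists>u. u \<in> reg W \<and> pb V (B.sec V v) = sec W u" by blast
    then have "\<chi> v \<in> reg W \<and> pb V (B.sec V v) = sec W (\<chi> v)" unfolding \<chi>_def by (rule someI_ex)
    then show "\<chi> v \<in> reg W" "pb V (B.sec V v) = sec W (\<chi> v)" by blast+
  qed
  have chi_eqI: "\<chi> v = u" if "v \<in> B.reg V" "pb V (B.sec V v) = sec W u" for u v
    using sec_inj[OF W W0 chi(1)[OF that(1)], of u] chi(2)[OF that(1)] that(2) by simp
  have car: "B.sec V u \<in> carrier (proj_sections M B.Phi V)" if "u \<in> B.reg V" for u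
    using that unfolding B.carrier_sections[OF V] by blast
  have chi_add: "\<chi> (u + v) = \<chi> u + \<chi> v" and chi_mult: "\<chi> (u * v) = \<chi> u * \<chi> v" if uv: "u \<in> B.reg V" "v \<in> B.reg V" for u v
  proof -
    show "\<chi> (u + v) = \<chi> u + \<chi> v"
      using ring_hom_add[OF hom[OF V] car[OF uv(1)] car[OF uv(2)]]
      by (intro chi_eqI B.reg_add[OF VX uv])
        (simp add: B.sec_add[OF VX uv] chi[OF uv(1)] chi[OF uv(2)] sec_add[OF WX] flip: W_def)
    show "\<chi> (u * v) = \<chi> u * \<chi> v"
      using ring_hom_mult[OF hom[OF V] car[OF uv(1)] car[OF uv(2)]]
      by (intro chi_eqI B.reg_mult[OF VX uv])
        (simp add: B.sec_mult[OF VX uv] chi[OF uv(1)] chi[OF uv(2)] sec_mult[OF WX] flip: W_def)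
  qed
  have chi_1: "\<chi> 1 = 1"
    using ring_hom_one[OF hom[OF V]] by (intro chi_eqI B.reg_1[OF VX]) (simp add: B.sec_1[OF VX] sec_1[OF WX] flip: W_def)
  have chi_const: "\<chi> (emb (c ^ p)) = emb (c ^ p)" for c
    using con[OF V, of c] unfolding B.sec_const[OF VX] W_def[symmetric] sec_const[OF WX]
    by (intro chi_eqI B.reg_const[OF VX])
  have chi_0: "\<chi> 0 = 0" using chi_add[OF B.reg_0[OF VX] B.reg_0[OF VX]] by (metis add.right_neutral add_left_cancel)
  have chi_pow: "v ^ n \<in> B.reg V \<and> \<chi> (v ^ n) = \<chi> v ^ n" if "v \<in> B.reg V" for v and n :: nat
    by (induction n) (simp_all add: chi_1 B.reg_1[OF VX] B.reg_mult[OF VX] chi_mult that)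
  have chi_sum: "(\<Sum>i<n. F i) \<in> B.reg V \<and> \<chi> (\<Sum>i<n. F i) = (\<Sum>i<n. \<chi> (F i))"
    if "\<And>i. i < n \<Longrightarrow> F i \<in> B.reg V" for F and n :: nat
    using that by (induction n) (simp_all add: chi_0 B.reg_0[OF VX] B.reg_add[OF VX] chi_add)
  define t where "t i = B.xi i / B.xi j" for i
  have t: "t i \<in> B.reg V" if i: "i < M" for i
  proof -
    have "(pvar i, pvar j) \<in> B.gm Q (t i)" if "Q \<in> V" for Q
      using that PR_pvar[OF i] PR_pvar[OF j(1)] homogeneous_pvar B.xi_nz[of j]
      by (auto simp: V_def B.gm_def proj_fracs_def B.th_pvar t_def)
    then show ?thesis by (auto simp: B.reg_def)
  qed
  have tp: "t i ^ p \<in> B.reg V" "\<chi> (t i ^ p) = \<chi> (t i) ^ p" if "i < M" for i using chi_pow[OF t[OF that], of p] by blast+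
  have "(\<Sum>i<M. emb (b i ^ p) * B.xi i ^ p) = B.th B.Phi"
    by (simp add: diag_poly_def rhom_simps[OF B.rhom_th] B.th_pconst B.th_pvar)
  then have "(\<Sum>i<M. emb (b i ^ p) * B.xi i ^ p) / B.xi j ^ p = 0" by (simp add: B.th_Phi)
  then have "(\<Sum>i<M. emb (b i ^ p) * t i ^ p) = 0"
    by (simp add: t_def power_divide sum_divide_distrib)
  moreover have "\<chi> (\<Sum>i<M. emb (b i ^ p) * t i ^ p) = (\<Sum>i<M. \<chi> (emb (b i ^ p) * t i ^ p))"
    using chi_sum[of M "\<lambda>i. emb (b i ^ p) * t i ^ p"] B.reg_mult[OF VX B.reg_const[OF VX] tp(1)] by blast
  moreover have "(\<Sum>i<M. \<chi> (emb (b i ^ p) * t i ^ p)) = (\<Sum>i<M. emb (b i ^ p) * \<chi> (t i) ^ p)"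
    by (rule sum.cong) (simp_all add: chi_mult[OF B.reg_const[OF VX] tp(1)] chi_const tp(2))
  ultimately have "(\<Sum>i<M. emb (b i ^ p) * \<chi> (t i) ^ p) = 0" using chi_0 by simp
  moreover have "t j = 1" using B.xi_nz by (simp add: t_def)
  then have "\<chi> (t j) \<noteq> 0" using chi_1 by simp
  moreover have "gm eta (\<chi> (t i)) \<noteq> {}" if "i < M" for i
    using chi(1)[OF t[OF that]] \<open>eta \<in> W\<close> by (simp add: reg_def)
  ultimately show ?thesis using j(1) by (intro rmap_of_fractions[of "\<lambda>i. \<chi> (t i)"]) auto
qed

end

section \<open>Birationality\<close>

text \<open>The first two conditions make \<open>P\<close> recoverable from its image
  (\<open>FG_iff\<close>); the last two are the pullbacks of these conditions for the inverse map.
  Pulling back the last two for the inverse map leads to the second condition again, once directly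
  and once through \<open>FG_iff\<close>. So each map sends its set into the other one.\<close>

definition bset :: "nat \<Rightarrow> 'a::field mpoly \<Rightarrow> (nat \<Rightarrow> 'a mpoly) \<Rightarrow> (nat \<Rightarrow> 'a mpoly) \<Rightarrow> 'a mpoly set set" where
  "bset N F0 h k = {P \<in> proj_points N F0. pvar 0 \<notin> P \<and> ev pconst h (k 0) \<notin> P \<and> h 0 \<notin> P \<and> ev pconst h (ev pconst k (h 0)) \<notin> P}"

context qform
begin

lemma pt_power: "P \<in> X \<Longrightarrow> f \<in> PN \<Longrightarrow> f \<notin> P \<Longrightarrow> f ^ n \<notin> P"
proof (induction n)
  case (Suc n)
  then show ?case using pt_prime[OF Suc.prems(1,2) PR_power[OF Suc.prems(2)]] by simp
qed (simp add: pt_1)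

lemma pt_sum: "P \<in> X \<Longrightarrow> (\<And>x. x \<in> A \<Longrightarrow> F x \<in> P) \<Longrightarrow> sum F A \<in> P"
  by (induction A rule: infinite_finite_induct) (auto simp: pt_0 intro: pt_add)

end

locale bimap = A: qform p ty N a + B: qform p ty N b + F: pmap p ty N a N b d h + G: pmap p ty N b N a e k
  for p and ty :: "'a::field itself" and N a b d h e k +
  assumes zF: "\<exists>z. z \<noteq> 0 \<and> (\<forall>i<N. A.th (ev pconst h (k i)) = z * A.xi i)"
    and zG: "\<exists>z. z \<noteq> 0 \<and> (\<forall>j<N. B.th (ev pconst k (h j)) = z * B.xi j)"
begin

abbreviation "U \<equiv> bset N A.Phi h k"
abbreviation "V \<equiv> bset N B.Phi k h"

text \<open>The locale is symmetric, so that every statement about one composite yields the one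
  about the other.\<close>

lemma swap: "bimap p N b a e k d h"
  by unfold_locales (use zF zG in blast)+

lemma N0: "0 < N" using A.N2 by simp

lemma FG_eq: "f \<in> A.PN \<Longrightarrow> F.H (G.H f) = ev pconst (\<lambda>i. F.H (k i)) f"
  by (rule rhom_eq_on_PR[OF rhom_comp[OF G.rhom_H F.rhom_H] rhom_ev[OF rhom_pconst], where N = N])
    (simp_all add: ev_pconst[OF rhom_pconst] ev_pvar[OF rhom_pconst] F.H_pconst G.H_pconst G.H_pvar)

lemma FG_scale: "\<exists>z. z \<noteq> 0 \<and> A.th (F.H (k 0)) = z * A.xi 0 \<and>
    (\<forall>t f. f \<in> A.PN \<longrightarrow> homogeneous t f \<longrightarrow> A.th (F.H (G.H f)) = z ^ t * A.th f)"
proof -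
  obtain z where z: "z \<noteq> 0" "\<forall>i<N. A.th (F.H (k i)) = z * A.xi i" using zF unfolding F.H_def by blast
  have "A.th (F.H (G.H f)) = z ^ t * A.th f" if "f \<in> A.PN" "homogeneous t f" for t f
    unfolding FG_eq[OF that(1)] by (rule A.th_scale[OF that]) (use z in blast)
  then show ?thesis using z N0 by blast
qed

text \<open>The composite scales the coordinates by z = H(k 0) / x_0 and hence a form of degree t by
  z^t. Cross-multiplied, this is a congruence modulo \<open>Phi\<close> between \<open>f\<close> and
  its image, with factors outside \<open>P\<close>.\<close>

lemma FG_homogeneous:
  assumes P: "P \<in> A.X" "pvar 0 \<notin> P" "F.H (k 0) \<notin> P" and f: "f \<in> A.PN" "homogeneous t f"
  shows "F.H (G.H f) \<in> P \<longleftrightarrow> f \<in> P"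
proof -
  obtain z where z: "A.th (F.H (k 0)) = z * A.xi 0" "A.th (F.H (G.H f)) = z ^ t * A.th f"
    using FG_scale f by blast
  define u q where "u = (pvar 0 ^ t :: 'a mpoly)" and "q = F.H (k 0) ^ t"
  have qp: "F.H (k 0) \<in> A.PN" "pvar 0 \<in> A.PN" by (rule F.H_PN[OF G.h_PN[OF N0]], rule PR_pvar[OF N0])
  have u: "u \<in> A.PN" "u \<notin> P" and q: "q \<in> A.PN" "q \<notin> P"
    unfolding u_def q_def using A.pt_power[OF P(1)] P(2,3) qp by (auto intro: PR_power)
  have FG: "F.H (G.H f) \<in> A.PN" by (intro F.H_PN G.H_PN f)
  have "A.th (u * F.H (G.H f) - q * f) = 0"
    by (simp add: u_def q_def rhom_simps[OF A.rhom_th] z A.th_pvar power_mult_distrib)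
  moreover have "u * F.H (G.H f) - q * f \<in> A.PN" by (intro PR_diff PR_mult u q f FG)
  ultimately have D: "u * F.H (G.H f) - q * f \<in> P" by (rule A.pt_th[OF P(1), rotated])
  have "u * F.H (G.H f) \<in> P \<longleftrightarrow> q * f \<in> P"
  proof
    assume "q * f \<in> P"
    from A.pt_add[OF P(1) D this] show "u * F.H (G.H f) \<in> P" by simp
  next
    assume "u * F.H (G.H f) \<in> P"
    moreover have "(- 1) * (u * F.H (G.H f) - q * f) \<in> P"
      by (rule A.pt_mult[OF P(1) PR_uminus[OF PR_1] D])
    ultimately have "u * F.H (G.H f) + (- 1) * (u * F.H (G.H f) - q * f) \<in> P" by (rule A.pt_add[OF P(1)])
    then show "q * f \<in> P" by simp
  qed
  then show ?thesis using A.pt_prime[OF P(1) u(1) FG] A.pt_prime[OF P(1) q(1) f(1)] u(2) q(2) by blast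
qed

text \<open>Points are homogeneous ideals, and the composite carries the component of degree t to
  that of degree t * e * d, so homogeneous \<open>f\<close> suffice.\<close>

lemma FG_iff:
  assumes P: "P \<in> A.X" "pvar 0 \<notin> P" "F.H (k 0) \<notin> P" and f: "f \<in> A.PN"
  shows "F.H (G.H f) \<in> P \<longleftrightarrow> f \<in> P"
proof -
  let ?T = "mono_deg ` Poly_Mapping.keys f"
  have c: "F.H (G.H (hom_component t f)) \<in> P \<longleftrightarrow> hom_component t f \<in> P" for t
    by (rule FG_homogeneous[OF P hom_component_PR[OF f] homogeneous_hom_component])
  have fs: "(\<Sum>t\<in>?T. hom_component t f) = f" by (rule sum_hom_components) auto
  then have "F.H (G.H f) = F.H (G.H (\<Sum>t\<in>?T. hom_component t f))" by simp
  also have "\<dots> = (\<Sum>t\<in>?T. F.H (G.H (hom_component t f)))"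
    by (simp only: rhom_sum[OF F.rhom_H] rhom_sum[OF G.rhom_H])
  finally have FGs: "F.H (G.H f) = (\<Sum>t\<in>?T. F.H (G.H (hom_component t f)))" .
  show ?thesis
  proof
    assume f: "f \<in> P"
    show "F.H (G.H f) \<in> P"
      unfolding FGs by (rule A.pt_sum[OF P(1)]) (simp add: c A.pt_hom[OF P(1) f])
  next
    assume FG: "F.H (G.H f) \<in> P"
    have "F.H (G.H (hom_component t f)) \<in> P" for t
      using A.pt_hom[OF P(1) FG, of "t * e * d"]
      by (simp add: F.H_hom_component[OF G.H_PN[OF f]] G.H_hom_component[OF f])
    then have "(\<Sum>t\<in>?T. hom_component t f) \<in> P" using c by (intro A.pt_sum[OF P(1)]) blast
    then show "f \<in> P" unfolding fs .
  qed
qed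

lemma U_iff: "P \<in> U \<longleftrightarrow> P \<in> A.X \<and> pvar 0 \<notin> P \<and> F.H (k 0) \<notin> P \<and> h 0 \<notin> P \<and> F.H (G.H (h 0)) \<notin> P"
  by (simp add: bset_def F.H_def G.H_def)

lemma U_open: "openin A.TX U"
proof -
  have GH: "G.H (h 0) \<in> A.PN" by (rule G.H_PN[OF F.h_PN[OF N0]])
  have "U = {P \<in> A.X. pvar 0 \<notin> P} \<inter> {P \<in> A.X. F.H (k 0) \<notin> P} \<inter> ({P \<in> A.X. h 0 \<notin> P} \<inter> {P \<in> A.X. F.H (G.H (h 0)) \<notin> P})"
    by (auto simp: U_iff)
  moreover have "openin A.TX {P \<in> A.X. pvar 0 \<notin> P}" by (rule openin_proj_basic[OF PR_pvar[OF N0] homogeneous_pvar])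
  moreover have "openin A.TX {P \<in> A.X. F.H (k 0) \<notin> P}"
    by (rule openin_proj_basic[OF F.H_PN[OF G.h_PN[OF N0]] F.H_homogeneous[OF G.h_PN[OF N0] G.h_hom[OF N0]]])
  moreover have "openin A.TX {P \<in> A.X. h 0 \<notin> P}" by (rule openin_proj_basic[OF F.h_PN[OF N0] F.h_hom[OF N0]])
  moreover have "openin A.TX {P \<in> A.X. F.H (G.H (h 0)) \<notin> P}"
    by (rule openin_proj_basic[OF F.H_PN[OF GH] F.H_homogeneous[OF GH G.H_homogeneous[OF F.h_PN[OF N0] F.h_hom[OF N0]]]])
  ultimately show ?thesis by (simp add: openin_Int)
qed

lemma eta_U: "A.eta \<in> U"
proof -
  obtain z where z: "z \<noteq> 0" "A.th (F.H (k 0)) = z * A.xi 0" "A.th (F.H (G.H (h 0))) = z ^ d * A.th (h 0)"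
    using FG_scale F.h_PN[OF N0] F.h_hom[OF N0] by blast
  have "B.th (G.H (h 0)) \<noteq> 0" using zG N0 B.xi_nz unfolding G.H_def by auto
  then have "A.th (h 0) \<noteq> 0" using G.th_H_zero[OF F.h_PN[OF N0]] by blast
  then show ?thesis using z A.eta_X A.xi_nz by (simp add: U_iff A.eta_iff A.th_pvar)
qed

lemma fpU: assumes P: "P \<in> U" shows "F.fp P \<in> V"
proof -
  have PX: "P \<in> A.X" and P': "pvar 0 \<notin> P" "F.H (k 0) \<notin> P" "h 0 \<notin> P" "F.H (G.H (h 0)) \<notin> P"
    using P by (auto simp: U_iff)
  have "F.fp P \<in> B.X" by (rule F.fp_point[OF PX N0 P'(3)])
  moreover have "G.H (F.H (k 0)) \<notin> F.fp P"
    using FG_iff[OF PX P'(1,2) F.H_PN[OF G.h_PN[OF N0]]] P'(2) by (simp add: F.fp_def)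
  ultimately show ?thesis using P'
    by (simp add: bset_def F.fp_def F.H_pvar flip: F.H_def G.H_def)
qed

lemma GF_fp: "P \<in> U \<Longrightarrow> G.fp (F.fp P) = P"
  using FG_iff[of P] A.pt_PN[of P] G.H_PN by (auto simp: U_iff G.fp_def F.fp_def)

text \<open>Inverse images of ideals preserve inclusion, and the generic point is the smallest
  point. It is the image of \<open>F.fp A.eta\<close>, so the image of the smallest point of the
  other side lies below it.\<close>

lemma G_eta: "G.fp B.eta = A.eta"
proof
  have "F.fp A.eta \<in> B.X" using fpU[OF eta_U] by (simp add: bset_def)
  then have "G.fp B.eta \<subseteq> G.fp (F.fp A.eta)" by (intro G.fp_mono B.eta_subset)
  then show "G.fp B.eta \<subseteq> A.eta" unfolding GF_fp[OF eta_U] .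
  have "G.fp B.eta \<in> A.X" using bimap.fpU[OF swap bimap.eta_U[OF swap]] by (simp add: bset_def)
  then show "A.eta \<subseteq> G.fp B.eta" by (rule A.eta_subset)
qed

lemma F_eta: "F.fp A.eta = B.eta"
  by (rule bimap.G_eta[OF swap])

text \<open>Numerator and denominator have the same degree t, so the scaling factor z^t of the
  composite cancels.\<close>

lemma sg_sg: "A.gm A.eta u \<noteq> {} \<Longrightarrow> F.sg (B.gm B.eta (G.sg (A.gm A.eta u))) = u"
proof -
  assume "A.gm A.eta u \<noteq> {}"
  then obtain g l where gl: "(g, l) \<in> A.gm A.eta u" by fast
  then have "(G.H g, G.H l) \<in> B.gm B.eta (G.sg (A.gm A.eta u))"
    using G.sg_eq(2)[OF B.eta_X, of g l u] unfolding G_eta by blast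
  then have 1: "F.sg (B.gm B.eta (G.sg (A.gm A.eta u))) = A.th (F.H (G.H g)) / A.th (F.H (G.H l))"
    using F.sg_eq(1)[OF A.eta_X, of "G.H g" "G.H l"] unfolding F_eta by blast
  have fr: "(g, l) \<in> proj_fracs N A.eta" "A.th l \<noteq> 0" "u = A.th g / A.th l" using A.gmD[OF A.eta_X gl] by auto
  then obtain t where t: "g \<in> A.PN" "l \<in> A.PN" "homogeneous t g" "homogeneous t l"
    unfolding proj_fracs_def by blast
  obtain z where z: "z \<noteq> 0" "A.th (F.H (G.H g)) = z ^ t * A.th g" "A.th (F.H (G.H l)) = z ^ t * A.th l"
    using FG_scale t by blast
  show ?thesis unfolding 1 z using z(1) fr by simp
qed

sublocale FO: pmap_on p ty N a N b d h U V
  by unfold_locales (use U_open bimap.U_open[OF swap] fpU in auto)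

sublocale GO: pmap_on p ty N b N a e k V U
  by unfold_locales (use U_open bimap.U_open[OF swap] bimap.fpU[OF swap] in auto)

lemma pre_pre: "W \<subseteq> V \<Longrightarrow> GO.pre (FO.pre W) = W"
  using bimap.GF_fp[OF swap] GO.fpU by (auto simp: FO.pre_def GO.pre_def)

lemma pb_pb:
  assumes W: "openin B.TX W" "W \<subseteq> V" and s: "s \<in> carrier (proj_sections N B.Phi W)"
  shows "GO.pb (FO.pre W) (FO.pb W s) = s"
proof -
  obtain v where v: "s = B.sec W v" "v \<in> B.reg W" using s unfolding B.carrier_sections[OF W(1)] by blast
  show ?thesis
  proof (cases "W = {}")
    case True
    have "GO.pb (FO.pre W) (FO.pb W s) = B.sec W (G.sg (FO.pb W s (G.fp B.eta)))"
      unfolding GO.pb_def pre_pre[OF W(2)] ..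
    then show ?thesis unfolding v(1) True using B.sec_empty by metis
  next
    case False
    then have eB: "B.eta \<in> W" using B.eta_open[OF W(1)] by blast
    then have eA: "A.eta \<in> FO.pre W" using eta_U F_eta by (simp add: FO.pre_def)
    have eB': "B.eta \<in> GO.pre (FO.pre W)" using eB pre_pre[OF W(2)] by simp
    have "B.gm B.eta v \<noteq> {}" using v(2) eB by (simp add: B.reg_def)
    then have "G.sg (A.gm A.eta (F.sg (B.gm B.eta v))) = v" by (rule bimap.sg_sg[OF swap])
    then show ?thesis
      unfolding v(1) FO.pb_sec[OF eA] GO.pb_sec[OF eB'] pre_pre[OF W(2)] F_eta G_eta by simp
  qed
qed

theorem isomorphism_fp: "isomorphism (open_sub A.HX U) (open_sub B.HX V) F.fp FO.pb"
proof -
  have tsU: "topspace (subtopology A.TX U) = U" and tsV: "topspace (subtopology B.TX V) = V"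
    by (auto simp: topspace_proj_topo bset_def)
  have "homeomorphic_maps (subtopology A.TX U) (subtopology B.TX V) F.fp G.fp"
    unfolding homeomorphic_maps_def tsU tsV
    using FO.continuous_fp GO.continuous_fp GF_fp bimap.GF_fp[OF swap] by blast
  then have "homeomorphic_map (subtopology A.TX U) (subtopology B.TX V) F.fp"
    using homeomorphic_map_maps by blast
  moreover have "FO.pb W \<in> ring_iso (proj_sections N B.Phi W) (proj_sections N A.Phi (FO.pre W))"
    if W: "openin B.TX W" "W \<subseteq> V" for W
  proof -
    have W': "openin A.TX (FO.pre W)" "FO.pre W \<subseteq> U" using FO.open_pre[OF W(1)] by (auto simp: FO.pre_def)
    have hF: "FO.pb W \<in> ring_hom (proj_sections N B.Phi W) (proj_sections N A.Phi (FO.pre W))"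
      by (rule FO.pb_ring_hom(1)[OF W(1)])
    have hG: "GO.pb (FO.pre W) \<in> ring_hom (proj_sections N A.Phi (FO.pre W)) (proj_sections N B.Phi W)"
      using GO.pb_ring_hom(1)[OF W'(1)] unfolding pre_pre[OF W(2)] .
    have "bij_betw (FO.pb W) (carrier (proj_sections N B.Phi W)) (carrier (proj_sections N A.Phi (FO.pre W)))"
    proof (rule bij_betw_byWitness[where f' = "GO.pb (FO.pre W)"])
      show "\<forall>s\<in>carrier (proj_sections N B.Phi W). GO.pb (FO.pre W) (FO.pb W s) = s" using pb_pb[OF W] by blast
      show "\<forall>s\<in>carrier (proj_sections N A.Phi (FO.pre W)). FO.pb W (GO.pb (FO.pre W) s) = s"
        using bimap.pb_pb[OF swap W'] unfolding pre_pre[OF W(2)] by blast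
    qed (use ring_hom_closed[OF hF] ring_hom_closed[OF hG] in blast)+
    then show ?thesis using hF by (simp add: ring_iso_def)
  qed
  ultimately show ?thesis
    unfolding isomorphism_def FO.preim_eq open_sub_simps proj_hypersurface_simps(1,2)
      openin_open_subtopology[OF FO.V]
    using FO.morphism_fp by blast
qed

theorem birational_fp: "birational A.HX B.HX"
  unfolding birational_def
proof (intro exI conjI)
  show "isomorphism (open_sub A.HX U) (open_sub B.HX V) F.fp FO.pb" by (rule isomorphism_fp)
  show "U \<noteq> {}" using eta_U by blast
  show "V \<noteq> {}" using bimap.eta_U[OF swap] by blast
qed (simp_all add: FO.U FO.V)

end

lemma (in char_p) birational_of_rmap:
  fixes a b :: "nat \<Rightarrow> 'a"
  assumes "2 \<le> N" "N = p ^ n + 1" "frob_indep p N a" "frob_indep p N b" "rmap p N a N b d h"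
  shows "birational (proj_hypersurface N (diag_poly p N a)) (proj_hypersurface N (diag_poly p N b))"
proof -
  obtain d h e k where r: "d > 0" "e > 0" "rmap p N a N b d h" "rmap p N b N a e k"
    and z: "\<exists>z. z \<noteq> 0 \<and> (\<forall>i<N. qform.th p N a (ev pconst h (k i)) = z * qform.xi N a i)"
      "\<exists>z. z \<noteq> 0 \<and> (\<forall>j<N. qform.th p N b (ev pconst k (h j)) = z * qform.xi N b j)"
    using rmap_birational[OF assms] by blast
  interpret bimap p ty N a b d h e k
    by unfold_locales (use r z assms in auto)
  show ?thesis by (rule birational_fp)
qed

section \<open>Quasilinear hypersurfaces\<close>

lemma dim_basis:
  assumes "is_basis smul bs" shows "vector_space.dim smul UNIV = length bs"
proof -
  interpret finite_dimensional_vector_space smul "set bs" using assms by (simp add: is_basis_def)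
  show ?thesis using assms by (simp add: is_basis_def dim_UNIV distinct_card)
qed

text \<open>By additivity and the p-th power rule, a relation over F^p between the values on the
  basis says that the form vanishes at the combination with coefficients \<open>c i\<close>. That
  vector is then 0, and so are its coordinates.\<close>

lemma anisotropic_frob_indep:
  fixes smul :: "'a::field \<Rightarrow> 'v::ab_group_add \<Rightarrow> 'v" and \<phi> :: "'v \<Rightarrow> 'a"
  assumes bs: "is_basis smul bs" and q: "quasilinear_form p smul \<phi>" and an: "anisotropic \<phi>"
  shows "frob_indep p (length bs) (\<lambda>i. \<phi> (bs ! i))"
  unfolding frob_indep_def
proof (intro allI impI)
  fix c i assume c: "(\<Sum>i<length bs. c i ^ p * \<phi> (bs ! i)) = 0" and i: "i < length bs"
  interpret finite_dimensional_vector_space smul "set bs" using bs by (simp add: is_basis_def)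
  have sc: "\<phi> (smul x v) = x ^ p * \<phi> v" and ad: "\<phi> (v + w) = \<phi> v + \<phi> w" for x v w
    using q by (auto simp: quasilinear_form_def)
  have \<phi>0: "\<phi> 0 = 0" using ad[of 0 0] by (metis add.right_neutral add_left_cancel)
  have \<phi>sum: "\<phi> (sum g A) = (\<Sum>x\<in>A. \<phi> (g x))" for g :: "nat \<Rightarrow> 'v" and A
    by (induction A rule: infinite_finite_induct) (simp_all add: \<phi>0 ad)
  have bij: "bij_betw ((!) bs) {..<length bs} (set bs)"
    using bs by (intro bij_betw_nth) (auto simp: is_basis_def)
  define u where "u v = c (the_inv_into {..<length bs} ((!) bs) v)" for v
  have u: "u (bs ! i) = c i" if "i < length bs" for i
    using that bij by (simp add: u_def the_inv_into_f_f bij_betw_def)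
  have "(\<Sum>v\<in>set bs. smul (u v) v) = (\<Sum>i<length bs. smul (u (bs ! i)) (bs ! i))"
    using sum.reindex_bij_betw[OF bij, of "\<lambda>v. smul (u v) v"] by simp
  also have "\<dots> = (\<Sum>i<length bs. smul (c i) (bs ! i))" by (rule sum.cong) (simp_all add: u)
  also have "\<dots> = 0"
  proof -
    have "\<phi> (\<Sum>i<length bs. smul (c i) (bs ! i)) = 0" unfolding \<phi>sum sc by (rule c)
    then show ?thesis using an by (auto simp: anisotropic_def isotropic_def)
  qed
  finally have "u (bs ! i) = 0"
    using independentD[OF independent_Basis finite_set subset_refl] i nth_mem by blast
  then show "c i = 0" using u[OF i] by simp
qed

theorem theorem6p12:
  fixes p n :: nat
    and scaleX :: "'a::field \<Rightarrow> 'v::ab_group_add \<Rightarrow> 'v" and \<phi> :: "'v \<Rightarrow> 'a" and bX :: "'v list"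
    and scaleY :: "'a \<Rightarrow> 'w::ab_group_add \<Rightarrow> 'w" and \<psi> :: "'w \<Rightarrow> 'a" and bY :: "'w list"
  assumes "prime p" and "CHAR('a) = p" and "\<not> surj (\<lambda>x::'a. x ^ p)"
    and "is_basis scaleX bX" and "quasilinear_form p scaleX \<phi>" and "anisotropic \<phi>"
    and "is_basis scaleY bY" and "quasilinear_form p scaleY \<psi>" and "anisotropic \<psi>"
    and "hypersurface_dim scaleY = int p ^ n - 1"
    and "int p ^ n - 1 \<le> hypersurface_dim scaleX"
    and "rational_morphism_exists (quasilinear_hypersurface p \<phi> bX) (quasilinear_hypersurface p \<psi> bY)"
  shows "rational_morphism_exists (quasilinear_hypersurface p \<psi> bY) (quasilinear_hypersurface p \<phi> bX)
    \<and> (hypersurface_dim scaleX = int p ^ n - 1 \<longrightarrow>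
        birational (quasilinear_hypersurface p \<phi> bX) (quasilinear_hypersurface p \<psi> bY))"
proof -
  define N M where "N = length bX" and "M = length bY"
  define a b where "a i = \<phi> (bX ! i)" and "b j = \<psi> (bY ! j)" for i j
  have dX: "hypersurface_dim scaleX = int N - 2" and dY: "hypersurface_dim scaleY = int M - 2"
    using dim_basis[OF assms(4)] dim_basis[OF assms(7)] by (simp_all add: hypersurface_dim_def N_def M_def)
  have p0: "p ^ n > 0" using assms(1) prime_gt_0_nat by simp
  have pn: "int p ^ n = int (p ^ n)" by simp
  have M: "M = p ^ n + 1" using assms(10) unfolding dY pn by linarith
  have MN: "M \<le> N" using assms(11) unfolding dX pn M by linarith
  have M2: "2 \<le> M" using M p0 by linarith
  have a: "a = (\<lambda>i. \<phi> (bX ! i))" and b: "b = (\<lambda>j. \<psi> (bY ! j))" by (simp_all add: fun_eq_iff a_def b_def)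
  have ia: "frob_indep p N a" and ib: "frob_indep p M b"
    using anisotropic_frob_indep[OF assms(4-6)] anisotropic_frob_indep[OF assms(7-9)]
    by (simp_all add: N_def M_def flip: a b)
  interpret char_p p "TYPE('a)" by standard (use assms in auto)
  interpret A: qform p "TYPE('a)" N a by standard (use M2 MN ia in auto)
  interpret B: qform p "TYPE('a)" M b by standard (use M2 ib in auto)
  have X: "quasilinear_hypersurface p \<phi> bX = A.HX" and Y: "quasilinear_hypersurface p \<psi> bY = B.HX"
    by (simp_all add: quasilinear_hypersurface_def form_poly_def diag_poly_def N_def M_def a_def b_def)
  interpret AB: qpair p "TYPE('a)" N a M b by standard
  obtain d h where h: "rmap p N a M b d h"
    using AB.rmap_of_rational_morphism assms(12) unfolding X Y by blast
  obtain e k where k: "e > 0" "rmap p M b N a e k"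
    using rmap_reverse[OF M2 M MN ia ib h] by blast
  interpret BA: pmap p "TYPE('a)" M b N a e k by standard (use k in auto)
  have "rational_morphism_exists B.HX A.HX" by (rule BA.rational_morphism_fp)
  moreover have "birational A.HX B.HX" if "hypersurface_dim scaleX = int p ^ n - 1"
  proof -
    have NM: "M = N" using that assms(10) unfolding dX dY by simp
    show ?thesis using birational_of_rmap[of N n a b d h] M2 M ia ib h unfolding NM by simp
  qed
  ultimately show ?thesis unfolding X Y by blast
qed

end
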